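(* Let $n\ge 1$ and $s>n/2+3$. Let $u_0\in H^s(\mathbb R^n)$ be an initial datum and let the coefficient $\mathfrak b:[0,+\infty)\times\mathbb R^n\to\mathbb R$ satisfy $\mathfrak b\in \mathcal C\cap L^\infty\big([0,+\infty),H^{s-1}(\mathbb R^n)\big)$. Then there exists a time $T_0>0$, depending on $u_0$ and $\mathfrak b$, and there exists a function $u\in\mathcal C\big([0,T_0],H^s(\mathbb R^n)\big)$ which is the unique solution of $$\partial_t u=\Delta u+|\nabla u|^2\,\mathfrak b,\qquad u(0,x)=u_0(x).$$
   Context: $H^s(\mathbb R^n)$ is the $L^2$-based Sobolev space; $u:[0,T_0]\times\mathbb R^n\to\mathbb R$ is real valued. $\mathcal C\cap L^\infty([0,+\infty),X)$ denotes bounded continuous functions of time with values in $X$. Solutions are obtained from the equivalent mild formulation $u(t,\cdot)=h_t*u_0+\int_0^t h_{t-\tau}*\big(|\nabla u(\tau,\cdot)|^2\,\mathfrak b(\tau,\cdot)\big)\,d\tau$, where $h_t$ is the heat kernel on $\mathbb R^n$. *)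

theory Defs
  imports "HOL-Analysis.Analysis"
begin

text \<open>
  Elements of Lebesgue and Sobolev spaces are represented by Borel measurable functions, two
  functions being identified when they agree almost everywhere with respect to \<^const>\<open>lborel\<close>.
\<close>

definition square_integrable :: "('a::euclidean_space \<Rightarrow> 'b::euclidean_space) \<Rightarrow> bool" where
  "square_integrable f \<longleftrightarrow>
     f \<in> borel_measurable lborel \<and> integrable lborel (\<lambda>x. (norm (f x))\<^sup>2)"

definition truncated_fourier ::
    "real \<Rightarrow> ('a::euclidean_space \<Rightarrow> real) \<Rightarrow> 'a \<Rightarrow> complex" where
  "truncated_fourier R f \<xi> = (LINT x:cball 0 R|lborel. complex_of_real (f x) * cis (- (x \<bullet> \<xi>)))"

text \<open>
  The Plancherel extension: the transform of \<open>f\<close> is the mean-square limit of the absolutely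
  convergent integrals of \<open>f x * exp (- i x \<bullet> \<xi>)\<close> over growing balls. The nonnegative integral is
  used so that a distance that is not finite cannot count as zero.
\<close>

definition has_fourier_transform ::
    "('a::euclidean_space \<Rightarrow> real) \<Rightarrow> ('a \<Rightarrow> complex) \<Rightarrow> bool" where
  "has_fourier_transform f F \<longleftrightarrow> square_integrable f \<and> square_integrable F \<and>
     ((\<lambda>R. \<integral>\<^sup>+\<xi>. ennreal ((norm (truncated_fourier R f \<xi> - F \<xi>))\<^sup>2) \<partial>lborel) \<longlongrightarrow> 0) at_top"

text \<open>Unique up to null sets; meaningful only for square integrable functions.\<close>

definition fourier_transform :: "('a::euclidean_space \<Rightarrow> real) \<Rightarrow> 'a \<Rightarrow> complex" where
  "fourier_transform f = (SOME F. has_fourier_transform f F)"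

text \<open>
  For \<open>s \<ge> 0\<close> the Sobolev space of order \<open>s\<close> is contained in the space of square integrable functions,
  so no distributions are needed. The definition is not meant for negative \<open>s\<close>.
\<close>

definition sobolev_density :: "real \<Rightarrow> ('a::euclidean_space \<Rightarrow> real) \<Rightarrow> 'a \<Rightarrow> real" where
  "sobolev_density s f \<xi> = (1 + (norm \<xi>)\<^sup>2) powr s * (norm (fourier_transform f \<xi>))\<^sup>2"

definition sobolev_space :: "real \<Rightarrow> ('a::euclidean_space \<Rightarrow> real) set" where
  "sobolev_space s = {f. square_integrable f \<and> integrable lborel (sobolev_density s f)}"

definition sobolev_norm :: "real \<Rightarrow> ('a::euclidean_space \<Rightarrow> real) \<Rightarrow> real" where
  "sobolev_norm s f = sqrt (LINT \<xi>|lborel. sobolev_density s f \<xi>)"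

definition sobolev_continuous_on ::
    "real \<Rightarrow> real set \<Rightarrow> (real \<Rightarrow> 'a::euclidean_space \<Rightarrow> real) \<Rightarrow> bool" where
  "sobolev_continuous_on s I u \<longleftrightarrow>
     (\<forall>t\<in>I. u t \<in> sobolev_space s) \<and>
     (\<forall>t\<in>I. ((\<lambda>r. sobolev_norm s (\<lambda>x. u r x - u t x)) \<longlongrightarrow> 0) (at t within I))"

definition sobolev_bounded_on ::
    "real \<Rightarrow> real set \<Rightarrow> (real \<Rightarrow> 'a::euclidean_space \<Rightarrow> real) \<Rightarrow> bool" where
  "sobolev_bounded_on s I u \<longleftrightarrow> (\<exists>M. \<forall>t\<in>I. sobolev_norm s (u t) \<le> M)"

text \<open>
  \<open>v\<close> is the derivative at \<open>t\<close> of \<open>u\<close>, seen as a curve on \<open>I\<close> whose difference quotients converge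
  in the norm of order \<open>s\<close>. The difference quotients themselves belong to the space of order \<open>s\<close>,
  which excludes junk values of the norm.
\<close>

definition has_sobolev_time_derivative ::
    "real \<Rightarrow> real set \<Rightarrow> (real \<Rightarrow> 'a::euclidean_space \<Rightarrow> real) \<Rightarrow> real \<Rightarrow> ('a \<Rightarrow> real) \<Rightarrow> bool" where
  "has_sobolev_time_derivative s I u t v \<longleftrightarrow>
     (\<forall>r\<in>I. u r \<in> sobolev_space s) \<and> v \<in> sobolev_space s \<and>
     ((\<lambda>r. sobolev_norm s (\<lambda>x. (u r x - u t x) / (r - t) - v x)) \<longlongrightarrow> 0) (at t within I)"

text \<open>\<open>D\<phi>\<close> is the gradient of the test function \<open>\<phi>\<close>.\<close>

definition test_function :: "('a::euclidean_space \<Rightarrow> real) \<Rightarrow> ('a \<Rightarrow> 'a) \<Rightarrow> bool" where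
  "test_function \<phi> D\<phi> \<longleftrightarrow>
     (\<forall>x. GDERIV \<phi> x :> D\<phi> x) \<and> continuous_on UNIV D\<phi> \<and> bounded {x. \<phi> x \<noteq> 0}"

definition has_weak_gradient :: "('a::euclidean_space \<Rightarrow> real) \<Rightarrow> ('a \<Rightarrow> 'a) \<Rightarrow> bool" where
  "has_weak_gradient f G \<longleftrightarrow> square_integrable f \<and> square_integrable G \<and>
     (\<forall>\<phi> D\<phi>. test_function \<phi> D\<phi> \<longrightarrow>
        (LINT x|lborel. f x *\<^sub>R D\<phi> x) = - (LINT x|lborel. \<phi> x *\<^sub>R G x))"

definition has_weak_divergence :: "('a::euclidean_space \<Rightarrow> 'a) \<Rightarrow> ('a \<Rightarrow> real) \<Rightarrow> bool" where
  "has_weak_divergence G h \<longleftrightarrow> square_integrable G \<and> square_integrable h \<and>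
     (\<forall>\<phi> D\<phi>. test_function \<phi> D\<phi> \<longrightarrow>
        (LINT x|lborel. G x \<bullet> D\<phi> x) = - (LINT x|lborel. \<phi> x * h x))"

definition has_weak_laplacian :: "('a::euclidean_space \<Rightarrow> real) \<Rightarrow> ('a \<Rightarrow> real) \<Rightarrow> bool" where
  "has_weak_laplacian f L \<longleftrightarrow> (\<exists>G. has_weak_gradient f G \<and> has_weak_divergence G L)"

text \<open>
  For a curve \<open>u\<close> that is continuous with values in the space of order \<open>s\<close>, the right-hand side
  of the equation lies in the space of order \<open>s - 2\<close>, and the equation is an identity there at
  every time of the closed interval (with one-sided time derivatives at the end points).
\<close>

definition solves_cauchy_problem ::
    "real \<Rightarrow> real \<Rightarrow> (real \<Rightarrow> 'a::euclidean_space \<Rightarrow> real) \<Rightarrow> ('a \<Rightarrow> real) \<Rightarrow>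
       (real \<Rightarrow> 'a \<Rightarrow> real) \<Rightarrow> bool" where
  "solves_cauchy_problem s T b u0 u \<longleftrightarrow>
     (AE x in lborel. u 0 x = u0 x) \<and>
     (\<forall>t\<in>{0..T}. \<exists>G L. has_weak_gradient (u t) G \<and> has_weak_laplacian (u t) L \<and>
        has_sobolev_time_derivative (s - 2) {0..T} u t (\<lambda>x. L x + (norm (G x))\<^sup>2 * b t x))"

end

theory Submission
  imports Defs "HOL-Probability.Characteristic_Functions"
begin

text \<open>
  The Fourier transform turns the Sobolev space of order \<open>s\<close> isometrically into an \<open>L\<^sup>2\<close> space: a
  function \<open>f\<close> is replaced by the class \<open>sobolev_coord s f\<close> of
  \<open>(1 + (norm \<xi>)\<^sup>2) powr (s / 2) * fourier_transform f \<xi>\<close>. In this coordinate derivatives become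
  Fourier multipliers, and the equation becomes a differential equation for a curve \<open>w\<close> in the
  Hilbert space \<open>l2\<close>, \<open>(A w)' = A w - w + B (nonlinearity (s - 1) w \<beta>)\<close>, where \<open>A\<close> and \<open>B\<close> are
  multiplication by \<open>(1 + (norm \<xi>)\<^sup>2) powr -1\<close> and by its square root and \<open>\<beta>\<close> is the coordinate of
  order \<open>s - 1\<close> of \<open>b\<close> (\<open>solves_cauchy_problem_iff\<close>). The factor \<open>A\<close> expresses that the time
  derivative is taken two orders lower.

  Three facts make the translation work. The Plancherel theorem is obtained by damping the energy
  of a Fourier integral with a Gaussian (\<open>damped_energy\<close>, \<open>plancherel_L1_L2\<close>); since the adjoint
  of the transform is again a transform, it is invertible (\<open>fourier_l2_fourier_adjoint\<close>), and real
  functions correspond exactly to the classes fixed by \<open>conj_reflect\<close> (\<open>sobolev_coord_surj\<close>). Weak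
  gradients and divergences are characterised by their transforms (\<open>weak_divergence_fourier_l2\<close>,
  \<open>weak_divergence_from_fourier_l2\<close>). Finally, the Sobolev space of order \<open>r > n / 2\<close> is an
  algebra: products become convolutions, the weight can be put on either factor, and the other
  factor is integrable (\<open>weighted_conv_bound\<close>, \<open>sobolev_coord_mult\<close>). With \<open>r = s - 1\<close> this makes
  the nonlinearity a bounded cubic map that loses one derivative.

  Existence: the heat flow regains that derivative at the price of a factor \<open>1 / sqrt (t - \<tau>)\<close>,
  which is integrable and even disappears after a quadratic change of the time variable. The mild
  formulation is therefore a contraction on a short time interval (\<open>mild_solution_exists\<close>), and
  its fixed point is differentiable two orders lower (\<open>mild_solution_has_derivative\<close>).

  Uniqueness: the difference \<open>z\<close> of two solutions has energy \<open>A z \<bullet> z\<close>, whose derivative is at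
  most \<open>2 * (A z \<bullet> z) - 2 * (norm z)\<^sup>2 + 2 * K * norm z * sqrt (A z \<bullet> z)\<close>. The negative term
  absorbs \<open>norm z\<close>, and Gronwall's argument gives \<open>z = 0\<close> (\<open>energy_uniqueness\<close>).
\<close>

section \<open>The Hilbert space of square integrable functions\<close>

lemma square_integrableI:
  fixes f :: "'a::euclidean_space \<Rightarrow> 'b::euclidean_space"
  assumes "f \<in> borel_measurable borel" "integrable lborel g" "\<And>x. (norm (f x))\<^sup>2 \<le> g x"
  shows "square_integrable f"
  unfolding square_integrable_def
proof
  show "f \<in> borel_measurable lborel" using assms(1) by simp
  show "integrable lborel (\<lambda>x. (norm (f x))\<^sup>2)"
    by (rule Bochner_Integration.integrable_bound[OF assms(2)])
      (use assms in \<open>auto intro!: AE_I2 intro: order_trans[OF _ abs_ge_self]\<close>)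
qed

lemma square_integrable_measurable [measurable_dest]:
  "square_integrable f \<Longrightarrow> f \<in> borel_measurable borel"
  by (simp add: square_integrable_def)

lemma square_integrable_norm_sq:
  "square_integrable f \<Longrightarrow> integrable lborel (\<lambda>x. (norm (f x))\<^sup>2)"
  by (simp add: square_integrable_def)

lemma square_integrable_zero [simp]: "square_integrable (\<lambda>x. 0)"
  by (simp add: square_integrable_def)

lemma square_integrable_dominated:
  fixes f :: "'a::euclidean_space \<Rightarrow> 'b::euclidean_space" and g :: "'a \<Rightarrow> 'c::euclidean_space"
  assumes "square_integrable g" "f \<in> borel_measurable borel" "\<And>x. norm (f x) \<le> C * norm (g x)"
  shows "square_integrable f"
proof (rule square_integrableI)
  show "integrable lborel (\<lambda>x. C\<^sup>2 * (norm (g x))\<^sup>2)"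
    using square_integrable_norm_sq[OF assms(1)] by simp
  show "(norm (f x))\<^sup>2 \<le> C\<^sup>2 * (norm (g x))\<^sup>2" for x
    using power_mono[OF assms(3)[of x], of 2] by (simp add: power_mult_distrib)
qed (use assms in auto)

lemma square_integrable_add:
  fixes f :: "'a::euclidean_space \<Rightarrow> 'b::euclidean_space"
  assumes f[measurable]: "square_integrable f" and g[measurable]: "square_integrable g"
  shows "square_integrable (\<lambda>x. f x + g x)"
proof (rule square_integrableI)
  show "integrable lborel (\<lambda>x. 2 * (norm (f x))\<^sup>2 + 2 * (norm (g x))\<^sup>2)"
    using f g by (auto simp: square_integrable_def)
  show "(norm (f x + g x))\<^sup>2 \<le> 2 * (norm (f x))\<^sup>2 + 2 * (norm (g x))\<^sup>2" for x
  proof -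
    have "(norm (f x + g x))\<^sup>2 \<le> (norm (f x) + norm (g x))\<^sup>2"
      by (rule power_mono[OF norm_triangle_ineq]) simp
    also have "\<dots> \<le> 2 * (norm (f x))\<^sup>2 + 2 * (norm (g x))\<^sup>2"
      using zero_le_power2[of "norm (f x) - norm (g x)"] by (simp add: power2_sum power2_diff)
    finally show ?thesis .
  qed
qed measurable

lemma square_integrable_scaleR:
  fixes f :: "'a::euclidean_space \<Rightarrow> 'b::euclidean_space"
  assumes f[measurable]: "square_integrable f"
  shows "square_integrable (\<lambda>x. c *\<^sub>R f x)"
  by (rule square_integrable_dominated[OF f, of _ "\<bar>c\<bar>"]) auto

lemma square_integrable_uminus:
  fixes f :: "'a::euclidean_space \<Rightarrow> 'b::euclidean_space"
  shows "square_integrable f \<Longrightarrow> square_integrable (\<lambda>x. - f x)"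
  using square_integrable_scaleR[of f "-1"] by simp

lemma square_integrable_diff:
  fixes f :: "'a::euclidean_space \<Rightarrow> 'b::euclidean_space"
  shows "square_integrable f \<Longrightarrow> square_integrable g \<Longrightarrow> square_integrable (\<lambda>x. f x - g x)"
  using square_integrable_add[OF _ square_integrable_uminus] by fastforce

lemma square_integrable_sum:
  fixes f :: "'i \<Rightarrow> 'a::euclidean_space \<Rightarrow> 'b::euclidean_space"
  shows "(\<And>i. i \<in> A \<Longrightarrow> square_integrable (f i)) \<Longrightarrow> square_integrable (\<lambda>x. \<Sum>i\<in>A. f i x)"
  by (induction A rule: infinite_finite_induct) (auto intro: square_integrable_add)

lemma square_integrable_mult_bounded:
  fixes f m :: "'a::euclidean_space \<Rightarrow> complex"
  assumes "square_integrable f" "m \<in> borel_measurable borel" "\<And>x. norm (m x) \<le> C"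
  shows "square_integrable (\<lambda>x. m x * f x)"
  by (rule square_integrable_dominated[OF assms(1), of _ C])
    (use assms in \<open>auto simp: norm_mult intro: mult_right_mono\<close>)

lemma square_integrable_product_integrable:
  fixes f g :: "'a::euclidean_space \<Rightarrow> 'b::euclidean_space"
  assumes f[measurable]: "square_integrable f" and g[measurable]: "square_integrable g"
  shows "integrable lborel (\<lambda>x. norm (f x) * norm (g x))"
proof (rule Bochner_Integration.integrable_bound)
  show "integrable lborel (\<lambda>x. (norm (f x))\<^sup>2 + (norm (g x))\<^sup>2)"
    using f g by (auto simp: square_integrable_def)
  have "norm (f x) * norm (g x) \<le> (norm (f x))\<^sup>2 + (norm (g x))\<^sup>2" for x
  proof -
    have "2 * (norm (f x) * norm (g x)) \<le> (norm (f x))\<^sup>2 + (norm (g x))\<^sup>2"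
      using zero_le_power2[of "norm (f x) - norm (g x)"] by (simp add: power2_diff)
    moreover have "0 \<le> (norm (f x))\<^sup>2 + (norm (g x))\<^sup>2" by simp
    ultimately show ?thesis by linarith
  qed
  then show "AE x in lborel. norm (norm (f x) * norm (g x)) \<le> norm ((norm (f x))\<^sup>2 + (norm (g x))\<^sup>2)"
    by (auto intro: order_trans[OF _ abs_ge_self])
qed measurable

lemma square_integrable_inner_integrable:
  fixes f g :: "'a::euclidean_space \<Rightarrow> 'b::euclidean_space"
  assumes f[measurable]: "square_integrable f" and g[measurable]: "square_integrable g"
  shows "integrable lborel (\<lambda>x. f x \<bullet> g x)"
  by (rule Bochner_Integration.integrable_bound[OF square_integrable_product_integrable[OF f g]])
    (measurable, auto simp: Cauchy_Schwarz_ineq2)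

lemma square_integrable_mult_integrable:
  fixes f g :: "'a::euclidean_space \<Rightarrow> complex"
  assumes f[measurable]: "square_integrable f" and g[measurable]: "square_integrable g"
  shows "integrable lborel (\<lambda>x. f x * g x)"
  by (rule Bochner_Integration.integrable_bound[OF square_integrable_product_integrable[OF f g]])
    (measurable, auto simp: norm_mult)

text \<open>
  Square integrable functions up to null sets. As a Banach space type it admits integrals of
  continuous curves, the fundamental theorem of calculus and the contraction principle. The scalar
  product is the real one; complex scalars act as constant multipliers.
\<close>

quotient_type (overloaded) 'a l2 = "'a::euclidean_space \<Rightarrow> complex" /
  partial: "\<lambda>f g. square_integrable f \<and> square_integrable g \<and> (AE x in lborel. f x = g x)"
  morphisms rep_l2 to_l2
proof (rule part_equivpI)
  show "\<exists>f::'a \<Rightarrow> complex. square_integrable f \<and> square_integrable f \<and> (AE x in lborel. f x = f x)"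
    by (rule exI[of _ "\<lambda>x. 0"]) simp
  show "symp (\<lambda>f g::'a \<Rightarrow> complex. square_integrable f \<and> square_integrable g \<and> (AE x in lborel. f x
      = g x))"
    by (auto simp: symp_def elim: eventually_mono)
  show "transp (\<lambda>f g::'a \<Rightarrow> complex. square_integrable f \<and> square_integrable g \<and> (AE x in lborel. f x
      = g x))"
    proof (rule transpI, intro conjI; (elim conjE)?)
    fix f g h :: "'a \<Rightarrow> complex"
    assume "AE x in lborel. f x = g x" "AE x in lborel. g x = h x"
    then show "AE x in lborel. f x = h x" by eventually_elim simp
  qed
qed

lemma rep_l2_square_integrable [simp]: "square_integrable (rep_l2 x)"
  using Quotient3_rep_reflp[OF Quotient3_l2, of x] by auto

lemma rep_l2_measurable [measurable]: "rep_l2 x \<in> borel_measurable borel"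
  by (rule square_integrable_measurable) simp

lemma to_l2_rep_l2 [simp]: "to_l2 (rep_l2 x) = x"
  by (rule Quotient3_abs_rep[OF Quotient3_l2])

lemma to_l2_eq_iff:
  "square_integrable f \<Longrightarrow> square_integrable g \<Longrightarrow> to_l2 f = to_l2 g \<longleftrightarrow> (AE x in lborel. f x = g x)"
  using Quotient3_rel[OF Quotient3_l2, of f g] by auto

lemma to_l2_cong:
  assumes "square_integrable f" "g \<in> borel_measurable borel" "AE x in lborel. f x = g x"
  shows "square_integrable g \<and> to_l2 f = to_l2 g"
proof -
  have "integrable lborel (\<lambda>x. (norm (f x))\<^sup>2) \<longleftrightarrow> integrable lborel (\<lambda>x. (norm (g x))\<^sup>2)"
    using assms by (intro integrable_cong_AE) (auto elim!: eventually_mono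
        simp: square_integrable_def)
  then have "square_integrable g" using assms by (simp add: square_integrable_def)
  then show ?thesis using assms by (simp add: to_l2_eq_iff)
qed

lemma rep_to_l2: "square_integrable f \<Longrightarrow> AE x in lborel. rep_l2 (to_l2 f) x = f x"
  using to_l2_eq_iff[of "rep_l2 (to_l2 f)" f] by simp

lemma l2_eqI: "AE \<xi> in lborel. rep_l2 x \<xi> = rep_l2 y \<xi> \<Longrightarrow> x = y"
  using to_l2_eq_iff[of "rep_l2 x" "rep_l2 y"] by simp

instantiation l2 :: (euclidean_space) real_vector
begin

definition "zero_l2 = to_l2 (\<lambda>\<xi>. 0)"
definition "plus_l2 x y = to_l2 (\<lambda>\<xi>. rep_l2 x \<xi> + rep_l2 y \<xi>)"
definition "minus_l2 x y = to_l2 (\<lambda>\<xi>. rep_l2 x \<xi> - rep_l2 y \<xi>)"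
definition "uminus_l2 x = to_l2 (\<lambda>\<xi>. - rep_l2 x \<xi>)"
definition "scaleR_l2 c x = to_l2 (\<lambda>\<xi>. c *\<^sub>R rep_l2 x \<xi>)"
lemma rep_l2_zero: "AE \<xi> in lborel. rep_l2 0 \<xi> = 0"
  unfolding zero_l2_def by (rule rep_to_l2) simp
lemma rep_l2_add: "AE \<xi> in lborel. rep_l2 (x + y) \<xi> = rep_l2 x \<xi> + rep_l2 y \<xi>"
  unfolding plus_l2_def by (rule rep_to_l2) (intro square_integrable_add rep_l2_square_integrable)
lemma rep_l2_diff: "AE \<xi> in lborel. rep_l2 (x - y) \<xi> = rep_l2 x \<xi> - rep_l2 y \<xi>"
  unfolding minus_l2_def by (rule rep_to_l2) (intro square_integrable_diff rep_l2_square_integrable)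
lemma rep_l2_uminus: "AE \<xi> in lborel. rep_l2 (- x) \<xi> = - rep_l2 x \<xi>"
  unfolding uminus_l2_def by (rule rep_to_l2) (intro square_integrable_uminus
      rep_l2_square_integrable)
lemma rep_l2_scaleR: "AE \<xi> in lborel. rep_l2 (c *\<^sub>R x) \<xi> = c *\<^sub>R rep_l2 x \<xi>"
  unfolding scaleR_l2_def by (rule rep_to_l2) (intro square_integrable_scaleR
      rep_l2_square_integrable)

instance
proof
  fix x y z :: "'a l2" and c d :: real
  show "x + y + z = x + (y + z)"
    by (rule l2_eqI)
      (use rep_l2_add[of "x + y" z] rep_l2_add[of x y]
        rep_l2_add[of x "y + z"] rep_l2_add[of y z] in \<open>eventually_elim, simp\<close>)
  show "x + y = y + x"
    by (rule l2_eqI)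
      (use rep_l2_add[of x y] rep_l2_add[of y x] in \<open>eventually_elim, simp\<close>)
  show "0 + x = x"
    by (rule l2_eqI)
      (use rep_l2_add[of 0 x] rep_l2_zero in \<open>eventually_elim, simp\<close>)
  show "- x + x = 0"
    by (rule l2_eqI)
      (use rep_l2_add[of "-x" x] rep_l2_uminus[of x] rep_l2_zero in \<open>eventually_elim, simp\<close>)
  show "x - y = x + - y"
    by (rule l2_eqI)
      (use rep_l2_add[of x "-y"] rep_l2_uminus[of y] rep_l2_diff[of x y] in \<open>eventually_elim, simp\<close>)
  show "c *\<^sub>R (x + y) = c *\<^sub>R x + c *\<^sub>R y"
    by (rule l2_eqI)
      (use rep_l2_add[of x y] rep_l2_add[of "c *\<^sub>R x" "c *\<^sub>R y"]
        rep_l2_scaleR[of c x] rep_l2_scaleR[of c y] rep_l2_scaleR[of c "x + y"]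
            in \<open>eventually_elim, simp add: scaleR_add_right\<close>)
  show "(c + d) *\<^sub>R x = c *\<^sub>R x + d *\<^sub>R x"
    by (rule l2_eqI)
      (use rep_l2_add[of "c *\<^sub>R x" "d *\<^sub>R x"]
        rep_l2_scaleR[of c x] rep_l2_scaleR[of d x] rep_l2_scaleR[of "c + d" x]
            in \<open>eventually_elim, simp add: scaleR_add_left\<close>)
  show "c *\<^sub>R d *\<^sub>R x = (c * d) *\<^sub>R x"
    by (rule l2_eqI)
      (use rep_l2_scaleR[of c "d *\<^sub>R x"] rep_l2_scaleR[of d x]
        rep_l2_scaleR[of "c * d" x] in \<open>eventually_elim, simp\<close>)
  show "1 *\<^sub>R x = x"
    by (rule l2_eqI)
      (use rep_l2_scaleR[of 1 x] in \<open>eventually_elim, simp\<close>)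
qed

end

instantiation l2 :: (euclidean_space) real_inner
begin

definition "inner_l2 x y = (LINT \<xi>|lborel. rep_l2 x \<xi> \<bullet> rep_l2 y \<xi>)"
definition "norm_l2 (x::'a l2) = sqrt (x \<bullet> x)"
definition "dist_l2 (x::'a l2) y = norm (x - y)"
definition "sgn_l2 (x::'a l2) = x /\<^sub>R norm x"
definition [code del]:
  "(uniformity :: ('a l2 \<times> 'a l2) filter) = (INF e\<in>{0 <..}. principal {(x, y). dist x y < e})"
definition [code del]:
  "open_l2 (U :: 'a l2 set) \<longleftrightarrow> (\<forall>x\<in>U. eventually (\<lambda>(x', y). x' = x \<longrightarrow> y \<in> U) uniformity)"

instance
proof
  fix x y z :: "'a l2" and c :: real
  show "dist x y = norm (x - y)" by (rule dist_l2_def)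
  show "sgn x = x /\<^sub>R norm x" by (rule sgn_l2_def)
  show "(uniformity :: ('a l2 \<times> 'a l2) filter) = (INF e\<in>{0 <..}. principal {(x, y). dist x y < e})"
    by (rule uniformity_l2_def)
  show "open U = (\<forall>x\<in>U. \<forall>\<^sub>F (x', y) in uniformity. x' = x \<longrightarrow> y \<in> U)" for U :: "'a l2 set"
    by (rule open_l2_def)
  show "x \<bullet> y = y \<bullet> x" unfolding inner_l2_def by (simp add: inner_commute)
  note int = square_integrable_inner_integrable[OF rep_l2_square_integrable
      rep_l2_square_integrable]
  show "(x + y) \<bullet> z = x \<bullet> z + y \<bullet> z"
  proof -
    have "(x + y) \<bullet> z = (LINT \<xi>|lborel. rep_l2 x \<xi> \<bullet> rep_l2 z \<xi> + rep_l2 y \<xi> \<bullet> rep_l2 z \<xi>)"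
      unfolding inner_l2_def by (rule integral_cong_AE, measurable)
        (use rep_l2_add[of x y] in \<open>eventually_elim, simp add: inner_add_left\<close>)
    then show ?thesis unfolding inner_l2_def by (simp add: int)
  qed
  show "(c *\<^sub>R x) \<bullet> y = c * (x \<bullet> y)"
  proof -
    have "(c *\<^sub>R x) \<bullet> y = (LINT \<xi>|lborel. c * (rep_l2 x \<xi> \<bullet> rep_l2 y \<xi>))"
      unfolding inner_l2_def by (rule integral_cong_AE, measurable)
        (use rep_l2_scaleR[of c x] in \<open>eventually_elim, simp\<close>)
    then show ?thesis unfolding inner_l2_def by simp
  qed
  show "0 \<le> x \<bullet> x" unfolding inner_l2_def by simp
  show "x \<bullet> x = 0 \<longleftrightarrow> x = 0"
  proof
    assume "x \<bullet> x = 0"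
    then have "AE \<xi> in lborel. rep_l2 x \<xi> \<bullet> rep_l2 x \<xi> = 0"
      unfolding inner_l2_def by (subst (asm) integral_nonneg_eq_0_iff_AE) (auto simp: int)
    then show "x = 0"
      using rep_l2_zero by (intro l2_eqI) (auto elim: eventually_elim2)
  next
    assume "x = 0"
    have "(LINT \<xi>|lborel. rep_l2 (0::'a l2) \<xi> \<bullet> rep_l2 0 \<xi>) = (LINT \<xi>|(lborel::'a measure). 0)"
      by (rule integral_cong_AE, measurable) (use rep_l2_zero in \<open>eventually_elim, simp\<close>)
    then show "x \<bullet> x = 0" using \<open>x = 0\<close> unfolding inner_l2_def by simp
  qed
  show "norm x = sqrt (x \<bullet> x)" by (rule norm_l2_def)
qed

end

lemma inner_to_l2:
  assumes "square_integrable f" "square_integrable g"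
  shows "to_l2 f \<bullet> to_l2 g = (LINT \<xi>|lborel. f \<xi> \<bullet> g \<xi>)"
proof -
  have [measurable]: "f \<in> borel_measurable borel" "g \<in> borel_measurable borel"
    using assms by (auto intro: square_integrable_measurable)
  show ?thesis unfolding inner_l2_def by (rule integral_cong_AE, measurable)
    (use rep_to_l2[OF assms(1)] rep_to_l2[OF assms(2)] in \<open>eventually_elim, simp\<close>)
qed

lemma norm_to_l2_sq: "square_integrable f \<Longrightarrow> (norm (to_l2 f))\<^sup>2 = (LINT \<xi>|lborel. (norm (f \<xi>))\<^sup>2)"
  by (simp add: power2_norm_eq_inner inner_to_l2)

lemma norm_l2_sq: "(norm x)\<^sup>2 = (LINT \<xi>|lborel. (norm (rep_l2 x \<xi>))\<^sup>2)"
  using norm_to_l2_sq[of "rep_l2 x"] by simp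

lemma nn_integral_norm_to_l2:
  "square_integrable f \<Longrightarrow> (\<integral>\<^sup>+\<xi>. ennreal ((norm (f \<xi>))\<^sup>2) \<partial>lborel) = ennreal ((norm (to_l2 f))\<^sup>2)"
  by (subst nn_integral_eq_integral) (auto simp: norm_to_l2_sq square_integrable_norm_sq)

lemma square_integrable_iff_nn_integral:
  fixes f :: "'a::euclidean_space \<Rightarrow> 'b::euclidean_space"
  assumes "f \<in> borel_measurable borel"
  shows "square_integrable f \<longleftrightarrow> (\<integral>\<^sup>+\<xi>. ennreal ((norm (f \<xi>))\<^sup>2) \<partial>lborel) < \<infinity>"
  using assms unfolding square_integrable_def by (auto simp: integrable_iff_bounded)

lemma
  assumes f: "square_integrable f" and g: "square_integrable g"
  shows to_l2_add: "to_l2 (\<lambda>\<xi>. f \<xi> + g \<xi>) = to_l2 f + to_l2 g"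
    and to_l2_diff: "to_l2 (\<lambda>\<xi>. f \<xi> - g \<xi>) = to_l2 f - to_l2 g"
proof -
  show "to_l2 (\<lambda>\<xi>. f \<xi> + g \<xi>) = to_l2 f + to_l2 g"
    by (rule l2_eqI)
      (use rep_to_l2[OF square_integrable_add[OF f g]] rep_l2_add[of "to_l2 f" "to_l2 g"]
      rep_to_l2[OF f] rep_to_l2[OF g] in \<open>eventually_elim, simp\<close>)
  show "to_l2 (\<lambda>\<xi>. f \<xi> - g \<xi>) = to_l2 f - to_l2 g"
    by (rule l2_eqI)
      (use rep_to_l2[OF square_integrable_diff[OF f g]] rep_l2_diff[of "to_l2 f" "to_l2 g"]
      rep_to_l2[OF f] rep_to_l2[OF g] in \<open>eventually_elim, simp\<close>)
qed

lemma to_l2_scaleR: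
  assumes f: "square_integrable f"
  shows "to_l2 (\<lambda>\<xi>. c *\<^sub>R f \<xi>) = c *\<^sub>R to_l2 f"
  by (rule l2_eqI)
      (use rep_to_l2[OF square_integrable_scaleR[OF f, of c]]
      rep_l2_scaleR[of c "to_l2 f"] rep_to_l2[OF f] in \<open>eventually_elim, simp\<close>)

lemma to_l2_sum:
  assumes "\<And>i. i \<in> A \<Longrightarrow> square_integrable (f i)"
  shows "to_l2 (\<lambda>\<xi>. \<Sum>i\<in>A. f i \<xi>) = (\<Sum>i\<in>A. to_l2 (f i))"
  using assms
proof (induction A rule: infinite_finite_induct)
  case (insert i A)
  then show ?case by (simp add: to_l2_add square_integrable_sum)
qed (simp_all add: zero_l2_def)

lemma norm_to_l2_mono:
  fixes f :: "'a::euclidean_space \<Rightarrow> complex"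
  assumes "square_integrable f" "square_integrable g" "\<And>x. norm (f x) \<le> C * norm (g x)" "C \<ge> 0"
  shows "norm (to_l2 f) \<le> C * norm (to_l2 g)"
proof (rule power2_le_imp_le)
  have "(norm (f x))\<^sup>2 \<le> C\<^sup>2 * (norm (g x))\<^sup>2" for x
    using power_mono[OF assms(3)[of x], of 2] by (simp add: power_mult_distrib)
  then have "(LINT x|lborel. (norm (f x))\<^sup>2) \<le> (LINT x|lborel. C\<^sup>2 * (norm (g x))\<^sup>2)"
    using assms by (intro integral_mono) (auto simp: square_integrable_norm_sq)
  then show "(norm (to_l2 f))\<^sup>2 \<le> (C * norm (to_l2 g))\<^sup>2"
    using assms by (simp add: norm_to_l2_sq power_mult_distrib)
qed (use assms in auto)

text \<open>
  Fatou's lemma identifies a mean-square limit with a pointwise limit; this is how the explicit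
  integral formulas below are recognised as the objects obtained by completion.
\<close>

lemma to_l2_pointwise_limit:
  fixes f :: "nat \<Rightarrow> 'a::euclidean_space \<Rightarrow> complex"
  assumes sq: "\<And>k. square_integrable (f k)" and g[measurable]: "g \<in> borel_measurable borel"
    and lim: "AE x in lborel. (\<lambda>k. f k x) \<longlonglongrightarrow> g x" and l2: "(\<lambda>k. to_l2 (f k)) \<longlonglongrightarrow> y"
  shows "square_integrable g \<and> to_l2 g = y"
proof -
  have [measurable]: "f k \<in> borel_measurable borel" for k using sq by
      (rule square_integrable_measurable)
  have "(\<integral>\<^sup>+x. ennreal ((norm (g x - rep_l2 y x))\<^sup>2) \<partial>lborel)
      = (\<integral>\<^sup>+x. liminf (\<lambda>k. ennreal ((norm (f k x - rep_l2 y x))\<^sup>2)) \<partial>lborel)"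
  proof (rule nn_integral_cong_AE, use lim in eventually_elim)
    case (elim x)
    have "(\<lambda>k. ennreal ((norm (f k x - rep_l2 y x))\<^sup>2)) \<longlonglongrightarrow> ennreal ((norm (g x - rep_l2 y x))\<^sup>2)"
      by (intro tendsto_intros elim)
    then show ?case by (rule lim_imp_Liminf[OF sequentially_bot, symmetric])
  qed
  also have "\<dots> \<le> liminf (\<lambda>k. \<integral>\<^sup>+x. ennreal ((norm (f k x - rep_l2 y x))\<^sup>2) \<partial>lborel)"
    by (rule nn_integral_liminf) simp
  also have "(\<lambda>k. \<integral>\<^sup>+x. ennreal ((norm (f k x - rep_l2 y x))\<^sup>2) \<partial>lborel)
      = (\<lambda>k. ennreal ((norm (to_l2 (f k) - y))\<^sup>2))"
    by (subst nn_integral_norm_to_l2) (auto simp: sq square_integrable_diff to_l2_diff)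
  also have "liminf \<dots> = ennreal ((norm (y - y))\<^sup>2)"
    by (intro lim_imp_Liminf tendsto_intros l2) simp
  finally have "(\<integral>\<^sup>+x. ennreal ((norm (g x - rep_l2 y x))\<^sup>2) \<partial>lborel) = 0" by simp
  then have "AE x in lborel. ennreal ((norm (g x - rep_l2 y x))\<^sup>2) = 0"
    by (subst (asm) nn_integral_0_iff_AE) auto
  then have "AE x in lborel. rep_l2 y x = g x" by eventually_elim auto
  then show ?thesis using to_l2_cong[OF rep_l2_square_integrable g] by simp
qed

lemma to_l2_dominated_convergence:
  fixes f :: "nat \<Rightarrow> 'a::euclidean_space \<Rightarrow> complex"
  assumes w: "square_integrable w" and f[measurable]: "\<And>k. f k \<in> borel_measurable borel"
    and g[measurable]: "g \<in> borel_measurable borel"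
    and lim: "AE x in lborel. (\<lambda>k. f k x) \<longlonglongrightarrow> g x" and bd: "\<And>k x. norm (f k x) \<le> norm (w x)"
  shows "(\<lambda>k. to_l2 (f k)) \<longlonglongrightarrow> to_l2 g \<and> square_integrable g"
proof -
  note [measurable] = square_integrable_measurable[OF w]
  have sqf: "square_integrable (f k)" for k
    by (rule square_integrable_dominated[OF w, of _ 1]) (use bd in auto)
  \<comment> \<open>A version of the limit that is dominated everywhere, not only almost everywhere.\<close>
  define h where "h x = (if norm (g x) \<le> norm (w x) then g x else 0)" for x
  have h[measurable]: "h \<in> borel_measurable borel" unfolding h_def by measurable
  have sqh: "square_integrable h"
    by (rule square_integrable_dominated[OF w, of _ 1]) (auto simp: h_def)
  have gh: "AE x in lborel. h x = g x"
    using lim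
  proof eventually_elim
    case (elim x)
    have "norm (g x) \<le> norm (w x)"
      by (rule LIMSEQ_le_const2[OF tendsto_norm[OF elim]]) (use bd in auto)
    then show ?case by (simp add: h_def)
  qed
  have sqg: "square_integrable g" and hg: "to_l2 h = to_l2 g" using to_l2_cong[OF sqh g gh] by auto
  have "(\<lambda>k. LINT x|lborel. (norm (f k x - h x))\<^sup>2) \<longlonglongrightarrow> (LINT x|(lborel::'a measure). (0::real))"
  proof (rule integral_dominated_convergence[where w="\<lambda>x. 4 * (norm (w x))\<^sup>2"])
    show "integrable lborel (\<lambda>x. 4 * (norm (w x))\<^sup>2)" using w by
        (simp add: square_integrable_norm_sq)
    show "AE x in lborel. (\<lambda>k. (norm (f k x - h x))\<^sup>2) \<longlonglongrightarrow> 0"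
      using lim gh
    proof eventually_elim
      case (elim x)
      then have "(\<lambda>k. (norm (f k x - h x))\<^sup>2) \<longlonglongrightarrow> (norm (g x - h x))\<^sup>2" by (intro tendsto_intros)
      then show ?case using elim by simp
    qed
    show "AE x in lborel. norm ((norm (f k x - h x))\<^sup>2) \<le> 4 * (norm (w x))\<^sup>2" for k
    proof (rule AE_I2)
      fix x
      have "norm (f k x - h x) \<le> 2 * norm (w x)"
        using norm_triangle_ineq4[of "f k x" "h x"] bd[of k x] norm_ge_zero[of "w x"]
        unfolding h_def by (smt (verit) norm_zero)
      from power_mono[OF this, of 2] show "norm ((norm (f k x - h x))\<^sup>2) \<le> 4 * (norm (w x))\<^sup>2"
        by (simp add: power_mult_distrib)
    qed
  qed measurable
  then have "(\<lambda>k. (norm (to_l2 (f k) - to_l2 h))\<^sup>2) \<longlonglongrightarrow> 0"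
    by (simp add: sqf sqh norm_to_l2_sq square_integrable_diff flip: to_l2_diff)
  then have "(\<lambda>k. sqrt ((norm (to_l2 (f k) - to_l2 h))\<^sup>2)) \<longlonglongrightarrow> sqrt 0"
    by (rule tendsto_real_sqrt)
  then have "(\<lambda>k. norm (to_l2 (f k) - to_l2 h)) \<longlonglongrightarrow> 0" by simp
  then have "(\<lambda>k. to_l2 (f k)) \<longlonglongrightarrow> to_l2 h"
    by (rule LIM_zero_cancel[OF tendsto_norm_zero_cancel])
  then show ?thesis using hg sqg by simp
qed

text \<open>
  The Riesz--Fischer theorem. The weights \<open>2 ^ k\<close> make the pointwise increments of a fast Cauchy
  subsequence summable almost everywhere, using a single exchange of sum and integral.
\<close>

instance l2 :: (euclidean_space) complete_space
proof
  fix X :: "nat \<Rightarrow> 'a l2" assume C: "Cauchy X"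
  have "\<forall>k. \<exists>N. \<forall>m\<ge>N. \<forall>n\<ge>N. dist (X m) (X n) < (1/2)^k"
    using C unfolding Cauchy_def by simp
  then obtain N where N: "\<And>k m n. m \<ge> N k \<Longrightarrow> n \<ge> N k \<Longrightarrow> dist (X m) (X n) < (1/2)^k" by metis
  \<comment> \<open>A choice of indices beyond all of the \<open>N i\<close> with \<open>i \<le> k\<close>.\<close>
  define r where "r k = (\<Sum>i\<le>k. N i) + k" for k
  have r_ge: "N k \<le> r l" if "k \<le> l" for k l
  proof -
    have "N k \<le> (\<Sum>i\<le>l. N i)" using that by (intro member_le_sum) auto
    then show ?thesis unfolding r_def by simp
  qed
  have fast: "norm (X (r l) - X (r k)) \<le> (1/2)^k" if "k \<le> l" for k l
    using N[OF r_ge[OF that] r_ge[OF order_refl]] by (simp add: dist_norm)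
  define g where "g k = rep_l2 (X (r k))" for k
  have [measurable]: "g k \<in> borel_measurable borel" for k unfolding g_def by measurable
  have int_g: "(\<integral>\<^sup>+x. ennreal ((norm (g l x - g k x))\<^sup>2) \<partial>lborel) \<le> ennreal (((1/2)^k)\<^sup>2)"
    if "k \<le> l" for k l
  proof -
    have "(\<integral>\<^sup>+x. ennreal ((norm (g l x - g k x))\<^sup>2) \<partial>lborel) = ennreal ((norm (X (r l) - X (r k)))\<^sup>2)"
      unfolding g_def by (subst nn_integral_norm_to_l2)
          (auto simp: square_integrable_diff to_l2_diff)
    also have "\<dots> \<le> ennreal (((1/2)^k)\<^sup>2)"
      using fast[OF that] by (intro ennreal_leI power_mono) auto
    finally show ?thesis .
  qed
  have "(\<integral>\<^sup>+x. (\<Sum>k. ennreal (2^k) * ennreal ((norm (g (Suc k) x - g k x))\<^sup>2)) \<partial>lborel)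
      = (\<Sum>k. ennreal (2^k) * (\<integral>\<^sup>+x. ennreal ((norm (g (Suc k) x - g k x))\<^sup>2) \<partial>lborel))"
    by (subst nn_integral_suminf) (auto simp: nn_integral_cmult)
  also have "\<dots> \<le> (\<Sum>k. ennreal ((1/2)^k))"
  proof (intro suminf_le summableI)
    fix k
    have "ennreal (2^k) * (\<integral>\<^sup>+x. ennreal ((norm (g (Suc k) x - g k x))\<^sup>2) \<partial>lborel)
       \<le> ennreal (2^k) * ennreal (((1/2)^k)\<^sup>2)"
      by (intro mult_left_mono int_g) auto
    also have "\<dots> = ennreal ((1/2)^k)"
      by (simp add: ennreal_mult[symmetric] power2_eq_square power_divide del: ennreal_power)
    finally show "ennreal (2^k) * (\<integral>\<^sup>+x. ennreal ((norm (g (Suc k) x - g k x))\<^sup>2) \<partial>lborel)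
        \<le> ennreal ((1/2)^k)" .
  qed
  also have "\<dots> < \<infinity>"
    by (subst suminf_ennreal2) (auto intro!: summable_geometric simp: less_top[symmetric])
  finally have "(\<integral>\<^sup>+x. (\<Sum>k. ennreal (2^k) * ennreal ((norm (g (Suc k) x - g k x))\<^sup>2)) \<partial>lborel) \<noteq> \<infinity>"
    by simp
  then have "AE x in lborel. (\<Sum>k. ennreal (2^k) * ennreal ((norm (g (Suc k) x - g k x))\<^sup>2)) \<noteq> \<infinity>"
    by (intro nn_integral_PInf_AE) measurable
  then have conv: "AE x in lborel. convergent (\<lambda>k. g k x)"
  proof eventually_elim
    case (elim x)
    define S where "S = (\<Sum>k. ennreal (2^k) * ennreal ((norm (g (Suc k) x - g k x))\<^sup>2))"
    obtain c where c: "S = ennreal c" "c \<ge> 0" using elim by (cases S) (auto simp: S_def)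
    have bd: "norm (g (Suc k) x - g k x) \<le> sqrt c * (sqrt (1/2))^k" for k
    proof -
      have "ennreal (2^k * (norm (g (Suc k) x - g k x))\<^sup>2)
          = ennreal (2^k) * ennreal ((norm (g (Suc k) x - g k x))\<^sup>2)"
        by (simp add: ennreal_mult del: ennreal_power)
      also have "\<dots> \<le> S"
        unfolding S_def using sum_le_suminf[of "\<lambda>k. ennreal (2^k) * ennreal ((norm (g (Suc k) x
            - g k x))\<^sup>2)" "{k}"]
        by simp
      finally have "2^k * (norm (g (Suc k) x - g k x))\<^sup>2 \<le> c" using c by (simp del: ennreal_mult')
      then have "(norm (g (Suc k) x - g k x))\<^sup>2 \<le> c * (1/2)^k" by
          (simp add: field_simps power_divide)
      then have "norm (g (Suc k) x - g k x) \<le> sqrt (c * (1/2)^k)" by (rule real_le_rsqrt)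
      then show ?thesis by (simp add: real_sqrt_mult real_sqrt_power)
    qed
    have "summable (\<lambda>k. sqrt c * (sqrt (1/2))^k)"
      by (intro summable_mult summable_geometric) (simp add: real_sqrt_divide)
    then have "summable (\<lambda>k. g (Suc k) x - g k x)"
      by (rule summable_comparison_test'[where N=0]) (use bd in auto)
    then have "convergent (\<lambda>n. \<Sum>k<n. g (Suc k) x - g k x)" by (simp add: summable_iff_convergent)
    then have "convergent (\<lambda>n. g n x - g 0 x)" by (subst (asm) sum_lessThan_telescope)
    then show ?case by (simp add: convergent_diff_const_right_iff)
  qed
  define h where "h x = lim (\<lambda>k. g k x)" for x
  have [measurable]: "h \<in> borel_measurable borel"
    unfolding h_def by (rule borel_measurable_lim_metric) measurable
  have hlim: "AE x in lborel. (\<lambda>k. g k x) \<longlonglongrightarrow> h x"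
    using conv by eventually_elim (simp add: h_def convergent_LIMSEQ_iff)
  have bound: "(\<integral>\<^sup>+x. ennreal ((norm (h x - g k x))\<^sup>2) \<partial>lborel) \<le> ennreal (((1/2)^k)\<^sup>2)" for k
  proof -
    have "(\<integral>\<^sup>+x. ennreal ((norm (h x - g k x))\<^sup>2) \<partial>lborel)
       = (\<integral>\<^sup>+x. liminf (\<lambda>l. ennreal ((norm (g l x - g k x))\<^sup>2)) \<partial>lborel)"
    proof (rule nn_integral_cong_AE, use hlim in eventually_elim)
      case (elim x)
      have "(\<lambda>l. ennreal ((norm (g l x - g k x))\<^sup>2)) \<longlonglongrightarrow> ennreal ((norm (h x - g k x))\<^sup>2)"
        by (intro tendsto_intros elim)
      then show ?case by (rule lim_imp_Liminf[OF sequentially_bot, symmetric])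
    qed
    also have "\<dots> \<le> liminf (\<lambda>l. \<integral>\<^sup>+x. ennreal ((norm (g l x - g k x))\<^sup>2) \<partial>lborel)"
      by (rule nn_integral_liminf) measurable
    also have "\<dots> \<le> liminf (\<lambda>l. ennreal (((1/2)^k)\<^sup>2))"
      by (rule Liminf_mono, rule eventually_sequentiallyI[of k]) (rule int_g)
    finally show ?thesis by (simp add: Liminf_const)
  qed
  have sqd: "square_integrable (\<lambda>x. h x - g k x)" for k
    by (subst square_integrable_iff_nn_integral)
      (use le_less_trans[OF bound ennreal_less_top] in \<open>auto\<close>)
  have "square_integrable (\<lambda>x. (h x - g 0 x) + g 0 x)"
    by (intro square_integrable_add sqd) (simp add: g_def)
  then have sqh: "square_integrable h" by simp
  have "dist (X (r k)) (to_l2 h) \<le> (1/2)^k" for k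
  proof -
    have "ennreal ((norm (to_l2 h - X (r k)))\<^sup>2) \<le> ennreal (((1/2)^k)\<^sup>2)"
      using bound[of k] nn_integral_norm_to_l2[OF sqd[of k]] sqh
      by (simp add: to_l2_diff g_def)
    then have "(norm (to_l2 h - X (r k)))\<^sup>2 \<le> ((1/2)^k)\<^sup>2" by
        (simp add: ennreal_le_iff del: ennreal_power)
    then show ?thesis by (simp add: power2_le_iff_abs_le dist_norm norm_minus_commute)
  qed
  have "(\<lambda>n. X n) \<longlonglongrightarrow> to_l2 h"
  proof (rule LIMSEQ_I)
    fix e :: real assume "e > 0"
    obtain k where k: "(1/2)^k < e/2" using real_arch_pow_inv[of "e/2" "1/2"] \<open>e > 0\<close> by auto
    have "norm (X n - to_l2 h) < e" if "n \<ge> r k" for n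
    proof -
      have "dist (X n) (X (r k)) < (1/2)^k"
        using that r_ge[of k k] by (intro N) auto
      then have "dist (X n) (to_l2 h) < e"
        using dist_triangle[of "X n" "to_l2 h" "X (r k)"] \<open>dist (X (r k)) (to_l2 h) \<le> (1/2)^k\<close> k
            by linarith
      then show ?thesis by (simp add: dist_norm)
    qed
    then show "\<exists>no. \<forall>n\<ge>no. norm (X n - to_l2 h) < e" by blast
  qed
  then show "convergent X" by (auto simp: convergent_def)
qed

instance l2 :: (euclidean_space) banach ..

section \<open>Fourier integrals and Gaussians\<close>

definition fourier_integral :: "('a::euclidean_space \<Rightarrow> complex) \<Rightarrow> 'a \<Rightarrow> complex" where
  "fourier_integral f \<xi> = (LINT x|lborel. f x * cis (- (x \<bullet> \<xi>)))"

lemma cis_measurable [measurable]: "cis \<in> borel_measurable borel"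
  by (intro borel_measurable_continuous_onI continuous_intros)

lemma integrable_mult_cis:
  fixes f :: "'a::euclidean_space \<Rightarrow> complex"
  assumes f: "integrable lborel f" and g[measurable]: "g \<in> borel_measurable borel"
  shows "integrable lborel (\<lambda>x. f x * cis (g x))"
proof (rule Bochner_Integration.integrable_bound[OF f])
  have [measurable]: "f \<in> borel_measurable borel" using f by (auto simp: integrable_iff_bounded)
  show "(\<lambda>x. f x * cis (g x)) \<in> borel_measurable lborel" by measurable
qed (auto simp: norm_mult)

lemma fourier_integral_measurable [measurable]:
  assumes [measurable]: "f \<in> borel_measurable borel"
  shows "fourier_integral f \<in> borel_measurable borel"
  unfolding fourier_integral_def[abs_def] by measurable

lemma fourier_integral_integrand: "integrable lborel f
    \<Longrightarrow> integrable lborel (\<lambda>x. f x * cis (- (x \<bullet> \<xi>)))"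
  by (rule integrable_mult_cis) auto

lemma fourier_integral_norm_le: "norm (fourier_integral f \<xi>) \<le> (LINT x|lborel. norm (f x))"
  unfolding fourier_integral_def by (rule order_trans[OF integral_norm_bound]) (simp add: norm_mult)

lemma fourier_integral_add: "integrable lborel f \<Longrightarrow> integrable lborel g
    \<Longrightarrow> fourier_integral (\<lambda>x. f x + g x) \<xi> = fourier_integral f \<xi> + fourier_integral g \<xi>"
  unfolding fourier_integral_def by (simp add: distrib_right fourier_integral_integrand)

lemma fourier_integral_diff: "integrable lborel f \<Longrightarrow> integrable lborel g
    \<Longrightarrow> fourier_integral (\<lambda>x. f x - g x) \<xi> = fourier_integral f \<xi> - fourier_integral g \<xi>"
  unfolding fourier_integral_def by (simp add: left_diff_distrib fourier_integral_integrand)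

lemma fourier_integral_cmult: "integrable lborel f \<Longrightarrow> fourier_integral (\<lambda>x. c * f x) \<xi>
    = c * fourier_integral f \<xi>"
  unfolding fourier_integral_def by (simp add: mult.assoc fourier_integral_integrand)

lemma fourier_integral_scaleR: "integrable lborel f \<Longrightarrow> fourier_integral (\<lambda>x. c *\<^sub>R f x) \<xi>
    = c *\<^sub>R fourier_integral f \<xi>"
  unfolding fourier_integral_def by (simp add: fourier_integral_integrand)

lemma fourier_integral_sum:
  "(\<And>i. i \<in> A \<Longrightarrow> integrable lborel (f i)) \<Longrightarrow> fourier_integral (\<lambda>x. \<Sum>i\<in>A. f i x) \<xi>
      = (\<Sum>i\<in>A. fourier_integral (f i) \<xi>)"
  unfolding fourier_integral_def by (simp add: sum_distrib_right fourier_integral_integrand)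

lemma fourier_integral_cong_AE:
  assumes [measurable]: "f \<in> borel_measurable borel" "g \<in> borel_measurable borel"
    and "AE x in lborel. f x = g x"
  shows "fourier_integral f = fourier_integral g"
proof
  show "fourier_integral f \<xi> = fourier_integral g \<xi>" for \<xi>
    unfolding fourier_integral_def by (rule integral_cong_AE, measurable)
        (use assms(3) in \<open>eventually_elim, simp\<close>)
qed

lemma lborel_distr_uminus_euclidean: "distr lborel borel (\<lambda>x. - x)
    = (lborel :: 'a::euclidean_space measure)"
proof -
  show ?thesis using lborel_affine[of "-1" "0::'a"] by (simp add: density_1)
qed

lemma lborel_integral_uminus:
  fixes f :: "'a::euclidean_space \<Rightarrow> 'b::{banach, second_countable_topology}"
  shows "(LINT x|lborel. f (- x)) = (LINT x|lborel. f x)"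
proof (cases "f \<in> borel_measurable borel")
  case True
  show ?thesis
    by (subst (2) lborel_distr_uminus_euclidean[symmetric], subst integral_distr) (use True in auto)
next
  case False
  have "(\<lambda>x. f (- x)) \<notin> borel_measurable borel"
  proof
    assume [measurable]: "(\<lambda>x. f (- x)) \<in> borel_measurable borel"
    have "(\<lambda>x. f (- (- x))) \<in> borel_measurable borel" by measurable
    then show False using False by simp
  qed
  then have "\<not> integrable lborel f" "\<not> integrable lborel (\<lambda>x. f (- x))"
    using False by (auto simp: integrable_iff_bounded)
  then show ?thesis by (simp add: not_integrable_integral_eq)
qed

lemma lborel_integrable_uminus:
  fixes f :: "'a::euclidean_space \<Rightarrow> 'b::{banach, second_countable_topology}"
  assumes "integrable lborel f" shows "integrable lborel (\<lambda>x. f (- x))"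
proof -
  have "f \<in> borel_measurable borel" using assms by (auto simp: integrable_iff_bounded)
  then show ?thesis
    using assms by (subst (asm) lborel_distr_uminus_euclidean[symmetric], subst (asm)
        integrable_distr_eq) auto
qed

lemma lborel_AE_uminus:
  assumes "AE x in lborel. P (x::'a::euclidean_space)" shows "AE x in lborel. P (- x)"
  using assms by (subst (asm) lborel_distr_uminus_euclidean[symmetric]) (rule AE_distrD, auto)

lemma lborel_integral_shift:
  fixes f :: "'a::euclidean_space \<Rightarrow> 'b::{banach, second_countable_topology}"
  assumes [measurable]: "f \<in> borel_measurable borel"
  shows "(LINT x|lborel. f (c + x)) = (LINT x|lborel. f x)"
  by (subst (2) lborel_distr_plus[of c, symmetric], subst integral_distr) auto

lemma lborel_integrable_shift:
  fixes f :: "'a::euclidean_space \<Rightarrow> 'b::{banach, second_countable_topology}"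
  assumes "integrable lborel f" shows "integrable lborel (\<lambda>x. f (c + x))"
proof -
  have "f \<in> borel_measurable borel" using assms by (auto simp: integrable_iff_bounded)
  then show ?thesis
    using assms by (subst (asm) lborel_distr_plus[of c, symmetric], subst (asm) integrable_distr_eq)
        auto
qed

lemma nn_integral_shift:
  fixes f :: "'a::euclidean_space \<Rightarrow> ennreal"
  assumes [measurable]: "f \<in> borel_measurable borel"
  shows "(\<integral>\<^sup>+x. f (c + x) \<partial>lborel) = (\<integral>\<^sup>+x. f x \<partial>lborel)"
  by (subst (2) lborel_distr_plus[of c, symmetric], subst nn_integral_distr) auto

lemma lborel_integral_scaleR:
  fixes f :: "'a::euclidean_space \<Rightarrow> 'b::{banach, second_countable_topology}"
  assumes [measurable]: "f \<in> borel_measurable borel" and "e > 0"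
  shows "(LINT x|lborel. f x) = e ^ DIM('a) *\<^sub>R (LINT x|lborel. f (e *\<^sub>R x))"
proof -
  have *: "lborel = density (distr lborel borel (\<lambda>x::'a. 0 + e *\<^sub>R x)) (\<lambda>_. ennreal (\<bar>e\<bar>^DIM('a)))"
    using lborel_affine[of e "0::'a"] \<open>e > 0\<close> by (simp add: ennreal_power)
  show ?thesis
    by (subst *, subst integral_density) (use \<open>e > 0\<close> in \<open>auto simp: integral_distr\<close>)
qed

text \<open>
  Lebesgue measure is a product measure over the coordinates, so tensor products integrate
  coordinatewise.
\<close>

lemma lborel_integral_prod:
  fixes f :: "'a::euclidean_space \<Rightarrow> real \<Rightarrow> complex"
  assumes "\<And>b. b \<in> Basis \<Longrightarrow> integrable lborel (f b)"
  shows "integrable lborel (\<lambda>x::'a. \<Prod>b\<in>Basis. f b (x \<bullet> b))" (is ?A)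
    and "(LINT x|(lborel::'a measure). (\<Prod>b\<in>Basis. f b (x \<bullet> b)))
        = (\<Prod>b\<in>Basis. (LINT x|lborel. f b x))" (is ?B)
proof -
  interpret product_sigma_finite "\<lambda>_::'a. lborel::real measure" by standard
  have [measurable]: "f b \<in> borel_measurable borel" if "b \<in> Basis" for b
    using assms[OF that] by (auto simp: integrable_iff_bounded)
  have m: "(\<lambda>x::'a. \<Prod>b\<in>Basis. f b (x \<bullet> b)) \<in> borel_measurable borel" by measurable
  have eq: "(\<Prod>b\<in>Basis. f b ((\<Sum>c\<in>Basis. g c *\<^sub>R c) \<bullet> b)) = (\<Prod>b\<in>Basis. f b (g b))" for g :: "'a \<Rightarrow> real"
    by (rule prod.cong) auto
  show ?A
    by (subst lborel_eq, subst integrable_distr_eq[OF _ m])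
      (auto simp: eq intro!: product_integrable_prod assms)
  show ?B
    by (subst lborel_eq, subst integral_distr[OF _ m])
      (auto simp: eq intro!: product_integral_prod assms)
qed

text \<open>
  A Gaussian of standard deviation \<open>1 / e\<close>, normalised to have the value 1 at the origin.
\<close>

definition gaussian :: "real \<Rightarrow> 'a::euclidean_space \<Rightarrow> real" where
  "gaussian e x = exp (- ((e * norm x)\<^sup>2) / 2)"

lemma gaussian_measurable [measurable]: "gaussian e \<in> borel_measurable borel"
  unfolding gaussian_def[abs_def] by measurable

text \<open>A rescaling of the characteristic function of the standard normal distribution.\<close>

lemma gaussian_one_dim:
  fixes e t :: real
  assumes "e > 0"
  shows "integrable lborel (\<lambda>y. complex_of_real (exp (- ((e * y)\<^sup>2) / 2)) * cis (- (y * t)))"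
    and "(LINT y|lborel. complex_of_real (exp (- ((e * y)\<^sup>2) / 2)) * cis (- (y * t)))
      = complex_of_real (sqrt (2 * pi) / e * exp (- ((t / e)\<^sup>2) / 2))"
proof -
  define f where "f y = complex_of_real (exp (- (y\<^sup>2) / 2)) * cis (- (y * (t / e)))" for y :: real
  have f_eq: "f y = complex_of_real (sqrt (2 * pi)) * (std_normal_density y *\<^sub>R iexp (- (t / e)
      * y))" for y
    unfolding f_def std_normal_density_def by (simp add: cis_conv_exp scaleR_conv_of_real mult_ac)
  have int: "integrable lborel (\<lambda>y. std_normal_density y *\<^sub>R iexp (- (t / e) * y))"
    by (rule Bochner_Integration.integrable_bound[OF integrable_normal_density[of 1 0]])
      (auto simp: normal_density_nonneg)
  then have intf: "integrable lborel f" unfolding f_eq[abs_def] by (rule integrable_mult_right)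
  have "(LINT y|lborel. std_normal_density y *\<^sub>R iexp (- (t / e) * y))
      = char std_normal_distribution (- (t / e))"
    unfolding char_def by (subst integral_density) (auto simp: normal_density_nonneg)
  then have intf_eq: "(LINT y|lborel. f y) = complex_of_real (sqrt (2 * pi)
      * exp (- ((t / e)\<^sup>2) / 2))"
    unfolding f_eq[abs_def] integral_mult_right_zero char_std_normal_distribution by simp
  have g_eq: "f (0 + e * y) = complex_of_real (exp (- ((e * y)\<^sup>2) / 2)) * cis (- (y * t))" for y
    unfolding f_def using assms by simp
  show "integrable lborel (\<lambda>y. complex_of_real (exp (- ((e * y)\<^sup>2) / 2)) * cis (- (y * t)))"
    using lborel_integrable_real_affine[OF intf, of e 0] assms unfolding g_eq by simp
  have "(LINT y|lborel. f y) = \<bar>e\<bar> *\<^sub>R (LINT y|lborel. f (0 + e * y))"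
    by (rule lborel_integral_real_affine) (use assms in simp)
  then show "(LINT y|lborel. complex_of_real (exp (- ((e * y)\<^sup>2) / 2)) * cis (- (y * t)))
      = complex_of_real (sqrt (2 * pi) / e * exp (- ((t / e)\<^sup>2) / 2))"
    unfolding g_eq intf_eq using assms by (simp add: field_simps scaleR_conv_of_real)
qed

lemma cis_sum: "finite A \<Longrightarrow> cis (\<Sum>i\<in>A. f i) = (\<Prod>i\<in>A. cis (f i))"
  by (induction A rule: finite_induct) (auto simp: cis_mult[symmetric])

lemma gaussian_prod: "gaussian e x = (\<Prod>b\<in>Basis. exp (- ((e * (x \<bullet> b))\<^sup>2) / 2))"
    for x :: "'a::euclidean_space"
proof -
  have "- ((e * norm x)\<^sup>2) / 2 = (\<Sum>b\<in>Basis. - ((e * (x \<bullet> b))\<^sup>2) / 2)"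
    by (simp add: power_mult_distrib norm_eq_sqrt_inner[of x] euclidean_inner[of x x] sum_nonneg
      power2_eq_square[symmetric] sum_distrib_left sum_divide_distrib sum_negf)
  then show ?thesis unfolding gaussian_def by (simp add: exp_sum)
qed

text \<open>Both the Gaussian and the plane wave are products over the coordinates.\<close>

lemma fourier_integral_gaussian:
  fixes x :: "'a::euclidean_space"
  assumes "e > 0"
  shows "integrable lborel (\<lambda>\<xi>::'a. complex_of_real (gaussian e \<xi>))"
    and "fourier_integral (\<lambda>\<xi>. complex_of_real (gaussian e \<xi>)) x
        = complex_of_real ((sqrt (2 * pi) / e) ^ DIM('a) * gaussian (1 / e) x)"
proof -
  define h where "h x b y = complex_of_real (exp (- ((e * y)\<^sup>2) / 2)) * cis (- (y * (x \<bullet> b)))"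
      for x b :: 'a and y
  have h_eq: "complex_of_real (gaussian e \<xi>) * cis (- (\<xi> \<bullet> x)) = (\<Prod>b\<in>Basis. h x b (\<xi> \<bullet> b))"
      for x \<xi> :: 'a
  proof -
    have "cis (- (\<xi> \<bullet> x)) = (\<Prod>b\<in>Basis. cis (- ((\<xi> \<bullet> b) * (x \<bullet> b))))"
      by (subst euclidean_inner) (simp add: sum_negf[symmetric] cis_sum)
    then show ?thesis unfolding h_def prod.distrib by (simp add: gaussian_prod)
  qed
  have int: "integrable lborel (h x b)" for x b :: 'a
    unfolding h_def[abs_def] by (rule gaussian_one_dim[OF assms])
  show "integrable lborel (\<lambda>\<xi>::'a. complex_of_real (gaussian e \<xi>))"
    using lborel_integral_prod(1)[of "h 0", OF int] unfolding h_eq[symmetric] by simp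
  have "fourier_integral (\<lambda>\<xi>. complex_of_real (gaussian e \<xi>)) x
      = (\<Prod>b\<in>Basis. (LINT y|lborel. h x b y))"
    unfolding fourier_integral_def h_eq by (rule lborel_integral_prod(2)[OF int])
  also have "\<dots> = (\<Prod>b\<in>(Basis::'a set). complex_of_real (sqrt (2 * pi) / e * exp (- (((x
      \<bullet> b) / e)\<^sup>2) / 2)))"
    unfolding h_def gaussian_one_dim(2)[OF assms] ..
  also have "\<dots> = complex_of_real ((sqrt (2 * pi) / e) ^ DIM('a) * gaussian (1 / e) x)"
    by (simp only: of_real_prod[symmetric] prod.distrib prod_constant gaussian_prod)
        (simp add: prod_dividef)
  finally show "fourier_integral (\<lambda>\<xi>. complex_of_real (gaussian e \<xi>)) x
      = complex_of_real ((sqrt (2 * pi) / e) ^ DIM('a) * gaussian (1 / e) x)" .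
qed

lemma integrable_gaussian: "e > 0 \<Longrightarrow> integrable lborel (gaussian e :: 'a::euclidean_space \<Rightarrow> real)"
  using fourier_integral_gaussian(1)[of e, where 'a='a] by (simp add: complex_of_real_integrable_eq)

lemma integral_gaussian_1: "(LINT x|(lborel::'a::euclidean_space measure). gaussian 1 x)
    = sqrt (2 * pi) ^ DIM('a)"
proof -
  have "complex_of_real (LINT x|(lborel::'a measure). gaussian 1 x)
      = fourier_integral (\<lambda>\<xi>::'a. complex_of_real (gaussian 1 \<xi>)) 0"
    unfolding fourier_integral_def by simp
  also have "\<dots> = complex_of_real (sqrt (2 * pi) ^ DIM('a))"
    using fourier_integral_gaussian(2)[of 1 "0::'a"] by (simp add: gaussian_def)
  finally show ?thesis by (simp only: of_real_eq_iff)
qed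

text \<open>Fubini's theorem, because the kernel \<open>cis (- (x \<bullet> \<xi>))\<close> is symmetric.\<close>

lemma fourier_integral_multiplication_formula:
  fixes F G :: "'a::euclidean_space \<Rightarrow> complex"
  assumes F: "integrable lborel F" and G: "integrable lborel G"
  shows "(LINT \<xi>|lborel. fourier_integral F \<xi> * G \<xi>) = (LINT x|lborel. F x * fourier_integral G x)"
proof -
  have [measurable]: "F \<in> borel_measurable borel" "G \<in> borel_measurable borel"
    using F G by (auto simp: integrable_iff_bounded)
  have int: "integrable (lborel \<Otimes>\<^sub>M lborel) (\<lambda>(x, \<xi>). F x * G \<xi> * cis (- (x \<bullet> \<xi>)))"
  proof (rule lborel_pair.Fubini_integrable)
    show "integrable lborel (\<lambda>x. LINT \<xi>|lborel. norm (case (x, \<xi>) of (x, \<xi>) \<Rightarrow> F x * G \<xi> * cis (- (x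
        \<bullet> \<xi>))))"
      using F by (simp add: norm_mult)
    show "AE x in lborel. integrable lborel (\<lambda>\<xi>. case (x, \<xi>) of (x, \<xi>) \<Rightarrow> F x * G \<xi> * cis (- (x
        \<bullet> \<xi>)))"
      using integrable_mult_cis[OF integrable_mult_right[OF G]] by simp
  qed measurable
  have "(LINT \<xi>|lborel. fourier_integral F \<xi> * G \<xi>)
      = (LINT \<xi>|lborel. LINT x|lborel. F x * G \<xi> * cis (- (x \<bullet> \<xi>)))"
  proof (rule Bochner_Integration.integral_cong[OF refl])
    fix \<xi>
    have "fourier_integral F \<xi> * G \<xi> = (LINT x|lborel. F x * cis (- (x \<bullet> \<xi>)) * G \<xi>)"
      unfolding fourier_integral_def by (rule integral_mult_left_zero[symmetric])
    then show "fourier_integral F \<xi> * G \<xi> = (LINT x|lborel. F x * G \<xi> * cis (- (x \<bullet> \<xi>)))" by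
        (simp add: mult_ac)
  qed
  also have "\<dots> = (LINT x|lborel. LINT \<xi>|lborel. F x * G \<xi> * cis (- (x \<bullet> \<xi>)))"
    by (rule lborel_pair.Fubini_integral[OF int])
  also have "\<dots> = (LINT x|lborel. F x * fourier_integral G x)"
    unfolding fourier_integral_def by (simp add: mult.assoc inner_commute)
  finally show ?thesis .
qed

section \<open>Continuity of translations in the mean\<close>

definition mean_translation :: "('a::euclidean_space \<Rightarrow> complex) \<Rightarrow> 'a \<Rightarrow> real" where
  "mean_translation f z = (LINT x|lborel. norm (f (x - z) - f x))"

lemma integrable_translate:
  fixes f :: "'a::euclidean_space \<Rightarrow> 'b::{banach, second_countable_topology}"
  shows "integrable lborel f \<Longrightarrow> integrable lborel (\<lambda>x. f (x - z))"
  using lborel_integrable_shift[of f "- z"] by simp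

lemma integral_translate:
  fixes f :: "'a::euclidean_space \<Rightarrow> 'b::{banach, second_countable_topology}"
  shows "f \<in> borel_measurable borel \<Longrightarrow> (LINT x|lborel. f (x - z)) = (LINT x|lborel. f x)"
  using lborel_integral_shift[of f "- z"] by simp

text \<open>Translations preserve integrals, so replacing \<open>f\<close> by \<open>g\<close> costs the distance twice.\<close>

lemma mean_translation_perturb:
  assumes f: "integrable lborel f" and g: "integrable lborel g"
  shows "mean_translation f z \<le> mean_translation g z + 2 * (LINT x|lborel. norm (f x - g x))"
proof -
  have d: "integrable lborel (\<lambda>x. norm (f x - g x))" using f g by simp
  have "mean_translation f z \<le> (LINT x|lborel. norm (g (x - z) - g x) + (norm (f (x - z) - g (x
      - z)) + norm (f x - g x)))"
    unfolding mean_translation_def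
  proof (rule integral_mono)
    show "norm (f (x - z) - f x) \<le> norm (g (x - z) - g x) + (norm (f (x - z) - g (x - z))
        + norm (f x - g x))" for x
    proof -
      have "f (x - z) - f x = (g (x - z) - g x) + ((f (x - z) - g (x - z)) - (f x - g x))" by simp
      then show ?thesis
        using norm_triangle_ineq[of "g (x - z) - g x" "(f (x - z) - g (x - z)) - (f x - g x)"]
          norm_triangle_ineq4[of "f (x - z) - g (x - z)" "f x - g x"] by simp
    qed
  qed (use f g integrable_translate[OF f, of z] integrable_translate[OF g, of z] in auto)
  also have "\<dots> = mean_translation g z + ((LINT x|lborel. norm (f (x - z) - g (x - z)))
      + (LINT x|lborel. norm (f x - g x)))"
    unfolding mean_translation_def
    using f g integrable_translate[OF f, of z] integrable_translate[OF g, of z] by auto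
  also have "(LINT x|lborel. norm (f (x - z) - g (x - z))) = (LINT x|lborel. norm (f x - g x))"
    by (rule integral_translate) (use borel_measurable_integrable[OF d] in simp)
  finally show ?thesis by simp
qed

text \<open>
  For an open set the indicator is lower semicontinuous, so dominated convergence controls the
  mass lost by a small translation; the mass gained is the same because translations preserve
  measure.
\<close>

lemma mean_translation_open:
  fixes U :: "'a::euclidean_space set" and z :: "nat \<Rightarrow> 'a"
  assumes U: "open U" and fin: "emeasure lborel U < \<infinity>" and z: "z \<longlonglongrightarrow> 0"
  shows "(\<lambda>k. mean_translation (indicator U) (z k)) \<longlonglongrightarrow> 0"
proof -
  define I where "I = (indicator U :: 'a \<Rightarrow> real)"
  have [measurable]: "U \<in> sets borel" using U by simp
  have I_m[measurable]: "I \<in> borel_measurable borel" unfolding I_def by measurable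
  have intI: "integrable lborel I" unfolding I_def using fin by (simp add: less_top[symmetric])
  define P where "P k x = max 0 (I x - I (x - z k))" for k x
  have "(\<lambda>k. LINT x|lborel. P k x) \<longlonglongrightarrow> (LINT x|(lborel::'a measure). 0)"
  proof (rule integral_dominated_convergence[where w=I])
    show "AE x in lborel. (\<lambda>k. P k x) \<longlonglongrightarrow> 0"
    proof (rule AE_I2)
      fix x
      show "(\<lambda>k. P k x) \<longlonglongrightarrow> 0"
      proof (cases "x \<in> U")
        case True
        have "(\<lambda>k. x - z k) \<longlonglongrightarrow> x - 0" by (intro tendsto_intros z)
        then have "\<forall>\<^sub>F k in sequentially. x - z k \<in> U"
          using topological_tendstoD[of _ "x - 0" sequentially U] U True by simp
        then have "\<forall>\<^sub>F k in sequentially. P k x = 0"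
          by eventually_elim (simp add: P_def I_def True)
        then show ?thesis by (rule tendsto_eventually)
      next
        case False
        then show ?thesis by (simp add: P_def I_def indicator_def)
      qed
    qed
    show "AE x in lborel. norm (P k x) \<le> I x" for k
      by (auto simp: P_def I_def indicator_def)
  qed (use intI in \<open>auto simp: P_def\<close>)
  then have P0: "(\<lambda>k. LINT x|lborel. P k x) \<longlonglongrightarrow> 0" by simp
  have intP: "integrable lborel (P k)" for k
    unfolding P_def[abs_def] using intI integrable_translate[OF intI] by simp
  have "mean_translation (indicator U) (z k) = 2 * (LINT x|lborel. P k x)" for k
  proof -
    have "mean_translation (indicator U) (z k) = (LINT x|lborel. 2 * P k x + (I (x - z k) - I x))"
      unfolding mean_translation_def
      by (rule Bochner_Integration.integral_cong) (auto simp: P_def I_def indicator_def)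
    also have "\<dots> = 2 * (LINT x|lborel. P k x) + ((LINT x|lborel. I (x - z k))
        - (LINT x|lborel. I x))"
      using intI integrable_translate[OF intI] intP by simp
    finally show ?thesis by (simp add: integral_translate)
  qed
  then show ?thesis using tendsto_mult_left[OF P0, of 2] by simp
qed

lemma mean_translation_closure:
  assumes f: "integrable lborel f"
    and approx: "\<And>e. e > 0 \<Longrightarrow> \<exists>g. integrable lborel g \<and> (LINT x|lborel. norm (f x - g x)) \<le> e
       \<and> (\<lambda>k. mean_translation g (z k)) \<longlonglongrightarrow> 0"
  shows "(\<lambda>k. mean_translation f (z k)) \<longlonglongrightarrow> 0"
proof (rule LIMSEQ_I)
  fix e :: real assume "e > 0"
  obtain g where g: "integrable lborel g" "(LINT x|lborel. norm (f x - g x)) \<le> e/4"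
    "(\<lambda>k. mean_translation g (z k)) \<longlonglongrightarrow> 0"
    using approx[of "e/4"] \<open>e > 0\<close> by auto
  obtain K where K: "\<And>k. k \<ge> K \<Longrightarrow> norm (mean_translation g (z k)) < e/2"
    using LIMSEQ_D[OF g(3), of "e/2"] \<open>e > 0\<close> by auto
  have "norm (mean_translation f (z k) - 0) < e" if "k \<ge> K" for k
  proof -
    have "0 \<le> mean_translation f (z k)" by (simp add: mean_translation_def)
    then show ?thesis using mean_translation_perturb[OF f g(1), of "z k"] K[OF that] g(2) by simp
  qed
  then show "\<exists>K. \<forall>k\<ge>K. norm (mean_translation f (z k) - 0) < e" by blast
qed

text \<open>
  Outer regularity reduces indicators of measurable sets to indicators of open sets; sums and
  dominated limits follow by closure.
\<close>

lemma mean_translation_tendsto_0: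
  fixes f :: "'a::euclidean_space \<Rightarrow> complex"
  assumes "integrable lborel f" and z: "z \<longlonglongrightarrow> 0"
  shows "(\<lambda>k. mean_translation f (z k)) \<longlonglongrightarrow> 0"
  using assms(1)
proof (induction rule: integrable_induct)
  case (base A c)
  have [measurable]: "A \<in> sets borel" using base by simp
  have intA: "integrable lborel (\<lambda>x. indicator A x *\<^sub>R c)"
    using base by (auto simp: less_top[symmetric])
  show ?case
  proof (rule mean_translation_closure[OF intA])
    fix e :: real assume "e > 0"
    \<comment> \<open>The 1 covers the case \<open>c = 0\<close>.\<close>
    define d where "d = e / (norm c + 1)"
    have "d > 0" unfolding d_def using \<open>e > 0\<close> by (simp add: add_nonneg_pos)
    obtain U where U: "open U" "A \<subseteq> U" "emeasure lborel (U - A) < d"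
      using outer_regular_lborel[of A d] \<open>d > 0\<close> by auto
    have [measurable]: "U \<in> sets borel" using U by simp
    have "emeasure lborel U \<le> emeasure lborel (U - A) + emeasure lborel A"
      using emeasure_subadditive[of "U - A" lborel A] U by (simp add: Un_absorb2)
    also have "\<dots> < \<infinity>" using U base by (metis ennreal_add_less_top ennreal_less_top
        infinity_ennreal_def less_trans)
    finally have finU: "emeasure lborel U < \<infinity>" .
    have intU: "integrable lborel (\<lambda>x. indicator U x *\<^sub>R c)" using finU by
        (auto simp: less_top[symmetric])
    have "mean_translation (\<lambda>x. indicator U x *\<^sub>R c) w = norm c * mean_translation (indicator U) w"
        for w
    proof -
      have "mean_translation (\<lambda>x. indicator U x *\<^sub>R c) w
         = (LINT x|lborel. norm c * norm (indicator U (x - w) - indicator U x :: complex))"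
        unfolding mean_translation_def by (rule Bochner_Integration.integral_cong)
            (auto simp: indicator_def)
      then show ?thesis by (simp add: mean_translation_def)
    qed
    then have "(\<lambda>k. mean_translation (\<lambda>x. indicator U x *\<^sub>R c) (z k)) \<longlonglongrightarrow> 0"
      using tendsto_mult_left[OF mean_translation_open[OF U(1) finU z], of "norm c"] by simp
    moreover have "(LINT x|lborel. norm (indicator A x *\<^sub>R c - indicator U x *\<^sub>R c)) \<le> e"
    proof -
      have "(LINT x|lborel. norm (indicator A x *\<^sub>R c - indicator U x *\<^sub>R c))
         = (LINT x|lborel. norm c * indicator (U - A) x)"
        by (rule Bochner_Integration.integral_cong) (use U in \<open>auto simp: indicator_def\<close>)
      also have "\<dots> = norm c * measure lborel (U - A)" by simp
      also have "\<dots> \<le> norm c * d"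
        using U(3) \<open>d > 0\<close> by (intro mult_left_mono) (auto simp: measure_def intro!: enn2real_leI)
      also have "\<dots> \<le> e" unfolding d_def using \<open>e > 0\<close>
        by (simp add: divide_simps add_nonneg_pos mult_left_mono)
      finally show ?thesis .
    qed
    ultimately show "\<exists>g. integrable lborel g \<and> (LINT x|lborel. norm (indicator A x *\<^sub>R c - g x)) \<le> e
        \<and>
       (\<lambda>k. mean_translation g (z k)) \<longlonglongrightarrow> 0"
      using intU by blast
  qed
next
  case (add f g)
  have "mean_translation (\<lambda>x. f x + g x) w \<le> mean_translation f w + mean_translation g w" for w
  proof -
    have "mean_translation (\<lambda>x. f x + g x) w \<le> (LINT x|lborel. norm (f (x - w) - f x) + norm (g (x
        - w) - g x))"
      unfolding mean_translation_def
    proof (rule integral_mono)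
      show "norm (f (x - w) + g (x - w) - (f x + g x))
          \<le> norm (f (x - w) - f x) + norm (g (x - w) - g x)" for x
        by (rule norm_diff_triangle_ineq)
    qed (use add integrable_translate[OF add(1), of w] integrable_translate[OF add(2), of w]
        in auto)
    then show ?thesis unfolding mean_translation_def
      using add integrable_translate[OF add(1), of w] integrable_translate[OF add(2), of w] by auto
  qed
  then show ?case
    by (intro tendsto_sandwich[OF _ _ tendsto_const tendsto_add_zero[OF add(3) add(4)]])
      (auto simp: mean_translation_def)
next
  case (lim f s)
  show ?case
  proof (rule mean_translation_closure[OF lim(4)])
    fix e :: real assume "e > 0"
    have "(\<lambda>i. LINT x|lborel. norm (f x - s i x)) \<longlonglongrightarrow> (LINT x|(lborel::'a measure). 0)"
    proof (rule integral_dominated_convergence[where w="\<lambda>x. 3 * norm (f x)"])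
      show "AE x in lborel. (\<lambda>i. norm (f x - s i x)) \<longlonglongrightarrow> 0"
      proof (rule AE_I2)
        fix x
        have "(\<lambda>i. norm (f x - s i x)) \<longlonglongrightarrow> norm (f x - f x)" by (intro tendsto_intros lim(2)) simp
        then show "(\<lambda>i. norm (f x - s i x)) \<longlonglongrightarrow> 0" by simp
      qed
      show "AE x in lborel. norm (norm (f x - s i x)) \<le> 3 * norm (f x)" for i
      proof (rule AE_I2)
        fix x
        show "norm (norm (f x - s i x)) \<le> 3 * norm (f x)"
          using norm_triangle_ineq4[of "f x" "s i x"] lim(3)[of x i] by simp
      qed
    qed (use lim in auto)
    then have "(\<lambda>i. LINT x|lborel. norm (f x - s i x)) \<longlonglongrightarrow> 0" by simp
    then obtain i where "(LINT x|lborel. norm (f x - s i x)) < e"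
      using \<open>e > 0\<close> by (metis (mono_tags, lifting) eventually_sequentially order_refl
          order_tendstoD(2))
    then show "\<exists>g. integrable lborel g \<and> (LINT x|lborel. norm (f x - g x)) \<le> e
        \<and> (\<lambda>k. mean_translation g (z k)) \<longlonglongrightarrow> 0"
      using lim(1,5) by (intro exI[of _ "s i"]) auto
  qed
qed

section \<open>The Plancherel theorem\<close>

lemma cnj_measurable [measurable (raw)]:
  "f \<in> borel_measurable M \<Longrightarrow> (\<lambda>x. cnj (f x)) \<in> borel_measurable M"
  by (rule measurable_compose[OF _ borel_measurable_continuous_onI]) (auto intro: continuous_intros)

lemma fourier_integral_add_fun: "integrable lborel f \<Longrightarrow> integrable lborel g \<Longrightarrow>
    fourier_integral (\<lambda>x. f x + g x) = (\<lambda>\<xi>. fourier_integral f \<xi> + fourier_integral g \<xi>)"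
  by (simp add: fun_eq_iff fourier_integral_add)

lemma fourier_integral_diff_fun: "integrable lborel f \<Longrightarrow> integrable lborel g \<Longrightarrow>
    fourier_integral (\<lambda>x. f x - g x) = (\<lambda>\<xi>. fourier_integral f \<xi> - fourier_integral g \<xi>)"
  by (simp add: fun_eq_iff fourier_integral_diff)

lemma fourier_integral_scaleR_fun: "integrable lborel f \<Longrightarrow> fourier_integral (\<lambda>x. c *\<^sub>R f x)
    = (\<lambda>\<xi>. c *\<^sub>R fourier_integral f \<xi>)"
  by (simp add: fun_eq_iff fourier_integral_scaleR)

lemma fourier_integral_cnj_reflect:
  "fourier_integral (\<lambda>y. cnj (f (- y))) \<xi> = cnj (fourier_integral f \<xi>)"
proof -
  have "cnj (fourier_integral f \<xi>) = (LINT y|lborel. cnj (f y) * cis (y \<bullet> \<xi>))"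
    unfolding fourier_integral_def by (subst Bochner_Integration.integral_cnj[symmetric])
        (simp add: cis_cnj)
  also have "\<dots> = (LINT y|lborel. cnj (f (- y)) * cis (- (y \<bullet> \<xi>)))"
    by (subst lborel_integral_uminus[symmetric]) simp
  finally show ?thesis unfolding fourier_integral_def ..
qed

lemma fourier_integral_cnj: "fourier_integral (\<lambda>y. cnj (f y)) \<xi> = cnj (fourier_integral f (- \<xi>))"
  unfolding fourier_integral_def by (subst Bochner_Integration.integral_cnj[symmetric])
      (simp add: cis_cnj)

text \<open>Its value at 0 is the squared norm of \<open>f\<close>.\<close>

definition autocorrelation :: "('a::euclidean_space \<Rightarrow> complex) \<Rightarrow> 'a \<Rightarrow> complex" where
  "autocorrelation f z = (LINT x|lborel. f x * cnj (f (x - z)))"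

lemma autocorrelation_measurable [measurable]:
  assumes [measurable]: "f \<in> borel_measurable borel"
  shows "autocorrelation f \<in> borel_measurable borel"
  unfolding autocorrelation_def[abs_def] by measurable

lemma integrable_bounded_mult:
  fixes f g :: "'a::euclidean_space \<Rightarrow> complex"
  assumes "integrable lborel f" "g \<in> borel_measurable borel" "\<And>x. norm (g x) \<le> M"
  shows "integrable lborel (\<lambda>x. f x * g x)"
proof (rule Bochner_Integration.integrable_bound)
  show "integrable lborel (\<lambda>x. M * norm (f x))" using assms(1) by simp
  have "M \<ge> 0" using assms(3)[of 0] norm_ge_zero order_trans by blast
  then show "AE x in lborel. norm (f x * g x) \<le> norm (M * norm (f x))"
    using assms(3) by (auto simp: norm_mult mult.commute[of M] intro!: mult_left_mono)
qed (use assms in \<open>auto simp: integrable_iff_bounded\<close>)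

lemma
  assumes f: "integrable lborel f" and M: "\<And>x. norm (f x) \<le> M"
  shows autocorrelation_bound: "norm (autocorrelation f z) \<le> M * (LINT x|lborel. norm (f x))"
    and autocorrelation_modulus: "norm (autocorrelation f z - autocorrelation f 0)
        \<le> M * mean_translation f z"
proof -
  have [measurable]: "f \<in> borel_measurable borel" using f by (auto simp: integrable_iff_bounded)
  have ii: "integrable lborel (\<lambda>x. f x * cnj (f (x - z)))" for z
    by (rule integrable_bounded_mult[OF f, of _ M]) (use M in auto)
  have "norm (autocorrelation f z) \<le> (LINT x|lborel. norm (f x * cnj (f (x - z))))"
    unfolding autocorrelation_def by (rule integral_norm_bound)
  also have "\<dots> \<le> (LINT x|lborel. M * norm (f x))"
    by (rule integral_mono[OF integrable_norm[OF ii]])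
      (use f M in \<open>auto simp: norm_mult mult.commute[of M] intro!: mult_left_mono\<close>)
  finally show "norm (autocorrelation f z) \<le> M * (LINT x|lborel. norm (f x))" by simp
  have "autocorrelation f z - autocorrelation f 0
      = (LINT x|lborel. f x * cnj (f (x - z)) - f x * cnj (f x))"
    unfolding autocorrelation_def using ii[of z] ii[of 0] by simp
  also have "norm \<dots> \<le> (LINT x|lborel. norm (f x * cnj (f (x - z)) - f x * cnj (f x)))"
    by (rule integral_norm_bound)
  also have "\<dots> \<le> (LINT x|lborel. M * norm (f (x - z) - f x))"
  proof (rule integral_mono)
    show "norm (f x * cnj (f (x - z)) - f x * cnj (f x)) \<le> M * norm (f (x - z) - f x)" for x
    proof -
      have "f x * cnj (f (x - z)) - f x * cnj (f x) = f x * cnj (f (x - z) - f x)" by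
          (simp add: algebra_simps)
      then have "norm (f x * cnj (f (x - z)) - f x * cnj (f x))
          = norm (f x) * norm (f (x - z) - f x)"
        by (simp only: norm_mult complex_mod_cnj)
      then show ?thesis using M[of x] by (simp add: mult_right_mono)
    qed
  qed (use ii[of z] ii[of 0] f integrable_translate[OF f, of z] in auto)
  finally show "norm (autocorrelation f z - autocorrelation f 0) \<le> M * mean_translation f z"
    unfolding mean_translation_def by simp
qed

text \<open>
  Damping the energy of the transform by a Gaussian makes every integral absolutely convergent;
  two uses of the multiplication formula and the self-duality of Gaussians turn the damped energy
  into a Gaussian average of the autocorrelation of \<open>f\<close> at scale \<open>e\<close>.
\<close>

lemma damped_energy:
  fixes f :: "'a::euclidean_space \<Rightarrow> complex"
  assumes f: "integrable lborel f" and M: "\<And>x. norm (f x) \<le> M" and "e > 0"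
  shows "(LINT \<xi>|lborel. fourier_integral f \<xi> * (cnj (fourier_integral f \<xi>)
      * complex_of_real (gaussian e \<xi>)))
    = complex_of_real (sqrt (2 * pi) ^ DIM('a))
      * (LINT w|lborel. complex_of_real (gaussian 1 w) * autocorrelation f (e *\<^sub>R w))"
proof -
  have [measurable]: "f \<in> borel_measurable borel" using f by (auto simp: integrable_iff_bounded)
  define c where "c = complex_of_real ((sqrt (2 * pi) / e) ^ DIM('a))"
  define G where "G \<xi> = cnj (fourier_integral f \<xi>) * complex_of_real (gaussian e \<xi>)" for \<xi>
  have gint: "integrable lborel (\<lambda>\<xi>::'a. complex_of_real (gaussian r \<xi>))" if "r > 0" for r
    using fourier_integral_gaussian(1)[OF that] .
  have G: "integrable lborel G"
  proof -
    have "integrable lborel (\<lambda>\<xi>. complex_of_real (gaussian e \<xi>) * cnj (fourier_integral f \<xi>))"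
      by (rule integrable_bounded_mult[OF gint[OF \<open>e > 0\<close>]]) (auto intro: fourier_integral_norm_le)
    then show ?thesis unfolding G_def[abs_def] by (simp add: mult.commute)
  qed
  have f': "integrable lborel (\<lambda>y. cnj (f (- y)))"
    using lborel_integrable_uminus[OF f] by simp
  have fG: "fourier_integral G x = (LINT z|lborel. cnj (f (x - z)) * (c
      * complex_of_real (gaussian (1 / e) z)))" for x
  proof -
    define H where "H \<xi> = complex_of_real (gaussian e \<xi>) * cis (- (\<xi> \<bullet> x))" for \<xi>
    have H: "integrable lborel H" unfolding H_def[abs_def]
      by (rule integrable_mult_cis[OF gint[OF \<open>e > 0\<close>]]) simp
    have fH: "fourier_integral H y = c * complex_of_real (gaussian (1 / e) (x + y))" for y
    proof -
      have "fourier_integral H y = fourier_integral (\<lambda>\<xi>. complex_of_real (gaussian e \<xi>)) (x + y)"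
        unfolding fourier_integral_def H_def
        by (rule Bochner_Integration.integral_cong) (auto simp: mult.assoc cis_mult inner_add_right)
      then show ?thesis using fourier_integral_gaussian(2)[OF \<open>e > 0\<close>, of "x + y"] unfolding c_def
          by simp
    qed
    have "fourier_integral G x = (LINT \<xi>|lborel. fourier_integral (\<lambda>y. cnj (f (- y))) \<xi> * H \<xi>)"
      unfolding fourier_integral_cnj_reflect G_def H_def fourier_integral_def[of "\<lambda>\<xi>. cnj
          (fourier_integral f \<xi>) * complex_of_real (gaussian e \<xi>)"]
      by (simp add: mult.assoc)
    also have "\<dots> = (LINT y|lborel. cnj (f (- y)) * fourier_integral H y)"
      by (rule fourier_integral_multiplication_formula[OF f' H])
    also have "\<dots> = (LINT z|lborel. cnj (f (- (- x + z))) * fourier_integral H (- x + z))"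
      by (rule lborel_integral_shift[symmetric]) (simp add: fH[abs_def])
    finally show ?thesis unfolding fH by simp
  qed
  have int: "integrable (lborel \<Otimes>\<^sub>M lborel) (\<lambda>(x, z). f x * (cnj (f (x - z)) * (c
      * complex_of_real (gaussian (1 / e) z))))"
  proof (rule lborel_pair.Fubini_integrable)
    have ii: "integrable lborel (\<lambda>z. cnj (f (x - z)) * (c * complex_of_real (gaussian (1 / e) z)))"
        for x
    proof -
      have "integrable lborel (\<lambda>z. c * complex_of_real (gaussian (1 / e) z) * cnj (f (x - z)))"
        by (rule integrable_bounded_mult[where M=M]) (use gint[of "1/e"] \<open>e > 0\<close> M in auto)
      then show ?thesis by (simp add: mult_ac)
    qed
    show "AE x in lborel. integrable lborel (\<lambda>z. case (x, z) of (x, z) \<Rightarrow> f x * (cnj (f (x - z)) * (c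
        * complex_of_real (gaussian (1 / e) z))))"
      using integrable_mult_right[OF ii] by auto
    show "integrable lborel (\<lambda>x. LINT z|lborel. norm (case (x, z) of (x, z) \<Rightarrow> f x * (cnj (f (x - z))
        * (c * complex_of_real (gaussian (1 / e) z)))))"
    proof (rule Bochner_Integration.integrable_bound)
      define K where "K = (LINT z|lborel. M * (norm c * norm (complex_of_real (gaussian (1 / e)
          (z::'a)))))"
      show "integrable lborel (\<lambda>x. K * norm (f x))" using f by simp
      have "(LINT z|lborel. norm (f x * (cnj (f (x - z)) * (c
          * complex_of_real (gaussian (1 / e) z))))) \<le> norm (f x) * K" for x
      proof -
        have "(LINT z|lborel. norm (cnj (f (x - z)) * (c * complex_of_real (gaussian (1 / e) z))))
            \<le> K"
          unfolding K_def
        proof (rule integral_mono)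
          show "integrable lborel (\<lambda>z::'a. M * (norm c * norm (complex_of_real (gaussian (1 / e)
              z))))"
            using integrable_norm[OF gint[of "1/e"]] \<open>e > 0\<close> by simp
          show "norm (cnj (f (x - z)) * (c * complex_of_real (gaussian (1 / e) z)))
              \<le> M * (norm c * norm (complex_of_real (gaussian (1 / e) z)))" for z
            unfolding norm_mult complex_mod_cnj by (rule mult_right_mono[OF M]) simp
        qed (use ii in simp)
        then show ?thesis by (simp only: norm_mult[of "f x"] integral_mult_right_zero)
            (rule mult_left_mono, auto)
      qed
      then show "AE x in lborel. norm (LINT z|lborel. norm (case (x, z) of (x, z) \<Rightarrow> f x * (cnj (f (x
          - z)) * (c * complex_of_real (gaussian (1 / e) z)))))
         \<le> norm (K * norm (f x))"
        by (auto simp: mult.commute[of K] intro!: order_trans[OF _ abs_ge_self])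
    qed measurable
  qed (measurable; simp)
  have "(LINT \<xi>|lborel. fourier_integral f \<xi> * G \<xi>) = (LINT x|lborel. f x * fourier_integral G x)"
    by (rule fourier_integral_multiplication_formula[OF f G])
  also have "\<dots> = (LINT x|lborel. LINT z|lborel. f x * (cnj (f (x - z)) * (c
      * complex_of_real (gaussian (1 / e) z))))"
    unfolding fG by simp
  also have "\<dots> = (LINT z|lborel. LINT x|lborel. f x * (cnj (f (x - z)) * (c
      * complex_of_real (gaussian (1 / e) z))))"
    by (rule lborel_pair.Fubini_integral[OF int, symmetric])
  also have "\<dots> = (LINT z|lborel. c * complex_of_real (gaussian (1 / e) z) * autocorrelation f z)"
  proof (rule Bochner_Integration.integral_cong[OF refl])
    fix z
    have "(LINT x|lborel. f x * (cnj (f (x - z)) * (c * complex_of_real (gaussian (1 / e) z))))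
      = (LINT x|lborel. c * complex_of_real (gaussian (1 / e) z) * (f x * cnj (f (x - z))))"
      by (simp add: mult_ac)
    then show "(LINT x|lborel. f x * (cnj (f (x - z)) * (c * complex_of_real (gaussian (1 / e) z))))
      = c * complex_of_real (gaussian (1 / e) z) * autocorrelation f z"
      unfolding autocorrelation_def by simp
  qed
  also have "\<dots> = e ^ DIM('a) *\<^sub>R (LINT w|lborel. c * complex_of_real (gaussian (1 / e) (e *\<^sub>R w))
      * autocorrelation f (e *\<^sub>R w))"
    by (rule lborel_integral_scaleR) (use \<open>e > 0\<close> in measurable)
  also have "\<dots> = e ^ DIM('a) *\<^sub>R (LINT w|lborel. c * (complex_of_real (gaussian 1 w)
      * autocorrelation f (e *\<^sub>R w)))"
  proof -
    have "gaussian (1 / e) (e *\<^sub>R w) = gaussian 1 w" for w :: 'a using \<open>e > 0\<close> by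
        (simp add: gaussian_def)
    then show ?thesis by (simp add: mult.assoc)
  qed
  also have "\<dots> = complex_of_real (sqrt (2 * pi) ^ DIM('a))
      * (LINT w|lborel. complex_of_real (gaussian 1 w) * autocorrelation f (e *\<^sub>R w))"
    using \<open>e > 0\<close> by (simp add: c_def scaleR_conv_of_real power_divide)
  finally show ?thesis unfolding G_def .
qed

text \<open>
  As \<open>e\<close> tends to 0, the damping disappears by monotone convergence, and the Gaussian average of
  the autocorrelation concentrates at 0. Boundedness of \<open>f\<close> bounds the modulus of continuity of
  the autocorrelation by that of translations in \<open>L\<^sup>1\<close>.
\<close>

lemma plancherel_bounded:
  fixes f :: "'a::euclidean_space \<Rightarrow> complex"
  assumes f: "integrable lborel f" and M: "\<And>x. norm (f x) \<le> M"
  shows "square_integrable f"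
    and "square_integrable (fourier_integral f)"
    and "(norm (to_l2 (fourier_integral f)))\<^sup>2 = (2 * pi) ^ DIM('a) * (norm (to_l2 f))\<^sup>2"
proof -
  have [measurable]: "f \<in> borel_measurable borel" using f by (auto simp: integrable_iff_bounded)
  show sqf: "square_integrable f"
    by (rule square_integrableI[where g="\<lambda>x. M * norm (f x)"])
      (use f M in \<open>auto simp: power2_eq_square intro!: mult_right_mono\<close>)
  define e where "e k = 1 / real (Suc k)" for k
  have e: "e k > 0" for k by (simp add: e_def)
  have e0: "e \<longlonglongrightarrow> 0" unfolding e_def[abs_def] by (rule LIMSEQ_Suc[OF lim_inverse_n'])
  define E where "E k = (LINT \<xi>|lborel. (norm (fourier_integral f \<xi>))\<^sup>2 * gaussian (e k) \<xi>)" for k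
  have int: "integrable lborel (\<lambda>\<xi>. (norm (fourier_integral f \<xi>))\<^sup>2 * gaussian (e k) \<xi>)" for k
  proof (rule Bochner_Integration.integrable_bound)
    show "integrable lborel (\<lambda>\<xi>::'a. (LINT x|lborel. norm (f x))\<^sup>2 * gaussian (e k) \<xi>)"
      by (intro integrable_mult_right integrable_gaussian e)
    show "AE \<xi> in lborel. norm ((norm (fourier_integral f \<xi>))\<^sup>2 * gaussian (e k) \<xi>)
        \<le> norm ((LINT x|lborel. norm (f x))\<^sup>2 * gaussian (e k) \<xi>)"
      by (auto simp: abs_mult gaussian_def intro!: mult_right_mono power_mono
          fourier_integral_norm_le)
  qed measurable
  have lhs: "(\<lambda>k. ennreal (E k)) \<longlonglongrightarrow> (\<integral>\<^sup>+\<xi>. ennreal ((norm (fourier_integral f \<xi>))\<^sup>2) \<partial>lborel)"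
  proof -
    have "(\<lambda>k. \<integral>\<^sup>+\<xi>. ennreal ((norm (fourier_integral f \<xi>))\<^sup>2 * gaussian (e k) \<xi>) \<partial>lborel)
        \<longlonglongrightarrow> (\<integral>\<^sup>+\<xi>. ennreal ((norm (fourier_integral f \<xi>))\<^sup>2) \<partial>lborel)"
    proof (rule nn_integral_LIMSEQ)
      show "incseq (\<lambda>k \<xi>. ennreal ((norm (fourier_integral f \<xi>))\<^sup>2 * gaussian (e k) \<xi>))"
      proof (rule incseq_SucI, rule le_funI, rule ennreal_leI, rule mult_left_mono)
        fix k and \<xi> :: 'a
        have "(e (Suc k) * norm \<xi>)\<^sup>2 \<le> (e k * norm \<xi>)\<^sup>2"
          by (intro power_mono mult_right_mono) (auto simp: e_def field_simps)
        then show "gaussian (e k) \<xi> \<le> gaussian (e (Suc k)) \<xi>" by (simp add: gaussian_def)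
      qed simp
      fix \<xi> :: 'a
      have "(\<lambda>k. gaussian (e k) \<xi>) \<longlonglongrightarrow> exp (- ((0 * norm \<xi>)\<^sup>2) / 2)"
        unfolding gaussian_def by (intro tendsto_intros e0) auto
      then have "(\<lambda>k. ennreal ((norm (fourier_integral f \<xi>))\<^sup>2 * gaussian (e k) \<xi>))
          \<longlonglongrightarrow> ennreal ((norm (fourier_integral f \<xi>))\<^sup>2 * 1)"
        by (intro tendsto_ennrealI tendsto_mult tendsto_const) simp
      then show "(\<lambda>k. ennreal ((norm (fourier_integral f \<xi>))\<^sup>2 * gaussian (e k) \<xi>))
          \<longlonglongrightarrow> ennreal ((norm (fourier_integral f \<xi>))\<^sup>2)" by simp
    qed measurable
    also have "(\<lambda>k. \<integral>\<^sup>+\<xi>. ennreal ((norm (fourier_integral f \<xi>))\<^sup>2 * gaussian (e k) \<xi>) \<partial>lborel)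
        = (\<lambda>k. ennreal (E k))"
      unfolding E_def by (rule ext, rule nn_integral_eq_integral[OF int]) (auto simp: gaussian_def)
    finally show ?thesis .
  qed
  have Eeq: "complex_of_real (E k) = complex_of_real (sqrt (2 * pi) ^ DIM('a))
      * (LINT w|lborel. complex_of_real (gaussian 1 w) * autocorrelation f (e k *\<^sub>R w))" for k
  proof -
    have "complex_of_real (E k) = (LINT \<xi>|lborel. fourier_integral f \<xi> * (cnj (fourier_integral f \<xi>)
        * complex_of_real (gaussian (e k) \<xi>)))"
      unfolding E_def integral_complex_of_real[symmetric]
      by (rule Bochner_Integration.integral_cong)
          (auto simp: complex_norm_square mult.assoc[symmetric] simp del: of_real_power)
    then show ?thesis using damped_energy[OF f M e] by simp
  qed
  have M0: "M \<ge> 0" using M[of 0] norm_ge_zero order_trans by blast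
  have "(\<lambda>k. LINT w|lborel. complex_of_real (gaussian 1 w) * autocorrelation f (e k *\<^sub>R w))
      \<longlonglongrightarrow> (LINT w|(lborel::'a measure). complex_of_real (gaussian 1 w) * autocorrelation f 0)"
  proof (rule integral_dominated_convergence[where w="\<lambda>w. gaussian 1 w * (M
      * (LINT x|lborel. norm (f x)))"])
    show "integrable lborel (\<lambda>w::'a. gaussian 1 w * (M * (LINT x|lborel. norm (f x))))"
      by (intro integrable_mult_left integrable_gaussian) simp
    show "AE w in lborel. norm (complex_of_real (gaussian 1 w) * autocorrelation f (e k *\<^sub>R w))
        \<le> gaussian 1 w * (M * (LINT x|lborel. norm (f x)))" for k
      by (auto simp: norm_mult gaussian_def intro!: mult_left_mono autocorrelation_bound f M)
    show "AE w in lborel. (\<lambda>k. complex_of_real (gaussian 1 w) * autocorrelation f (e k *\<^sub>R w))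
        \<longlonglongrightarrow> complex_of_real (gaussian 1 w) * autocorrelation f 0"
    proof (rule AE_I2, rule tendsto_mult[OF tendsto_const])
      fix w :: 'a
      have "(\<lambda>k. e k *\<^sub>R w) \<longlonglongrightarrow> 0 *\<^sub>R w" by (intro tendsto_intros e0)
      then have z: "(\<lambda>k. e k *\<^sub>R w) \<longlonglongrightarrow> 0" by simp
      have "(\<lambda>k. M * mean_translation f (e k *\<^sub>R w)) \<longlonglongrightarrow> M * 0"
        by (intro tendsto_mult tendsto_const mean_translation_tendsto_0[OF f z])
      then have "(\<lambda>k. M * mean_translation f (e k *\<^sub>R w)) \<longlonglongrightarrow> 0" by simp
      then have "(\<lambda>k. autocorrelation f (e k *\<^sub>R w) - autocorrelation f 0) \<longlonglongrightarrow> 0"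
        by (rule Lim_null_comparison[rotated]) (intro always_eventually allI autocorrelation_modulus
            f M)
      then show "(\<lambda>k. autocorrelation f (e k *\<^sub>R w)) \<longlonglongrightarrow> autocorrelation f 0"
        by (rule LIM_zero_cancel)
    qed
  qed measurable
  moreover have "(LINT w|(lborel::'a measure). complex_of_real (gaussian 1 w) * autocorrelation f 0)
      = complex_of_real (sqrt (2 * pi) ^ DIM('a) * (norm (to_l2 f))\<^sup>2)"
  proof -
    have "autocorrelation f 0 = (LINT x|lborel. complex_of_real ((norm (f x))\<^sup>2))"
      unfolding autocorrelation_def
      by (rule Bochner_Integration.integral_cong)
          (auto simp: complex_norm_square simp del: of_real_power)
    then have "autocorrelation f 0 = complex_of_real ((norm (to_l2 f))\<^sup>2)"
      by (simp only: norm_to_l2_sq[OF sqf] integral_complex_of_real)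
    then have "(LINT w|(lborel::'a measure). complex_of_real (gaussian 1 w) * autocorrelation f 0)
       = complex_of_real (LINT w|(lborel::'a measure). gaussian 1 w)
           * complex_of_real ((norm (to_l2 f))\<^sup>2)"
      by (simp only: integral_mult_left_zero integral_complex_of_real)
    then show ?thesis unfolding integral_gaussian_1 by simp
  qed
  ultimately have "(\<lambda>k. complex_of_real (E k)) \<longlonglongrightarrow> complex_of_real (sqrt (2 * pi) ^ DIM('a))
      * complex_of_real (sqrt (2 * pi) ^ DIM('a) * (norm (to_l2 f))\<^sup>2)"
    unfolding Eeq by (intro tendsto_mult tendsto_const) simp
  also have "complex_of_real (sqrt (2 * pi) ^ DIM('a)) * complex_of_real (sqrt (2 * pi) ^ DIM('a)
      * (norm (to_l2 f))\<^sup>2)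
     = complex_of_real ((2 * pi) ^ DIM('a) * (norm (to_l2 f))\<^sup>2)"
  proof -
    have "sqrt (2 * pi) ^ DIM('a) * sqrt (2 * pi) ^ DIM('a)
        = (sqrt (2 * pi) * sqrt (2 * pi)) ^ DIM('a)"
      by (rule power_mult_distrib[symmetric])
    also have "sqrt (2 * pi) * sqrt (2 * pi) = 2 * pi" by simp
    finally show ?thesis by (simp only: of_real_mult[symmetric] mult.assoc[symmetric])
  qed
  finally have "E \<longlonglongrightarrow> (2 * pi) ^ DIM('a) * (norm (to_l2 f))\<^sup>2"
    by (simp only: tendsto_of_real_iff)
  then have "(\<lambda>k. ennreal (E k)) \<longlonglongrightarrow> ennreal ((2 * pi) ^ DIM('a) * (norm (to_l2 f))\<^sup>2)"
    by (rule tendsto_ennrealI)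
  then have eq: "(\<integral>\<^sup>+\<xi>. ennreal ((norm (fourier_integral f \<xi>))\<^sup>2) \<partial>lborel)
      = ennreal ((2 * pi) ^ DIM('a) * (norm (to_l2 f))\<^sup>2)"
    using lhs LIMSEQ_unique by blast
  then show sq: "square_integrable (fourier_integral f)"
      by (subst square_integrable_iff_nn_integral) auto
  show "(norm (to_l2 (fourier_integral f)))\<^sup>2 = (2 * pi) ^ DIM('a) * (norm (to_l2 f))\<^sup>2"
    using eq unfolding nn_integral_norm_to_l2[OF sq] by (subst (asm) ennreal_inj) auto
qed

lemma square_root_norm_eq:
  "(norm x)\<^sup>2 = c * (norm y)\<^sup>2 \<Longrightarrow> norm x = sqrt c * norm y"
  by (metis real_sqrt_mult real_sqrt_unique norm_ge_zero)

text \<open>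
  Cut off the large values of \<open>f\<close>. The transforms converge pointwise because \<open>f\<close> is integrable,
  and in mean square because the transform is isometric up to a constant on bounded functions.
\<close>

lemma plancherel_L1_L2:
  fixes f :: "'a::euclidean_space \<Rightarrow> complex"
  assumes f: "integrable lborel f" and sqf: "square_integrable f"
  shows "square_integrable (fourier_integral f)"
    and "norm (to_l2 (fourier_integral f)) = sqrt ((2 * pi) ^ DIM('a)) * norm (to_l2 f)"
proof -
  have [measurable]: "f \<in> borel_measurable borel" using f by (auto simp: integrable_iff_bounded)
  define c where "c = sqrt ((2 * pi) ^ DIM('a))"
  define g where "g k x = (if norm (f x) \<le> real k then f x else 0)" for k x
  have [measurable]: "g k \<in> borel_measurable borel" for k unfolding g_def by measurable
  have gle: "norm (g k x) \<le> norm (f x)" for k x by (simp add: g_def)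
  have gi: "integrable lborel (g k)" for k
    by (rule Bochner_Integration.integrable_bound[OF f]) (use gle in auto)
  have gb: "norm (g k x) \<le> real k" for k x by (simp add: g_def)
  have lim: "(\<lambda>k. g k x) \<longlonglongrightarrow> f x" for x
  proof (rule tendsto_eventually)
    obtain N :: nat where "norm (f x) \<le> real N" using real_arch_simple by blast
    then show "\<forall>\<^sub>F k in sequentially. g k x = f x"
      by (intro eventually_sequentiallyI[of N]) (auto simp: g_def)
  qed
  have gl2: "(\<lambda>k. to_l2 (g k)) \<longlonglongrightarrow> to_l2 f"
    using to_l2_dominated_convergence[OF sqf, of g f] gle lim by auto
  note sqg = plancherel_bounded(1)[OF gi gb]
  note sqFg = plancherel_bounded(2)[OF gi gb]
  have iso: "norm (to_l2 (fourier_integral (g k)) - to_l2 (fourier_integral (g l)))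
      = c * norm (to_l2 (g k) - to_l2 (g l))" for k l
  proof -
    have gd: "integrable lborel (\<lambda>x. g k x - g l x)" using gi by simp
    have bd: "norm (g k x - g l x) \<le> real k + real l" for x
      using norm_triangle_ineq4[of "g k x" "g l x"] gb[of k x] gb[of l x] by linarith
    have "to_l2 (fourier_integral (g k)) - to_l2 (fourier_integral (g l))
        = to_l2 (fourier_integral (\<lambda>x. g k x - g l x))"
      by (simp add: to_l2_diff[OF sqFg sqFg] fourier_integral_diff_fun gi)
    moreover have "to_l2 (g k) - to_l2 (g l) = to_l2 (\<lambda>x. g k x - g l x)"
      by (simp add: to_l2_diff[OF sqg sqg])
    ultimately show ?thesis
      using square_root_norm_eq[OF plancherel_bounded(3)[OF gd bd]] by (simp add: c_def)
  qed
  have "Cauchy (\<lambda>k. to_l2 (fourier_integral (g k)))"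
  proof (rule metric_CauchyI)
    fix e :: real assume "e > 0"
    have c0: "c > 0" by (simp add: c_def)
    obtain K where K: "\<And>m n. m \<ge> K \<Longrightarrow> n \<ge> K \<Longrightarrow> dist (to_l2 (g m)) (to_l2 (g n)) < e / c"
      using metric_CauchyD[OF LIMSEQ_imp_Cauchy[OF gl2], of "e / c"] \<open>e > 0\<close> c0 by auto
    show "\<exists>K. \<forall>m\<ge>K. \<forall>n\<ge>K. dist (to_l2 (fourier_integral (g m))) (to_l2 (fourier_integral (g n))) <
        e"
      using K c0 by (intro exI[of _ K]) (auto simp: dist_norm iso field_simps)
  qed
  then obtain y where y: "(\<lambda>k. to_l2 (fourier_integral (g k))) \<longlonglongrightarrow> y"
    using Cauchy_convergent convergent_def by blast
  have "(\<lambda>k. fourier_integral (g k) \<xi>) \<longlonglongrightarrow> fourier_integral f \<xi>" for \<xi>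
    unfolding fourier_integral_def
  proof (rule integral_dominated_convergence[where w="\<lambda>x. norm (f x)"])
    show "AE x in lborel. (\<lambda>k. g k x * cis (- (x \<bullet> \<xi>))) \<longlonglongrightarrow> f x * cis (- (x \<bullet> \<xi>))"
      by (intro AE_I2 tendsto_mult lim tendsto_const)
  qed (use f gle in \<open>auto simp: norm_mult\<close>)
  then have *: "square_integrable (fourier_integral f) \<and> to_l2 (fourier_integral f) = y"
    by (intro to_l2_pointwise_limit[OF sqFg _ _ y]) auto
  then show "square_integrable (fourier_integral f)" by simp
  have "(\<lambda>k. norm (to_l2 (fourier_integral (g k)))) \<longlonglongrightarrow> c * norm (to_l2 f)"
    using square_root_norm_eq[OF plancherel_bounded(3)[OF gi gb]]
    by (auto simp: c_def intro!: tendsto_intros gl2)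
  then show "norm (to_l2 (fourier_integral f)) = sqrt ((2 * pi) ^ DIM('a)) * norm (to_l2 f)"
    using LIMSEQ_unique[OF tendsto_norm[OF y]] * c_def by auto
qed

definition ball_cut :: "real \<Rightarrow> ('a::euclidean_space \<Rightarrow> 'b::zero) \<Rightarrow> 'a \<Rightarrow> 'b" where
  "ball_cut R f x = (if norm x \<le> R then f x else 0)"

lemma ball_cut_measurable [measurable]:
  fixes f :: "'a::euclidean_space \<Rightarrow> 'b::euclidean_space"
  assumes [measurable]: "f \<in> borel_measurable borel"
  shows "ball_cut R f \<in> borel_measurable borel"
  unfolding ball_cut_def[abs_def] by measurable

lemma norm_ball_cut_le: "norm (ball_cut R f x) \<le> norm (f x)"
    for f :: "'a::euclidean_space \<Rightarrow> 'b::euclidean_space"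
  by (simp add: ball_cut_def)

lemma ball_cut_square_integrable:
  fixes f :: "'a::euclidean_space \<Rightarrow> 'b::euclidean_space"
  assumes "square_integrable f" shows "square_integrable (ball_cut R f)"
  by (rule square_integrable_dominated[OF assms, of _ 1])
    (use assms in \<open>auto simp: norm_ball_cut_le square_integrable_measurable\<close>)

lemma square_integrable_indicator_cball:
  "square_integrable (indicator (cball 0 R) :: 'a::euclidean_space \<Rightarrow> complex)"
proof (rule square_integrableI[where g="indicator (cball 0 R)"])
  show "integrable lborel (indicator (cball 0 R) :: 'a \<Rightarrow> real)"
    using emeasure_lborel_cball_finite[of "0::'a" R] by (simp add: less_top[symmetric])
qed (auto simp: indicator_def[abs_def])

lemma ball_cut_integrable:
  fixes f :: "'a::euclidean_space \<Rightarrow> complex"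
  assumes "square_integrable f" shows "integrable lborel (ball_cut R f)"
proof -
  have "integrable lborel (\<lambda>x. indicator (cball 0 R) x * f x)"
    by (rule square_integrable_mult_integrable[OF square_integrable_indicator_cball assms])
  also have "(\<lambda>x. indicator (cball 0 R) x * f x) = ball_cut R f" by
      (auto simp: ball_cut_def fun_eq_iff)
  finally show ?thesis .
qed

lemma ball_cut_tendsto:
  fixes f :: "'a::euclidean_space \<Rightarrow> complex"
  assumes f: "square_integrable f"
  shows "((\<lambda>R. to_l2 (ball_cut R f)) \<longlongrightarrow> to_l2 f) at_top"
proof (rule tendsto_at_topI_sequentially)
  fix R :: "nat \<Rightarrow> real" assume R: "filterlim R at_top sequentially"
  have "(\<lambda>k. ball_cut (R k) f x) \<longlonglongrightarrow> f x" for x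
  proof (rule tendsto_eventually)
    have "\<forall>\<^sub>F k in sequentially. norm x \<le> R k" using R by (simp add: filterlim_at_top)
    then show "\<forall>\<^sub>F k in sequentially. ball_cut (R k) f x = f x" by eventually_elim
        (simp add: ball_cut_def)
  qed
  then show "(\<lambda>k. to_l2 (ball_cut (R k) f)) \<longlonglongrightarrow> to_l2 f"
    using to_l2_dominated_convergence[OF f, of "\<lambda>k. ball_cut (R k) f" f] f
    by (auto simp: norm_ball_cut_le square_integrable_measurable)
qed

lemma ball_cut_tendsto_nat:
  "square_integrable f \<Longrightarrow> (\<lambda>k. to_l2 (ball_cut (real k) f)) \<longlonglongrightarrow> to_l2 f"
  by (rule filterlim_compose[OF ball_cut_tendsto filterlim_real_sequentially])

text \<open>
  The mean-square limit of the transforms of truncations. It is not normalised, so it multiplies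
  norms by \<open>sqrt ((2 * pi) ^ DIM('a))\<close>.
\<close>

definition fourier_l2 :: "'a::euclidean_space l2 \<Rightarrow> 'a l2" where
  "fourier_l2 x = lim (\<lambda>k. to_l2 (fourier_integral (ball_cut (real k) (rep_l2 x))))"

lemma fourier_integral_isometry:
  assumes f: "integrable lborel f" "square_integrable f"
      and g: "integrable lborel g" "square_integrable g"
  shows "norm (to_l2 (fourier_integral f) - to_l2 (fourier_integral g))
      = sqrt ((2 * pi) ^ DIM('a)) * norm (to_l2 f - to_l2 (g :: 'a::euclidean_space \<Rightarrow> complex))"
proof -
  have "to_l2 (fourier_integral f) - to_l2 (fourier_integral g)
      = to_l2 (fourier_integral (\<lambda>x. f x - g x))"
    using plancherel_L1_L2(1)[OF f] plancherel_L1_L2(1)[OF g]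
    by (simp add: to_l2_diff fourier_integral_diff_fun f g)
  moreover have "to_l2 f - to_l2 g = to_l2 (\<lambda>x. f x - g x)" using f g by (simp add: to_l2_diff)
  ultimately show ?thesis
    using plancherel_L1_L2(2)[of "\<lambda>x. f x - g x"] f g by (simp add: square_integrable_diff)
qed

lemma fourier_l2_tendsto:
  fixes f :: "'a::euclidean_space \<Rightarrow> complex"
  assumes f: "square_integrable f"
  shows "(\<lambda>k. to_l2 (fourier_integral (ball_cut (real k) f))) \<longlonglongrightarrow> fourier_l2 (to_l2 f)"
proof -
  have "Cauchy (\<lambda>k. to_l2 (fourier_integral (ball_cut (real k) f)))"
  proof (rule metric_CauchyI)
    fix e :: real assume "e > 0"
    define c where "c = sqrt ((2 * pi) ^ DIM('a))"
    have c0: "c > 0" by (simp add: c_def)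
    obtain K where K: "\<And>m n. m \<ge> K \<Longrightarrow> n \<ge> K \<Longrightarrow> dist (to_l2 (ball_cut (real m) f)) (to_l2 (ball_cut
        (real n) f)) < e / c"
      using metric_CauchyD[OF LIMSEQ_imp_Cauchy[OF ball_cut_tendsto_nat[OF f]],
          of "e / c"] \<open>e > 0\<close> c0 by auto
    have "dist (to_l2 (fourier_integral (ball_cut (real m) f))) (to_l2 (fourier_integral (ball_cut
        (real n) f))) < e" if "m \<ge> K" "n \<ge> K" for m n
    proof -
      have "dist (to_l2 (fourier_integral (ball_cut (real m) f))) (to_l2 (fourier_integral (ball_cut
          (real n) f)))
         = c * dist (to_l2 (ball_cut (real m) f)) (to_l2 (ball_cut (real n) f))"
        unfolding dist_norm c_def
        by (rule fourier_integral_isometry[OF ball_cut_integrable[OF f]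
            ball_cut_square_integrable[OF f] ball_cut_integrable[OF f] ball_cut_square_integrable[OF
            f]])
      then show ?thesis using K[OF that] c0 by (simp add: field_simps)
    qed
    then show "\<exists>K. \<forall>m\<ge>K. \<forall>n\<ge>K. dist (to_l2 (fourier_integral (ball_cut (real m) f))) (to_l2
        (fourier_integral (ball_cut (real n) f))) < e" by blast
  qed
  then have conv: "convergent (\<lambda>k. to_l2 (fourier_integral (ball_cut (real k) f)))" by
      (rule Cauchy_convergent)
  have eq: "fourier_integral (ball_cut (real k) (rep_l2 (to_l2 f)))
      = fourier_integral (ball_cut (real k) f)" for k
  proof (rule fourier_integral_cong_AE)
    show "AE x in lborel. ball_cut (real k) (rep_l2 (to_l2 f)) x = ball_cut (real k) f x"
      using rep_to_l2[OF f] by eventually_elim (simp add: ball_cut_def)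
  qed (use f in \<open>auto intro: square_integrable_measurable ball_cut_measurable\<close>)
  show ?thesis unfolding fourier_l2_def eq using conv by (simp add: convergent_LIMSEQ_iff)
qed

text \<open>
  Truncations of an integrable function converge in mean square, and isometry carries this over to
  their transforms.
\<close>

lemma fourier_l2_to_l2:
  fixes f :: "'a::euclidean_space \<Rightarrow> complex"
  assumes f: "integrable lborel f" "square_integrable f"
  shows "fourier_l2 (to_l2 f) = to_l2 (fourier_integral f)"
proof -
  have "(\<lambda>k. norm (to_l2 (fourier_integral (ball_cut (real k) f)) - to_l2 (fourier_integral f)))
      \<longlonglongrightarrow> sqrt ((2 * pi) ^ DIM('a)) * norm (to_l2 f - to_l2 f)"
    unfolding fourier_integral_isometry[OF ball_cut_integrable[OF f(2)]
        ball_cut_square_integrable[OF f(2)] f]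
    by (intro tendsto_intros ball_cut_tendsto_nat f)
  then have "(\<lambda>k. norm (to_l2 (fourier_integral (ball_cut (real k) f))
      - to_l2 (fourier_integral f))) \<longlonglongrightarrow> 0" by simp
  then have "(\<lambda>k. to_l2 (fourier_integral (ball_cut (real k) f))) \<longlonglongrightarrow> to_l2 (fourier_integral f)"
    by (rule LIM_zero_cancel[OF tendsto_norm_zero_cancel])
  then show ?thesis using fourier_l2_tendsto[OF f(2)] LIMSEQ_unique by blast
qed

lemma norm_fourier_l2: "norm (fourier_l2 x) = sqrt ((2 * pi) ^ DIM('a))
    * norm (x :: 'a::euclidean_space l2)"
proof -
  let ?f = "rep_l2 x"
  have "(\<lambda>k. norm (to_l2 (fourier_integral (ball_cut (real k) ?f)))) \<longlonglongrightarrow> norm (fourier_l2 x)"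
    using tendsto_norm[OF fourier_l2_tendsto[OF rep_l2_square_integrable, of x]] by simp
  moreover have "(\<lambda>k. norm (to_l2 (fourier_integral (ball_cut (real k) ?f))))
      \<longlonglongrightarrow> sqrt ((2 * pi) ^ DIM('a)) * norm (to_l2 ?f)"
    unfolding plancherel_L1_L2(2)[OF ball_cut_integrable[OF rep_l2_square_integrable]
        ball_cut_square_integrable[OF rep_l2_square_integrable]]
    by (intro tendsto_intros ball_cut_tendsto_nat rep_l2_square_integrable)
  ultimately show ?thesis using LIMSEQ_unique by fastforce
qed

lemma bounded_linear_fourier_l2: "bounded_linear (fourier_l2 :: 'a::euclidean_space l2 \<Rightarrow> 'a l2)"
proof (rule bounded_linear_intro)
  fix x y :: "'a l2" and c :: real
  let ?f = "rep_l2 x" and ?g = "rep_l2 y"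
  note sq = rep_l2_square_integrable[of x] rep_l2_square_integrable[of y]
  note ci = sq[THEN ball_cut_integrable] and cs = sq[THEN ball_cut_square_integrable]
  note Fi = plancherel_L1_L2(1)[OF ci(1) cs(1)] plancherel_L1_L2(1)[OF ci(2) cs(2)]
  have "(\<lambda>k. to_l2 (fourier_integral (ball_cut (real k) (\<lambda>\<xi>. ?f \<xi> + ?g \<xi>))))
      \<longlonglongrightarrow> fourier_l2 (to_l2 (\<lambda>\<xi>. ?f \<xi> + ?g \<xi>))"
    by (intro fourier_l2_tendsto square_integrable_add sq)
  moreover have "to_l2 (fourier_integral (ball_cut (real k) (\<lambda>\<xi>. ?f \<xi> + ?g \<xi>)))
      = to_l2 (fourier_integral (ball_cut (real k) ?f)) + to_l2 (fourier_integral (ball_cut (real k)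
          ?g))" for k
  proof -
    have "ball_cut (real k) (\<lambda>\<xi>. ?f \<xi> + ?g \<xi>) = (\<lambda>\<xi>. ball_cut (real k) ?f \<xi>
        + ball_cut (real k) ?g \<xi>)"
      by (auto simp: ball_cut_def fun_eq_iff)
    then show ?thesis by (simp add: fourier_integral_add_fun[OF ci] to_l2_add[OF Fi])
  qed
  ultimately have "(\<lambda>k. to_l2 (fourier_integral (ball_cut (real k) ?f))
      + to_l2 (fourier_integral (ball_cut (real k) ?g))) \<longlonglongrightarrow> fourier_l2 (x + y)"
    by (simp add: to_l2_add)
  moreover have "(\<lambda>k. to_l2 (fourier_integral (ball_cut (real k) ?f))
      + to_l2 (fourier_integral (ball_cut (real k) ?g))) \<longlonglongrightarrow> fourier_l2 x + fourier_l2 y"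
    using tendsto_add[OF fourier_l2_tendsto[OF sq(1)] fourier_l2_tendsto[OF sq(2)]] by simp
  ultimately show "fourier_l2 (x + y) = fourier_l2 x + fourier_l2 y" using LIMSEQ_unique by blast
  have "(\<lambda>k. to_l2 (fourier_integral (ball_cut (real k) (\<lambda>\<xi>. c *\<^sub>R ?f \<xi>))))
      \<longlonglongrightarrow> fourier_l2 (to_l2 (\<lambda>\<xi>. c *\<^sub>R ?f \<xi>))"
    by (intro fourier_l2_tendsto square_integrable_scaleR sq)
  moreover have "to_l2 (fourier_integral (ball_cut (real k) (\<lambda>\<xi>. c *\<^sub>R ?f \<xi>)))
      = c *\<^sub>R to_l2 (fourier_integral (ball_cut (real k) ?f))" for k
  proof -
    have "ball_cut (real k) (\<lambda>\<xi>. c *\<^sub>R ?f \<xi>) = (\<lambda>\<xi>. c *\<^sub>R ball_cut (real k) ?f \<xi>)"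
      by (auto simp: ball_cut_def fun_eq_iff)
    then show ?thesis by (simp add: fourier_integral_scaleR_fun[OF ci(1)] to_l2_scaleR[OF Fi(1)])
  qed
  ultimately have "(\<lambda>k. c *\<^sub>R to_l2 (fourier_integral (ball_cut (real k) ?f))) \<longlonglongrightarrow> fourier_l2 (c *\<^sub>R x)"
    by (simp add: to_l2_scaleR)
  moreover have "(\<lambda>k. c *\<^sub>R to_l2 (fourier_integral (ball_cut (real k) ?f))) \<longlonglongrightarrow> c *\<^sub>R fourier_l2 x"
    using tendsto_scaleR[OF tendsto_const fourier_l2_tendsto[OF sq(1)]] by simp
  ultimately show "fourier_l2 (c *\<^sub>R x) = c *\<^sub>R fourier_l2 x" using LIMSEQ_unique by blast
  show "norm (fourier_l2 x) \<le> norm x * sqrt ((2 * pi) ^ DIM('a))" by (simp add: norm_fourier_l2)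
qed

section \<open>The Fourier transform as a multiple of a unitary map\<close>

lemmas bounded_linear_add = linear_add[OF bounded_linear.linear]
  and bounded_linear_diff = linear_diff[OF bounded_linear.linear]
  and bounded_linear_scaleR = linear_scale[OF bounded_linear.linear]

lemma square_integrable_cnj:
  assumes [measurable]: "square_integrable f" shows "square_integrable (\<lambda>x. cnj (f x))"
  by (rule square_integrable_dominated[OF assms, of _ 1]) auto

lemma square_integrable_reflect:
  fixes f :: "'a::euclidean_space \<Rightarrow> complex"
  assumes "square_integrable f" shows "square_integrable (\<lambda>x. f (- x))"
proof -
  have [measurable]: "f \<in> borel_measurable borel" using assms by (rule square_integrable_measurable)
  have "(\<lambda>x. f (- x)) \<in> borel_measurable borel" by measurable
  then show ?thesis
    using lborel_integrable_uminus[OF square_integrable_norm_sq[OF assms]] by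
        (simp add: square_integrable_def)
qed

lemma square_integrable_conj_reflect:
  "square_integrable f \<Longrightarrow> square_integrable (\<lambda>x. cnj (f (- x)))"
  by (rule square_integrable_cnj[OF square_integrable_reflect])

definition conj_l2 :: "'a::euclidean_space l2 \<Rightarrow> 'a l2" where
  "conj_l2 x = to_l2 (\<lambda>\<xi>. cnj (rep_l2 x \<xi>))"

text \<open>Complex conjugation seen from the Fourier side.\<close>

definition conj_reflect :: "'a::euclidean_space l2 \<Rightarrow> 'a l2" where
  "conj_reflect x = to_l2 (\<lambda>\<xi>. cnj (rep_l2 x (- \<xi>)))"

lemma conj_l2_to_l2:
  assumes "square_integrable f" shows "conj_l2 (to_l2 f) = to_l2 (\<lambda>\<xi>. cnj (f \<xi>))"
  unfolding conj_l2_def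
  by (subst to_l2_eq_iff) (use rep_to_l2[OF assms] assms in \<open>auto intro: square_integrable_cnj elim:
      eventually_mono\<close>)

lemma conj_reflect_to_l2:
  assumes "square_integrable f" shows "conj_reflect (to_l2 f) = to_l2 (\<lambda>\<xi>. cnj (f (- \<xi>)))"
  unfolding conj_reflect_def
  by (subst to_l2_eq_iff[OF square_integrable_conj_reflect[OF rep_l2_square_integrable]
      square_integrable_conj_reflect[OF assms]])
    (use lborel_AE_uminus[OF rep_to_l2[OF assms]] in \<open>auto elim: eventually_mono\<close>)

lemma norm_conj_l2 [simp]: "norm (conj_l2 x) = norm x"
proof -
  have "(norm (conj_l2 x))\<^sup>2 = (norm x)\<^sup>2"
    unfolding conj_l2_def by (subst norm_to_l2_sq)
        (auto intro: square_integrable_cnj simp: norm_l2_sq)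
  then show ?thesis by simp
qed

lemma norm_conj_reflect [simp]: "norm (conj_reflect x) = norm x"
proof -
  have "(norm (conj_reflect x))\<^sup>2 = (norm x)\<^sup>2"
    unfolding conj_reflect_def norm_to_l2_sq[OF square_integrable_conj_reflect[OF
        rep_l2_square_integrable]]
    by (simp add: norm_l2_sq lborel_integral_uminus[of "\<lambda>\<xi>. (cmod (rep_l2 x \<xi>))\<^sup>2"])
  then show ?thesis by simp
qed

lemma bounded_linear_conj_l2: "bounded_linear conj_l2"
proof (rule bounded_linear_intro[where K=1])
  fix x y :: "'a l2" and r :: real
  have "conj_l2 (to_l2 (\<lambda>\<xi>. rep_l2 x \<xi> + rep_l2 y \<xi>)) = conj_l2 x + conj_l2 y"
    by (subst conj_l2_to_l2) (auto simp: conj_l2_def to_l2_add square_integrable_add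
        square_integrable_cnj)
  then show "conj_l2 (x + y) = conj_l2 x + conj_l2 y" by (simp add: to_l2_add)
  have "conj_l2 (to_l2 (\<lambda>\<xi>. r *\<^sub>R rep_l2 x \<xi>)) = r *\<^sub>R conj_l2 x"
    by (subst conj_l2_to_l2) (auto simp: conj_l2_def to_l2_scaleR square_integrable_scaleR
        square_integrable_cnj)
  then show "conj_l2 (r *\<^sub>R x) = r *\<^sub>R conj_l2 x" by (simp add: to_l2_scaleR)
qed simp

lemma bounded_linear_conj_reflect: "bounded_linear conj_reflect"
proof (rule bounded_linear_intro[where K=1])
  fix x y :: "'a l2" and r :: real
  note rf = square_integrable_conj_reflect[OF rep_l2_square_integrable]
  have "conj_reflect (to_l2 (\<lambda>\<xi>. rep_l2 x \<xi> + rep_l2 y \<xi>)) = conj_reflect x + conj_reflect y"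
    by (subst conj_reflect_to_l2) (auto simp: conj_reflect_def to_l2_add square_integrable_add rf)
  then show "conj_reflect (x + y) = conj_reflect x + conj_reflect y" by (simp add: to_l2_add)
  have "conj_reflect (to_l2 (\<lambda>\<xi>. r *\<^sub>R rep_l2 x \<xi>)) = r *\<^sub>R conj_reflect x"
    by (subst conj_reflect_to_l2) (auto simp: conj_reflect_def to_l2_scaleR square_integrable_scaleR
        rf)
  then show "conj_reflect (r *\<^sub>R x) = r *\<^sub>R conj_reflect x" by (simp add: to_l2_scaleR)
qed simp

text \<open>The integral with the opposite sign in the exponent, extended by continuity.\<close>

definition fourier_adjoint :: "'a::euclidean_space l2 \<Rightarrow> 'a l2" where
  "fourier_adjoint y = conj_l2 (fourier_l2 (conj_l2 y))"

lemma bounded_linear_fourier_adjoint: "bounded_linear fourier_adjoint"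
  using bounded_linear_compose[OF bounded_linear_conj_l2 bounded_linear_compose[OF
      bounded_linear_fourier_l2 bounded_linear_conj_l2]]
  by (simp add: fourier_adjoint_def[abs_def])

lemma norm_fourier_adjoint: "norm (fourier_adjoint y)
    = sqrt ((2 * pi) ^ DIM('a)) * norm (y :: 'a::euclidean_space l2)"
  by (simp add: fourier_adjoint_def norm_fourier_l2)

lemma fourier_adjoint_to_l2:
  assumes "integrable lborel f" "square_integrable f"
  shows "fourier_adjoint (to_l2 f) = to_l2 (\<lambda>x. fourier_integral f (- x))"
  unfolding fourier_adjoint_def
  by (simp add: conj_l2_to_l2 assms fourier_l2_to_l2 square_integrable_cnj fourier_integral_cnj
      plancherel_L1_L2 fun_eq_iff)

lemma inner_complex_Re: "x \<bullet> y = Re (x * cnj y)" for x y :: complex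
  by (simp add: inner_complex_def)

text \<open>
  The multiplication formula says that \<open>fourier_adjoint\<close> is the adjoint of \<open>fourier_l2\<close>. Since
  both multiply norms by the same constant, each is, up to that constant, the inverse of the
  other.
\<close>

lemma fourier_l2_adjoint: "fourier_l2 x \<bullet> y = x \<bullet> fourier_adjoint y"
proof -
  have L1: "fourier_l2 (to_l2 f) \<bullet> to_l2 g = to_l2 f \<bullet> fourier_adjoint (to_l2 g)"
    if f: "integrable lborel f" "square_integrable f"
        and g: "integrable lborel g" "square_integrable g"
    for f g :: "'a \<Rightarrow> complex"
  proof -
    have g': "integrable lborel (\<lambda>x. cnj (g x))" "square_integrable (\<lambda>x. cnj (g x))"
      using g by (auto intro: square_integrable_cnj)
    note Ff = plancherel_L1_L2(1)[OF f] and Fg = plancherel_L1_L2(1)[OF g']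
    have "fourier_l2 (to_l2 f) \<bullet> to_l2 g = (LINT \<xi>|lborel. Re (fourier_integral f \<xi> * cnj (g \<xi>)))"
      by (simp add: fourier_l2_to_l2[OF f] inner_to_l2[OF Ff g(2)] inner_complex_Re)
    also have "\<dots> = Re (LINT \<xi>|lborel. fourier_integral f \<xi> * cnj (g \<xi>))"
      by (rule integral_Re) (rule square_integrable_mult_integrable[OF Ff g'(2)])
    also have "\<dots> = Re (LINT x|lborel. f x * fourier_integral (\<lambda>x. cnj (g x)) x)"
      by (simp add: fourier_integral_multiplication_formula[OF f(1) g'(1)])
    also have "\<dots> = (LINT x|lborel. Re (f x * fourier_integral (\<lambda>x. cnj (g x)) x))"
      by (rule integral_Re[symmetric]) (rule square_integrable_mult_integrable[OF f(2) Fg])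
    also have "\<dots> = to_l2 f \<bullet> to_l2 (\<lambda>x. cnj (fourier_integral (\<lambda>x. cnj (g x)) x))"
      by (simp add: inner_to_l2[OF f(2) square_integrable_cnj[OF Fg]] inner_complex_Re)
    also have "to_l2 (\<lambda>x. cnj (fourier_integral (\<lambda>x. cnj (g x)) x)) = fourier_adjoint (to_l2 g)"
      by (simp add: fourier_adjoint_to_l2[OF g] fourier_integral_cnj)
    finally show ?thesis .
  qed
  let ?f = "rep_l2 x" and ?g = "rep_l2 y"
  let ?F = "\<lambda>k. to_l2 (ball_cut (real k) ?f)" and ?G = "\<lambda>k. to_l2 (ball_cut (real k) ?g)"
  have F: "?F \<longlonglongrightarrow> x" and G: "?G \<longlonglongrightarrow> y"
    using ball_cut_tendsto_nat[OF rep_l2_square_integrable] by auto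
  have "(\<lambda>k. fourier_l2 (?F k) \<bullet> ?G k) \<longlonglongrightarrow> fourier_l2 x \<bullet> y"
    by (intro tendsto_inner bounded_linear.tendsto[OF bounded_linear_fourier_l2] F G)
  moreover have "(\<lambda>k. ?F k \<bullet> fourier_adjoint (?G k)) \<longlonglongrightarrow> x \<bullet> fourier_adjoint y"
    by (intro tendsto_inner bounded_linear.tendsto[OF bounded_linear_fourier_adjoint] F G)
  moreover have "fourier_l2 (?F k) \<bullet> ?G k = ?F k \<bullet> fourier_adjoint (?G k)" for k
    by (intro L1 ball_cut_integrable ball_cut_square_integrable rep_l2_square_integrable)
  ultimately show ?thesis using LIMSEQ_unique by fastforce
qed

text \<open>Expand the square of the norm of \<open>U (V y) - c *\<^sub>R y\<close>.\<close>

lemma isometry_adjoint_inverse: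
  fixes U V :: "'h::real_inner \<Rightarrow> 'h"
  assumes adj: "\<And>x y. U x \<bullet> y = x \<bullet> V y" and nU: "\<And>x. norm (U x) = sqrt c * norm x"
    and nV: "\<And>x. norm (V x) = sqrt c * norm x" and c: "c \<ge> 0"
  shows "U (V y) = c *\<^sub>R y"
proof -
  have nn: "U x \<bullet> U x = c * (x \<bullet> x)" "V x \<bullet> V x = c * (x \<bullet> x)" for x
    unfolding power2_norm_eq_inner[symmetric] nU nV power_mult_distrib real_sqrt_pow2[OF c] by
        (rule refl)+
  have "U (V y) \<bullet> y = c * (y \<bullet> y)" unfolding adj nn ..
  moreover have "U (V y) \<bullet> U (V y) = c * (c * (y \<bullet> y))" unfolding nn ..
  ultimately have "(U (V y) - c *\<^sub>R y) \<bullet> (U (V y) - c *\<^sub>R y) = 0"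
    by (simp add: inner_diff_left inner_diff_right inner_commute[of y "U (V y)"])
  then show ?thesis by simp
qed

lemma fourier_l2_fourier_adjoint: "fourier_l2 (fourier_adjoint y)
    = ((2 * pi) ^ DIM('a)) *\<^sub>R (y :: 'a::euclidean_space l2)"
  by (rule isometry_adjoint_inverse[of fourier_l2 fourier_adjoint])
      (auto simp: fourier_l2_adjoint norm_fourier_l2 norm_fourier_adjoint)

lemma fourier_adjoint_fourier_l2: "fourier_adjoint (fourier_l2 y)
    = ((2 * pi) ^ DIM('a)) *\<^sub>R (y :: 'a::euclidean_space l2)"
  by (rule isometry_adjoint_inverse[of fourier_adjoint fourier_l2])
    (auto simp: fourier_l2_adjoint norm_fourier_l2 norm_fourier_adjoint inner_commute[of
        "fourier_adjoint x" y for x y] inner_commute[of x "fourier_l2 y" for x y])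

lemma fourier_l2_inner: "fourier_l2 x \<bullet> fourier_l2 y
    = (2 * pi) ^ DIM('a) * (x \<bullet> (y :: 'a::euclidean_space l2))"
  by (simp add: fourier_l2_adjoint fourier_adjoint_fourier_l2)

lemma fourier_l2_inject: "fourier_l2 x = fourier_l2 y \<longleftrightarrow> x = y"
proof
  assume "fourier_l2 x = fourier_l2 y"
  then have "norm (fourier_l2 (x - y)) = 0" by
      (simp add: bounded_linear_diff[OF bounded_linear_fourier_l2])
  then show "x = y" by (simp add: norm_fourier_l2)
qed simp

lemma fourier_l2_conj_l2: "fourier_l2 (conj_l2 x) = conj_reflect (fourier_l2 x)"
proof -
  let ?f = "rep_l2 x" and ?F = "\<lambda>k. to_l2 (ball_cut (real k) (rep_l2 x))"
  have F: "?F \<longlonglongrightarrow> x" using ball_cut_tendsto_nat[OF rep_l2_square_integrable, of x] by simp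
  have "fourier_l2 (conj_l2 (?F k)) = conj_reflect (fourier_l2 (?F k))" for k
  proof -
    have i: "integrable lborel (ball_cut (real k) ?f)" "square_integrable (ball_cut (real k) ?f)"
      by (auto intro: ball_cut_integrable ball_cut_square_integrable)
    then show ?thesis
      by (simp add: conj_l2_to_l2 fourier_l2_to_l2 square_integrable_cnj conj_reflect_to_l2
          plancherel_L1_L2 fourier_integral_cnj[abs_def])
  qed
  moreover have "(\<lambda>k. fourier_l2 (conj_l2 (?F k))) \<longlonglongrightarrow> fourier_l2 (conj_l2 x)"
    by (intro bounded_linear.tendsto[OF bounded_linear_fourier_l2] bounded_linear.tendsto[OF
        bounded_linear_conj_l2] F)
  moreover have "(\<lambda>k. conj_reflect (fourier_l2 (?F k))) \<longlonglongrightarrow> conj_reflect (fourier_l2 x)"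
    by (intro bounded_linear.tendsto[OF bounded_linear_fourier_l2] bounded_linear.tendsto[OF
        bounded_linear_conj_reflect] F)
  ultimately show ?thesis using LIMSEQ_unique by fastforce
qed

definition real_l2 :: "('a::euclidean_space \<Rightarrow> real) \<Rightarrow> 'a l2" where
  "real_l2 f = to_l2 (\<lambda>x. complex_of_real (f x))"

lemma square_integrable_of_real [simp]:
  "square_integrable (\<lambda>x. complex_of_real (f x)) \<longleftrightarrow> square_integrable f"
proof -
  have "f \<in> borel_measurable lborel" if "(\<lambda>x. complex_of_real (f x)) \<in> borel_measurable lborel"
    using measurable_compose[OF that borel_measurable_Re] by (simp only: Re_complex_of_real)
  then have "(\<lambda>x. complex_of_real (f x)) \<in> borel_measurable lborel \<longleftrightarrow> f \<in> borel_measurable lborel"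
    using measurable_compose[OF _ borel_measurable_of_real] by blast
  then show ?thesis by (simp only: square_integrable_def norm_of_real power2_abs real_norm_def)
qed

lemma truncated_fourier_eq: "truncated_fourier R f
    = fourier_integral (ball_cut R (\<lambda>x. complex_of_real (f x)))"
  unfolding truncated_fourier_def fourier_integral_def set_lebesgue_integral_def ball_cut_def
  by (intro ext Bochner_Integration.integral_cong) auto

lemma truncated_fourier_tendsto:
  assumes f: "square_integrable f"
  shows "((\<lambda>R. to_l2 (truncated_fourier R f)) \<longlongrightarrow> fourier_l2 (real_l2 f)) at_top"
proof -
  have sq: "square_integrable (\<lambda>x. complex_of_real (f x))" using f by simp
  have "((\<lambda>R. fourier_l2 (to_l2 (ball_cut R (\<lambda>x. complex_of_real (f x)))))
      \<longlongrightarrow> fourier_l2 (real_l2 f)) at_top"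
    unfolding real_l2_def by (intro bounded_linear.tendsto[OF bounded_linear_fourier_l2]
        ball_cut_tendsto sq)
  then show ?thesis
    by (simp add: fourier_l2_to_l2[OF ball_cut_integrable[OF sq] ball_cut_square_integrable[OF sq]]
        truncated_fourier_eq)
qed

text \<open>
  In particular every square integrable function has a transform, and it is unique up to null
  sets.
\<close>

lemma has_fourier_transform_iff:
  assumes f: "square_integrable f"
  shows "has_fourier_transform f F \<longleftrightarrow> square_integrable F \<and> to_l2 F = fourier_l2 (real_l2 f)"
proof (cases "square_integrable F")
  case F: True
  have sq: "square_integrable (truncated_fourier R f)" for R
    unfolding truncated_fourier_eq using f
    by (intro plancherel_L1_L2 ball_cut_integrable ball_cut_square_integrable) auto
  have eq: "(\<integral>\<^sup>+\<xi>. ennreal ((norm (truncated_fourier R f \<xi> - F \<xi>))\<^sup>2) \<partial>lborel)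
      = ennreal ((norm (to_l2 (truncated_fourier R f) - to_l2 F))\<^sup>2)" for R
    using nn_integral_norm_to_l2[OF square_integrable_diff[OF sq F]] by
        (simp add: to_l2_diff[OF sq F])
  have lim: "((\<lambda>R. ennreal ((norm (to_l2 (truncated_fourier R f) - to_l2 F))\<^sup>2)) \<longlongrightarrow>
      ennreal ((norm (fourier_l2 (real_l2 f) - to_l2 F))\<^sup>2)) at_top"
    by (intro tendsto_intros truncated_fourier_tendsto f)
  have "has_fourier_transform f F \<longleftrightarrow> ennreal ((norm (fourier_l2 (real_l2 f) - to_l2 F))\<^sup>2) = 0"
  proof
    assume "has_fourier_transform f F"
    then have "((\<lambda>R. ennreal ((norm (to_l2 (truncated_fourier R f) - to_l2 F))\<^sup>2)) \<longlongrightarrow> 0) at_top"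
      by (simp add: has_fourier_transform_def eq)
    then show "ennreal ((norm (fourier_l2 (real_l2 f) - to_l2 F))\<^sup>2) = 0"
      using tendsto_unique[OF _ lim] by (simp add: trivial_limit_at_top_linorder)
  next
    assume "ennreal ((norm (fourier_l2 (real_l2 f) - to_l2 F))\<^sup>2) = 0"
    then show "has_fourier_transform f F" using lim f F by (simp add: has_fourier_transform_def eq)
  qed
  then show ?thesis using F by auto
qed (simp add: has_fourier_transform_def)

lemma fourier_transform_l2:
  assumes f: "square_integrable f"
  shows "square_integrable (fourier_transform f)" "to_l2 (fourier_transform f)
      = fourier_l2 (real_l2 f)"
proof -
  have "has_fourier_transform f (rep_l2 (fourier_l2 (real_l2 f)))" by
      (simp add: has_fourier_transform_iff[OF f])
  then have "has_fourier_transform f (fourier_transform f)"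
    unfolding fourier_transform_def by (rule someI[where P="has_fourier_transform f"])
  then show "square_integrable (fourier_transform f)" "to_l2 (fourier_transform f)
      = fourier_l2 (real_l2 f)"
    by (auto simp: has_fourier_transform_iff[OF f])
qed

lemma real_l2_inject:
  assumes "square_integrable f" "square_integrable g"
  shows "real_l2 f = real_l2 g \<longleftrightarrow> (AE x in lborel. f x = g x)"
  unfolding real_l2_def using assms by (subst to_l2_eq_iff) auto

lemma conj_l2_real_l2: "square_integrable f \<Longrightarrow> conj_l2 (real_l2 f) = real_l2 f"
  unfolding real_l2_def by (subst conj_l2_to_l2) auto

text \<open>The real part of a representative represents the same class.\<close>

lemma conj_l2_fixed_imp_real:
  assumes "conj_l2 x = x"
  shows "\<exists>f. square_integrable f \<and> real_l2 f = x"
proof (intro exI conjI)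
  let ?f = "\<lambda>\<xi>. Re (rep_l2 x \<xi>)"
  show sq: "square_integrable ?f"
    by (rule square_integrable_dominated[OF rep_l2_square_integrable[of x], of _ 1])
        (auto simp: abs_Re_le_cmod)
  have "AE \<xi> in lborel. cnj (rep_l2 x \<xi>) = rep_l2 x \<xi>"
    using assms unfolding conj_l2_def
    by (subst (asm) (2) to_l2_rep_l2[symmetric], subst (asm) to_l2_eq_iff)
        (auto intro: square_integrable_cnj)
  then have ae: "AE \<xi> in lborel. complex_of_real (?f \<xi>) = rep_l2 x \<xi>"
    by eventually_elim (auto simp: complex_eq_iff)
  show "real_l2 ?f = x"
    unfolding real_l2_def
    by (subst (2) to_l2_rep_l2[symmetric], subst to_l2_eq_iff) (use sq ae in auto)
qed

section \<open>Fourier multipliers and Sobolev spaces\<close>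

definition bounded_symbol :: "('a::euclidean_space \<Rightarrow> complex) \<Rightarrow> bool" where
  "bounded_symbol m \<longleftrightarrow> m \<in> borel_measurable borel \<and> (\<exists>C. \<forall>\<xi>. norm (m \<xi>) \<le> C)"

text \<open>
  Meaningful whenever the product is square integrable, in particular for bounded symbols.
\<close>

definition multiplier :: "('a::euclidean_space \<Rightarrow> complex) \<Rightarrow> 'a l2 \<Rightarrow> 'a l2" where
  "multiplier m x = to_l2 (\<lambda>\<xi>. m \<xi> * rep_l2 x \<xi>)"

lemma bounded_symbolI: "m \<in> borel_measurable borel \<Longrightarrow> (\<And>\<xi>. norm (m \<xi>) \<le> C) \<Longrightarrow> bounded_symbol m"
  by (auto simp: bounded_symbol_def)

lemma bounded_symbol_measurable [measurable_dest]: "bounded_symbol m \<Longrightarrow> m \<in> borel_measurable borel"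
  by (simp add: bounded_symbol_def)

lemma square_integrable_bounded_symbol:
  "bounded_symbol m \<Longrightarrow> square_integrable f \<Longrightarrow> square_integrable (\<lambda>\<xi>. m \<xi> * f \<xi>)"
  unfolding bounded_symbol_def using square_integrable_mult_bounded by blast

lemma bounded_symbol_mult: "bounded_symbol m \<Longrightarrow> bounded_symbol k \<Longrightarrow> bounded_symbol (\<lambda>\<xi>. m \<xi> * k \<xi>)"
proof -
  assume m: "bounded_symbol m" and k: "bounded_symbol k"
  obtain C D where C: "\<And>\<xi>. norm (m \<xi>) \<le> C" and D: "\<And>\<xi>. norm (k \<xi>) \<le> D"
    using m k by (auto simp: bounded_symbol_def)
  have "norm (m \<xi> * k \<xi>) \<le> C * D" for \<xi>
    unfolding norm_mult using C[of \<xi>] D[of \<xi>] by (intro mult_mono)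
        (auto intro: order_trans[OF norm_ge_zero])
  then show ?thesis using m k by (intro bounded_symbolI) auto
qed

lemma multiplier_to_l2:
  assumes m: "m \<in> borel_measurable borel" and f: "square_integrable f"
      and mf: "square_integrable (\<lambda>\<xi>. m \<xi> * f \<xi>)"
  shows "multiplier m (to_l2 f) = to_l2 (\<lambda>\<xi>. m \<xi> * f \<xi>)"
proof -
  have "AE \<xi> in lborel. m \<xi> * f \<xi> = m \<xi> * rep_l2 (to_l2 f) \<xi>"
    using rep_to_l2[OF f] by eventually_elim simp
  then show ?thesis unfolding multiplier_def using to_l2_cong[OF mf _ ] m
    by (metis borel_measurable_times rep_l2_measurable)
qed

lemma rep_multiplier: "bounded_symbol m \<Longrightarrow> AE \<xi> in lborel. rep_l2 (multiplier m x) \<xi>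
    = m \<xi> * rep_l2 x \<xi>"
  unfolding multiplier_def by (rule rep_to_l2) (simp add: square_integrable_bounded_symbol)

lemma norm_multiplier_le:
  assumes "m \<in> borel_measurable borel" "\<And>\<xi>. norm (m \<xi>) \<le> C"
  shows "norm (multiplier m x) \<le> C * norm x"
proof -
  have C0: "C \<ge> 0" using assms(2)[of 0] norm_ge_zero order_trans by blast
  have "norm (to_l2 (\<lambda>\<xi>. m \<xi> * rep_l2 x \<xi>)) \<le> C * norm (to_l2 (rep_l2 x))"
    using assms by (intro norm_to_l2_mono[OF _ _ _ C0] square_integrable_bounded_symbol
        bounded_symbolI)
      (auto simp: norm_mult intro: mult_right_mono)
  then show ?thesis by (simp add: multiplier_def)
qed

lemma bounded_linear_multiplier:
  assumes m: "bounded_symbol m"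
  shows "bounded_linear (multiplier m)"
proof -
  obtain C where C: "\<And>\<xi>. norm (m \<xi>) \<le> C" using m by (auto simp: bounded_symbol_def)
  show ?thesis
  proof (rule bounded_linear_intro)
    show "multiplier m (x + y) = multiplier m x + multiplier m y" for x y
      by (rule l2_eqI) (use rep_multiplier[OF m, of "x + y"] rep_multiplier[OF m,
          of x] rep_multiplier[OF m, of y]
          rep_l2_add[of x y] rep_l2_add[of "multiplier m x" "multiplier m y"]
              in \<open>eventually_elim, simp add: distrib_left\<close>)
    show "multiplier m (r *\<^sub>R x) = r *\<^sub>R multiplier m x" for r x
      by (rule l2_eqI) (use rep_multiplier[OF m, of "r *\<^sub>R x"] rep_multiplier[OF m, of x]
          rep_l2_scaleR[of r x] rep_l2_scaleR[of r "multiplier m x"] in \<open>eventually_elim, simp\<close>)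
    show "norm (multiplier m x) \<le> norm x * C" for x
      using norm_multiplier_le[OF bounded_symbol_measurable[OF m] C] by (simp add: mult.commute)
  qed
qed

lemma multiplier_multiplier:
  assumes m: "bounded_symbol m" and k: "bounded_symbol k"
  shows "multiplier m (multiplier k x) = multiplier (\<lambda>\<xi>. m \<xi> * k \<xi>) x"
  by (rule l2_eqI) (use rep_multiplier[OF m, of "multiplier k x"] rep_multiplier[OF k,
      of x] rep_multiplier[OF bounded_symbol_mult[OF m k], of x]
      in \<open>eventually_elim, simp add: mult.assoc\<close>)

lemma multiplier_inner_symmetric:
  assumes m: "bounded_symbol (\<lambda>\<xi>. complex_of_real (m \<xi>))"
  shows "multiplier (\<lambda>\<xi>. complex_of_real (m \<xi>)) x \<bullet> y
      = x \<bullet> multiplier (\<lambda>\<xi>. complex_of_real (m \<xi>)) y"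
proof -
  have [measurable]: "(\<lambda>\<xi>. complex_of_real (m \<xi>)) \<in> borel_measurable borel" using m by measurable
  note sq = square_integrable_bounded_symbol[OF m rep_l2_square_integrable]
  have "to_l2 (\<lambda>\<xi>. complex_of_real (m \<xi>) * rep_l2 x \<xi>) \<bullet> to_l2 (rep_l2 y)
      = to_l2 (rep_l2 x) \<bullet> to_l2 (\<lambda>\<xi>. complex_of_real (m \<xi>) * rep_l2 y \<xi>)"
    unfolding inner_to_l2[OF sq rep_l2_square_integrable] inner_to_l2[OF rep_l2_square_integrable
        sq]
    by (rule Bochner_Integration.integral_cong) (auto simp: inner_complex_def)
  then show ?thesis by (simp add: multiplier_def)
qed

lemma conj_reflect_multiplier:
  assumes m: "bounded_symbol m"
  shows "conj_reflect (multiplier m x) = multiplier (\<lambda>\<xi>. cnj (m (- \<xi>))) (conj_reflect x)"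
proof -
  note [measurable] = bounded_symbol_measurable[OF m]
  have m': "bounded_symbol (\<lambda>\<xi>. cnj (m (- \<xi>)))" using m by (auto simp: bounded_symbol_def)
  note sq = square_integrable_conj_reflect[OF rep_l2_square_integrable, of x]
  show ?thesis
    unfolding conj_reflect_def[of x] multiplier_def[of m]
    by (subst conj_reflect_to_l2, simp add: square_integrable_bounded_symbol m, subst
        multiplier_to_l2)
      (auto simp: sq square_integrable_bounded_symbol[OF m' sq] bounded_symbol_measurable[OF m'])
qed

text \<open>Complex valued, because it serves as a multiplier symbol.\<close>

definition weight :: "real \<Rightarrow> 'a::euclidean_space \<Rightarrow> complex" where
  "weight r \<xi> = complex_of_real ((1 + (norm \<xi>)\<^sup>2) powr (r / 2))"

lemma weight_measurable [measurable]: "weight r \<in> borel_measurable borel"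
  unfolding weight_def[abs_def] by measurable

lemma weight_base: "1 + (norm \<xi>)\<^sup>2 \<ge> (1::real)" by simp

lemma norm_weight: "norm (weight r \<xi>) = (1 + (norm \<xi>)\<^sup>2) powr (r / 2)"
  by (simp add: weight_def)

lemma weight_add: "weight a \<xi> * weight b \<xi> = weight (a + b) \<xi>"
  unfolding weight_def by (simp add: add_divide_distrib powr_add flip: of_real_mult)

lemma weight_0 [simp]: "weight 0 \<xi> = 1"
proof -
  have "1 + (norm \<xi>)\<^sup>2 \<noteq> 0" using weight_base[of \<xi>] by linarith
  then show ?thesis by (simp add: weight_def)
qed

lemma weight_nonzero [simp]: "weight a \<xi> \<noteq> 0"
  using weight_add[of a \<xi> "- a"] by auto

lemma norm_weight_le_1: "r \<le> 0 \<Longrightarrow> norm (weight r \<xi>) \<le> 1"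
  unfolding norm_weight using powr_mono[of "r/2" 0 "1 + (norm \<xi>)\<^sup>2"] by
      (simp add: add_nonneg_eq_0_iff)

lemma bounded_symbol_weight: "r \<le> 0 \<Longrightarrow> bounded_symbol (weight r)"
  by (intro bounded_symbolI[of _ 1] norm_weight_le_1 weight_measurable)

lemma cnj_weight_reflect [simp]: "cnj (weight r (- \<xi>)) = weight r \<xi>"
  by (simp add: weight_def)

lemma multiplier_weight_inject:
  assumes "r \<le> 0" shows "multiplier (weight r) x = multiplier (weight r) y \<longleftrightarrow> x = y"
proof
  assume *: "multiplier (weight r) x = multiplier (weight r) y"
  show "x = y"
    by (rule l2_eqI) (use rep_multiplier[OF bounded_symbol_weight[OF assms],
        of x, unfolded *] rep_multiplier[OF bounded_symbol_weight[OF assms], of y]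
       in \<open>eventually_elim, simp\<close>)
qed simp

text \<open>
  The isometric coordinate on the Sobolev space of order \<open>s\<close>: the transform of the Bessel
  potential of order \<open>- s\<close> of \<open>f\<close>.
\<close>

definition sobolev_coord :: "real \<Rightarrow> ('a::euclidean_space \<Rightarrow> real) \<Rightarrow> 'a l2" where
  "sobolev_coord s f = to_l2 (\<lambda>\<xi>. weight s \<xi> * fourier_transform f \<xi>)"

lemma sobolev_density_eq: "sobolev_density s f \<xi> = (norm (weight s \<xi> * fourier_transform f \<xi>))\<^sup>2"
proof -
  have "((1 + (norm \<xi>)\<^sup>2) powr (s / 2))\<^sup>2 = (1 + (norm \<xi>)\<^sup>2) powr s"
    by (simp add: power2_eq_square flip: powr_add)
  then show ?thesis unfolding sobolev_density_def norm_mult norm_weight power_mult_distrib by simp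
qed

lemma sobolev_space_iff:
  "f \<in> sobolev_space s \<longleftrightarrow> square_integrable f \<and> square_integrable (\<lambda>\<xi>. weight s \<xi>
      * fourier_transform f \<xi>)"
proof (cases "square_integrable f")
  case True
  note [measurable] = square_integrable_measurable[OF fourier_transform_l2(1)[OF True]]
  have "(\<lambda>\<xi>. weight s \<xi> * fourier_transform f \<xi>) \<in> borel_measurable lborel" by measurable
  then show ?thesis
    unfolding sobolev_space_def square_integrable_def[of "\<lambda>\<xi>. weight s \<xi>
        * fourier_transform f \<xi>"] sobolev_density_eq[abs_def]
    by simp
qed (simp add: sobolev_space_def)

lemma sobolev_square_integrable: "f \<in> sobolev_space s \<Longrightarrow> square_integrable f"
  by (simp add: sobolev_space_iff)

lemma sobolev_norm_eq: "f \<in> sobolev_space s \<Longrightarrow> sobolev_norm s f = norm (sobolev_coord s f)"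
  unfolding sobolev_norm_def sobolev_density_eq sobolev_coord_def
  by (simp add: sobolev_space_iff flip: norm_to_l2_sq)

text \<open>
  The characterisation from which all facts about \<open>sobolev_coord\<close> are derived by calculations in
  \<open>l2\<close>.
\<close>

lemma sobolev_coord_iff:
  assumes s: "s \<ge> 0" and f: "square_integrable f"
  shows "f \<in> sobolev_space s \<and> sobolev_coord s f = w \<longleftrightarrow> fourier_l2 (real_l2 f)
      = multiplier (weight (- s)) w"
proof -
  let ?F = "fourier_transform f"
  note F = fourier_transform_l2[OF f]
  note [measurable] = square_integrable_measurable[OF F(1)]
  have b: "bounded_symbol (weight (- s))" using s by (simp add: bounded_symbol_weight)
  have cancel: "weight (- s) \<xi> * (weight s \<xi> * z) = z" for \<xi> and z
    by (simp add: weight_add flip: mult.assoc)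
  have cancel': "weight s \<xi> * (weight (- s) \<xi> * z) = z" for \<xi> and z
    by (simp add: weight_add flip: mult.assoc)
  show ?thesis
  proof
    assume "f \<in> sobolev_space s \<and> sobolev_coord s f = w"
    then have sq: "square_integrable (\<lambda>\<xi>. weight s \<xi> * ?F \<xi>)" and w: "w
        = to_l2 (\<lambda>\<xi>. weight s \<xi> * ?F \<xi>)"
      by (auto simp: sobolev_space_iff sobolev_coord_def)
    show "fourier_l2 (real_l2 f) = multiplier (weight (- s)) w"
      unfolding w F(2)[symmetric]
      by (subst multiplier_to_l2) (use sq F(1) in \<open>auto simp: cancel\<close>)
  next
    assume *: "fourier_l2 (real_l2 f) = multiplier (weight (- s)) w"
    have "AE \<xi> in lborel. ?F \<xi> = weight (- s) \<xi> * rep_l2 w \<xi>"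
    proof -
      have "to_l2 ?F = to_l2 (\<lambda>\<xi>. weight (- s) \<xi> * rep_l2 w \<xi>)" using * F(2) by
          (simp add: multiplier_def)
      then show ?thesis using F(1) by (subst (asm) to_l2_eq_iff)
          (auto simp: square_integrable_bounded_symbol b)
    qed
    then have "AE \<xi> in lborel. rep_l2 w \<xi> = weight s \<xi> * ?F \<xi>" by eventually_elim
        (simp add: cancel')
    then have "square_integrable (\<lambda>\<xi>. weight s \<xi> * ?F \<xi>) \<and> to_l2 (rep_l2 w)
        = to_l2 (\<lambda>\<xi>. weight s \<xi> * ?F \<xi>)"
      by (intro to_l2_cong) auto
    then show "f \<in> sobolev_space s \<and> sobolev_coord s f = w" by
        (simp add: sobolev_space_iff f sobolev_coord_def)
  qed
qed

lemma fourier_l2_real_l2: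
  "s \<ge> 0 \<Longrightarrow> f \<in> sobolev_space s \<Longrightarrow> fourier_l2 (real_l2 f)
      = multiplier (weight (- s)) (sobolev_coord s f)"
  using sobolev_coord_iff[of s f "sobolev_coord s f"] sobolev_square_integrable by blast

lemma sobolev_coord_lower:
  assumes "0 \<le> t" "t \<le> s" "f \<in> sobolev_space s"
  shows "f \<in> sobolev_space t \<and> sobolev_coord t f = multiplier (weight (t - s)) (sobolev_coord s f)"
  using assms by (subst sobolev_coord_iff)
    (auto simp: sobolev_square_integrable fourier_l2_real_l2 multiplier_multiplier
        bounded_symbol_weight weight_add)

lemma real_l2_diff: "square_integrable f \<Longrightarrow> square_integrable g \<Longrightarrow> real_l2 (\<lambda>x. f x - g x)
    = real_l2 f - real_l2 g"
  unfolding real_l2_def by (simp add: to_l2_diff)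

lemma real_l2_add: "square_integrable f \<Longrightarrow> square_integrable g \<Longrightarrow> real_l2 (\<lambda>x. f x + g x)
    = real_l2 f + real_l2 g"
  unfolding real_l2_def by (simp add: to_l2_add)

lemma real_l2_cmult: "square_integrable f \<Longrightarrow> real_l2 (\<lambda>x. c * f x) = c *\<^sub>R real_l2 f"
  unfolding real_l2_def using to_l2_scaleR[of "\<lambda>x. complex_of_real (f x)" c] by
      (simp add: scaleR_conv_of_real)

lemma sobolev_coord_add:
  assumes "0 \<le> s" "f \<in> sobolev_space s" "g \<in> sobolev_space s"
  shows "(\<lambda>x. f x + g x) \<in> sobolev_space s \<and> sobolev_coord s (\<lambda>x. f x + g x)
      = sobolev_coord s f + sobolev_coord s g"
  using assms by (subst sobolev_coord_iff)
    (auto simp: sobolev_square_integrable square_integrable_add real_l2_add fourier_l2_real_l2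
      bounded_linear_add[OF bounded_linear_fourier_l2] bounded_linear_add[OF
          bounded_linear_multiplier] bounded_symbol_weight)

lemma sobolev_coord_diff:
  assumes "0 \<le> s" "f \<in> sobolev_space s" "g \<in> sobolev_space s"
  shows "(\<lambda>x. f x - g x) \<in> sobolev_space s \<and> sobolev_coord s (\<lambda>x. f x - g x)
      = sobolev_coord s f - sobolev_coord s g"
  using assms by (subst sobolev_coord_iff)
    (auto simp: sobolev_square_integrable square_integrable_diff real_l2_diff fourier_l2_real_l2
      bounded_linear_diff[OF bounded_linear_fourier_l2] bounded_linear_diff[OF
          bounded_linear_multiplier] bounded_symbol_weight)

lemma sobolev_coord_cmult:
  assumes "0 \<le> s" "f \<in> sobolev_space s"
  shows "(\<lambda>x. c * f x) \<in> sobolev_space s \<and> sobolev_coord s (\<lambda>x. c * f x) = c *\<^sub>R sobolev_coord s f"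
  using assms square_integrable_scaleR[of f c] by (subst sobolev_coord_iff)
    (auto simp: sobolev_square_integrable real_l2_cmult fourier_l2_real_l2
      bounded_linear_scaleR[OF bounded_linear_fourier_l2] bounded_linear_scaleR[OF
          bounded_linear_multiplier] bounded_symbol_weight)

lemma sobolev_coord_inject:
  assumes "0 \<le> s" "f \<in> sobolev_space s" "g \<in> sobolev_space s"
  shows "sobolev_coord s f = sobolev_coord s g \<longleftrightarrow> (AE x in lborel. f x = g x)"
proof -
  have "sobolev_coord s f = sobolev_coord s g \<longleftrightarrow> fourier_l2 (real_l2 f) = fourier_l2 (real_l2 g)"
    using assms by (simp add: fourier_l2_real_l2 multiplier_weight_inject)
  then show ?thesis
    using assms by (simp add: fourier_l2_inject real_l2_inject sobolev_square_integrable)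
qed

lemma sobolev_coord_conj_reflect:
  assumes "0 \<le> s" "f \<in> sobolev_space s" shows "conj_reflect (sobolev_coord s f) = sobolev_coord s f"
proof -
  have "multiplier (weight (- s)) (conj_reflect (sobolev_coord s f))
      = conj_reflect (fourier_l2 (real_l2 f))"
    using assms by (simp add: fourier_l2_real_l2 conj_reflect_multiplier bounded_symbol_weight)
  also have "\<dots> = multiplier (weight (- s)) (sobolev_coord s f)"
    unfolding fourier_l2_conj_l2[symmetric] using assms
    by (simp add: conj_l2_real_l2 sobolev_square_integrable fourier_l2_real_l2)
  finally show ?thesis using assms by (simp add: multiplier_weight_inject)
qed

text \<open>
  Together with \<open>sobolev_coord_conj_reflect\<close>: the coordinates of real functions are exactly the
  fixed points of \<open>conj_reflect\<close>.
\<close>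

lemma sobolev_coord_surj:
  fixes w :: "'a::euclidean_space l2"
  assumes "0 \<le> s" "conj_reflect w = w" shows "\<exists>f\<in>sobolev_space s. sobolev_coord s f = w"
proof -
  define c where "c = (2 * pi) ^ DIM('a)"
  have c: "c > 0" by (simp add: c_def)
  define x where "x = (1 / c) *\<^sub>R fourier_adjoint (multiplier (weight (- s)) w)"
  have Fx: "fourier_l2 x = multiplier (weight (- s)) w"
    unfolding x_def bounded_linear_scaleR[OF bounded_linear_fourier_l2] fourier_l2_fourier_adjoint
        c_def[symmetric] using c by simp
  have "fourier_l2 (conj_l2 x) = fourier_l2 x"
    unfolding fourier_l2_conj_l2 Fx using assms by
        (simp add: conj_reflect_multiplier bounded_symbol_weight)
  then have "conj_l2 x = x" by (simp add: fourier_l2_inject)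
  then obtain f where f: "square_integrable f" "real_l2 f = x" using conj_l2_fixed_imp_real by blast
  then show ?thesis using sobolev_coord_iff[OF assms(1) f(1), of w] Fx by auto
qed

section \<open>Convolutions and products of Sobolev functions\<close>

text \<open>
  On the dyadic shell with outer radius \<open>2 ^ k\<close> the squared weight is at most
  \<open>4 powr (r - r * k)\<close>, while the volume grows like \<open>2 ^ (k * n)\<close>; for \<open>r > n / 2\<close> the product
  decays geometrically.
\<close>

lemma square_integrable_weight:
  assumes r: "r > real DIM('a) / 2"
  shows "square_integrable (weight (- r) :: 'a::euclidean_space \<Rightarrow> complex)"
proof -
  define n where "n = DIM('a)"
  define a where "a k = 4 powr (r - r * real k)" for k :: nat
  have r0: "r > 0" using r by (rule order_le_less_trans[rotated]) simp
  have nsq: "(norm (weight (- r) \<xi>))\<^sup>2 = (1 + (norm \<xi>)\<^sup>2) powr (- r)" for \<xi> :: 'a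
    unfolding norm_weight by (simp add: power2_eq_square flip: powr_add)
  have pt: "ennreal ((1 + (norm \<xi>)\<^sup>2) powr (- r))
      \<le> (\<Sum>k. ennreal (a k) * indicator (cball 0 (2 ^ k)) \<xi>)" for \<xi> :: 'a
  proof -
    \<comment> \<open>The dyadic shell containing \<open>\<xi>\<close>; the shell with \<open>k = 0\<close> is the unit ball.\<close>
    define k where "k = (LEAST k. norm \<xi> \<le> 2 ^ k)"
    have ex: "\<exists>k. norm \<xi> \<le> 2 ^ k" using real_arch_pow[of 2 "norm \<xi>"] by (auto intro: less_imp_le)
    have k: "norm \<xi> \<le> 2 ^ k" unfolding k_def by (rule LeastI_ex[OF ex])
    have "(1 + (norm \<xi>)\<^sup>2) powr (- r) \<le> a k"
    proof (cases k)
      case 0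
      have "(1 + (norm \<xi>)\<^sup>2) powr (- r) \<le> (1 + (norm \<xi>)\<^sup>2) powr 0" using r0 by (intro powr_mono) auto
      also have "\<dots> = 1" by (simp add: add_nonneg_eq_0_iff)
      also have "1 \<le> a k" using r0 powr_mono[of 0 r 4] by (simp add: a_def 0)
      finally show ?thesis .
    next
      case (Suc j)
      have "\<not> norm \<xi> \<le> 2 ^ j" using not_less_Least[of j "\<lambda>k. norm \<xi> \<le> 2 ^ k"] Suc k_def by auto
      then have "(2 ^ j)\<^sup>2 \<le> (norm \<xi>)\<^sup>2" by (intro power_mono) auto
      then have "4 ^ j \<le> 1 + (norm \<xi>)\<^sup>2" by (simp add: power2_eq_square flip: power_mult_distrib)
      then have "(1 + (norm \<xi>)\<^sup>2) powr (- r) \<le> (4 ^ j) powr (- r)" using r0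
          by (intro powr_mono2') auto
      also have "\<dots> = a k" by (simp add: a_def Suc powr_powr algebra_simps flip: powr_realpow)
      finally show ?thesis .
    qed
    then have "ennreal ((1 + (norm \<xi>)\<^sup>2) powr (- r)) \<le> ennreal (a k) * indicator (cball 0 (2 ^ k)) \<xi>"
      using k by (auto intro: ennreal_leI)
    also have "\<dots> \<le> (\<Sum>k. ennreal (a k) * indicator (cball 0 (2 ^ k)) \<xi>)"
    proof -
      define h where "h k = ennreal (a k) * indicator (cball 0 (2 ^ k)) \<xi>" for k
      have "sum h {k} \<le> suminf h" by (rule sum_le_suminf) auto
      then have "h k \<le> suminf h" by simp
      then show ?thesis unfolding h_def[abs_def] .
    qed
    finally show ?thesis .
  qed
  have "(\<integral>\<^sup>+\<xi>. ennreal ((norm (weight (- r) (\<xi>::'a)))\<^sup>2) \<partial>lborel)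
      \<le> (\<integral>\<^sup>+\<xi>. (\<Sum>k. ennreal (a k) * indicator (cball 0 (2 ^ k)) (\<xi>::'a)) \<partial>lborel)"
    unfolding nsq by (intro nn_integral_mono pt)
  also have "\<dots> = (\<Sum>k. ennreal (a k) * emeasure lborel (cball (0::'a) (2 ^ k)))"
  proof -
    have [measurable]: "cball (0::'a) R \<in> sets borel" for R by simp
    have m: "(\<lambda>\<xi>::'a. ennreal (a k) * indicator (cball 0 (2 ^ k)) \<xi>) \<in> borel_measurable lborel"
        for k
      by measurable
    show ?thesis unfolding nn_integral_suminf[OF m] by (simp add: nn_integral_cmult_indicator)
  qed
  also have "\<dots> = (\<Sum>k. ennreal (a k * (unit_ball_vol (real n) * (2 ^ k) ^ n)))"
  proof -
    have "ennreal (a k) * emeasure lborel (cball (0::'a) (2 ^ k))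
        = ennreal (a k * (unit_ball_vol (real n) * (2 ^ k) ^ n))" for k
      by (subst emeasure_cball, simp, subst ennreal_mult'[of "a k"]) (simp_all add: a_def n_def)
    then show ?thesis by simp
  qed
  also have "\<dots> < \<infinity>"
  proof -
    define q where "q = 2 powr (real n - 2 * r)"
    have "q < 2 powr 0" unfolding q_def using r by (intro powr_less_mono) (auto simp: n_def)
    then have q: "q < 1" "q \<ge> 0" by (auto simp: q_def)
    have eq: "a k * (unit_ball_vol (real n) * (2 ^ k) ^ n)
        = (4 powr r * unit_ball_vol (real n)) * q ^ k" for k
    proof -
      have four: "4 powr y = 2 powr (2 * y)" for y :: real
        using powr_powr[of 2 2 y] by simp
      have "a k = 4 powr r * 4 powr (- (r * real k))" unfolding a_def by (simp flip: powr_add)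
      also have "4 powr (- (r * real k)) = 2 powr (- 2 * r * real k)" unfolding four by
          (simp add: mult.assoc)
      finally have "a k * (2 ^ k) ^ n = 4 powr r * (2 powr (- 2 * r * real k) * 2 powr (real (k
          * n)))"
        by (simp only: power_mult[symmetric] powr_realpow[OF zero_less_numeral] mult.assoc)
      also have "2 powr (- 2 * r * real k) * 2 powr (real (k * n)) = q powr real k"
        unfolding q_def by (simp add: powr_powr algebra_simps flip: powr_add)
      also have "\<dots> = q ^ k" by (simp add: q_def powr_realpow)
      finally show ?thesis by (simp add: mult_ac)
    qed
    have "summable (\<lambda>k. a k * (unit_ball_vol (real n) * (2 ^ k) ^ n))"
      unfolding eq using q by (intro summable_mult summable_geometric) auto
    then show ?thesis by (subst suminf_ennreal2) (auto simp: a_def)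
  qed
  finally show ?thesis by (subst square_integrable_iff_nn_integral) auto
qed

lemma Cauchy_Schwarz_integral:
  assumes f: "square_integrable f" and g: "square_integrable g"
  shows "(LINT x|lborel. norm (f x) * norm (g x))
      \<le> norm (to_l2 f) * norm (to_l2 (g :: 'a::euclidean_space \<Rightarrow> complex))"
proof -
  have abs: "square_integrable (\<lambda>x. norm (h x))" "norm (to_l2 (\<lambda>x. complex_of_real (norm (h x))))
      = norm (to_l2 h)"
    if h: "square_integrable h" for h :: "'a \<Rightarrow> complex"
  proof -
    note [measurable] = square_integrable_measurable[OF h]
    show 1: "square_integrable (\<lambda>x. norm (h x))"
      by (rule square_integrable_dominated[OF h, of _ 1]) auto
    have "(norm (to_l2 (\<lambda>x. complex_of_real (norm (h x)))))\<^sup>2 = (norm (to_l2 h))\<^sup>2"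
      using 1 h by (simp add: norm_to_l2_sq)
    then show "norm (to_l2 (\<lambda>x. complex_of_real (norm (h x)))) = norm (to_l2 h)" by simp
  qed
  have "(LINT x|lborel. norm (f x) * norm (g x))
      = to_l2 (\<lambda>x. complex_of_real (norm (f x))) \<bullet> to_l2 (\<lambda>x. complex_of_real (norm (g x)))"
    using abs(1)[OF f] abs(1)[OF g] by (simp add: inner_to_l2 inner_complex_def)
  also have "\<dots> \<le> norm (to_l2 (\<lambda>x. complex_of_real (norm (f x))))
      * norm (to_l2 (\<lambda>x. complex_of_real (norm (g x))))"
    by (rule norm_cauchy_schwarz)
  finally show ?thesis by (simp add: abs f g)
qed

lemma lborel_integral_reflect_shift:
  fixes f :: "'a::euclidean_space \<Rightarrow> 'b::{banach, second_countable_topology}"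
  assumes [measurable]: "f \<in> borel_measurable borel"
  shows "(LINT x|lborel. f (c - x)) = (LINT x|lborel. f x)"
  using lborel_integral_uminus[of "\<lambda>x. f (c + x)"] lborel_integral_shift[of f c] by simp

lemma lborel_integrable_reflect_shift:
  fixes f :: "'a::euclidean_space \<Rightarrow> 'b::{banach, second_countable_topology}"
  assumes "integrable lborel f" shows "integrable lborel (\<lambda>x. f (c - x))"
  using lborel_integrable_uminus[OF lborel_integrable_shift[OF assms, of c]] by simp

lemma lborel_AE_reflect_shift:
  assumes "AE x in lborel. P (x::'a::euclidean_space)" shows "AE x in lborel. P (c - x)"
proof -
  have "AE x in lborel. P (c + x)"
    using assms by (subst (asm) lborel_distr_plus[of c, symmetric]) (rule AE_distrD, auto)
  then show ?thesis using lborel_AE_uminus[of "\<lambda>x. P (c + x)"] by simp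
qed

lemma square_integrable_reflect_shift:
  fixes f :: "'a::euclidean_space \<Rightarrow> complex"
  assumes f: "square_integrable f" shows "square_integrable (\<lambda>x. f (c - x))"
proof -
  have [measurable]: "f \<in> borel_measurable borel" using f by (rule square_integrable_measurable)
  have "(\<lambda>x. f (c - x)) \<in> borel_measurable borel" by measurable
  then show ?thesis
    using lborel_integrable_reflect_shift[OF square_integrable_norm_sq[OF f], of c] by
        (simp add: square_integrable_def)
qed

definition conv :: "('a::euclidean_space \<Rightarrow> complex) \<Rightarrow> ('a \<Rightarrow> complex) \<Rightarrow> 'a \<Rightarrow> complex" where
  "conv F G \<xi> = (LINT \<eta>|lborel. F (\<xi> - \<eta>) * G \<eta>)"

definition conv_norm :: "('a::euclidean_space \<Rightarrow> complex) \<Rightarrow> ('a \<Rightarrow> complex) \<Rightarrow> 'a \<Rightarrow> real" where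
  "conv_norm F G \<xi> = (LINT \<eta>|lborel. norm (F (\<xi> - \<eta>)) * norm (G \<eta>))"

lemma conv_measurable [measurable]:
  assumes [measurable]: "F \<in> borel_measurable borel" "G \<in> borel_measurable borel"
  shows "conv F G \<in> borel_measurable borel" "conv_norm F G \<in> borel_measurable borel"
  unfolding conv_def[abs_def] conv_norm_def[abs_def] by measurable

lemma conv_integrand:
  fixes F G :: "'a::euclidean_space \<Rightarrow> complex"
  assumes "square_integrable F" "square_integrable G"
  shows "integrable lborel (\<lambda>\<eta>. F (\<xi> - \<eta>) * G \<eta>)" "integrable lborel (\<lambda>\<eta>. norm (F (\<xi> - \<eta>))
      * norm (G \<eta>))"
  using square_integrable_mult_integrable[OF square_integrable_reflect_shift[OF assms(1)] assms(2)]
    square_integrable_product_integrable[OF square_integrable_reflect_shift[OF assms(1)] assms(2)]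
        by auto

lemma conv_norm_commute:
  assumes [measurable]: "F \<in> borel_measurable borel" "G \<in> borel_measurable borel"
  shows "conv_norm F G \<xi> = conv_norm G F \<xi>"
  unfolding conv_norm_def
  by (subst lborel_integral_reflect_shift[of "\<lambda>\<eta>. norm (F (\<xi> - \<eta>)) * norm (G \<eta>)" \<xi>, symmetric])
      (auto simp: mult.commute)

lemma conv_cong_AE:
  assumes [measurable]: "F \<in> borel_measurable borel" "F' \<in> borel_measurable borel"
      "G \<in> borel_measurable borel" "G' \<in> borel_measurable borel"
    and F: "AE x in lborel. F x = F' x" and G: "AE x in lborel. G x = G' x"
  shows "conv F G = conv F' G'"
proof
  fix \<xi>
  show "conv F G \<xi> = conv F' G' \<xi>"
    unfolding conv_def
    by (rule integral_cong_AE, measurable) (use lborel_AE_reflect_shift[OF F, of \<xi>] G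
        in \<open>eventually_elim, simp\<close>)
qed

text \<open>
  Young's inequality for \<open>L\<^sup>2 * L\<^sup>1\<close>: by the Cauchy--Schwarz inequality for the measure with density
  \<open>norm \<circ> G\<close>, the square of the convolution is dominated by a convolution of \<open>L\<^sup>1\<close> functions.
\<close>

lemma young_L2_L1:
  fixes F G :: "'a::euclidean_space \<Rightarrow> complex"
  assumes F: "square_integrable F" and G: "integrable lborel G"
  shows "square_integrable (\<lambda>\<xi>. complex_of_real (conv_norm F G \<xi>))"
    and "norm (to_l2 (\<lambda>\<xi>. complex_of_real (conv_norm F G \<xi>)))
        \<le> (LINT \<eta>|lborel. norm (G \<eta>)) * norm (to_l2 F)"
proof -
  have [measurable]: "F \<in> borel_measurable borel" "G \<in> borel_measurable borel"
    using F G by (auto simp: integrable_iff_bounded square_integrable_measurable)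
  define N where "N = (LINT \<eta>|lborel. norm (G \<eta>))"
  have N0: "N \<ge> 0" by (simp add: N_def)
  have N: "(\<integral>\<^sup>+\<eta>. ennreal (norm (G \<eta>)) \<partial>lborel) = ennreal N"
    unfolding N_def by (rule nn_integral_eq_integral) (use G in auto)
  define I where "I \<xi> = (\<integral>\<^sup>+\<eta>. ennreal ((norm (F (\<xi> - \<eta>)))\<^sup>2 * norm (G \<eta>)) \<partial>lborel)" for \<xi>
  have [measurable]: "I \<in> borel_measurable borel" unfolding I_def[abs_def] by measurable
  have intI: "(\<integral>\<^sup>+\<xi>. I \<xi> \<partial>lborel) = ennreal (N * (norm (to_l2 F))\<^sup>2)"
  proof -
    have "(\<integral>\<^sup>+\<xi>. I \<xi> \<partial>lborel)
       = (\<integral>\<^sup>+\<eta>. \<integral>\<^sup>+\<xi>. ennreal ((norm (F (\<xi> - \<eta>)))\<^sup>2 * norm (G \<eta>)) \<partial>lborel \<partial>lborel)"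
      unfolding I_def by (rule lborel_pair.Fubini') measurable
    also have "\<dots> = (\<integral>\<^sup>+\<eta>. ennreal ((norm (to_l2 F))\<^sup>2) * ennreal (norm (G \<eta>)) \<partial>lborel)"
    proof (rule nn_integral_cong)
      fix \<eta>
      have "(\<integral>\<^sup>+\<xi>. ennreal ((norm (F (\<xi> - \<eta>)))\<^sup>2 * norm (G \<eta>)) \<partial>lborel)
         = (\<integral>\<^sup>+\<xi>. ennreal ((norm (F (- \<eta> + \<xi>)))\<^sup>2) \<partial>lborel) * ennreal (norm (G \<eta>))"
        by (subst nn_integral_multc[symmetric]) (auto simp: ennreal_mult)
      also have "(\<integral>\<^sup>+\<xi>. ennreal ((norm (F (- \<eta> + \<xi>)))\<^sup>2) \<partial>lborel)
          = (\<integral>\<^sup>+\<xi>. ennreal ((norm (F \<xi>))\<^sup>2) \<partial>lborel)"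
        by (rule nn_integral_shift) measurable
      finally show "(\<integral>\<^sup>+\<xi>. ennreal ((norm (F (\<xi> - \<eta>)))\<^sup>2 * norm (G \<eta>)) \<partial>lborel)
         = ennreal ((norm (to_l2 F))\<^sup>2) * ennreal (norm (G \<eta>))"
        by (simp add: nn_integral_norm_to_l2[OF F])
    qed
    also have "\<dots> = ennreal ((norm (to_l2 F))\<^sup>2) * ennreal N"
      by (subst nn_integral_cmult) (auto simp: N)
    finally show ?thesis using N0 by (simp add: ennreal_mult mult.commute)
  qed
  then have "(\<integral>\<^sup>+\<xi>. I \<xi> \<partial>lborel) \<noteq> \<infinity>" by simp
  then have "AE \<xi> in lborel. I \<xi> \<noteq> \<infinity>" by (intro nn_integral_PInf_AE) measurable
  then have ae: "AE \<xi> in lborel. ennreal ((conv_norm F G \<xi>)\<^sup>2) \<le> I \<xi> * ennreal N"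
  proof eventually_elim
    case (elim \<xi>)
    \<comment> \<open>The density \<open>norm (G \<eta>)\<close> is shared equally between the two factors.\<close>
    define p where "p \<eta> = complex_of_real (norm (F (\<xi> - \<eta>)) * sqrt (norm (G \<eta>)))" for \<eta>
    define q where "q \<eta> = complex_of_real (sqrt (norm (G \<eta>)))" for \<eta>
    have [measurable]: "p \<in> borel_measurable borel" "q \<in> borel_measurable borel"
      unfolding p_def q_def by measurable
    have np: "(norm (p \<eta>))\<^sup>2 = (norm (F (\<xi> - \<eta>)))\<^sup>2 * norm (G \<eta>)" for \<eta>
      by (simp add: p_def norm_mult power_mult_distrib)
    have nq: "(norm (q \<eta>))\<^sup>2 = norm (G \<eta>)" for \<eta> by (simp add: q_def)
    have p: "square_integrable p"
      by (subst square_integrable_iff_nn_integral) (use elim in \<open>auto simp: np I_def less_top\<close>)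
    have q: "square_integrable q"
      by (subst square_integrable_iff_nn_integral) (auto simp: nq N)
    have "conv_norm F G \<xi> = (LINT \<eta>|lborel. norm (p \<eta>) * norm (q \<eta>))"
      unfolding conv_norm_def by (simp add: p_def q_def norm_mult mult.assoc flip: real_sqrt_mult)
    also have "\<dots> \<le> norm (to_l2 p) * norm (to_l2 q)" by (rule Cauchy_Schwarz_integral[OF p q])
    finally have "(conv_norm F G \<xi>)\<^sup>2 \<le> (norm (to_l2 p) * norm (to_l2 q))\<^sup>2"
      by (intro power_mono) (auto simp: conv_norm_def)
    then have "ennreal ((conv_norm F G \<xi>)\<^sup>2) \<le> ennreal ((norm (to_l2 p))\<^sup>2)
        * ennreal ((norm (to_l2 q))\<^sup>2)"
      by (simp add: power_mult_distrib ennreal_leI flip: ennreal_mult)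
    also have "\<dots> = I \<xi> * ennreal N"
      by (simp add: nn_integral_norm_to_l2[OF p, symmetric] nn_integral_norm_to_l2[OF q, symmetric]
          np nq I_def N)
    finally show ?case .
  qed
  have bound: "(\<integral>\<^sup>+\<xi>. ennreal ((norm (complex_of_real (conv_norm F G \<xi>)))\<^sup>2) \<partial>lborel)
      \<le> ennreal ((N * norm (to_l2 F))\<^sup>2)"
  proof -
    have "(\<integral>\<^sup>+\<xi>. ennreal ((norm (complex_of_real (conv_norm F G \<xi>)))\<^sup>2) \<partial>lborel)
        \<le> (\<integral>\<^sup>+\<xi>. I \<xi> * ennreal N \<partial>lborel)"
      by (rule nn_integral_mono_AE) (use ae in simp)
    also have "\<dots> = ennreal (N * (norm (to_l2 F))\<^sup>2) * ennreal N" by (subst nn_integral_multc)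
        (auto simp: intI)
    also have "\<dots> = ennreal ((N * norm (to_l2 F))\<^sup>2)"
      using N0 by (simp add: power2_eq_square mult_ac flip: ennreal_mult)
    finally show ?thesis .
  qed
  show sq: "square_integrable (\<lambda>\<xi>. complex_of_real (conv_norm F G \<xi>))"
    by (subst square_integrable_iff_nn_integral)
        (use le_less_trans[OF bound ennreal_less_top] in \<open>auto simp del: square_integrable_of_real\<close>)
  have "(norm (to_l2 (\<lambda>\<xi>. complex_of_real (conv_norm F G \<xi>))))\<^sup>2 \<le> (N * norm (to_l2 F))\<^sup>2"
    using bound unfolding nn_integral_norm_to_l2[OF sq] by (subst (asm) ennreal_le_iff) auto
  then show "norm (to_l2 (\<lambda>\<xi>. complex_of_real (conv_norm F G \<xi>)))
      \<le> (LINT \<eta>|lborel. norm (G \<eta>)) * norm (to_l2 F)"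
    unfolding N_def[symmetric] by (rule power2_le_imp_le) (use N0 in simp)
qed

lemma norm_conv_le: "norm (conv F G \<xi>) \<le> conv_norm F G \<xi>"
  unfolding conv_def conv_norm_def norm_mult[symmetric] by (rule integral_norm_bound)

lemma square_integrable_conv:
  assumes F: "square_integrable F" and G: "integrable lborel G"
  shows "square_integrable (conv F G)"
proof (rule square_integrable_dominated[OF young_L2_L1(1)[OF F G], of _ 1])
  show "conv F G \<in> borel_measurable borel"
    by (rule conv_measurable) (use F G in \<open>auto simp: integrable_iff_bounded
        square_integrable_measurable\<close>)
  show "norm (conv F G \<xi>) \<le> 1 * norm (complex_of_real (conv_norm F G \<xi>))" for \<xi>
    using norm_conv_le[of F G \<xi>] by (simp add: order_trans[OF _ abs_ge_self])
qed

text \<open>The convolution theorem for integrable functions, by Fubini's theorem.\<close>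

lemma fourier_integral_conv:
  fixes F G :: "'a::euclidean_space \<Rightarrow> complex"
  assumes F: "integrable lborel F" and G: "integrable lborel G"
  shows "integrable lborel (conv F G)" "fourier_integral (conv F G) x
      = fourier_integral F x * fourier_integral G x"
proof -
  have [measurable]: "F \<in> borel_measurable borel" "G \<in> borel_measurable borel"
    using F G by (auto simp: integrable_iff_bounded)
  have int: "integrable (lborel \<Otimes>\<^sub>M lborel) (\<lambda>(\<eta>, \<xi>). F (\<xi> - \<eta>) * G \<eta> * cis (- (\<xi> \<bullet> x)))" for x
  proof (rule lborel_pair.Fubini_integrable)
    show "integrable lborel (\<lambda>\<eta>. LINT \<xi>|lborel. norm (case (\<eta>, \<xi>) of (\<eta>, \<xi>) \<Rightarrow> F (\<xi> - \<eta>) * G \<eta>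
        * cis (- (\<xi> \<bullet> x))))"
      using G by (simp add: norm_mult integral_translate[of "\<lambda>\<xi>. norm (F \<xi>)"])
    show "AE \<eta> in lborel. integrable lborel (\<lambda>\<xi>. case (\<eta>, \<xi>) of (\<eta>, \<xi>) \<Rightarrow> F (\<xi> - \<eta>) * G \<eta> * cis (- (\<xi>
        \<bullet> x)))"
      by (auto intro!: integrable_mult_cis integrable_mult_left integrable_translate F)
  qed measurable
  have conv0: "conv F G = (\<lambda>\<xi>. LINT \<eta>|lborel. F (\<xi> - \<eta>) * G \<eta> * cis (- (\<xi> \<bullet> 0)))"
    by (simp add: conv_def fun_eq_iff)
  show "integrable lborel (conv F G)"
    unfolding conv0 by (rule lborel_pair.integrable_snd[OF int])
  have "fourier_integral (conv F G) x = (LINT \<xi>|lborel. LINT \<eta>|lborel. F (\<xi> - \<eta>) * G \<eta> * cis (- (\<xi>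
      \<bullet> x)))"
    unfolding fourier_integral_def conv_def by simp
  also have "\<dots> = (LINT \<eta>|lborel. LINT \<xi>|lborel. F (\<xi> - \<eta>) * G \<eta> * cis (- (\<xi> \<bullet> x)))"
    by (rule lborel_pair.Fubini_integral[OF int])
  also have "\<dots> = (LINT \<eta>|lborel. G \<eta> * cis (- (\<eta> \<bullet> x)) * fourier_integral F x)"
  proof (rule Bochner_Integration.integral_cong[OF refl])
    fix \<eta>
    have "(LINT \<xi>|lborel. F (\<xi> - \<eta>) * G \<eta> * cis (- (\<xi> \<bullet> x)))
       = (LINT \<xi>|lborel. (\<lambda>z. G \<eta> * cis (- (\<eta> \<bullet> x)) * (F z * cis (- (z \<bullet> x)))) (\<xi> - \<eta>))"
    proof (rule Bochner_Integration.integral_cong[OF refl])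
      fix \<xi>
      have "cis (- (\<xi> \<bullet> x)) = cis (- (\<eta> \<bullet> x)) * cis (- ((\<xi> - \<eta>) \<bullet> x))"
        by (simp add: cis_mult inner_diff_left)
      then show "F (\<xi> - \<eta>) * G \<eta> * cis (- (\<xi> \<bullet> x))
          = (\<lambda>z. G \<eta> * cis (- (\<eta> \<bullet> x)) * (F z * cis (- (z \<bullet> x)))) (\<xi> - \<eta>)"
        by (simp add: mult_ac)
    qed
    also have "\<dots> = (LINT z|lborel. G \<eta> * cis (- (\<eta> \<bullet> x)) * (F z * cis (- (z \<bullet> x))))"
      by (rule integral_translate) measurable
    finally show "(LINT \<xi>|lborel. F (\<xi> - \<eta>) * G \<eta> * cis (- (\<xi> \<bullet> x)))
        = G \<eta> * cis (- (\<eta> \<bullet> x)) * fourier_integral F x"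
      unfolding fourier_integral_def by simp
  qed
  also have "\<dots> = fourier_integral F x * fourier_integral G x" by
      (simp add: fourier_integral_def mult.commute)
  finally show "fourier_integral (conv F G) x = fourier_integral F x * fourier_integral G x" .
qed

text \<open>
  The pointwise product in the coordinate of order \<open>r\<close>, see \<open>sobolev_coord_mult\<close>; the constant
  comes from the transform not being normalised.
\<close>

definition sobolev_product :: "real \<Rightarrow> 'a::euclidean_space l2 \<Rightarrow> 'a l2 \<Rightarrow> 'a l2" where
  "sobolev_product r v w = to_l2 (\<lambda>\<xi>. complex_of_real (1 / (2 * pi) ^ DIM('a)) * (weight r \<xi>
      * conv (\<lambda>\<eta>. weight (- r) \<eta> * rep_l2 v \<eta>) (\<lambda>\<eta>. weight (- r) \<eta> * rep_l2 w \<eta>) \<xi>))"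

text \<open>One of the frequencies \<open>\<xi> - \<eta>\<close> and \<open>\<eta>\<close> is at least half as large as \<open>\<xi>\<close>.\<close>

lemma weight_subadditive:
  assumes "r \<ge> 0"
  shows "norm (weight r \<xi>) \<le> 2 powr r * (norm (weight r (\<xi> - \<eta>)) + norm (weight r \<eta>))"
proof -
  define m where "m = max (norm (\<xi> - \<eta>)) (norm \<eta>)"
  have "norm \<xi> \<le> norm (\<xi> - \<eta>) + norm \<eta>" using norm_triangle_ineq[of "\<xi> - \<eta>" \<eta>] by simp
  then have "norm \<xi> \<le> 2 * m" by (auto simp: m_def)
  then have "(norm \<xi>)\<^sup>2 \<le> (2 * m)\<^sup>2" by (intro power_mono) auto
  then have "1 + (norm \<xi>)\<^sup>2 \<le> 4 * (1 + m\<^sup>2)" by (simp add: power_mult_distrib)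
  then have "norm (weight r \<xi>) \<le> (4 * (1 + m\<^sup>2)) powr (r / 2)"
    unfolding norm_weight using assms by (intro powr_mono2) auto
  also have "\<dots> = 4 powr (r / 2) * (1 + m\<^sup>2) powr (r / 2)" by (rule powr_mult)
  also have "4 powr (r / 2) = 2 powr r"
  proof -
    have "(4::real) = 2 powr 2" by (simp add: powr_numeral)
    then show ?thesis by (simp add: powr_powr)
  qed
  also have "(1 + m\<^sup>2) powr (r / 2) \<le> norm (weight r (\<xi> - \<eta>)) + norm (weight r \<eta>)"
    unfolding norm_weight m_def max_def by auto
  finally show ?thesis by simp
qed

lemma weighted_integrable:
  fixes w :: "'a::euclidean_space l2"
  assumes r: "r > real DIM('a) / 2"
  shows "integrable lborel (\<lambda>\<eta>. weight (- r) \<eta> * rep_l2 w \<eta>)"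
    and "(LINT \<eta>|lborel. norm (weight (- r) \<eta> * rep_l2 w \<eta>))
        \<le> norm (to_l2 (weight (- r) :: 'a \<Rightarrow> complex)) * norm w"
  using square_integrable_mult_integrable[OF square_integrable_weight[OF r]
      rep_l2_square_integrable]
    Cauchy_Schwarz_integral[OF square_integrable_weight[OF r] rep_l2_square_integrable] by
        (auto simp: norm_mult)

text \<open>
  The algebra property. By \<open>weight_subadditive\<close> the outer weight falls on one of the two factors
  and cancels the weight there; the other factor keeps its weight, so it is integrable, and
  Young's inequality applies.
\<close>

lemma weighted_conv_bound:
  fixes v w :: "'a::euclidean_space l2"
  assumes r: "r > real DIM('a) / 2"
  defines "F \<equiv> \<lambda>\<eta>. weight (- r) \<eta> * rep_l2 v \<eta>" and "G \<equiv> \<lambda>\<eta>. weight (- r) \<eta> * rep_l2 w \<eta>"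
  shows "square_integrable (\<lambda>\<xi>. weight r \<xi> * conv F G \<xi>)"
    and "norm (to_l2 (\<lambda>\<xi>. weight r \<xi> * conv F G \<xi>))
      \<le> 2 * 2 powr r * norm (to_l2 (weight (- r) :: 'a \<Rightarrow> complex)) * (norm v * norm w)"
proof -
  have r0: "r > 0" using r by (rule order_le_less_trans[rotated]) simp
  have b: "bounded_symbol (weight (- r) :: 'a \<Rightarrow> complex)" using r0
      by (intro bounded_symbol_weight) simp
  have sF: "square_integrable F" and sG: "square_integrable G"
    unfolding F_def G_def by (auto intro: square_integrable_bounded_symbol b)
  have [measurable]: "F \<in> borel_measurable borel" "G \<in> borel_measurable borel"
    unfolding F_def G_def by measurable
  have iF: "integrable lborel F" and iG: "integrable lborel G"
    unfolding F_def G_def by (auto intro: weighted_integrable[OF r])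
  define A where "A \<xi> = complex_of_real (conv_norm (rep_l2 v) G \<xi>)" for \<xi>
  define B where "B \<xi> = complex_of_real (conv_norm (rep_l2 w) F \<xi>)" for \<xi>
  note A = young_L2_L1[OF rep_l2_square_integrable[of v] iG, folded A_def]
  note B = young_L2_L1[OF rep_l2_square_integrable[of w] iF, folded B_def]
  have A': "square_integrable A" and B': "square_integrable B" using A(1) B(1)
      by (simp_all add: A_def[abs_def] B_def[abs_def])
  have pt: "norm (weight r \<xi> * conv F G \<xi>) \<le> 2 powr r * norm (A \<xi> + B \<xi>)" for \<xi>
  proof -
    have cancel: "norm (weight r \<eta>) * norm (weight (- r) \<eta> * z) = norm z" for \<eta> :: 'a and z
      using weight_add[of r \<eta> "- r"] by (simp add: norm_mult flip: mult.assoc norm_mult)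
    note ci = conv_integrand[OF rep_l2_square_integrable sG, of v \<xi>] conv_integrand[OF sF
        rep_l2_square_integrable, of \<xi> w]
    have "norm (weight r \<xi> * conv F G \<xi>) \<le> norm (weight r \<xi>) * conv_norm F G \<xi>"
      unfolding norm_mult by (intro mult_left_mono norm_conv_le) simp
    also have "\<dots> = (LINT \<eta>|lborel. norm (weight r \<xi>) * (norm (F (\<xi> - \<eta>)) * norm (G \<eta>)))"
      by (simp add: conv_norm_def)
    also have "\<dots> \<le> (LINT \<eta>|lborel. 2 powr r * (norm (rep_l2 v (\<xi> - \<eta>)) * norm (G \<eta>)
        + norm (F (\<xi> - \<eta>)) * norm (rep_l2 w \<eta>)))"
    proof (rule integral_mono)
      show "integrable lborel (\<lambda>\<eta>. norm (weight r \<xi>) * (norm (F (\<xi> - \<eta>)) * norm (G \<eta>)))"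
        using conv_integrand[OF sF sG, of \<xi>] by simp
      show "integrable lborel (\<lambda>\<eta>. 2 powr r * (norm (rep_l2 v (\<xi> - \<eta>)) * norm (G \<eta>) + norm (F (\<xi>
          - \<eta>)) * norm (rep_l2 w \<eta>)))"
        using ci by simp
      fix \<eta>
      have "norm (weight r \<xi>) * (norm (F (\<xi> - \<eta>)) * norm (G \<eta>))
         \<le> 2 powr r * (norm (weight r (\<xi> - \<eta>)) + norm (weight r \<eta>)) * (norm (F (\<xi> - \<eta>))
             * norm (G \<eta>))"
        using r0 by (intro mult_right_mono weight_subadditive) auto
      also have "\<dots> = 2 powr r * ((norm (weight r (\<xi> - \<eta>)) * norm (F (\<xi> - \<eta>))) * norm (G \<eta>)
          + norm (F (\<xi> - \<eta>)) * (norm (weight r \<eta>) * norm (G \<eta>)))"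
        by (simp add: algebra_simps)
      also have "\<dots> = 2 powr r * (norm (rep_l2 v (\<xi> - \<eta>)) * norm (G \<eta>) + norm (F (\<xi> - \<eta>))
          * norm (rep_l2 w \<eta>))"
        unfolding F_def G_def cancel ..
      finally show "norm (weight r \<xi>) * (norm (F (\<xi> - \<eta>)) * norm (G \<eta>))
         \<le> 2 powr r * (norm (rep_l2 v (\<xi> - \<eta>)) * norm (G \<eta>) + norm (F (\<xi> - \<eta>))
             * norm (rep_l2 w \<eta>))" .
    qed
    also have "\<dots> = 2 powr r * (conv_norm (rep_l2 v) G \<xi> + conv_norm F (rep_l2 w) \<xi>)"
      using ci by (simp add: conv_norm_def)
    also have "conv_norm F (rep_l2 w) \<xi> = conv_norm (rep_l2 w) F \<xi>" by
        (rule conv_norm_commute) measurable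
    also have "conv_norm (rep_l2 v) G \<xi> + conv_norm (rep_l2 w) F \<xi> \<le> norm (A \<xi> + B \<xi>)"
      unfolding A_def B_def of_real_add[symmetric] norm_of_real by simp
    finally show ?thesis by simp
  qed
  have sAB: "square_integrable (\<lambda>\<xi>. A \<xi> + B \<xi>)" using A' B' by (rule square_integrable_add)
  show sq: "square_integrable (\<lambda>\<xi>. weight r \<xi> * conv F G \<xi>)"
    by (rule square_integrable_dominated[OF sAB _ pt]) measurable
  have "norm (to_l2 (\<lambda>\<xi>. weight r \<xi> * conv F G \<xi>)) \<le> 2 powr r * norm (to_l2 (\<lambda>\<xi>. A \<xi> + B \<xi>))"
    by (rule norm_to_l2_mono[OF sq sAB pt]) simp
  also have "\<dots> \<le> 2 powr r * (norm (to_l2 A) + norm (to_l2 B))"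
    by (intro mult_left_mono) (auto simp: to_l2_add A' B' norm_triangle_ineq)
  also have "\<dots> \<le> 2 powr r * ((norm (to_l2 (weight (- r) :: 'a \<Rightarrow> complex)) * norm w) * norm v
      + (norm (to_l2 (weight (- r) :: 'a \<Rightarrow> complex)) * norm v) * norm w)"
  proof (intro mult_left_mono add_mono)
    have "norm (to_l2 A) \<le> (LINT \<eta>|lborel. norm (G \<eta>)) * norm v" using A(2) by
        (simp add: A_def[abs_def])
    also have "\<dots> \<le> (norm (to_l2 (weight (- r) :: 'a \<Rightarrow> complex)) * norm w) * norm v"
      unfolding G_def by (intro mult_right_mono weighted_integrable(2)[OF r]) simp
    finally show "norm (to_l2 A) \<le> (norm (to_l2 (weight (- r) :: 'a \<Rightarrow> complex)) * norm w)
        * norm v" .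
    have "norm (to_l2 B) \<le> (LINT \<eta>|lborel. norm (F \<eta>)) * norm w" using B(2) by
        (simp add: B_def[abs_def])
    also have "\<dots> \<le> (norm (to_l2 (weight (- r) :: 'a \<Rightarrow> complex)) * norm v) * norm w"
      unfolding F_def by (intro mult_right_mono weighted_integrable(2)[OF r]) simp
    finally show "norm (to_l2 B) \<le> (norm (to_l2 (weight (- r) :: 'a \<Rightarrow> complex)) * norm v)
        * norm w" .
  qed simp
  finally show "norm (to_l2 (\<lambda>\<xi>. weight r \<xi> * conv F G \<xi>))
      \<le> 2 * 2 powr r * norm (to_l2 (weight (- r) :: 'a \<Rightarrow> complex)) * (norm v * norm w)"
    by (simp add: algebra_simps)
qed

lemma sobolev_product_cong:
  fixes v w :: "'a::euclidean_space l2"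
  assumes r: "r > real DIM('a) / 2"
    and f: "f \<in> borel_measurable borel" "AE \<xi> in lborel. rep_l2 v \<xi> = f \<xi>"
    and g: "g \<in> borel_measurable borel" "AE \<xi> in lborel. rep_l2 w \<xi> = g \<xi>"
  shows "sobolev_product r v w = (1 / (2 * pi) ^ DIM('a)) *\<^sub>R to_l2 (\<lambda>\<xi>. weight r \<xi>
      * conv (\<lambda>\<eta>. weight (- r) \<eta> * f \<eta>) (\<lambda>\<eta>. weight (- r) \<eta> * g \<eta>) \<xi>)"
proof -
  note [measurable] = f(1) g(1)
  have "conv (\<lambda>\<eta>. weight (- r) \<eta> * rep_l2 v \<eta>) (\<lambda>\<eta>. weight (- r) \<eta> * rep_l2 w \<eta>)
      = conv (\<lambda>\<eta>. weight (- r) \<eta> * f \<eta>) (\<lambda>\<eta>. weight (- r) \<eta> * g \<eta>)"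
    by (rule conv_cong_AE) (use f(2) g(2) in \<open>auto elim: eventually_mono\<close>)
  then show ?thesis
    unfolding sobolev_product_def using to_l2_scaleR[OF weighted_conv_bound(1)[OF r, of v w],
        of "1 / (2 * pi) ^ DIM('a)"]
    by (simp add: scaleR_conv_of_real)
qed

lemma bounded_bilinear_sobolev_product:
  assumes r: "r > real DIM('a) / 2"
  shows "bounded_bilinear (sobolev_product r :: 'a::euclidean_space l2 \<Rightarrow> 'a l2 \<Rightarrow> 'a l2)"
proof -
  define c where "c = 1 / (2 * pi) ^ DIM('a)"
  define F where "F w = (\<lambda>\<eta>. weight (- r) \<eta> * rep_l2 w \<eta>)" for w :: "'a l2"
  have r0: "r > 0" using r by (rule order_le_less_trans[rotated]) simp
  have sF: "square_integrable (F w)" for w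
    unfolding F_def using r0 by (auto intro!: square_integrable_bounded_symbol
        bounded_symbol_weight)
  have sobolev_product: "sobolev_product r v w = c *\<^sub>R to_l2 (\<lambda>\<xi>. weight r \<xi> * conv (F v) (F w) \<xi>)"
      for v w
    unfolding c_def F_def by (rule sobolev_product_cong[OF r]) auto
  note sq = weighted_conv_bound(1)[OF r, folded F_def]
  note ci = conv_integrand(1)[OF sF sF]
  show ?thesis
  proof
    fix u v w :: "'a l2" and a :: real
    have "sobolev_product r (u + v) w = c *\<^sub>R to_l2 (\<lambda>\<xi>. weight r \<xi> * conv (\<lambda>\<eta>. weight (- r) \<eta>
        * (rep_l2 u \<eta> + rep_l2 v \<eta>)) (F w) \<xi>)"
      unfolding c_def F_def by (rule sobolev_product_cong[OF r _ rep_l2_add]) auto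
    also have "(\<lambda>\<xi>. weight r \<xi> * conv (\<lambda>\<eta>. weight (- r) \<eta> * (rep_l2 u \<eta> + rep_l2 v \<eta>)) (F w) \<xi>)
        = (\<lambda>\<xi>. weight r \<xi> * conv (F u) (F w) \<xi> + weight r \<xi> * conv (F v) (F w) \<xi>)"
      unfolding conv_def using ci by (auto simp: fun_eq_iff F_def algebra_simps)
    finally show "sobolev_product r (u + v) w = sobolev_product r u w + sobolev_product r v w"
      unfolding sobolev_product by (simp add: to_l2_add sq scaleR_add_right)
    have "sobolev_product r u (v + w) = c *\<^sub>R to_l2 (\<lambda>\<xi>. weight r \<xi> * conv (F u) (\<lambda>\<eta>. weight (- r) \<eta>
        * (rep_l2 v \<eta> + rep_l2 w \<eta>)) \<xi>)"
      unfolding c_def F_def by (rule sobolev_product_cong[OF r _ _ _ rep_l2_add]) auto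
    also have "(\<lambda>\<xi>. weight r \<xi> * conv (F u) (\<lambda>\<eta>. weight (- r) \<eta> * (rep_l2 v \<eta> + rep_l2 w \<eta>)) \<xi>)
        = (\<lambda>\<xi>. weight r \<xi> * conv (F u) (F v) \<xi> + weight r \<xi> * conv (F u) (F w) \<xi>)"
      unfolding conv_def using ci by (auto simp: fun_eq_iff F_def algebra_simps)
    finally show "sobolev_product r u (v + w) = sobolev_product r u v + sobolev_product r u w"
      unfolding sobolev_product by (simp add: to_l2_add sq scaleR_add_right)
    have "sobolev_product r (a *\<^sub>R u) w = c *\<^sub>R to_l2 (\<lambda>\<xi>. weight r \<xi> * conv (\<lambda>\<eta>. weight (- r) \<eta>
        * (a *\<^sub>R rep_l2 u \<eta>)) (F w) \<xi>)"
      unfolding c_def F_def by (rule sobolev_product_cong[OF r _ rep_l2_scaleR]) auto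
    also have "(\<lambda>\<xi>. weight r \<xi> * conv (\<lambda>\<eta>. weight (- r) \<eta> * (a *\<^sub>R rep_l2 u \<eta>)) (F w) \<xi>)
        = (\<lambda>\<xi>. a *\<^sub>R (weight r \<xi> * conv (F u) (F w) \<xi>))"
      unfolding conv_def by (auto simp: fun_eq_iff F_def)
    finally show "sobolev_product r (a *\<^sub>R u) w = a *\<^sub>R sobolev_product r u w"
      unfolding sobolev_product by (simp add: to_l2_scaleR sq)
    have "sobolev_product r u (a *\<^sub>R w) = c *\<^sub>R to_l2 (\<lambda>\<xi>. weight r \<xi> * conv (F u) (\<lambda>\<eta>. weight (- r) \<eta>
        * (a *\<^sub>R rep_l2 w \<eta>)) \<xi>)"
      unfolding c_def F_def by (rule sobolev_product_cong[OF r _ _ _ rep_l2_scaleR]) auto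
    also have "(\<lambda>\<xi>. weight r \<xi> * conv (F u) (\<lambda>\<eta>. weight (- r) \<eta> * (a *\<^sub>R rep_l2 w \<eta>)) \<xi>)
        = (\<lambda>\<xi>. a *\<^sub>R (weight r \<xi> * conv (F u) (F w) \<xi>))"
      unfolding conv_def by (auto simp: fun_eq_iff F_def)
    finally show "sobolev_product r u (a *\<^sub>R w) = a *\<^sub>R sobolev_product r u w"
      unfolding sobolev_product by (simp add: to_l2_scaleR sq)
  next
    have c0: "c \<ge> 0" by (simp add: c_def)
    define K where "K = c * (2 * 2 powr r * norm (to_l2 (weight (- r) :: 'a \<Rightarrow> complex)))"
    have "norm (sobolev_product r v w) \<le> norm v * norm w * K" for v w :: "'a l2"
    proof -
      have "norm (sobolev_product r v w) \<le> c * (2 * 2 powr r * norm (to_l2 (weight (- r) :: 'a \<Rightarrow>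
          complex)) * (norm v * norm w))"
        unfolding sobolev_product norm_scaleR F_def
            using mult_left_mono[OF weighted_conv_bound(2)[OF r, of v w], of c] c0 by simp
      then show ?thesis unfolding K_def by (simp add: mult_ac)
    qed
    then show "\<exists>K. \<forall>v w :: 'a l2. norm (sobolev_product r v w) \<le> norm v * norm w * K"
      by (intro exI[of _ K] allI)
  qed
qed

text \<open>
  Since the transforms of \<open>f\<close> and \<open>g\<close> are integrable, both functions are given almost everywhere
  by inversion integrals. Their product is the inversion integral of a convolution, and inversion
  is injective.
\<close>

lemma sobolev_coord_mult:
  fixes f g :: "'a::euclidean_space \<Rightarrow> real"
  assumes r: "r > real DIM('a) / 2" and f: "f \<in> sobolev_space r" and g: "g \<in> sobolev_space r"
  shows "(\<lambda>x. f x * g x) \<in> sobolev_space r \<and> sobolev_coord r (\<lambda>x. f x * g x)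
      = sobolev_product r (sobolev_coord r f) (sobolev_coord r g)"
proof -
  define c where "c = (2 * pi) ^ DIM('a)"
  have c: "c > 0" by (simp add: c_def)
  have r0: "r > 0" using r by (rule order_le_less_trans[rotated]) simp
  have b: "bounded_symbol (weight (- r) :: 'a \<Rightarrow> complex)" using r0
      by (intro bounded_symbol_weight) simp
  define F where "F h = (\<lambda>\<eta>. weight (- r) \<eta> * rep_l2 (sobolev_coord r h) \<eta>)" for h :: "'a \<Rightarrow> real"
  have sF: "square_integrable (F h)" and iF: "integrable lborel (F h)" for h
    unfolding F_def by (auto intro: square_integrable_bounded_symbol b weighted_integrable[OF r])
  have ae: "AE x in lborel. fourier_integral (F h) (- x) = complex_of_real (c * h x)"
      if h: "h \<in> sobolev_space r" for h
  proof -
    have sh: "square_integrable h" using h by (rule sobolev_square_integrable)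
    have sch: "square_integrable (\<lambda>x. complex_of_real (c * h x))"
      using square_integrable_scaleR[OF sh, of c] unfolding square_integrable_of_real by simp
    have "to_l2 (F h) = fourier_l2 (real_l2 h)" using r0 h by
        (simp add: fourier_l2_real_l2[of r] multiplier_def F_def)
    then have "fourier_adjoint (to_l2 (F h)) = c *\<^sub>R real_l2 h" by
        (simp add: fourier_adjoint_fourier_l2 c_def)
    then have "to_l2 (\<lambda>x. fourier_integral (F h) (- x)) = to_l2 (\<lambda>x. complex_of_real (c * h x))"
      using fourier_adjoint_to_l2[OF iF sF] real_l2_cmult[OF sh, of c] by (simp add: real_l2_def)
    then show ?thesis
      by (subst (asm) to_l2_eq_iff[OF square_integrable_reflect[OF plancherel_L1_L2(1)[OF iF sF]]
          sch])
  qed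
  have iC: "integrable lborel (conv (F f) (F g))" and sC: "square_integrable (conv (F f) (F g))"
    by (auto intro: fourier_integral_conv square_integrable_conv iF sF)
  have [measurable]: "f \<in> borel_measurable borel" "g \<in> borel_measurable borel"
    using f g by (auto intro: square_integrable_measurable sobolev_square_integrable)
  have aefg: "AE x in lborel. fourier_integral (conv (F f) (F g)) (- x)
      = complex_of_real (c\<^sup>2 * (f x * g x))"
    using ae[OF f] ae[OF g] by eventually_elim
        (simp add: fourier_integral_conv[OF iF iF] power2_eq_square)
  have "square_integrable (\<lambda>x. complex_of_real (c\<^sup>2 * (f x * g x))) \<and>
      to_l2 (\<lambda>x. fourier_integral (conv (F f) (F g)) (- x))
          = to_l2 (\<lambda>x. complex_of_real (c\<^sup>2 * (f x * g x)))"
    by (rule to_l2_cong[OF square_integrable_reflect[OF plancherel_L1_L2(1)[OF iC sC]] _ aefg])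
        measurable
  then have sqc: "square_integrable (\<lambda>x. c\<^sup>2 * (f x * g x))"
    and eq: "fourier_adjoint (to_l2 (conv (F f) (F g))) = real_l2 (\<lambda>x. c\<^sup>2 * (f x * g x))"
    unfolding square_integrable_of_real by (auto simp: fourier_adjoint_to_l2[OF iC sC] real_l2_def)
  have sq: "square_integrable (\<lambda>x. f x * g x)"
    using square_integrable_scaleR[OF sqc, of "1 / c\<^sup>2"] c by simp
  have "c *\<^sub>R to_l2 (conv (F f) (F g)) = fourier_l2 (c\<^sup>2 *\<^sub>R real_l2 (\<lambda>x. f x * g x))"
    using arg_cong[OF eq, of fourier_l2] unfolding fourier_l2_fourier_adjoint real_l2_cmult[OF sq]
        c_def .
  then have "c *\<^sub>R to_l2 (conv (F f) (F g)) = c\<^sup>2 *\<^sub>R fourier_l2 (real_l2 (\<lambda>x. f x * g x))"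
    by (simp add: bounded_linear_scaleR[OF bounded_linear_fourier_l2])
  then have "(1 / c\<^sup>2) *\<^sub>R (c *\<^sub>R to_l2 (conv (F f) (F g))) = fourier_l2 (real_l2 (\<lambda>x. f x * g x))"
    using c by simp
  then have Feq: "fourier_l2 (real_l2 (\<lambda>x. f x * g x)) = (1 / c) *\<^sub>R to_l2 (conv (F f) (F g))"
    using c by (simp add: power2_eq_square)
  note sqw = weighted_conv_bound(1)[OF r, of "sobolev_coord r f" "sobolev_coord r g", folded F_def]
  have cancel: "weight (- r) \<xi> * (weight r \<xi> * z) = z" for \<xi> :: 'a and z
    by (simp add: weight_add flip: mult.assoc)
  have "multiplier (weight (- r)) (sobolev_product r (sobolev_coord r f) (sobolev_coord r g))
      = (1 / c) *\<^sub>R multiplier (weight (- r)) (to_l2 (\<lambda>\<xi>. weight r \<xi> * conv (F f) (F g) \<xi>))"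
    using sobolev_product_cong[OF r, of "rep_l2 (sobolev_coord r f)" "sobolev_coord r f" "rep_l2
        (sobolev_coord r g)" "sobolev_coord r g"]
    by (simp add: bounded_linear_scaleR[OF bounded_linear_multiplier[OF b]] c_def F_def)
  also have "multiplier (weight (- r)) (to_l2 (\<lambda>\<xi>. weight r \<xi> * conv (F f) (F g) \<xi>))
      = to_l2 (conv (F f) (F g))"
    by (subst multiplier_to_l2) (use sqw sC in \<open>auto simp: cancel\<close>)
  finally show ?thesis using sobolev_coord_iff[of r "\<lambda>x. f x * g x"] r0 sq Feq by simp
qed

section \<open>Weak derivatives on the Fourier side\<close>

lemma GDERIV_imp_isCont: "GDERIV f x :> D \<Longrightarrow> isCont f x"
  unfolding gderiv_def by (rule has_derivative_continuous)

lemma GDERIV_unique: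
  assumes "GDERIV f x :> D" "GDERIV f x :> E" shows "D = E"
proof -
  have "(\<lambda>h. h \<bullet> D) = (\<lambda>h. h \<bullet> E)"
    using assms unfolding gderiv_def by (rule has_derivative_unique)
  then have "(D - E) \<bullet> D = (D - E) \<bullet> E" by metis
  then have "(D - E) \<bullet> (D - E) = 0" by (simp add: inner_diff_right)
  then show ?thesis by simp
qed

text \<open>The gradient also vanishes outside a ball, since it is determined by values nearby.\<close>

lemma test_function_bounds:
  assumes "test_function \<phi> D\<phi>"
  obtains R M where "R > 0" "M \<ge> 0" "\<And>x. norm x > R \<Longrightarrow> \<phi> x = 0 \<and> D\<phi> x = 0"
    "\<And>x. \<bar>\<phi> x\<bar> \<le> M" "\<And>x. norm (D\<phi> x) \<le> M" "continuous_on UNIV \<phi>" "continuous_on UNIV D\<phi>"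
proof -
  have g: "\<And>x. GDERIV \<phi> x :> D\<phi> x" and cD: "continuous_on UNIV D\<phi>" and bd: "bounded {x. \<phi> x \<noteq> 0}"
    using assms by (auto simp: test_function_def)
  have c: "continuous_on UNIV \<phi>"
    using GDERIV_imp_isCont[OF g] by (simp add: continuous_at_imp_continuous_on)
  obtain R where R: "R > 0" "\<And>x. \<phi> x \<noteq> 0 \<Longrightarrow> norm x \<le> R"
    using bd unfolding bounded_pos by auto
  have z: "\<phi> x = 0 \<and> D\<phi> x = 0" if "norm x > R" for x
  proof
    show "\<phi> x = 0" using R(2)[of x] that by auto
    have op: "open {y::'a. norm y > R}" by (intro open_Collect_less continuous_intros)
    have "((\<lambda>y. 0) has_derivative (\<lambda>h. h \<bullet> D\<phi> x)) (at x)"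
      using g[of x] unfolding gderiv_def
      by (rule has_derivative_transform_within_open[OF _ op]) (use that R(2) in force)+
    then have "GDERIV (\<lambda>y. 0) x :> D\<phi> x" by (simp add: gderiv_def)
    moreover have "GDERIV (\<lambda>y. 0) x :> 0" by (rule GDERIV_const)
    ultimately show "D\<phi> x = 0" by (rule GDERIV_unique)
  qed
  have "compact (\<phi> ` cball 0 R)" "compact (D\<phi> ` cball 0 R)"
    by (auto intro!: compact_continuous_image continuous_on_subset[OF c] continuous_on_subset[OF
        cD])
  then have "bounded (\<phi> ` cball 0 R)" "bounded (D\<phi> ` cball 0 R)" by
      (auto intro: compact_imp_bounded)
  then obtain M1 M2 where "\<forall>y\<in>\<phi> ` cball 0 R. norm y \<le> M1" "\<forall>y\<in>D\<phi> ` cball 0 R. norm y \<le> M2"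
    unfolding bounded_iff by blast
  then have M: "norm x \<le> R \<Longrightarrow> \<bar>\<phi> x\<bar> \<le> M1" "norm x \<le> R \<Longrightarrow> norm (D\<phi> x) \<le> M2" for x
    by auto
  show thesis
  proof (rule that[of R "max 0 (max M1 M2)"])
    show "\<bar>\<phi> x\<bar> \<le> max 0 (max M1 M2)" for x
      using M(1)[of x] z[of x] by (cases "norm x \<le> R") auto
    show "norm (D\<phi> x) \<le> max 0 (max M1 M2)" for x
      using M(2)[of x] z[of x] by (cases "norm x \<le> R") auto
  qed (use R z c cD in auto)
qed

lemma test_function_mult_square_integrable:
  fixes f :: "'a::euclidean_space \<Rightarrow> 'b::euclidean_space" and g :: "'a \<Rightarrow> real"
  assumes f: "square_integrable f" and g: "g \<in> borel_measurable borel" and M: "\<And>x. norm (g x)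
      \<le> M * norm (f x)"
    and z: "\<And>x. norm x > R \<Longrightarrow> g x = 0"
  shows "square_integrable g" "integrable lborel g"
proof -
  show sq: "square_integrable g" by (rule square_integrable_dominated[OF f g M])
  have "integrable lborel (ball_cut R (\<lambda>x. complex_of_real (g x)))" by (rule ball_cut_integrable)
      (simp add: sq)
  also have "ball_cut R (\<lambda>x. complex_of_real (g x)) = (\<lambda>x. complex_of_real (g x))"
    using z by (auto simp: ball_cut_def fun_eq_iff not_le)
  finally show "integrable lborel g" by (simp add: complex_of_real_integrable_eq)
qed

text \<open>
  Test functions may be modulated by plane waves; this is how frequencies enter the weak
  formulation.
\<close>

lemma test_function_cos:
  assumes t: "test_function \<phi> D\<phi>"
  shows "test_function (\<lambda>x. \<phi> x * cos (x \<bullet> \<xi>)) (\<lambda>x. cos (x \<bullet> \<xi>) *\<^sub>R D\<phi> x - (\<phi> x * sin (x \<bullet> \<xi>)) *\<^sub>R \<xi>)"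
  unfolding test_function_def
proof (intro conjI allI)
  note tt = t[unfolded test_function_def]
  fix x
  have "GDERIV (\<lambda>x. x \<bullet> \<xi>) x :> \<xi>" unfolding gderiv_def by (auto intro!: derivative_eq_intros)
  then have "GDERIV (\<lambda>x. cos (x \<bullet> \<xi>)) x :> (- sin (x \<bullet> \<xi>)) *\<^sub>R \<xi>"
    by (rule GDERIV_DERIV_compose) (rule DERIV_cos)
  from GDERIV_mult[OF _ this, of \<phi> "D\<phi> x"] show "GDERIV (\<lambda>x. \<phi> x * cos (x \<bullet> \<xi>)) x :>
      cos (x \<bullet> \<xi>) *\<^sub>R D\<phi> x - (\<phi> x * sin (x \<bullet> \<xi>)) *\<^sub>R \<xi>"
    using tt by (simp add: algebra_simps)
next
  show "continuous_on UNIV (\<lambda>x. cos (x \<bullet> \<xi>) *\<^sub>R D\<phi> x - (\<phi> x * sin (x \<bullet> \<xi>)) *\<^sub>R \<xi>)"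
    using test_function_bounds[OF t] by (auto intro!: continuous_intros)
  show "bounded {x. \<phi> x * cos (x \<bullet> \<xi>) \<noteq> 0}"
    using t unfolding test_function_def by (auto elim!: bounded_subset)
qed

lemma test_function_sin:
  assumes t: "test_function \<phi> D\<phi>"
  shows "test_function (\<lambda>x. \<phi> x * sin (x \<bullet> \<xi>)) (\<lambda>x. sin (x \<bullet> \<xi>) *\<^sub>R D\<phi> x + (\<phi> x * cos (x \<bullet> \<xi>)) *\<^sub>R \<xi>)"
  unfolding test_function_def
proof (intro conjI allI)
  note tt = t[unfolded test_function_def]
  fix x
  have "GDERIV (\<lambda>x. x \<bullet> \<xi>) x :> \<xi>" unfolding gderiv_def by (auto intro!: derivative_eq_intros)
  then have "GDERIV (\<lambda>x. sin (x \<bullet> \<xi>)) x :> cos (x \<bullet> \<xi>) *\<^sub>R \<xi>"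
    by (rule GDERIV_DERIV_compose) (rule DERIV_sin)
  from GDERIV_mult[OF _ this, of \<phi> "D\<phi> x"] show "GDERIV (\<lambda>x. \<phi> x * sin (x \<bullet> \<xi>)) x :>
      sin (x \<bullet> \<xi>) *\<^sub>R D\<phi> x + (\<phi> x * cos (x \<bullet> \<xi>)) *\<^sub>R \<xi>"
    using tt by (simp add: algebra_simps)
next
  show "continuous_on UNIV (\<lambda>x. sin (x \<bullet> \<xi>) *\<^sub>R D\<phi> x + (\<phi> x * cos (x \<bullet> \<xi>)) *\<^sub>R \<xi>)"
    using test_function_bounds[OF t] by (auto intro!: continuous_intros)
  show "bounded {x. \<phi> x * sin (x \<bullet> \<xi>) \<noteq> 0}"
    using t unfolding test_function_def by (auto elim!: bounded_subset)
qed

lemma fourier_integral_of_real: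
  assumes p: "integrable lborel p"
  shows "fourier_integral (\<lambda>x. complex_of_real (p x)) \<xi>
    = complex_of_real (LINT x|lborel. p x * cos (x \<bullet> \<xi>)) - \<i> * complex_of_real (LINT x|lborel. p x
        * sin (x \<bullet> \<xi>))"
    and "integrable lborel (\<lambda>x. p x * cos (x \<bullet> \<xi>))" "integrable lborel (\<lambda>x. p x * sin (x \<bullet> \<xi>))"
proof -
  have [measurable]: "p \<in> borel_measurable borel" using p by (auto simp: integrable_iff_bounded)
  have *: "integrable lborel (\<lambda>x. p x * g x)" if [measurable]: "g \<in> borel_measurable borel"
      and "\<And>x. \<bar>g x\<bar> \<le> 1" for g :: "_ \<Rightarrow> real"
  proof (rule Bochner_Integration.integrable_bound[OF p])
    show "AE x in lborel. norm (p x * g x) \<le> norm (p x)"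
      by (rule AE_I2) (auto simp: abs_mult intro: mult_left_le that(2))
  qed measurable
  show c: "integrable lborel (\<lambda>x. p x * cos (x \<bullet> \<xi>))"
      and s: "integrable lborel (\<lambda>x. p x * sin (x \<bullet> \<xi>))"
    by (intro *; simp)+
  have "fourier_integral (\<lambda>x. complex_of_real (p x)) \<xi>
     = (LINT x|lborel. complex_of_real (p x * cos (x \<bullet> \<xi>)) - \<i> * complex_of_real (p x * sin (x
         \<bullet> \<xi>)))"
    unfolding fourier_integral_def by (rule Bochner_Integration.integral_cong)
        (auto simp: complex_eq_iff)
  also have "\<dots> = complex_of_real (LINT x|lborel. p x * cos (x \<bullet> \<xi>)) - \<i>
      * complex_of_real (LINT x|lborel. p x * sin (x \<bullet> \<xi>))"
    using c s by (subst Bochner_Integration.integral_diff)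
      (simp_all only: integral_mult_right_zero integral_complex_of_real
          complex_of_real_integrable_eq integrable_mult_right)
  finally show "fourier_integral (\<lambda>x. complex_of_real (p x)) \<xi>
    = complex_of_real (LINT x|lborel. p x * cos (x \<bullet> \<xi>)) - \<i> * complex_of_real (LINT x|lborel. p x
        * sin (x \<bullet> \<xi>))" .
qed

text \<open>
  The symbol of the derivative in direction \<open>b\<close> followed by a smoothing operator of order one.
  Only this bounded combination occurs as a multiplier.
\<close>

definition riesz_symbol :: "'a::euclidean_space \<Rightarrow> 'a \<Rightarrow> complex" where
  "riesz_symbol b \<xi> = \<i> * complex_of_real (\<xi> \<bullet> b) * weight (- 1) \<xi>"

lemma norm_riesz_symbol_le:
  assumes "b \<in> Basis" shows "norm (riesz_symbol b \<xi>) \<le> 1"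
proof -
  have "\<bar>\<xi> \<bullet> b\<bar> \<le> sqrt (1 + (norm \<xi>)\<^sup>2)"
    using Basis_le_norm[OF assms, of \<xi>] by (intro real_le_rsqrt order_trans[OF power_mono[of "\<bar>\<xi>
        \<bullet> b\<bar>" "norm \<xi>" 2]]) auto
  moreover have "norm (weight (- 1) \<xi>) = 1 / sqrt (1 + (norm \<xi>)\<^sup>2)"
    unfolding norm_weight using weight_base[of \<xi>] by (simp add: powr_minus_divide powr_half_sqrt)
  moreover have "sqrt (1 + (norm \<xi>)\<^sup>2) > 0" by (intro real_sqrt_gt_zero add_pos_nonneg) auto
  ultimately show ?thesis by (simp add: riesz_symbol_def norm_mult divide_le_eq_1)
qed

lemma riesz_symbol_measurable [measurable]: "riesz_symbol b \<in> borel_measurable borel"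
  unfolding riesz_symbol_def[abs_def] by measurable

lemma bounded_symbol_riesz_symbol: "b \<in> Basis \<Longrightarrow> bounded_symbol (riesz_symbol b)"
  by (rule bounded_symbolI[of _ 1]) (auto intro: norm_riesz_symbol_le)

lemma cnj_riesz_symbol_reflect [simp]: "cnj (riesz_symbol b (- \<xi>)) = riesz_symbol b \<xi>"
  by (simp add: riesz_symbol_def weight_def)

text \<open>
  The bounded form of the Laplacian: \<open>- (norm \<xi>)\<^sup>2 = 1 - (1 + (norm \<xi>)\<^sup>2)\<close>, multiplied by
  \<open>weight (- 2)\<close>.
\<close>

lemma sum_riesz_symbol_sq: "(\<Sum>b\<in>Basis. riesz_symbol b \<xi> * riesz_symbol b \<xi>) = weight (- 2) \<xi> - 1"
proof -
  have "(\<Sum>b\<in>Basis. riesz_symbol b \<xi> * riesz_symbol b \<xi>)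
      = - complex_of_real (\<Sum>b\<in>Basis. (\<xi> \<bullet> b)\<^sup>2) * weight (- 2) \<xi>"
  proof -
    have "riesz_symbol b \<xi> * riesz_symbol b \<xi> = - complex_of_real ((\<xi> \<bullet> b)\<^sup>2) * (weight (- 1) \<xi>
        * weight (- 1) \<xi>)" for b
    proof -
      have "riesz_symbol b \<xi> * riesz_symbol b \<xi>
          = (\<i> * \<i>) * (complex_of_real (\<xi> \<bullet> b) * complex_of_real (\<xi> \<bullet> b)) * (weight (- 1) \<xi>
          * weight (- 1) \<xi>)"
        unfolding riesz_symbol_def by (simp only: mult_ac)
      then show ?thesis by (simp add: power2_eq_square)
    qed
    then show ?thesis by (simp add: weight_add sum_distrib_right sum_negf)
  qed
  also have "(\<Sum>b\<in>Basis. (\<xi> \<bullet> b)\<^sup>2) = (norm \<xi>)\<^sup>2"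
    unfolding power2_norm_eq_inner euclidean_inner[of \<xi> \<xi>] by (simp add: power2_eq_square)
  also have "- complex_of_real ((norm \<xi>)\<^sup>2) * weight (- 2) \<xi>
      = weight (- 2) \<xi> - weight 2 \<xi> * weight (- 2) \<xi>"
  proof -
    have "weight 2 \<xi> = 1 + complex_of_real ((norm \<xi>)\<^sup>2)" unfolding weight_def using weight_base[of \<xi>]
        by (simp add: powr_one)
    then show ?thesis by (simp add: algebra_simps)
  qed
  also have "weight 2 \<xi> * weight (- 2) \<xi> = 1" by (simp add: weight_add)
  finally show ?thesis .
qed

text \<open>
  Testing against \<open>\<phi>\<close> times a plane wave turns the weak identity into an identity between Fourier
  integrals, valid at every frequency.
\<close>

lemma weak_divergence_localised:
  fixes G :: "'a::euclidean_space \<Rightarrow> 'a"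
  assumes wd: "has_weak_divergence G h" and t: "test_function \<phi> D\<phi>"
  shows "multiplier (weight (- 1)) (fourier_l2 (real_l2 (\<lambda>x. \<phi> x * h x)))
    = (\<Sum>b\<in>Basis. multiplier (riesz_symbol b) (fourier_l2 (real_l2 (\<lambda>x. \<phi> x * (G x \<bullet> b)))))
      - multiplier (weight (- 1)) (fourier_l2 (real_l2 (\<lambda>x. G x \<bullet> D\<phi> x)))"
proof -
  have sG: "square_integrable G" and sh: "square_integrable h"
    and w: "\<And>\<phi> D\<phi>. test_function \<phi> D\<phi> \<Longrightarrow> (LINT x|lborel. G x \<bullet> D\<phi> x) = - (LINT x|lborel. \<phi> x * h x)"
    using wd by (auto simp: has_weak_divergence_def)
  obtain R M where R: "R > 0" and M0: "M \<ge> 0" and z: "\<And>x. norm x > R \<Longrightarrow> \<phi> x = 0 \<and> D\<phi> x = 0"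
    and M: "\<And>x. \<bar>\<phi> x\<bar> \<le> M" "\<And>x. norm (D\<phi> x) \<le> M"
        and c: "continuous_on UNIV \<phi>" "continuous_on UNIV D\<phi>"
    using test_function_bounds[OF t] by metis
  have [measurable]: "\<phi> \<in> borel_measurable borel" "D\<phi> \<in> borel_measurable borel"
    "G \<in> borel_measurable borel" "h \<in> borel_measurable borel"
    using c sG sh by (auto intro: borel_measurable_continuous_onI square_integrable_measurable)
  define p1 where "p1 x = G x \<bullet> D\<phi> x" for x
  define p3 where "p3 x = \<phi> x * h x" for x
  define q where "q b x = \<phi> x * (G x \<bullet> b)" for b x
  have p1: "square_integrable p1" "integrable lborel p1"
  proof -
    have b: "norm (p1 x) \<le> M * norm (G x)" for x
      unfolding p1_def using Cauchy_Schwarz_ineq2[of "G x" "D\<phi> x"] mult_left_mono[OF M(2)[of x],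
          of "norm (G x)"]
      by (simp add: mult.commute)
    have m: "p1 \<in> borel_measurable borel" unfolding p1_def by measurable
    have "p1 x = 0" if "norm x > R" for x using z[OF that] by (simp add: p1_def)
    then show "square_integrable p1" "integrable lborel p1"
      using test_function_mult_square_integrable[OF sG m b, of R] by blast+
  qed
  have p3: "square_integrable p3" "integrable lborel p3"
  proof -
    have b: "norm (p3 x) \<le> M * norm (h x)" for x
      unfolding p3_def using M(1)[of x] by (simp add: abs_mult mult_right_mono)
    have m: "p3 \<in> borel_measurable borel" unfolding p3_def by measurable
    have "p3 x = 0" if "norm x > R" for x using z[OF that] by (simp add: p3_def)
    then show "square_integrable p3" "integrable lborel p3"
      using test_function_mult_square_integrable[OF sh m b, of R] by blast+
  qed
  have q: "square_integrable (q b)" "integrable lborel (q b)" for b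
  proof -
    have b: "norm (q b x) \<le> (M * norm b) * norm (G x)" for x
      unfolding q_def abs_mult real_norm_def using M(1)[of x] M0 Cauchy_Schwarz_ineq2[of "G x" b]
      by (subst mult.assoc) (intro mult_mono, auto simp: mult.commute)
    have m: "q b \<in> borel_measurable borel" unfolding q_def by measurable
    have "q b x = 0" if "norm x > R" for x using z[OF that] by (simp add: q_def)
    then show "square_integrable (q b)" "integrable lborel (q b)"
      using test_function_mult_square_integrable[OF sG m b, of R] by blast+
  qed
  have id: "fourier_integral (\<lambda>x. complex_of_real (p3 x)) \<xi>
     = (\<Sum>b\<in>Basis. \<i> * complex_of_real (\<xi> \<bullet> b) * fourier_integral (\<lambda>x. complex_of_real (q b x)) \<xi>)
         - fourier_integral (\<lambda>x. complex_of_real (p1 x)) \<xi>" for \<xi>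
  proof -
    have qq: "q \<xi> x = (\<Sum>b\<in>Basis. (\<xi> \<bullet> b) * q b x)" for x
      unfolding q_def using euclidean_inner[of "G x" \<xi>] by (simp add: sum_distrib_left mult_ac)
    have C: "(LINT x|lborel. p1 x * cos (x \<bullet> \<xi>)) - (LINT x|lborel. q \<xi> x * sin (x \<bullet> \<xi>))
        = - (LINT x|lborel. p3 x * cos (x \<bullet> \<xi>))"
    proof -
      have "(LINT x|lborel. G x \<bullet> (cos (x \<bullet> \<xi>) *\<^sub>R D\<phi> x - (\<phi> x * sin (x \<bullet> \<xi>)) *\<^sub>R \<xi>))
         = - (LINT x|lborel. \<phi> x * cos (x \<bullet> \<xi>) * h x)" by (rule w[OF test_function_cos[OF t]])
      moreover have "(LINT x|lborel. G x \<bullet> (cos (x \<bullet> \<xi>) *\<^sub>R D\<phi> x - (\<phi> x * sin (x \<bullet> \<xi>)) *\<^sub>R \<xi>))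
         = (LINT x|lborel. p1 x * cos (x \<bullet> \<xi>) - q \<xi> x * sin (x \<bullet> \<xi>))"
        by (rule Bochner_Integration.integral_cong)
            (auto simp: p1_def q_def inner_diff_right algebra_simps)
      ultimately show ?thesis
        using fourier_integral_of_real(2,3)[OF p1(2), of \<xi>] fourier_integral_of_real(2,3)[OF q(2),
            of \<xi> \<xi>] by (simp add: p3_def mult_ac)
    qed
    have S: "(LINT x|lborel. p1 x * sin (x \<bullet> \<xi>)) + (LINT x|lborel. q \<xi> x * cos (x \<bullet> \<xi>))
        = - (LINT x|lborel. p3 x * sin (x \<bullet> \<xi>))"
    proof -
      have "(LINT x|lborel. G x \<bullet> (sin (x \<bullet> \<xi>) *\<^sub>R D\<phi> x + (\<phi> x * cos (x \<bullet> \<xi>)) *\<^sub>R \<xi>))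
         = - (LINT x|lborel. \<phi> x * sin (x \<bullet> \<xi>) * h x)" by (rule w[OF test_function_sin[OF t]])
      moreover have "(LINT x|lborel. G x \<bullet> (sin (x \<bullet> \<xi>) *\<^sub>R D\<phi> x + (\<phi> x * cos (x \<bullet> \<xi>)) *\<^sub>R \<xi>))
         = (LINT x|lborel. p1 x * sin (x \<bullet> \<xi>) + q \<xi> x * cos (x \<bullet> \<xi>))"
        by (rule Bochner_Integration.integral_cong)
            (auto simp: p1_def q_def inner_add_right algebra_simps)
      ultimately show ?thesis
        using fourier_integral_of_real(2,3)[OF p1(2), of \<xi>] fourier_integral_of_real(2,3)[OF q(2),
            of \<xi> \<xi>] by (simp add: p3_def mult_ac)
    qed
    have "fourier_integral (\<lambda>x. complex_of_real (p1 x)) \<xi> - \<i>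
        * fourier_integral (\<lambda>x. complex_of_real (q \<xi> x)) \<xi>
        = complex_of_real ((LINT x|lborel. p1 x * cos (x \<bullet> \<xi>)) - (LINT x|lborel. q \<xi> x * sin (x
            \<bullet> \<xi>)))
         - \<i> * complex_of_real ((LINT x|lborel. p1 x * sin (x \<bullet> \<xi>)) + (LINT x|lborel. q \<xi> x * cos (x
             \<bullet> \<xi>)))"
      unfolding fourier_integral_of_real(1)[OF p1(2)] fourier_integral_of_real(1)[OF q(2)]
          of_real_add of_real_diff by (simp add: algebra_simps)
    also have "\<dots> = - fourier_integral (\<lambda>x. complex_of_real (p3 x)) \<xi>"
      unfolding C S fourier_integral_of_real(1)[OF p3(2)] by simp
    finally have "fourier_integral (\<lambda>x. complex_of_real (p3 x)) \<xi>
        = \<i> * fourier_integral (\<lambda>x. complex_of_real (q \<xi> x)) \<xi>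
        - fourier_integral (\<lambda>x. complex_of_real (p1 x)) \<xi>"
      by (simp add: algebra_simps)
    moreover have "fourier_integral (\<lambda>x. complex_of_real (q \<xi> x)) \<xi>
        = (\<Sum>b\<in>Basis. complex_of_real (\<xi> \<bullet> b) * fourier_integral (\<lambda>x. complex_of_real (q b x)) \<xi>)"
      unfolding qq of_real_sum of_real_mult
      by (subst fourier_integral_sum, simp add: complex_of_real_integrable_eq q, subst
          fourier_integral_cmult) (simp_all add: complex_of_real_integrable_eq q)
    ultimately show ?thesis by (simp add: sum_distrib_left mult.assoc)
  qed
  have b1: "bounded_symbol (weight (- 1) :: 'a \<Rightarrow> complex)" by (rule bounded_symbol_weight) simp
  have F: "fourier_l2 (real_l2 p) = to_l2 (fourier_integral (\<lambda>x. complex_of_real (p x)))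
      \<and> square_integrable (fourier_integral (\<lambda>x. complex_of_real (p x)))"
    if "square_integrable p" "integrable lborel p" for p
    unfolding real_l2_def using that by (auto simp: fourier_l2_to_l2 complex_of_real_integrable_eq
        intro!: plancherel_L1_L2)
  have mF: "multiplier m (fourier_l2 (real_l2 p))
      = to_l2 (\<lambda>\<xi>. m \<xi> * fourier_integral (\<lambda>x. complex_of_real (p x)) \<xi>)
      \<and> square_integrable (\<lambda>\<xi>. m \<xi> * fourier_integral (\<lambda>x. complex_of_real (p x)) \<xi>)"
    if m: "bounded_symbol m" and p: "square_integrable p" "integrable lborel p" for m p
  proof -
    note sq = square_integrable_bounded_symbol[OF m conjunct2[OF F[OF p]]]
    show ?thesis using F[OF p] m by (auto simp: sq multiplier_to_l2 bounded_symbol_measurable)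
  qed
  have "to_l2 (\<lambda>\<xi>. weight (- 1) \<xi> * fourier_integral (\<lambda>x. complex_of_real (p3 x)) \<xi>)
     = to_l2 (\<lambda>\<xi>. (\<Sum>b\<in>Basis. riesz_symbol b \<xi> * fourier_integral (\<lambda>x. complex_of_real (q b x)) \<xi>)
         - weight (- 1) \<xi> * fourier_integral (\<lambda>x. complex_of_real (p1 x)) \<xi>)"
    unfolding id by (simp add: riesz_symbol_def right_diff_distrib sum_distrib_left mult_ac)
  also have "\<dots> = (\<Sum>b\<in>Basis. to_l2 (\<lambda>\<xi>. riesz_symbol b \<xi> * fourier_integral (\<lambda>x. complex_of_real (q b
      x)) \<xi>)) - to_l2 (\<lambda>\<xi>. weight (- 1) \<xi> * fourier_integral (\<lambda>x. complex_of_real (p1 x)) \<xi>)"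
    by (subst to_l2_diff) (auto simp: to_l2_sum mF bounded_symbol_riesz_symbol q b1 p1
        intro!: square_integrable_sum)
  finally show ?thesis
    unfolding p1_def[symmetric] p3_def[symmetric] q_def[symmetric]
    by (simp add: mF bounded_symbol_riesz_symbol q b1 p1 p3)
qed

lemma DERIV_positive_part_sq: "((\<lambda>t::real. (max 0 t)\<^sup>2) has_real_derivative 2 * max 0 t) (at t)"
proof (cases "t = 0")
  case True
  have "(\<lambda>h::real. (max 0 h)\<^sup>2 / h) \<midarrow>0\<rightarrow> 0"
  proof (rule Lim_null_comparison)
    show "\<forall>\<^sub>F h in at 0. norm ((max 0 h)\<^sup>2 / h) \<le> \<bar>h\<bar>" for h :: real
      by (rule always_eventually) (auto simp: max_def power2_eq_square)
    show "(\<lambda>h::real. \<bar>h\<bar>) \<midarrow>0\<rightarrow> 0" by (rule tendsto_eq_intros refl)+ simp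
  qed
  then show ?thesis using True by (simp add: DERIV_def)
next
  case False
  show ?thesis
  proof (cases "t > 0")
    case True
    have "((\<lambda>t::real. t\<^sup>2) has_real_derivative 2 * max 0 t) (at t)"
      by (rule derivative_eq_intros refl)+ (use True in simp)
    then show ?thesis
      by (rule has_field_derivative_transform_within_open[of _ _ _ "{0<..}"]) (use True in auto)
  next
    case neg: False
    have "((\<lambda>t::real. 0) has_real_derivative 2 * max 0 t) (at t)" using neg by simp
    then show ?thesis
      by (rule has_field_derivative_transform_within_open[of _ _ _ "{..<0}"])
          (use neg False in auto)
  qed
qed

text \<open>Squaring the positive part makes the cutoff continuously differentiable.\<close>

definition cutoff :: "real \<Rightarrow> 'a::euclidean_space \<Rightarrow> real" where
  "cutoff R x = (max 0 (1 - (norm x)\<^sup>2 / R\<^sup>2))\<^sup>2"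

definition cutoff_grad :: "real \<Rightarrow> 'a::euclidean_space \<Rightarrow> 'a" where
  "cutoff_grad R x = (2 * max 0 (1 - (norm x)\<^sup>2 / R\<^sup>2) * (- 2 / R\<^sup>2)) *\<^sub>R x"

lemma test_function_cutoff:
  assumes "R > 0" shows "test_function (cutoff R) (cutoff_grad R :: 'a::euclidean_space \<Rightarrow> 'a)"
  unfolding test_function_def
proof (intro conjI allI)
  fix x :: 'a
  have "GDERIV (\<lambda>x. 1 - (norm x)\<^sup>2 / R\<^sup>2) x :> (- 2 / R\<^sup>2) *\<^sub>R x"
  proof -
    have "((\<lambda>x. 1 - (x \<bullet> x) / R\<^sup>2) has_derivative (\<lambda>h. 0 - (x \<bullet> h + h \<bullet> x) / R\<^sup>2)) (at x)"
      by (intro has_derivative_diff has_derivative_const bounded_linear.has_derivative[OF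
          bounded_linear_divide]
        has_derivative_inner has_derivative_ident)
    moreover have "(\<lambda>h. 0 - (x \<bullet> h + h \<bullet> x) / R\<^sup>2) = (\<lambda>h. h \<bullet> ((- 2 / R\<^sup>2) *\<^sub>R x))"
      by (simp add: fun_eq_iff inner_commute[of x])
    ultimately show ?thesis unfolding gderiv_def power2_norm_eq_inner by simp
  qed
  from GDERIV_DERIV_compose[OF this DERIV_positive_part_sq]
  show "GDERIV (cutoff R) x :> cutoff_grad R x"
    unfolding cutoff_def[abs_def] cutoff_grad_def by simp
next
  show "continuous_on UNIV (cutoff_grad R :: 'a \<Rightarrow> 'a)"
    unfolding cutoff_grad_def[abs_def] using assms by (intro continuous_intros) auto
  have "norm x \<le> R" if "cutoff R x \<noteq> 0" for x :: 'a
  proof (rule ccontr)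
    assume "\<not> norm x \<le> R"
    then have "R\<^sup>2 \<le> (norm x)\<^sup>2" using assms by (intro power_mono) auto
    then show False using that assms by (auto simp: cutoff_def max_def field_simps split: if_splits)
  qed
  then show "bounded {x::'a. cutoff R x \<noteq> 0}" by (auto simp: bounded_iff)
qed

lemma cutoff_bounds:
  assumes "R > 0"
  shows "\<bar>cutoff R x\<bar> \<le> 1" "norm (cutoff_grad R x) \<le> 4 / R"
proof -
  have m: "0 \<le> max 0 (1 - (norm x)\<^sup>2 / R\<^sup>2)" "max 0 (1 - (norm x)\<^sup>2 / R\<^sup>2) \<le> 1"
    using assms by auto
  then show "\<bar>cutoff R x\<bar> \<le> 1" unfolding cutoff_def by (simp add: power_le_one)
  show "norm (cutoff_grad R x) \<le> 4 / R"
  proof (cases "norm x \<le> R")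
    case True
    have "norm (cutoff_grad R x) = max 0 (1 - (norm x)\<^sup>2 / R\<^sup>2) * (4 / R\<^sup>2 * norm x)"
      unfolding cutoff_grad_def using m by (simp add: abs_mult)
    also have "\<dots> \<le> 1 * (4 / R\<^sup>2 * R)"
      by (intro mult_mono m) (use True assms in auto)
    finally show ?thesis using assms by (simp add: power2_eq_square)
  next
    case False
    then have "R\<^sup>2 \<le> (norm x)\<^sup>2" using assms by (intro power_mono) auto
    then have "max 0 (1 - (norm x)\<^sup>2 / R\<^sup>2) = 0" using assms by (simp add: field_simps)
    then show ?thesis using assms by (simp add: cutoff_grad_def)
  qed
qed

lemma cutoff_mult_tendsto:
  assumes f: "square_integrable f"
  shows "(\<lambda>k. real_l2 (\<lambda>x. cutoff (real (Suc k)) x * f x)) \<longlonglongrightarrow> real_l2 f"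
proof -
  have sq: "square_integrable (\<lambda>x. complex_of_real (f x))" using f by simp
  have [measurable]: "f \<in> borel_measurable borel" using f by (rule square_integrable_measurable)
  have "(\<lambda>k. to_l2 (\<lambda>x. complex_of_real (cutoff (real (Suc k)) x * f x)))
      \<longlonglongrightarrow> to_l2 (\<lambda>x. complex_of_real (f x))
     \<and> square_integrable (\<lambda>x. complex_of_real (f x))"
  proof (rule to_l2_dominated_convergence[OF sq])
    show "(\<lambda>x. complex_of_real (cutoff (real (Suc k)) x * f x)) \<in> borel_measurable borel" for k
      unfolding cutoff_def by measurable
    show "norm (complex_of_real (cutoff (real (Suc k)) x * f x)) \<le> norm (complex_of_real (f x))"
        for k x
      using cutoff_bounds(1)[of "real (Suc k)" x] unfolding norm_of_real abs_mult
          by (intro mult_left_le_one_le) auto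
    have "cutoff (real (Suc k)) x = (max 0 (1 - (norm x * inverse (real (Suc k)))\<^sup>2))\<^sup>2" for x :: 'a
        and k
      unfolding cutoff_def by (simp add: power_mult_distrib divide_inverse power_inverse)
    moreover have "(\<lambda>k. (max 0 (1 - (norm x * inverse (real (Suc k)))\<^sup>2))\<^sup>2)
        \<longlonglongrightarrow> (max 0 (1 - (norm x * 0)\<^sup>2))\<^sup>2" for x :: 'a
      by (intro tendsto_intros LIMSEQ_inverse_real_of_nat)
    ultimately have "(\<lambda>k. cutoff (real (Suc k)) x) \<longlonglongrightarrow> 1" for x :: 'a by simp
    then have "(\<lambda>k. complex_of_real (cutoff (real (Suc k)) x * f x)) \<longlonglongrightarrow> complex_of_real (1 * f x)"
        for x
      by (intro tendsto_intros)
    then show "AE x in lborel. (\<lambda>k. complex_of_real (cutoff (real (Suc k)) x * f x))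
        \<longlonglongrightarrow> complex_of_real (f x)"
      by simp
  qed measurable
  then show ?thesis by (simp add: real_l2_def)
qed

lemma cutoff_grad_tendsto:
  fixes G :: "'a::euclidean_space \<Rightarrow> 'a"
  assumes G: "square_integrable G"
  shows "(\<lambda>k. real_l2 (\<lambda>x. G x \<bullet> cutoff_grad (real (Suc k)) x)) \<longlonglongrightarrow> 0"
proof (rule Lim_null_comparison)
  have [measurable]: "G \<in> borel_measurable borel" using G by (rule square_integrable_measurable)
  define n where "n x = complex_of_real (norm (G x))" for x
  have n: "square_integrable n" unfolding n_def square_integrable_of_real
    by (rule square_integrable_dominated[OF G, of _ 1]) auto
  show "\<forall>\<^sub>F k in sequentially. norm (real_l2 (\<lambda>x. G x \<bullet> cutoff_grad (real (Suc k)) x))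
      \<le> 4 / real (Suc k) * norm (to_l2 n)"
  proof (rule always_eventually, rule allI)
    fix k
    have pt: "norm (complex_of_real (G x \<bullet> cutoff_grad (real (Suc k)) x))
        \<le> 4 / real (Suc k) * norm (n x)" for x
      using Cauchy_Schwarz_ineq2[of "G x" "cutoff_grad (real (Suc k)) x"]
        mult_left_mono[OF cutoff_bounds(2)[of "real (Suc k)" x], of "norm (G x)"]
      by (simp add: n_def mult.commute)
    have "(\<lambda>x. complex_of_real (G x \<bullet> cutoff_grad (real (Suc k)) x)) \<in> borel_measurable borel"
      unfolding cutoff_grad_def by measurable
    from square_integrable_dominated[OF n this pt]
    show "norm (real_l2 (\<lambda>x. G x \<bullet> cutoff_grad (real (Suc k)) x))
        \<le> 4 / real (Suc k) * norm (to_l2 n)"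
      unfolding real_l2_def by (rule norm_to_l2_mono[OF _ n pt]) simp
  qed
  have "(\<lambda>k. 4 * inverse (real (Suc k)) * norm (to_l2 n)) \<longlonglongrightarrow> 4 * 0 * norm (to_l2 n)"
    by (intro tendsto_intros LIMSEQ_inverse_real_of_nat)
  then show "(\<lambda>k. 4 / real (Suc k) * norm (to_l2 n)) \<longlonglongrightarrow> 0" by (simp add: divide_inverse)
qed

text \<open>
  Along growing cutoffs the error term contains the gradient of the cutoff, which is of order
  \<open>1 / R\<close>.
\<close>

lemma weak_divergence_fourier_l2:
  fixes G :: "'a::euclidean_space \<Rightarrow> 'a"
  assumes wd: "has_weak_divergence G h"
  shows "multiplier (weight (- 1)) (fourier_l2 (real_l2 h))
      = (\<Sum>b\<in>Basis. multiplier (riesz_symbol b) (fourier_l2 (real_l2 (\<lambda>x. G x \<bullet> b))))"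
proof -
  have sG: "square_integrable G" and sh: "square_integrable h" using wd by
      (auto simp: has_weak_divergence_def)
  have sGb: "square_integrable (\<lambda>x. G x \<bullet> b)" if "b \<in> Basis" for b
    by (rule square_integrable_dominated[OF sG, of _ 1])
      (use square_integrable_measurable[OF sG] Basis_le_norm[OF that] in auto)
  have b1: "bounded_symbol (weight (- 1) :: 'a \<Rightarrow> complex)" by (rule bounded_symbol_weight) simp
  note lim = bounded_linear.tendsto[OF bounded_linear_multiplier] bounded_linear.tendsto[OF
      bounded_linear_fourier_l2]
  have "(\<lambda>k. multiplier (weight (- 1)) (fourier_l2 (real_l2 (\<lambda>x. cutoff (real (Suc k)) x * h x))))
      \<longlonglongrightarrow> multiplier (weight (- 1)) (fourier_l2 (real_l2 h))"
    by (intro lim cutoff_mult_tendsto sh b1)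
  moreover have "(\<lambda>k. (\<Sum>b\<in>Basis. multiplier (riesz_symbol b) (fourier_l2 (real_l2 (\<lambda>x. cutoff (real
      (Suc k)) x * (G x \<bullet> b)))))
      - multiplier (weight (- 1)) (fourier_l2 (real_l2 (\<lambda>x. G x \<bullet> cutoff_grad (real (Suc k)) x))))
     \<longlonglongrightarrow> (\<Sum>b\<in>Basis. multiplier (riesz_symbol b) (fourier_l2 (real_l2 (\<lambda>x. G x \<bullet> b))))
         - multiplier (weight (- 1)) (fourier_l2 0)"
    by (intro tendsto_diff tendsto_sum lim cutoff_mult_tendsto cutoff_grad_tendsto sG sGb b1
        bounded_symbol_riesz_symbol)
  moreover have "multiplier (weight (- 1)) (fourier_l2 (real_l2 (\<lambda>x. cutoff (real (Suc k)) x
      * h x)))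
     = (\<Sum>b\<in>Basis. multiplier (riesz_symbol b) (fourier_l2 (real_l2 (\<lambda>x. cutoff (real (Suc k)) x
         * (G x \<bullet> b)))))
      - multiplier (weight (- 1)) (fourier_l2 (real_l2 (\<lambda>x. G x \<bullet> cutoff_grad (real (Suc k)) x)))"
          for k
    by (rule weak_divergence_localised[OF wd test_function_cutoff]) simp
  ultimately have "multiplier (weight (- 1)) (fourier_l2 (real_l2 h))
     = (\<Sum>b\<in>Basis. multiplier (riesz_symbol b) (fourier_l2 (real_l2 (\<lambda>x. G x \<bullet> b))))
         - multiplier (weight (- 1)) (fourier_l2 0)"
    using LIMSEQ_unique by fastforce
  then show ?thesis
    by (simp add: linear_0[OF bounded_linear.linear[OF bounded_linear_fourier_l2]] linear_0[OF
        bounded_linear.linear[OF bounded_linear_multiplier[OF b1]]])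
qed

text \<open>
  Integration by parts without iterated integrals: difference quotients integrate to zero by
  translation invariance and are dominated by the mean value theorem.
\<close>

lemma integral_test_function_gradient:
  fixes \<phi> :: "'a::euclidean_space \<Rightarrow> real"
  assumes t: "test_function \<phi> D\<phi>"
  shows "(LINT x|lborel. D\<phi> x \<bullet> v) = 0"
proof -
  have g: "GDERIV \<phi> x :> D\<phi> x" for x using t by (auto simp: test_function_def)
  obtain R M where R: "R > 0" and M0: "M \<ge> 0" and z: "\<And>x. norm x > R \<Longrightarrow> \<phi> x = 0 \<and> D\<phi> x = 0"
    and M: "\<And>x. \<bar>\<phi> x\<bar> \<le> M" "\<And>x. norm (D\<phi> x) \<le> M"
        and c: "continuous_on UNIV \<phi>" "continuous_on UNIV D\<phi>"
    using test_function_bounds[OF t] by metis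
  have [measurable]: "\<phi> \<in> borel_measurable borel" "D\<phi> \<in> borel_measurable borel"
    using c by (auto intro: borel_measurable_continuous_onI)
  have line: "((\<lambda>r. \<phi> (x + r *\<^sub>R v)) has_real_derivative D\<phi> (x + r *\<^sub>R v) \<bullet> v) (at r)" for x r
  proof -
    have "((\<lambda>r. x + r *\<^sub>R v) has_derivative (\<lambda>h. h *\<^sub>R v)) (at r)" by
        (auto intro!: derivative_eq_intros)
    from diff_chain_at[OF this g[of "x + r *\<^sub>R v", unfolded gderiv_def]]
    show ?thesis unfolding has_field_derivative_def o_def
      by (simp add: inner_commute mult_commute_abs)
  qed
  define \<tau> where "\<tau> k = inverse (real (Suc k))" for k
  have \<tau>: "\<tau> k > 0" "\<tau> k \<le> 1" for k by (auto simp: \<tau>_def field_simps)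
  define u where "u k x = (\<phi> (x + \<tau> k *\<^sub>R v) - \<phi> x) / \<tau> k" for k x
  define S where "S = R + norm v"
  have u_out: "u k x = 0" if "norm x > S" for k x
  proof -
    have "norm (\<tau> k *\<^sub>R v) \<le> norm v" using \<tau>[of k] by (simp add: mult_left_le_one_le)
    moreover have "norm x \<le> norm (x + \<tau> k *\<^sub>R v) + norm (\<tau> k *\<^sub>R v)"
        using norm_triangle_ineq4[of "x + \<tau> k *\<^sub>R v" "\<tau> k *\<^sub>R v"] by simp
    ultimately have "norm (x + \<tau> k *\<^sub>R v) > R" "norm x > R"
      using that norm_ge_zero[of v] unfolding S_def by linarith+
    then show ?thesis using z by (simp add: u_def)
  qed
  have u_bd: "\<bar>u k x\<bar> \<le> M * norm v" for k x
  proof -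
    obtain r where r: "\<phi> (x + \<tau> k *\<^sub>R v) - \<phi> (x + 0 *\<^sub>R v) = (\<tau> k - 0) * (D\<phi> (x + r *\<^sub>R v) \<bullet> v)"
      using MVT2[of 0 "\<tau> k" "\<lambda>r. \<phi> (x + r *\<^sub>R v)" "\<lambda>r. D\<phi> (x + r *\<^sub>R v) \<bullet> v"] line \<tau>(1)[of k] by auto
    then have "u k x = D\<phi> (x + r *\<^sub>R v) \<bullet> v" using \<tau>(1)[of k] by (simp add: u_def)
    then show ?thesis
      using Cauchy_Schwarz_ineq2[of "D\<phi> (x + r *\<^sub>R v)" v] mult_right_mono[OF M(2)[of "x + r *\<^sub>R v"],
          of "norm v"] by simp
  qed
  have lim: "(\<lambda>k. u k x) \<longlonglongrightarrow> D\<phi> x \<bullet> v" for x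
  proof -
    have "(\<lambda>h. (\<phi> (x + (0 + h) *\<^sub>R v) - \<phi> (x + 0 *\<^sub>R v)) / h) \<midarrow>0\<rightarrow> D\<phi> (x + 0 *\<^sub>R v) \<bullet> v"
      using line[of x 0] unfolding DERIV_def .
    moreover have "filterlim \<tau> (at 0) sequentially"
      unfolding filterlim_at
    proof
      show "\<forall>\<^sub>F k in sequentially. \<tau> k \<in> UNIV \<and> \<tau> k \<noteq> 0"
        using \<tau>(1) by (intro always_eventually) (metis UNIV_I less_irrefl)
      show "\<tau> \<longlonglongrightarrow> 0" unfolding \<tau>_def[abs_def] by (rule LIMSEQ_inverse_real_of_nat)
    qed
    ultimately have "(\<lambda>k. (\<phi> (x + (0 + \<tau> k) *\<^sub>R v) - \<phi> (x + 0 *\<^sub>R v)) / \<tau> k) \<longlonglongrightarrow> D\<phi> (x + 0 *\<^sub>R v) \<bullet> v"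
      by (rule filterlim_compose)
    then show ?thesis by (simp add: u_def)
  qed
  have int_ind: "integrable lborel (\<lambda>x::'a. M * norm v * indicator (cball 0 S) x)"
    using emeasure_lborel_cball_finite[of "0::'a" S] by (simp add: less_top[symmetric])
  have "(\<lambda>k. LINT x|lborel. u k x) \<longlonglongrightarrow> (LINT x|lborel. D\<phi> x \<bullet> v)"
  proof (rule integral_dominated_convergence[OF _ _ int_ind])
    show "AE x in lborel. norm (u k x) \<le> M * norm v * indicator (cball 0 S) x" for k
      using u_bd[of k] u_out[of _ k] by (auto simp: indicator_def not_le)
  qed (use lim in \<open>auto simp: u_def\<close>)
  moreover have "(LINT x|lborel. u k x) = 0" for k
  proof -
    have i: "integrable lborel \<phi>"
    proof (rule Bochner_Integration.integrable_bound)
      show "integrable lborel (\<lambda>x::'a. M * indicator (cball 0 R) x)"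
        using emeasure_lborel_cball_finite[of "0::'a" R] by (simp add: less_top[symmetric])
      show "AE x in lborel. norm (\<phi> x) \<le> norm (M * indicator (cball 0 R) x :: real)"
        using M(1) z M0 by (auto simp: indicator_def not_le)
    qed measurable
    have "(LINT x|lborel. u k x) = ((LINT x|lborel. \<phi> (\<tau> k *\<^sub>R v + x)) - (LINT x|lborel. \<phi> x)) / \<tau> k"
      unfolding u_def using i lborel_integrable_shift[OF i, of "\<tau> k *\<^sub>R v"] by
          (simp add: add.commute)
    also have "(LINT x|lborel. \<phi> (\<tau> k *\<^sub>R v + x)) = (LINT x|lborel. \<phi> x)" by
        (rule lborel_integral_shift) measurable
    finally show ?thesis by simp
  qed
  ultimately show ?thesis using LIMSEQ_unique[of "\<lambda>k. 0" _ 0] by auto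
qed

lemma test_function_square_integrable:
  fixes \<phi> :: "'a::euclidean_space \<Rightarrow> real"
  assumes t: "test_function \<phi> D\<phi>"
  shows "square_integrable \<phi>" "integrable lborel \<phi>"
    "square_integrable (\<lambda>x. D\<phi> x \<bullet> v)" "integrable lborel (\<lambda>x. D\<phi> x \<bullet> v)"
proof -
  obtain R M where R: "R > 0" and M0: "M \<ge> 0" and z: "\<And>x. norm x > R \<Longrightarrow> \<phi> x = 0 \<and> D\<phi> x = 0"
    and M: "\<And>x. \<bar>\<phi> x\<bar> \<le> M" "\<And>x. norm (D\<phi> x) \<le> M"
        and c: "continuous_on UNIV \<phi>" "continuous_on UNIV D\<phi>"
    using test_function_bounds[OF t] by metis
  have [measurable]: "\<phi> \<in> borel_measurable borel" "D\<phi> \<in> borel_measurable borel"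
    using c by (auto intro: borel_measurable_continuous_onI)
  define I where "I = (indicator (cball 0 R) :: 'a \<Rightarrow> complex)"
  have I: "square_integrable I" unfolding I_def by (rule square_integrable_indicator_cball)
  have b1: "norm (\<phi> x) \<le> M * norm (I x)" for x
    using M(1)[of x] z[of x] by (cases "norm x \<le> R") (auto simp: I_def)
  have b2: "norm (D\<phi> x \<bullet> v) \<le> (M * norm v) * norm (I x)" for x
    using order_trans[OF Cauchy_Schwarz_ineq2[of "D\<phi> x" v] mult_right_mono[OF M(2)[of x],
        of "norm v"]] z[of x]
    by (cases "norm x \<le> R") (auto simp: I_def)
  have z1: "\<phi> x = 0" and z2: "D\<phi> x \<bullet> v = 0" if "norm x > R" for x using z[OF that] by auto
  have m2: "(\<lambda>x. D\<phi> x \<bullet> v) \<in> borel_measurable borel" by measurable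
  show "square_integrable \<phi>" "integrable lborel \<phi>"
    using test_function_mult_square_integrable[OF I \<open>\<phi> \<in> borel_measurable borel\<close> b1, of R] z1
        by blast+
  show "square_integrable (\<lambda>x. D\<phi> x \<bullet> v)" "integrable lborel (\<lambda>x. D\<phi> x \<bullet> v)"
    using test_function_mult_square_integrable[OF I m2 b2, of R] z2 by blast+
qed

text \<open>The modulated test functions have gradients of mean zero.\<close>

lemma fourier_integral_test_function_gradient:
  fixes \<phi> :: "'a::euclidean_space \<Rightarrow> real"
  assumes t: "test_function \<phi> D\<phi>"
  shows "fourier_integral (\<lambda>x. complex_of_real (D\<phi> x \<bullet> v)) \<xi>
      = \<i> * complex_of_real (\<xi> \<bullet> v) * fourier_integral (\<lambda>x. complex_of_real (\<phi> x)) \<xi>"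
proof -
  note i = test_function_square_integrable(2)[OF t] test_function_square_integrable(4)[OF t, of v]
  note f1 = fourier_integral_of_real[OF i(1), of \<xi>] and f2 = fourier_integral_of_real[OF i(2), of \<xi>]
  have C: "(LINT x|lborel. D\<phi> x \<bullet> v * cos (x \<bullet> \<xi>)) = (\<xi> \<bullet> v) * (LINT x|lborel. \<phi> x * sin (x \<bullet> \<xi>))"
  proof -
    have "(LINT x|lborel. (cos (x \<bullet> \<xi>) *\<^sub>R D\<phi> x - (\<phi> x * sin (x \<bullet> \<xi>)) *\<^sub>R \<xi>) \<bullet> v) = 0"
      by (rule integral_test_function_gradient[OF test_function_cos[OF t]])
    also have "(LINT x|lborel. (cos (x \<bullet> \<xi>) *\<^sub>R D\<phi> x - (\<phi> x * sin (x \<bullet> \<xi>)) *\<^sub>R \<xi>) \<bullet> v)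
       = (LINT x|lborel. D\<phi> x \<bullet> v * cos (x \<bullet> \<xi>) - (\<xi> \<bullet> v) * (\<phi> x * sin (x \<bullet> \<xi>)))"
      by (rule Bochner_Integration.integral_cong) (auto simp: inner_diff_left algebra_simps)
    finally show ?thesis using f1(3) f2(2) by simp
  qed
  have S: "(LINT x|lborel. D\<phi> x \<bullet> v * sin (x \<bullet> \<xi>)) = - (\<xi> \<bullet> v) * (LINT x|lborel. \<phi> x * cos (x \<bullet> \<xi>))"
  proof -
    have "(LINT x|lborel. (sin (x \<bullet> \<xi>) *\<^sub>R D\<phi> x + (\<phi> x * cos (x \<bullet> \<xi>)) *\<^sub>R \<xi>) \<bullet> v) = 0"
      by (rule integral_test_function_gradient[OF test_function_sin[OF t]])
    also have "(LINT x|lborel. (sin (x \<bullet> \<xi>) *\<^sub>R D\<phi> x + (\<phi> x * cos (x \<bullet> \<xi>)) *\<^sub>R \<xi>) \<bullet> v)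
       = (LINT x|lborel. D\<phi> x \<bullet> v * sin (x \<bullet> \<xi>) + (\<xi> \<bullet> v) * (\<phi> x * cos (x \<bullet> \<xi>)))"
      by (rule Bochner_Integration.integral_cong) (auto simp: inner_add_left algebra_simps)
    finally show ?thesis using f1(2) f2(3) by simp
  qed
  show ?thesis unfolding f1(1) f2(1) C S by (simp add: complex_eq_iff algebra_simps)
qed

lemma inner_real_l2:
  "square_integrable f \<Longrightarrow> square_integrable g \<Longrightarrow> real_l2 f \<bullet> real_l2 g = (LINT x|lborel. f x * g x)"
  unfolding real_l2_def by (subst inner_to_l2) (auto simp: inner_complex_def)

lemma square_integrable_component:
  fixes G :: "'a::euclidean_space \<Rightarrow> 'b::euclidean_space"
  assumes G: "square_integrable G" and b: "b \<in> Basis" shows "square_integrable (\<lambda>x. G x \<bullet> b)"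
  by (rule square_integrable_dominated[OF G, of _ 1])
    (use square_integrable_measurable[OF G] Basis_le_norm[OF b] in auto)

text \<open>
  By Plancherel's theorem the pairing with a test function can be computed on the Fourier side,
  where the derivative can be moved from one factor to the other pointwise.
\<close>

lemma weak_divergence_from_fourier_l2:
  fixes G :: "'a::euclidean_space \<Rightarrow> 'a"
  assumes G: "square_integrable G" and h: "square_integrable h"
    and eq: "multiplier (weight (- 1)) (fourier_l2 (real_l2 h))
        = (\<Sum>b\<in>Basis. multiplier (riesz_symbol b) (fourier_l2 (real_l2 (\<lambda>x. G x \<bullet> b))))"
  shows "has_weak_divergence G h"
  unfolding has_weak_divergence_def
proof (intro conjI allI impI G h)
  fix \<phi> D\<phi> assume t: "test_function \<phi> (D\<phi> :: 'a \<Rightarrow> 'a)"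
  note ts = test_function_square_integrable[OF t]
  define H where "H = rep_l2 (fourier_l2 (real_l2 h))"
  define g where "g b = rep_l2 (fourier_l2 (real_l2 (\<lambda>x. G x \<bullet> b)))" for b
  define p where "p = fourier_integral (\<lambda>x. complex_of_real (\<phi> x))"
  have Gb: "square_integrable (\<lambda>x. G x \<bullet> b)" if "b \<in> Basis" for b
    using square_integrable_component[OF G that] .
  have b1: "bounded_symbol (weight (- 1) :: 'a \<Rightarrow> complex)" by (rule bounded_symbol_weight) simp
  have F: "fourier_l2 (real_l2 q) = to_l2 (fourier_integral (\<lambda>x. complex_of_real (q x)))
      \<and> square_integrable (fourier_integral (\<lambda>x. complex_of_real (q x)))"
    if "square_integrable q" "integrable lborel q" for q
    unfolding real_l2_def using that by (auto simp: fourier_l2_to_l2 complex_of_real_integrable_eq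
        intro!: plancherel_L1_L2)
  have p: "fourier_l2 (real_l2 \<phi>) = to_l2 p" "square_integrable p" using F[OF ts(1,2)] by
      (auto simp: p_def)
  have dp: "fourier_l2 (real_l2 (\<lambda>x. D\<phi> x \<bullet> b)) = to_l2 (\<lambda>\<xi>. \<i> * complex_of_real (\<xi> \<bullet> b) * p \<xi>)"
    "square_integrable (\<lambda>\<xi>. \<i> * complex_of_real (\<xi> \<bullet> b) * p \<xi>)" for b
  proof -
    have e: "fourier_integral (\<lambda>x. complex_of_real (D\<phi> x \<bullet> b))
        = (\<lambda>\<xi>. \<i> * complex_of_real (\<xi> \<bullet> b) * p \<xi>)"
      by (simp add: fun_eq_iff p_def fourier_integral_test_function_gradient[OF t])
    show "fourier_l2 (real_l2 (\<lambda>x. D\<phi> x \<bullet> b)) = to_l2 (\<lambda>\<xi>. \<i> * complex_of_real (\<xi> \<bullet> b) * p \<xi>)"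
      "square_integrable (\<lambda>\<xi>. \<i> * complex_of_real (\<xi> \<bullet> b) * p \<xi>)"
      using F[OF ts(3,4), of b] unfolding e by auto
  qed
  have "to_l2 (\<lambda>\<xi>. weight (- 1) \<xi> * H \<xi>) = to_l2 (\<lambda>\<xi>. \<Sum>b\<in>Basis. riesz_symbol b \<xi> * g b \<xi>)"
    using eq unfolding multiplier_def H_def g_def
    by (subst to_l2_sum) (auto intro: square_integrable_bounded_symbol bounded_symbol_riesz_symbol)
  then have "AE \<xi> in lborel. weight (- 1) \<xi> * H \<xi> = (\<Sum>b\<in>Basis. riesz_symbol b \<xi> * g b \<xi>)"
    by (subst (asm) to_l2_eq_iff) (auto simp: H_def g_def
      intro!: square_integrable_bounded_symbol bounded_symbol_riesz_symbol square_integrable_sum b1)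
  then have ae: "AE \<xi> in lborel. H \<xi> = (\<Sum>b\<in>Basis. \<i> * complex_of_real (\<xi> \<bullet> b) * g b \<xi>)"
  proof eventually_elim
    case (elim \<xi>)
    have "weight (- 1) \<xi> * H \<xi> = weight (- 1) \<xi> * (\<Sum>b\<in>Basis. \<i> * complex_of_real (\<xi> \<bullet> b) * g b \<xi>)"
      unfolding elim by (simp add: riesz_symbol_def sum_distrib_left mult_ac)
    then show ?case by simp
  qed
  have sg: "square_integrable (g b)" for b by (simp add: g_def)
  have "(2 * pi) ^ DIM('a) * (LINT x|lborel. \<phi> x * h x)
      = fourier_l2 (real_l2 \<phi>) \<bullet> fourier_l2 (real_l2 h)"
    by (simp add: fourier_l2_inner inner_real_l2 ts h)
  also have "\<dots> = (LINT \<xi>|lborel. p \<xi> \<bullet> H \<xi>)"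
    unfolding p using inner_to_l2[OF p(2), of H] by (simp add: H_def)
  also have "\<dots> = (LINT \<xi>|lborel. - (\<Sum>b\<in>Basis. (\<i> * complex_of_real (\<xi> \<bullet> b) * p \<xi>) \<bullet> g b \<xi>))"
  proof (rule integral_cong_AE)
    have [measurable]: "p \<in> borel_measurable borel" using p(2) by
        (rule square_integrable_measurable)
    show "(\<lambda>\<xi>. p \<xi> \<bullet> H \<xi>) \<in> borel_measurable lborel" "(\<lambda>\<xi>. - (\<Sum>b\<in>Basis. (\<i> * complex_of_real (\<xi> \<bullet> b)
        * p \<xi>) \<bullet> g b \<xi>)) \<in> borel_measurable lborel"
      unfolding H_def g_def by measurable
    show "AE \<xi> in lborel. p \<xi> \<bullet> H \<xi> = - (\<Sum>b\<in>Basis. (\<i> * complex_of_real (\<xi> \<bullet> b) * p \<xi>) \<bullet> g b \<xi>)"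
      using ae
    proof eventually_elim
      case (elim \<xi>)
      have "p \<xi> \<bullet> (\<i> * complex_of_real (\<xi> \<bullet> b) * g b \<xi>)
          = - ((\<i> * complex_of_real (\<xi> \<bullet> b) * p \<xi>) \<bullet> g b \<xi>)" for b
        by (simp add: inner_complex_def algebra_simps)
      then show ?case unfolding elim inner_sum_right by (simp add: sum_negf)
    qed
  qed
  also have "\<dots> = - (\<Sum>b\<in>Basis. LINT \<xi>|lborel. (\<i> * complex_of_real (\<xi> \<bullet> b) * p \<xi>) \<bullet> g b \<xi>)"
    using square_integrable_inner_integrable[OF dp(2) sg] by simp
  also have "\<dots> = - (\<Sum>b\<in>Basis. fourier_l2 (real_l2 (\<lambda>x. D\<phi> x \<bullet> b)) \<bullet> fourier_l2 (real_l2 (\<lambda>x. G x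
      \<bullet> b)))"
    unfolding dp(1) using inner_to_l2[OF dp(2) sg] by (simp add: g_def)
  also have "\<dots> = - (\<Sum>b\<in>Basis. (2 * pi) ^ DIM('a) * (LINT x|lborel. (D\<phi> x \<bullet> b) * (G x \<bullet> b)))"
    by (simp add: fourier_l2_inner inner_real_l2 ts Gb)
  also have "\<dots> = - ((2 * pi) ^ DIM('a) * (LINT x|lborel. (\<Sum>b\<in>Basis. (D\<phi> x \<bullet> b) * (G x \<bullet> b))))"
  proof -
    have "integrable lborel (\<lambda>x. (D\<phi> x \<bullet> b) * (G x \<bullet> b))" if "b \<in> Basis" for b
      using square_integrable_inner_integrable[OF ts(3) Gb[OF that], of b] by simp
    then show ?thesis by (simp add: sum_distrib_left)
  qed
  also have "(LINT x|lborel. (\<Sum>b\<in>Basis. (D\<phi> x \<bullet> b) * (G x \<bullet> b))) = (LINT x|lborel. G x \<bullet> D\<phi> x)"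
    by (simp add: euclidean_inner[of "G _" "D\<phi> _"] mult.commute)
  finally have "(2 * pi) ^ DIM('a) * ((LINT x|lborel. \<phi> x * h x) + (LINT x|lborel. G x \<bullet> D\<phi> x)) = 0"
    by (simp only: distrib_left)
  then show "(LINT x|lborel. G x \<bullet> D\<phi> x) = - (LINT x|lborel. \<phi> x * h x)" by simp
qed

lemma integrable_scaleR_square_integrable:
  fixes f :: "'a::euclidean_space \<Rightarrow> real" and V :: "'a \<Rightarrow> 'a"
  assumes f: "square_integrable f" and V: "square_integrable V"
  shows "integrable lborel (\<lambda>x. f x *\<^sub>R V x)"
proof -
  have [measurable]: "f \<in> borel_measurable borel" "V \<in> borel_measurable borel"
    using f V by (auto intro: square_integrable_measurable)
  have n: "square_integrable (\<lambda>x. norm (V x))" by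
      (rule square_integrable_dominated[OF V, of _ 1]) auto
  show ?thesis
    by (rule Bochner_Integration.integrable_bound[OF square_integrable_product_integrable[OF f n]])
        auto
qed

lemma test_function_gradient_square_integrable:
  fixes \<phi> :: "'a::euclidean_space \<Rightarrow> real"
  assumes t: "test_function \<phi> D\<phi>" shows "square_integrable D\<phi>"
proof -
  have "square_integrable (\<lambda>x. \<Sum>b\<in>Basis. (D\<phi> x \<bullet> b) *\<^sub>R b)"
  proof (rule square_integrable_sum)
    fix b :: 'a assume b: "b \<in> Basis"
    note s = test_function_square_integrable(3)[OF t, of b]
    show "square_integrable (\<lambda>x. (D\<phi> x \<bullet> b) *\<^sub>R b)"
      by (rule square_integrable_dominated[OF s, of _ 1])
          (use square_integrable_measurable[OF s] b in auto)
  qed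
  then show ?thesis by (simp add: euclidean_representation)
qed

text \<open>
  Divergences suffice: the component of the gradient in direction \<open>b\<close> is the divergence of
  \<open>\<lambda>x. f x *\<^sub>R b\<close>.
\<close>

lemma weak_gradient_iff:
  fixes G :: "'a::euclidean_space \<Rightarrow> 'a"
  assumes f: "square_integrable f" and G: "square_integrable G"
  shows "has_weak_gradient f G \<longleftrightarrow> (\<forall>b\<in>Basis. has_weak_divergence (\<lambda>x. f x *\<^sub>R b) (\<lambda>x. G x \<bullet> b))"
proof -
  have sfb: "square_integrable (\<lambda>x. f x *\<^sub>R b)" if "b \<in> Basis" for b :: 'a
    by (rule square_integrable_dominated[OF f, of _ 1])
        (use that square_integrable_measurable[OF f] in auto)
  have e: "((LINT x|lborel. f x *\<^sub>R D\<phi> x) = - (LINT x|lborel. \<phi> x *\<^sub>R G x)) \<longleftrightarrow>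
      (\<forall>b\<in>Basis. (LINT x|lborel. (f x *\<^sub>R b) \<bullet> D\<phi> x) = - (LINT x|lborel. \<phi> x * (G x \<bullet> b)))"
    if t: "test_function \<phi> D\<phi>" for \<phi> D\<phi>
  proof -
    have 1: "integrable lborel (\<lambda>x. f x *\<^sub>R D\<phi> x)"
      by (rule integrable_scaleR_square_integrable[OF f test_function_gradient_square_integrable[OF
          t]])
    have 2: "integrable lborel (\<lambda>x. \<phi> x *\<^sub>R G x)"
      by (rule integrable_scaleR_square_integrable[OF test_function_square_integrable(1)[OF t] G])
    have "(LINT x|lborel. (f x *\<^sub>R b) \<bullet> D\<phi> x) = (LINT x|lborel. f x *\<^sub>R D\<phi> x) \<bullet> b" for b
      by (subst integral_inner_left[OF 1, symmetric]) (simp add: inner_commute)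
    moreover have "(LINT x|lborel. \<phi> x * (G x \<bullet> b)) = (LINT x|lborel. \<phi> x *\<^sub>R G x) \<bullet> b" for b
      by (subst integral_inner_left[OF 2, symmetric]) simp
    ultimately show ?thesis by (simp add: euclidean_eq_iff[of "LINT x|lborel. f x *\<^sub>R D\<phi> x"])
  qed
  show ?thesis
    unfolding has_weak_gradient_def has_weak_divergence_def
    using f G sfb square_integrable_component[OF G] e by blast
qed

lemma sum_Basis_single:
  fixes f :: "'a::euclidean_space \<Rightarrow> real"
  assumes f: "square_integrable f" and c: "c \<in> Basis"
  shows "(\<Sum>b\<in>Basis. multiplier (riesz_symbol b) (fourier_l2 (real_l2 (\<lambda>x. (f x *\<^sub>R c) \<bullet> b))))
      = multiplier (riesz_symbol c) (fourier_l2 (real_l2 f))"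
proof -
  have "multiplier (riesz_symbol b) (fourier_l2 (real_l2 (\<lambda>x. (f x *\<^sub>R c) \<bullet> b))) = (if b
      = c then multiplier (riesz_symbol c) (fourier_l2 (real_l2 f)) else 0)"
    if b: "b \<in> Basis" for b
  proof -
    have "real_l2 (\<lambda>x::'a. 0) = 0" by (simp add: real_l2_def zero_l2_def)
    then show ?thesis using b c
      by (auto simp: inner_Basis linear_0[OF bounded_linear.linear[OF bounded_linear_fourier_l2]]
        linear_0[OF bounded_linear.linear[OF bounded_linear_multiplier[OF
            bounded_symbol_riesz_symbol]]])
  qed
  then show ?thesis using c by simp
qed

lemma weak_gradient_sobolev_coord:
  assumes s: "s \<ge> 1" and f: "f \<in> sobolev_space s" and g: "has_weak_gradient f G" and b: "b \<in> Basis"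
  shows "(\<lambda>x. G x \<bullet> b) \<in> sobolev_space (s - 1) \<and> sobolev_coord (s - 1) (\<lambda>x. G x \<bullet> b)
      = multiplier (riesz_symbol b) (sobolev_coord s f)"
proof -
  have sf: "square_integrable f" and sG: "square_integrable G" using g by
      (auto simp: has_weak_gradient_def)
  have "has_weak_divergence (\<lambda>x. f x *\<^sub>R b) (\<lambda>x. G x \<bullet> b)" using g weak_gradient_iff[OF sf sG] b
      by blast
  from weak_divergence_fourier_l2[OF this]
  have "multiplier (weight (- 1)) (fourier_l2 (real_l2 (\<lambda>x. G x \<bullet> b)))
      = multiplier (riesz_symbol b) (fourier_l2 (real_l2 f))"
    using sum_Basis_single[OF sf b] by simp
  also have "\<dots> = multiplier (weight (- 1)) (multiplier (weight (- (s
      - 1))) (multiplier (riesz_symbol b) (sobolev_coord s f)))"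
    using s f by (simp add: fourier_l2_real_l2[of s] multiplier_multiplier bounded_symbol_mult
        bounded_symbol_weight bounded_symbol_riesz_symbol[OF b]
      weight_add mult_ac flip: mult.assoc)
  finally have "fourier_l2 (real_l2 (\<lambda>x. G x \<bullet> b))
      = multiplier (weight (- (s - 1))) (multiplier (riesz_symbol b) (sobolev_coord s f))"
    by (simp add: multiplier_weight_inject)
  then show ?thesis
    using sobolev_coord_iff[of "s - 1" "\<lambda>x. G x \<bullet> b"] s square_integrable_component[OF sG b] by simp
qed

lemma weak_gradient_exists:
  fixes f :: "'a::euclidean_space \<Rightarrow> real"
  assumes s: "s \<ge> 1" and f: "f \<in> sobolev_space s"
  shows "\<exists>G. has_weak_gradient f G"
proof -
  have sf: "square_integrable f" using f by (rule sobolev_square_integrable)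
  have "\<forall>b\<in>Basis. \<exists>g. g \<in> sobolev_space (s - 1) \<and> sobolev_coord (s - 1) g
      = multiplier (riesz_symbol b) (sobolev_coord s f)"
  proof
    fix b :: 'a assume b: "b \<in> Basis"
    have "conj_reflect (multiplier (riesz_symbol b) (sobolev_coord s f))
        = multiplier (riesz_symbol b) (sobolev_coord s f)"
      using s f by (simp add: conj_reflect_multiplier bounded_symbol_riesz_symbol b
          sobolev_coord_conj_reflect)
    then show "\<exists>g. g \<in> sobolev_space (s - 1) \<and> sobolev_coord (s - 1) g
        = multiplier (riesz_symbol b) (sobolev_coord s f)"
      using sobolev_coord_surj[of "s - 1"] s by fastforce
  qed
  then obtain g where g: "\<And>b. b \<in> Basis \<Longrightarrow> g b \<in> sobolev_space (s - 1)"
    "\<And>b. b \<in> Basis \<Longrightarrow> sobolev_coord (s - 1) (g b) = multiplier (riesz_symbol b) (sobolev_coord s f)"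
        by metis
  define G where "G x = (\<Sum>b\<in>Basis. g b x *\<^sub>R b)" for x
  have Gb: "(\<lambda>x. G x \<bullet> b) = g b" if "b \<in> Basis" for b
    using that by (auto simp: G_def fun_eq_iff)
  have sG: "square_integrable G"
    unfolding G_def[abs_def]
  proof (rule square_integrable_sum)
    fix b :: 'a assume b: "b \<in> Basis"
    note sg = sobolev_square_integrable[OF g(1)[OF b]]
    show "square_integrable (\<lambda>x. g b x *\<^sub>R b)"
      by (rule square_integrable_dominated[OF sg, of _ 1])
          (use square_integrable_measurable[OF sg] b in auto)
  qed
  have "has_weak_gradient f G"
    unfolding weak_gradient_iff[OF sf sG]
  proof
    fix b :: 'a assume b: "b \<in> Basis"
    show "has_weak_divergence (\<lambda>x. f x *\<^sub>R b) (\<lambda>x. G x \<bullet> b)"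
    proof (rule weak_divergence_from_fourier_l2)
      show "square_integrable (\<lambda>x. f x *\<^sub>R b)"
        by (rule square_integrable_dominated[OF sf, of _ 1])
            (use b square_integrable_measurable[OF sf] in auto)
      show "square_integrable (\<lambda>x. G x \<bullet> b)" by (rule square_integrable_component[OF sG b])
      have "multiplier (weight (- 1)) (fourier_l2 (real_l2 (g b)))
          = multiplier (riesz_symbol b) (fourier_l2 (real_l2 f))"
        using s f g[OF b] by (simp add: fourier_l2_real_l2[of s] fourier_l2_real_l2[of "s
            - 1"] multiplier_multiplier bounded_symbol_mult
          bounded_symbol_weight bounded_symbol_riesz_symbol[OF b] weight_add mult_ac flip:
              mult.assoc)
      then show "multiplier (weight (- 1)) (fourier_l2 (real_l2 (\<lambda>x. G x \<bullet> b)))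
         = (\<Sum>c\<in>Basis. multiplier (riesz_symbol c) (fourier_l2 (real_l2 (\<lambda>x. (f x *\<^sub>R b) \<bullet> c))))"
        using sum_Basis_single[OF sf b] Gb[OF b] by simp
    qed
  qed
  then show ?thesis by blast
qed

lemma sum_riesz_symbol_riesz_symbol: "(\<Sum>b\<in>Basis. multiplier (riesz_symbol b) (multiplier
    (riesz_symbol b) w)) = multiplier (weight (- 2)) w - w"
proof -
  have b2: "bounded_symbol (weight (- 2) :: 'a \<Rightarrow> complex)" by (rule bounded_symbol_weight) simp
  have "(\<Sum>b\<in>Basis. multiplier (riesz_symbol b) (multiplier (riesz_symbol b) w))
      = (\<Sum>b\<in>Basis. multiplier (\<lambda>\<xi>. riesz_symbol b \<xi> * riesz_symbol b \<xi>) w)"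
    by (simp add: multiplier_multiplier bounded_symbol_riesz_symbol)
  also have "\<dots> = to_l2 (\<lambda>\<xi>. (\<Sum>b\<in>Basis. (riesz_symbol b \<xi> * riesz_symbol b \<xi>) * rep_l2 w \<xi>))"
    unfolding multiplier_def
    by (rule to_l2_sum[symmetric]) (intro square_integrable_bounded_symbol bounded_symbol_mult
        bounded_symbol_riesz_symbol rep_l2_square_integrable)
  also have "(\<lambda>\<xi>. (\<Sum>b\<in>Basis. (riesz_symbol b \<xi> * riesz_symbol b \<xi>) * rep_l2 w \<xi>))
      = (\<lambda>\<xi>. weight (- 2) \<xi> * rep_l2 w \<xi> - rep_l2 w \<xi>)"
    by (simp add: fun_eq_iff sum_riesz_symbol_sq left_diff_distrib flip: sum_distrib_right)
  also have "to_l2 \<dots> = multiplier (weight (- 2)) w - w"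
    unfolding multiplier_def by (subst to_l2_diff) (auto intro: square_integrable_bounded_symbol b2)
  finally show ?thesis .
qed

lemma sum_riesz_symbol_gradient:
  fixes f :: "'a::euclidean_space \<Rightarrow> real"
  assumes s: "s \<ge> 1" and f: "f \<in> sobolev_space s" and g: "has_weak_gradient f G"
  shows "(\<Sum>b\<in>Basis. multiplier (riesz_symbol b) (fourier_l2 (real_l2 (\<lambda>x. G x \<bullet> b))))
      = multiplier (weight (1 - s)) (multiplier (weight (- 2)) (sobolev_coord s f)
      - sobolev_coord s f)"
proof -
  have bs: "bounded_symbol (weight (1 - s) :: 'a \<Rightarrow> complex)" by (rule bounded_symbol_weight)
      (use s in simp)
  have "(\<Sum>b\<in>Basis. multiplier (riesz_symbol b) (fourier_l2 (real_l2 (\<lambda>x. G x \<bullet> b))))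
     = (\<Sum>b\<in>Basis. multiplier (weight (1 - s)) (multiplier (riesz_symbol b) (multiplier (riesz_symbol
         b) (sobolev_coord s f))))"
  proof (rule sum.cong[OF refl])
    fix b :: 'a assume b: "b \<in> Basis"
    note G = weak_gradient_sobolev_coord[OF s f g b]
    have "fourier_l2 (real_l2 (\<lambda>x. G x \<bullet> b)) = multiplier (weight (1
        - s)) (multiplier (riesz_symbol b) (sobolev_coord s f))"
      using fourier_l2_real_l2[of "s - 1" "\<lambda>x. G x \<bullet> b"] G s by simp
    then show "multiplier (riesz_symbol b) (fourier_l2 (real_l2 (\<lambda>x. G x \<bullet> b)))
        = multiplier (weight (1 - s)) (multiplier (riesz_symbol b) (multiplier (riesz_symbol b)
        (sobolev_coord s f)))"
      using bs bounded_symbol_riesz_symbol[OF b] by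
          (simp add: multiplier_multiplier bounded_symbol_mult mult_ac)
  qed
  then show ?thesis
    by (simp only: sum_riesz_symbol_riesz_symbol linear_sum[OF bounded_linear.linear[OF
        bounded_linear_multiplier[OF bs]], symmetric])
qed

lemma weak_laplacian_sobolev_coord:
  fixes f :: "'a::euclidean_space \<Rightarrow> real"
  assumes s: "s \<ge> 2" and f: "f \<in> sobolev_space s" and L: "has_weak_laplacian f L"
  shows "L \<in> sobolev_space (s - 2) \<and> sobolev_coord (s - 2) L
      = multiplier (weight (- 2)) (sobolev_coord s f) - sobolev_coord s f"
proof -
  obtain G where g: "has_weak_gradient f G" and d: "has_weak_divergence G L"
    using L by (auto simp: has_weak_laplacian_def)
  have sL: "square_integrable L" using d by (simp add: has_weak_divergence_def)
  let ?y = "multiplier (weight (- 2)) (sobolev_coord s f) - sobolev_coord s f"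
  have "multiplier (weight (- 1)) (fourier_l2 (real_l2 L)) = multiplier (weight (1 - s)) ?y"
    using weak_divergence_fourier_l2[OF d] sum_riesz_symbol_gradient[OF _ f g] s by simp
  also have "\<dots> = multiplier (weight (- 1)) (multiplier (weight (- (s - 2))) ?y)"
    using s by (simp add: multiplier_multiplier[of "weight (- 1)"] bounded_symbol_weight weight_add)
  finally have "fourier_l2 (real_l2 L) = multiplier (weight (- (s - 2))) ?y" by
      (simp add: multiplier_weight_inject)
  then show ?thesis using sobolev_coord_iff[of "s - 2" L ?y] s sL by simp
qed

lemma weak_laplacian_exists:
  fixes f :: "'a::euclidean_space \<Rightarrow> real"
  assumes s: "s \<ge> 2" and f: "f \<in> sobolev_space s"
  shows "\<exists>L. has_weak_laplacian f L"
proof -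
  obtain G where g: "has_weak_gradient f G" using weak_gradient_exists[of s f] s f by auto
  let ?y = "multiplier (weight (- 2)) (sobolev_coord s f) - sobolev_coord s f"
  have b2: "bounded_symbol (weight (- 2) :: 'a \<Rightarrow> complex)" by (rule bounded_symbol_weight) simp
  have "conj_reflect ?y = ?y"
    using s f by (simp add: bounded_linear_diff[OF bounded_linear_conj_reflect]
        conj_reflect_multiplier b2 sobolev_coord_conj_reflect)
  then obtain L where L: "L \<in> sobolev_space (s - 2)" "sobolev_coord (s - 2) L = ?y"
      using sobolev_coord_surj[of "s - 2" ?y] s by auto
  have "has_weak_divergence G L"
  proof (rule weak_divergence_from_fourier_l2)
    show "square_integrable G" using g by (simp add: has_weak_gradient_def)
    show "square_integrable L" using L(1) by (rule sobolev_square_integrable)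
    have "multiplier (weight (- 1)) (fourier_l2 (real_l2 L))
        = multiplier (weight (- 1)) (multiplier (weight (- (s - 2))) ?y)"
      using fourier_l2_real_l2[of "s - 2" L] L s by simp
    also have "\<dots> = multiplier (weight (1 - s)) ?y"
      using s by (simp add: multiplier_multiplier[of "weight (- 1)"] bounded_symbol_weight
          weight_add)
    finally show "multiplier (weight (- 1)) (fourier_l2 (real_l2 L))
        = (\<Sum>b\<in>Basis. multiplier (riesz_symbol b) (fourier_l2 (real_l2 (\<lambda>x. G x \<bullet> b))))"
      using sum_riesz_symbol_gradient[OF _ f g] s by simp
  qed
  then show ?thesis using g by (auto simp: has_weak_laplacian_def)
qed

text \<open>
  The map \<open>(u, \<beta>) \<mapsto> \<bar>\<nabla>u\<bar>\<^sup>2 * \<beta>\<close> in coordinates: of order \<open>r + 1\<close> for \<open>w\<close>, and of order \<open>r\<close> for \<open>v\<close>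
  and for the value.
\<close>

definition nonlinearity :: "real \<Rightarrow> 'a::euclidean_space l2 \<Rightarrow> 'a l2 \<Rightarrow> 'a l2" where
  "nonlinearity r w v = (\<Sum>b\<in>Basis. sobolev_product r (sobolev_product r (multiplier (riesz_symbol b)
      w) (multiplier (riesz_symbol b) w)) v)"

lemma sobolev_coord_zero: "s \<ge> 0 \<Longrightarrow> (\<lambda>x::'a::euclidean_space. 0) \<in> sobolev_space s
    \<and> sobolev_coord s (\<lambda>x::'a. 0) = 0"
proof -
  assume s: "s \<ge> 0"
  have "real_l2 (\<lambda>x::'a. 0) = 0" by (simp add: real_l2_def zero_l2_def)
  then show ?thesis using s
    by (subst sobolev_coord_iff) (auto simp: linear_0[OF bounded_linear.linear[OF
        bounded_linear_fourier_l2]]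
        linear_0[OF bounded_linear.linear[OF bounded_linear_multiplier]] bounded_symbol_weight)
qed

lemma sobolev_coord_sum:
  assumes s: "s \<ge> 0" and f: "\<And>i. i \<in> A \<Longrightarrow> f i \<in> sobolev_space s"
  shows "(\<lambda>x. \<Sum>i\<in>A. f i x) \<in> sobolev_space s \<and> sobolev_coord s (\<lambda>x. \<Sum>i\<in>A. f i x)
      = (\<Sum>i\<in>A. sobolev_coord s (f i))"
  using f
proof (induction A rule: infinite_finite_induct)
  case (insert i A)
  have IH: "(\<lambda>x. \<Sum>i\<in>A. f i x) \<in> sobolev_space s" "sobolev_coord s (\<lambda>x. \<Sum>i\<in>A. f i x)
      = (\<Sum>i\<in>A. sobolev_coord s (f i))"
    using insert by auto
  show ?case using sobolev_coord_add[OF s _ IH(1), of "f i"] insert IH by simp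
qed (use s sobolev_coord_zero in auto)

lemma sobolev_coord_nonlinearity:
  fixes f \<beta> :: "'a::euclidean_space \<Rightarrow> real"
  assumes s: "s - 1 > real DIM('a) / 2" and f: "f \<in> sobolev_space s" and g: "has_weak_gradient f G"
    and \<beta>: "\<beta> \<in> sobolev_space (s - 1)"
  shows "(\<lambda>x. (norm (G x))\<^sup>2 * \<beta> x) \<in> sobolev_space (s - 1) \<and>
    sobolev_coord (s - 1) (\<lambda>x. (norm (G x))\<^sup>2 * \<beta> x)
        = nonlinearity (s - 1) (sobolev_coord s f) (sobolev_coord (s - 1) \<beta>)"
proof -
  have s1: "s - 1 > 0" using s by (rule order_le_less_trans[rotated]) simp
  have eq: "(norm (G x))\<^sup>2 * \<beta> x = (\<Sum>b\<in>Basis. ((G x \<bullet> b) * (G x \<bullet> b)) * \<beta> x)" for x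
    unfolding power2_norm_eq_inner euclidean_inner[of "G x" "G x"] by (simp add: sum_distrib_right)
  have "(\<lambda>x. ((G x \<bullet> b) * (G x \<bullet> b)) * \<beta> x) \<in> sobolev_space (s - 1) \<and>
      sobolev_coord (s - 1) (\<lambda>x. ((G x \<bullet> b) * (G x \<bullet> b)) * \<beta> x)
      = sobolev_product (s - 1) (sobolev_product (s - 1) (multiplier (riesz_symbol b) (sobolev_coord
          s f)) (multiplier (riesz_symbol b) (sobolev_coord s f))) (sobolev_coord (s - 1) \<beta>)"
    if b: "b \<in> Basis" for b
  proof -
    have Gb: "(\<lambda>x. G x \<bullet> b) \<in> sobolev_space (s - 1)" "sobolev_coord (s - 1) (\<lambda>x. G x \<bullet> b)
        = multiplier (riesz_symbol b) (sobolev_coord s f)"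
      using weak_gradient_sobolev_coord[OF _ f g b] s1 by auto
    note GG = sobolev_coord_mult[OF s Gb(1) Gb(1)]
    show ?thesis using sobolev_coord_mult[OF s conjunct1[OF GG] \<beta>] GG Gb by simp
  qed
  then show ?thesis
    unfolding eq nonlinearity_def using sobolev_coord_sum[of "s - 1" Basis "\<lambda>b x. ((G x \<bullet> b) * (G x
        \<bullet> b)) * \<beta> x"] s1 by simp
qed

section \<open>The heat flow and the Duhamel integral\<close>

text \<open>
  Multipliers depend continuously on their symbols only in the strong sense: bounded pointwise
  convergence of the symbols suffices.
\<close>

lemma multiplier_tendsto:
  fixes m :: "nat \<Rightarrow> 'a::euclidean_space \<Rightarrow> complex"
  assumes meas[measurable]: "\<And>n. m n \<in> borel_measurable borel" "l \<in> borel_measurable borel"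
    and bd: "\<And>n \<xi>. norm (m n \<xi>) \<le> C" and lim: "\<And>\<xi>. (\<lambda>n. m n \<xi>) \<longlonglongrightarrow> l \<xi>" and x: "x \<longlonglongrightarrow> y"
  shows "(\<lambda>n. multiplier (m n) (x n)) \<longlonglongrightarrow> multiplier l y"
proof -
  have bs: "bounded_symbol (m n)" for n using meas(1) bd by (rule bounded_symbolI)
  have C0: "C \<ge> 0" using bd[of 0 0] norm_ge_zero order_trans by blast
  have sw: "square_integrable (\<lambda>\<xi>. C *\<^sub>R rep_l2 y \<xi>)"
      by (intro square_integrable_scaleR rep_l2_square_integrable)
  have 1: "(\<lambda>n. multiplier (m n) y) \<longlonglongrightarrow> multiplier l y"
  proof -
    have "(\<lambda>n. to_l2 (\<lambda>\<xi>. m n \<xi> * rep_l2 y \<xi>)) \<longlonglongrightarrow> to_l2 (\<lambda>\<xi>. l \<xi> * rep_l2 y \<xi>)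
        \<and> square_integrable (\<lambda>\<xi>. l \<xi> * rep_l2 y \<xi>)"
    proof (rule to_l2_dominated_convergence[OF sw])
      show "norm (m n \<xi> * rep_l2 y \<xi>) \<le> norm (C *\<^sub>R rep_l2 y \<xi>)" for n \<xi>
        using mult_right_mono[OF bd[of n \<xi>], of "norm (rep_l2 y \<xi>)"] C0 by (simp add: norm_mult)
      show "AE \<xi> in lborel. (\<lambda>n. m n \<xi> * rep_l2 y \<xi>) \<longlonglongrightarrow> l \<xi> * rep_l2 y \<xi>"
        by (intro AE_I2 tendsto_mult lim tendsto_const)
    qed measurable
    then show ?thesis by (simp add: multiplier_def)
  qed
  have "(\<lambda>n. multiplier (m n) (x n - y)) \<longlonglongrightarrow> 0"
  proof (rule Lim_null_comparison)
    show "\<forall>\<^sub>F n in sequentially. norm (multiplier (m n) (x n - y)) \<le> C * norm (x n - y)"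
      by (intro always_eventually allI norm_multiplier_le meas bd)
    have "(\<lambda>n. C * norm (x n - y)) \<longlonglongrightarrow> C * norm (y - y)" by (intro tendsto_intros x)
    then show "(\<lambda>n. C * norm (x n - y)) \<longlonglongrightarrow> 0" by simp
  qed
  from tendsto_add[OF this 1] show ?thesis
    by (simp add: bounded_linear_diff[OF bounded_linear_multiplier[OF bs]])
qed

lemma continuous_on_multiplier:
  fixes m :: "'p::metric_space \<Rightarrow> 'a::euclidean_space \<Rightarrow> complex"
  assumes meas: "\<And>p. m p \<in> borel_measurable borel"
    and bd: "\<And>p \<xi>. p \<in> P \<Longrightarrow> norm (m p \<xi>) \<le> C" and lim: "\<And>\<xi>. continuous_on P (\<lambda>p. m p \<xi>)"
        and g: "continuous_on P g"
  shows "continuous_on P (\<lambda>p. multiplier (m p) (g p))"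
  unfolding continuous_on_sequentially
proof (intro allI ballI impI)
  fix u a assume a: "a \<in> P" and u: "(\<forall>n. u n \<in> P) \<and> u \<longlonglongrightarrow> a"
  have c: "(\<lambda>n. h (u n)) \<longlonglongrightarrow> h a" if "continuous_on P h" for h :: "'p \<Rightarrow> 'q::metric_space"
    using that a u unfolding continuous_on_sequentially o_def by blast
  show "((\<lambda>p. multiplier (m p) (g p)) \<circ> u) \<longlonglongrightarrow> multiplier (m a) (g a)"
    unfolding o_def by (rule multiplier_tendsto[of "\<lambda>n. m (u n)" "m a" C])
        (use meas bd u c[OF lim] c[OF g] in auto)
qed

lemma has_vector_derivative_iff_quotient:
  fixes f :: "real \<Rightarrow> 'b::real_normed_vector"
  shows "(f has_vector_derivative D) (at t within S) \<longleftrightarrow>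
    ((\<lambda>r. (1 / (r - t)) *\<^sub>R (f r - f t)) \<longlongrightarrow> D) (at t within S)"
proof -
  have eq: "norm (f r - f t - (r - t) *\<^sub>R D) / norm (r - t)
      = norm ((1 / (r - t)) *\<^sub>R (f r - f t) - D)" if "r \<noteq> t" for r
  proof -
    have "f r - f t - (r - t) *\<^sub>R D = (r - t) *\<^sub>R ((1 / (r - t)) *\<^sub>R (f r - f t) - D)"
      using that by (simp add: scaleR_diff_right)
    then show ?thesis using that by (simp only: norm_scaleR) simp
  qed
  have "(f has_vector_derivative D) (at t within S) \<longleftrightarrow>
     ((\<lambda>r. norm (f r - f t - (r - t) *\<^sub>R D) / norm (r - t)) \<longlongrightarrow> 0) (at t within S)"
    unfolding has_vector_derivative_def has_derivative_iff_norm by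
        (simp add: bounded_linear_scaleR_left)
  also have "\<dots> \<longleftrightarrow> ((\<lambda>r. norm ((1 / (r - t)) *\<^sub>R (f r - f t) - D)) \<longlongrightarrow> 0) (at t within S)"
    by (rule tendsto_cong) (use eq in \<open>auto simp: eventually_at_filter\<close>)
  also have "\<dots> \<longleftrightarrow> ((\<lambda>r. (1 / (r - t)) *\<^sub>R (f r - f t)) \<longlongrightarrow> D) (at t within S)"
    by (simp add: tendsto_norm_zero_iff LIM_zero_iff)
  finally show ?thesis .
qed

definition heat_symbol :: "real \<Rightarrow> 'a::euclidean_space \<Rightarrow> complex" where
  "heat_symbol t \<xi> = complex_of_real (exp (- t * (norm \<xi>)\<^sup>2))"

text \<open>
  After the substitution \<open>\<tau> = t * (1 - \<theta>\<^sup>2)\<close> the Duhamel integral runs over the fixed interval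
  \<open>{0..1}\<close>, and the Jacobian \<open>2 * t * \<theta>\<close> cancels the singularity of the smoothing operator
  \<open>weight 1 * exp (- (t - \<tau>) * (norm \<xi>)\<^sup>2)\<close>: the integrand becomes bounded and strongly continuous.
\<close>

definition duhamel_symbol :: "real \<Rightarrow> real \<Rightarrow> 'a::euclidean_space \<Rightarrow> complex" where
  "duhamel_symbol t \<theta> \<xi> = complex_of_real (2 * t * \<theta>) * heat_symbol (t * \<theta>\<^sup>2) \<xi> * weight 1 \<xi>"

definition duhamel :: "(real \<Rightarrow> 'a::euclidean_space l2) \<Rightarrow> real \<Rightarrow> 'a l2" where
  "duhamel f t = integral {0..1} (\<lambda>\<theta>. multiplier (duhamel_symbol t \<theta>) (f (t * (1 - \<theta>\<^sup>2))))"

lemma heat_symbol_measurable [measurable]: "heat_symbol t \<in> borel_measurable borel"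
  unfolding heat_symbol_def[abs_def] by measurable

lemma duhamel_symbol_measurable [measurable]: "duhamel_symbol t \<theta> \<in> borel_measurable borel"
  unfolding duhamel_symbol_def[abs_def] by measurable

lemma norm_heat_symbol_le: "t \<ge> 0 \<Longrightarrow> norm (heat_symbol t \<xi>) \<le> 1"
  by (simp add: heat_symbol_def)

text \<open>
  The dangerous part is \<open>sqrt t\<close> times \<open>x * exp (- x\<^sup>2)\<close> with \<open>x = sqrt t * \<theta> * norm \<xi>\<close>, which is
  bounded by 1 for all \<open>x\<close>.
\<close>

lemma norm_duhamel_symbol_le:
  assumes t: "0 \<le> t" "t \<le> 1" and \<theta>: "0 \<le> \<theta>" "\<theta> \<le> 1"
  shows "norm (duhamel_symbol t \<theta> \<xi>) \<le> 4 * sqrt t"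
proof -
  define x where "x = sqrt t * \<theta> * norm \<xi>"
  define E where "E = exp (- (t * \<theta>\<^sup>2) * (norm \<xi>)\<^sup>2)"
  have x0: "x \<ge> 0" using t \<theta> by (simp add: x_def)
  have E: "E = exp (- x\<^sup>2)" "0 \<le> E" "E \<le> 1" using t by (auto simp: E_def x_def power_mult_distrib)
  have xE: "x * E \<le> 1"
  proof -
    have "x \<le> 1 + x\<^sup>2" using zero_le_power2[of "x - 1"] x0 by (simp add: power2_diff)
    also have "\<dots> \<le> exp (x\<^sup>2)" by (rule exp_ge_add_one_self)
    finally show ?thesis unfolding E(1) by (simp add: exp_minus divide_simps)
  qed
  have w: "norm (weight 1 \<xi>) \<le> 1 + norm \<xi>"
  proof -
    have "norm (weight 1 \<xi>) = sqrt (1 + (norm \<xi>)\<^sup>2)" unfolding norm_weight by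
        (simp add: powr_half_sqrt)
    also have "\<dots> \<le> sqrt ((1 + norm \<xi>)\<^sup>2)" by (intro real_sqrt_le_mono) (simp add: power2_sum)
    finally show ?thesis by simp
  qed
  have tt: "t = sqrt t * sqrt t" using t by simp
  have st: "sqrt t \<le> 1" using t by simp
  have "norm (duhamel_symbol t \<theta> \<xi>) = 2 * t * \<theta> * E * norm (weight 1 \<xi>)"
  proof -
    have "norm (complex_of_real (2 * t * \<theta>)) = 2 * t * \<theta>" unfolding norm_of_real using t \<theta> by simp
    then show ?thesis unfolding duhamel_symbol_def heat_symbol_def norm_mult[of "_
        * _" "weight 1 \<xi>"] norm_mult[of "complex_of_real (2 * t * \<theta>)"]
      by (simp add: E_def)
  qed
  also have "\<dots> \<le> 2 * t * \<theta> * E * (1 + norm \<xi>)"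
    by (intro mult_left_mono w) (use t \<theta> E in auto)
  also have "\<dots> = 2 * sqrt t * (sqrt t * (\<theta> * E) + x * E)"
  proof -
    have "2 * sqrt t * (sqrt t * (\<theta> * E) + x * E) = 2 * (sqrt t * sqrt t) * \<theta> * E * (1 + norm \<xi>)"
      by (simp only: x_def distrib_left distrib_right mult_ac mult_1_right mult_1_left)
    then show ?thesis using tt by simp
  qed
  also have "\<dots> \<le> 2 * sqrt t * (1 + 1)"
  proof (intro mult_left_mono add_mono xE)
    have "sqrt t * (\<theta> * E) \<le> 1 * (1 * 1)" using st \<theta> E t by (intro mult_mono) auto
    then show "sqrt t * (\<theta> * E) \<le> 1" by simp
  qed (use t in auto)
  finally show ?thesis by simp
qed

lemma continuous_on_heat_symbol: "continuous_on P (\<lambda>t. heat_symbol t \<xi>)"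
  unfolding heat_symbol_def by (intro continuous_intros)

lemma duhamel_time:
  assumes "0 \<le> t" "t \<le> T" "0 \<le> \<theta>" "\<theta> \<le> (1::real)"
  shows "0 \<le> t * (1 - \<theta>\<^sup>2)" "t * (1 - \<theta>\<^sup>2) \<le> t" "t * (1 - \<theta>\<^sup>2) \<in> {0..T}"
proof -
  have "0 \<le> 1 - \<theta>\<^sup>2" "1 - \<theta>\<^sup>2 \<le> 1" using assms by (auto simp: power_le_one)
  then show 1: "0 \<le> t * (1 - \<theta>\<^sup>2)" "t * (1 - \<theta>\<^sup>2) \<le> t" using assms by (auto intro: mult_left_le)
  then show "t * (1 - \<theta>\<^sup>2) \<in> {0..T}" using assms by auto
qed

lemma continuous_on_duhamel_integrand:
  assumes T: "T \<le> 1" and f: "continuous_on {0..T} f"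
  shows "continuous_on ({0..T} \<times> cbox 0 1) (\<lambda>(t, \<theta>). multiplier (duhamel_symbol t \<theta>) (f (t * (1
      - \<theta>\<^sup>2))))"
proof -
  have "continuous_on ({0..T} \<times> cbox 0 (1::real)) (\<lambda>p. multiplier ((\<lambda>p. duhamel_symbol (fst p) (snd
      p)) p) ((\<lambda>p. f (fst p * (1 - (snd p)\<^sup>2))) p))"
  proof (rule continuous_on_multiplier)
    show "norm (duhamel_symbol (fst p) (snd p) \<xi>) \<le> 4" if "p \<in> {0..T} \<times> cbox 0 1" for p and \<xi> :: 'a
    proof -
      have p: "0 \<le> fst p" "fst p \<le> 1" "0 \<le> snd p" "snd p \<le> 1" using that T by auto
      have "norm (duhamel_symbol (fst p) (snd p) \<xi>) \<le> 4 * sqrt (fst p)" by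
          (rule norm_duhamel_symbol_le[OF p])
      also have "\<dots> \<le> 4" using p by simp
      finally show ?thesis .
    qed
    show "continuous_on ({0..T} \<times> cbox 0 1) (\<lambda>p. duhamel_symbol (fst p) (snd p) \<xi>)" for \<xi> :: 'a
      unfolding duhamel_symbol_def heat_symbol_def by (intro continuous_intros)
    show "continuous_on ({0..T} \<times> cbox 0 1) (\<lambda>p. f (fst p * (1 - (snd p)\<^sup>2)))"
      by (rule continuous_on_compose2[OF f]) (use duhamel_time in \<open>auto intro!: continuous_intros\<close>)
  qed measurable
  then show ?thesis by (simp add: case_prod_beta)
qed

lemma continuous_on_duhamel_section:
  assumes T: "T \<le> 1" and f: "continuous_on {0..T} f" and t: "t \<in> {0..T}"
  shows "continuous_on {0..1} (\<lambda>\<theta>. multiplier (duhamel_symbol t \<theta>) (f (t * (1 - \<theta>\<^sup>2))))"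
proof -
  have c: "continuous_on {0..1} (\<lambda>\<theta>. (t, \<theta>))" by (intro continuous_intros)
  have "(\<lambda>\<theta>::real. (t, \<theta>)) ` {0..1} \<subseteq> {0..T} \<times> cbox 0 1" using t by (auto simp: box_real)
  from continuous_on_compose2[OF continuous_on_duhamel_integrand[OF T f] c this] show ?thesis
      by simp
qed

lemma continuous_on_duhamel:
  assumes T: "T \<le> 1" and f: "continuous_on {0..T} f"
  shows "continuous_on {0..T} (duhamel f)"
  using integral_continuous_on_param[OF continuous_on_duhamel_integrand[OF T f]]
  unfolding duhamel_def[abs_def] by simp

lemma norm_duhamel_le:
  assumes T: "T \<le> 1" and f: "continuous_on {0..T} f" and t: "t \<in> {0..T}"
    and K: "\<And>\<tau>. \<tau> \<in> {0..T} \<Longrightarrow> norm (f \<tau>) \<le> K"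
  shows "norm (duhamel f t) \<le> 4 * sqrt T * K"
proof -
  have K0: "K \<ge> 0" using K[of t] t norm_ge_zero order_trans by blast
  have "norm (duhamel f t) \<le> (4 * sqrt T * K) * (1 - 0)"
    unfolding duhamel_def
  proof (rule integral_bound[OF _ continuous_on_duhamel_section[OF T f t]])
    fix \<theta> :: real assume \<theta>: "\<theta> \<in> {0..1}"
    have "norm (multiplier (duhamel_symbol t \<theta>) (f (t * (1 - \<theta>\<^sup>2))))
        \<le> (4 * sqrt t) * norm (f (t * (1 - \<theta>\<^sup>2)))"
      by (rule norm_multiplier_le) (use T t \<theta> in \<open>auto intro!: norm_duhamel_symbol_le\<close>)
    also have "\<dots> \<le> (4 * sqrt T) * K"
      by (intro mult_mono K duhamel_time) (use t \<theta> K0 in auto)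
    finally show "norm (multiplier (duhamel_symbol t \<theta>) (f (t * (1 - \<theta>\<^sup>2)))) \<le> 4 * sqrt T * K" .
  qed simp
  then show ?thesis by simp
qed

lemma duhamel_diff:
  assumes T: "T \<le> 1" and f: "continuous_on {0..T} f" and g: "continuous_on {0..T} g"
      and t: "t \<in> {0..T}"
  shows "duhamel f t - duhamel g t = duhamel (\<lambda>\<tau>. f \<tau> - g \<tau>) t"
proof -
  have b: "bounded_symbol (duhamel_symbol t \<theta>)" if "\<theta> \<in> {0..1}" for \<theta>
    by (rule bounded_symbolI[of _ "4 * sqrt t"])
        (use that t T in \<open>auto intro!: norm_duhamel_symbol_le\<close>)
  have "duhamel f t - duhamel g t
     = integral {0..1} (\<lambda>\<theta>. multiplier (duhamel_symbol t \<theta>) (f (t * (1 - \<theta>\<^sup>2)))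
         - multiplier (duhamel_symbol t \<theta>) (g (t * (1 - \<theta>\<^sup>2))))"
    unfolding duhamel_def
    by (rule Henstock_Kurzweil_Integration.integral_diff[symmetric])
      (intro integrable_continuous_real continuous_on_duhamel_section[OF T _ t] f g)+
  also have "\<dots> = duhamel (\<lambda>\<tau>. f \<tau> - g \<tau>) t"
    unfolding duhamel_def
    by (rule Henstock_Kurzweil_Integration.integral_cong)
        (simp add: bounded_linear_diff[OF bounded_linear_multiplier[OF b]])
  finally show ?thesis .
qed

lemma conj_reflect_duhamel:
  assumes T: "T \<le> 1" and f: "continuous_on {0..T} f" and t: "t \<in> {0..T}"
    and c: "\<And>\<tau>. \<tau> \<in> {0..T} \<Longrightarrow> conj_reflect (f \<tau>) = f \<tau>"
  shows "conj_reflect (duhamel f t) = duhamel f t"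
proof -
  have b: "bounded_symbol (duhamel_symbol t \<theta>)" if "\<theta> \<in> {0..1}" for \<theta>
    by (rule bounded_symbolI[of _ "4 * sqrt t"])
        (use that t T in \<open>auto intro!: norm_duhamel_symbol_le\<close>)
  have r: "cnj (duhamel_symbol t \<theta> (- \<xi>)) = duhamel_symbol t \<theta> \<xi>" for \<theta> and \<xi> :: 'a
    by (simp add: duhamel_symbol_def heat_symbol_def)
  have "conj_reflect (duhamel f t)
     = integral {0..1} (conj_reflect \<circ> (\<lambda>\<theta>. multiplier (duhamel_symbol t \<theta>) (f (t * (1 - \<theta>\<^sup>2)))))"
    unfolding duhamel_def
    by (rule integral_linear[symmetric, OF integrable_continuous_real[OF
        continuous_on_duhamel_section[OF T f t]] bounded_linear_conj_reflect])
  also have "\<dots> = duhamel f t"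
    unfolding duhamel_def
    by (rule Henstock_Kurzweil_Integration.integral_cong)
      (use t in \<open>auto simp: conj_reflect_multiplier[OF b] r intro!: arg_cong[where f="multiplier _"]
          c duhamel_time\<close>)
  finally show ?thesis .
qed

text \<open>Frequencies below \<open>k\<close>: here the heat flow extends to a norm-differentiable group.\<close>

definition trunc_heat :: "nat \<Rightarrow> real \<Rightarrow> 'a::euclidean_space \<Rightarrow> complex" where
  "trunc_heat k t \<xi> = (if norm \<xi> \<le> real k then heat_symbol t \<xi> else 0)"

lemma trunc_heat_measurable [measurable]: "trunc_heat k t \<in> borel_measurable borel"
  unfolding trunc_heat_def[abs_def] by measurable

lemma norm_trunc_heat_le: "norm (trunc_heat k t \<xi>) \<le> exp (\<bar>t\<bar> * (real k)\<^sup>2)"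
proof -
  have "- t * (norm \<xi>)\<^sup>2 \<le> \<bar>t\<bar> * (real k)\<^sup>2" if "norm \<xi> \<le> real k"
  proof -
    have "- t * (norm \<xi>)\<^sup>2 \<le> \<bar>t\<bar> * (norm \<xi>)\<^sup>2" by (intro mult_right_mono) auto
    also have "\<dots> \<le> \<bar>t\<bar> * (real k)\<^sup>2" using that by (intro mult_left_mono power_mono) auto
    finally show ?thesis .
  qed
  then show ?thesis by (simp add: trunc_heat_def heat_symbol_def)
qed

lemma bounded_symbol_trunc_heat: "bounded_symbol (trunc_heat k t)"
  by (rule bounded_symbolI[OF trunc_heat_measurable norm_trunc_heat_le])

lemma bounded_symbol_trunc_weight: "bounded_symbol (\<lambda>\<xi>. trunc_heat k 0 \<xi> * weight r \<xi>)"
proof (rule bounded_symbolI[of _ "(1 + (real k)\<^sup>2) powr \<bar>r / 2\<bar>"])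
  fix \<xi> :: 'a
  show "norm (trunc_heat k 0 \<xi> * weight r \<xi>) \<le> (1 + (real k)\<^sup>2) powr \<bar>r / 2\<bar>"
  proof (cases "norm \<xi> \<le> real k")
    case True
    have "norm (weight r \<xi>) \<le> (1 + (norm \<xi>)\<^sup>2) powr \<bar>r / 2\<bar>" unfolding norm_weight
        by (intro powr_mono) auto
    also have "\<dots> \<le> (1 + (real k)\<^sup>2) powr \<bar>r / 2\<bar>" using True by (intro powr_mono2)
        (auto intro: power_mono)
    finally show ?thesis using True by (simp add: trunc_heat_def heat_symbol_def)
  qed (simp add: trunc_heat_def)
qed measurable

text \<open>The truncations converge strongly to the identity.\<close>

lemma trunc_zero_imp:
  assumes "\<And>k. multiplier (trunc_heat k 0) x = multiplier (trunc_heat k 0) y" shows "x = y"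
proof -
  have "(\<lambda>k. multiplier (trunc_heat k 0) z) \<longlonglongrightarrow> z" for z :: "'a l2"
  proof -
    have "(\<lambda>k. multiplier (trunc_heat k 0) z) \<longlonglongrightarrow> multiplier (\<lambda>_. 1) z"
    proof (rule multiplier_tendsto[where C=1])
      show "norm (trunc_heat k 0 \<xi>) \<le> 1" for k and \<xi> :: 'a using norm_trunc_heat_le[of k 0 \<xi>]
          by simp
      show "(\<lambda>k. trunc_heat k 0 \<xi>) \<longlonglongrightarrow> 1" for \<xi> :: 'a
      proof (rule tendsto_eventually)
        obtain N :: nat where "norm \<xi> \<le> real N" using real_arch_simple by blast
        then show "\<forall>\<^sub>F k in sequentially. trunc_heat k 0 \<xi> = 1"
          by (intro eventually_sequentiallyI[of N]) (auto simp: trunc_heat_def heat_symbol_def)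
      qed
    qed auto
    then show ?thesis by (simp add: multiplier_def)
  qed
  then show ?thesis using assms LIMSEQ_unique by (metis (no_types, lifting) ext)
qed

lemma exp_lipschitz: "0 \<le> x \<Longrightarrow> 0 \<le> y \<Longrightarrow> \<bar>exp (- x) - exp (- y)\<bar> \<le> \<bar>x - y\<bar>" for x y :: real
proof -
  have *: "\<bar>exp (- x) - exp (- y)\<bar> \<le> \<bar>x - y\<bar>" if "0 \<le> x" "x \<le> y" for x y :: real
  proof -
    have "exp (- x) - exp (- y) = exp (- x) * (1 - exp (- (y - x)))" by
        (simp add: algebra_simps flip: exp_add)
    also have "\<dots> \<le> 1 * (y - x)"
    proof (intro mult_mono)
      show "1 - exp (- (y - x)) \<le> y - x" using exp_ge_add_one_self[of "- (y - x)"] by linarith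
    qed (use that in auto)
    finally show ?thesis using that by simp
  qed
  assume "0 \<le> x" "0 \<le> y"
  then show ?thesis using *[of x y] *[of y x] by (cases "x \<le> y") (auto simp: abs_minus_commute)
qed

text \<open>The generator of the truncated heat flow.\<close>

definition trunc_lap :: "nat \<Rightarrow> 'a::euclidean_space \<Rightarrow> complex" where
  "trunc_lap k \<xi> = trunc_heat k 0 \<xi> * (- complex_of_real ((norm \<xi>)\<^sup>2))"

lemma trunc_lap_measurable [measurable]: "trunc_lap k \<in> borel_measurable borel"
  unfolding trunc_lap_def[abs_def] by measurable

lemma bounded_symbol_trunc_lap: "bounded_symbol (trunc_lap k)"
  by (rule bounded_symbolI[of _ "(real k)\<^sup>2"])
    (auto simp: trunc_lap_def trunc_heat_def heat_symbol_def norm_mult norm_power intro: power_mono)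

text \<open>
  The product rule for a truncated heat flow applied to a differentiable curve. The difference
  quotients of the symbol are bounded by the square of the truncation frequency.
\<close>

lemma trunc_heat_has_derivative:
  assumes g: "(g has_vector_derivative g') (at t within {0..T})" and t: "t \<in> {0..T}"
  shows "((\<lambda>r. multiplier (trunc_heat k r) (g r)) has_vector_derivative
     multiplier (trunc_lap k) (multiplier (trunc_heat k t) (g t))
         + multiplier (trunc_heat k t) g') (at t within {0..T})"
  unfolding has_vector_derivative_iff_quotient tendsto_at_iff_sequentially
proof (intro allI impI)
  fix X :: "nat \<Rightarrow> real" assume X: "\<forall>i. X i \<in> {0..T} - {t}" "X \<longlonglongrightarrow> t"
  have X0: "X i \<ge> 0" "X i \<noteq> t" for i using X(1) by auto
  define q where "q i \<xi> = complex_of_real (1 / (X i - t)) * (trunc_heat k (X i) \<xi>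
      - trunc_heat k t \<xi>)" for i and \<xi> :: 'a
  have [measurable]: "q i \<in> borel_measurable borel" for i unfolding q_def by measurable
  have q_eq: "q i \<xi> = complex_of_real ((exp (- X i * (norm \<xi>)\<^sup>2) - exp (- t * (norm \<xi>)\<^sup>2)) / (X i
      - t))"
    if "norm \<xi> \<le> real k" for i \<xi> using that by (simp add: q_def trunc_heat_def heat_symbol_def)
  have q_bd: "norm (q i \<xi>) \<le> (real k)\<^sup>2" for i \<xi>
  proof (cases "norm \<xi> \<le> real k")
    case True
    have "\<bar>exp (- (X i * (norm \<xi>)\<^sup>2)) - exp (- (t * (norm \<xi>)\<^sup>2))\<bar> \<le> \<bar>X i * (norm \<xi>)\<^sup>2 - t * (norm \<xi>)\<^sup>2\<bar>"
      by (rule exp_lipschitz) (use X0 t in auto)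
    also have "\<dots> = \<bar>X i - t\<bar> * (norm \<xi>)\<^sup>2" by (simp add: abs_mult flip: left_diff_distrib)
    also have "\<dots> \<le> \<bar>X i - t\<bar> * (real k)\<^sup>2" using True by (intro mult_left_mono power_mono) auto
    finally show ?thesis unfolding q_eq[OF True] norm_of_real using X0(2)[of i] by
        (simp add: divide_simps mult.commute)
  qed (simp add: q_def trunc_heat_def)
  have q_lim: "(\<lambda>i. q i \<xi>) \<longlonglongrightarrow> trunc_lap k \<xi> * trunc_heat k t \<xi>" for \<xi>
  proof (cases "norm \<xi> \<le> real k")
    case True
    have "((\<lambda>r. exp (- r * (norm \<xi>)\<^sup>2)) has_real_derivative - (norm \<xi>)\<^sup>2 * exp (- t
        * (norm \<xi>)\<^sup>2)) (at t)"
      by (auto intro!: derivative_eq_intros)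
    then have "((\<lambda>r. (exp (- r * (norm \<xi>)\<^sup>2) - exp (- t * (norm \<xi>)\<^sup>2)) / (r - t))
        \<longlongrightarrow> - (norm \<xi>)\<^sup>2 * exp (- t * (norm \<xi>)\<^sup>2)) (at t)"
      by (simp add: has_field_derivative_iff)
    then have "(\<lambda>i. (exp (- X i * (norm \<xi>)\<^sup>2) - exp (- t * (norm \<xi>)\<^sup>2)) / (X i - t))
        \<longlonglongrightarrow> - (norm \<xi>)\<^sup>2 * exp (- t * (norm \<xi>)\<^sup>2)"
      using X X0 unfolding tendsto_at_iff_sequentially o_def by auto
    then have "(\<lambda>i. q i \<xi>) \<longlonglongrightarrow> complex_of_real (- (norm \<xi>)\<^sup>2 * exp (- t * (norm \<xi>)\<^sup>2))"
      unfolding q_eq[OF True] by (rule tendsto_of_real)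
    moreover have "complex_of_real (- (norm \<xi>)\<^sup>2 * exp (- t * (norm \<xi>)\<^sup>2))
        = trunc_lap k \<xi> * trunc_heat k t \<xi>"
      using True by (simp add: trunc_lap_def trunc_heat_def heat_symbol_def)
    ultimately show ?thesis by simp
  qed (simp add: q_def trunc_heat_def trunc_lap_def)
  have 1: "(\<lambda>i. multiplier (q i) (g t)) \<longlonglongrightarrow> multiplier (\<lambda>\<xi>. trunc_lap k \<xi> * trunc_heat k t \<xi>) (g t)"
    by (rule multiplier_tendsto[OF _ _ q_bd q_lim tendsto_const]) measurable
  have bdT: "norm (trunc_heat k (X i) \<xi>) \<le> 1" for i and \<xi> :: 'a
    using X0 by (simp add: trunc_heat_def norm_heat_symbol_le)
  have limT: "(\<lambda>i. trunc_heat k (X i) \<xi>) \<longlonglongrightarrow> trunc_heat k t \<xi>" for \<xi> :: 'a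
    unfolding trunc_heat_def heat_symbol_def using X(2) by (auto intro!: tendsto_intros)
  have gq: "(\<lambda>i. (1 / (X i - t)) *\<^sub>R (g (X i) - g t)) \<longlonglongrightarrow> g'"
    using g X unfolding has_vector_derivative_iff_quotient tendsto_at_iff_sequentially o_def
        by blast
  have 2: "(\<lambda>i. multiplier (trunc_heat k (X i)) ((1 / (X i - t)) *\<^sub>R (g (X i) - g t)))
      \<longlonglongrightarrow> multiplier (trunc_heat k t) g'"
    by (rule multiplier_tendsto[OF _ _ bdT limT gq]) measurable
  have bq: "bounded_symbol (q i)" for i by (rule bounded_symbolI[OF _ q_bd]) measurable
  note bl = bounded_linear_multiplier[OF bounded_symbol_trunc_heat]
  have qd: "multiplier (q i) x = (1 / (X i - t)) *\<^sub>R (multiplier (trunc_heat k (X i)) x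
      - multiplier (trunc_heat k t) x)" for i x
  proof -
    note sq = square_integrable_bounded_symbol[OF bounded_symbol_trunc_heat
        rep_l2_square_integrable, of k _ x]
    have "multiplier (q i) x = to_l2 (\<lambda>\<xi>. (1 / (X i - t)) *\<^sub>R (trunc_heat k (X i) \<xi> * rep_l2 x \<xi>
        - trunc_heat k t \<xi> * rep_l2 x \<xi>))"
      unfolding multiplier_def q_def by (simp add: scaleR_conv_of_real algebra_simps)
    then show ?thesis by (simp add: multiplier_def to_l2_scaleR square_integrable_diff sq
        to_l2_diff)
  qed
  have "((\<lambda>r. (1 / (r - t)) *\<^sub>R (multiplier (trunc_heat k r) (g r)
      - multiplier (trunc_heat k t) (g t))) \<circ> X)
      = (\<lambda>i. multiplier (q i) (g t) + multiplier (trunc_heat k (X i)) ((1 / (X i - t)) *\<^sub>R (g (X i)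
          - g t)))"
    unfolding o_def qd by (simp add: bounded_linear_scaleR[OF bl] bounded_linear_diff[OF bl] flip:
        scaleR_add_right)
  then show "((\<lambda>r. (1 / (r - t)) *\<^sub>R (multiplier (trunc_heat k r) (g r)
      - multiplier (trunc_heat k t) (g t))) \<circ> X) \<longlonglongrightarrow>
      multiplier (trunc_lap k) (multiplier (trunc_heat k t) (g t)) + multiplier (trunc_heat k t) g'"
    using tendsto_add[OF 1 2] by (simp add: multiplier_multiplier bounded_symbol_trunc_lap
        bounded_symbol_trunc_heat)
qed

text \<open>
  Below frequency \<open>k\<close> the substitution can be undone, and the heat flow at time \<open>t - \<tau>\<close> splits
  into the flows at times \<open>t\<close> and \<open>- \<tau>\<close>.
\<close>

lemma trunc_duhamel:
  fixes f :: "real \<Rightarrow> 'a::euclidean_space l2" and k :: nat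
  assumes T: "T \<le> 1" and f: "continuous_on {0..T} f" and t: "t \<in> {0..T}"
  defines "q \<equiv> \<lambda>\<tau>. multiplier (trunc_heat k (- \<tau>)) (multiplier (\<lambda>\<xi>. trunc_heat k 0 \<xi>
      * weight 1 \<xi>) (f \<tau>))"
  shows "continuous_on {0..T} q"
    and "multiplier (trunc_heat k 0) (duhamel f t)
        = multiplier (trunc_heat k t) (integral {0..t} q)"
proof -
  note bt = bounded_symbol_trunc_heat bounded_symbol_trunc_weight
  have fc: "continuous_on {0..T} (\<lambda>\<tau>. multiplier (\<lambda>\<xi>. trunc_heat k 0 \<xi> * weight 1 \<xi>) (f \<tau>))"
    by (rule bounded_linear.continuous_on[OF bounded_linear_multiplier[OF bt(2)] f])
  show q: "continuous_on {0..T} q"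
    unfolding q_def
  proof (rule continuous_on_multiplier[OF _ _ _ fc])
    show "norm (trunc_heat k (- \<tau>) \<xi>) \<le> exp (T * (real k)\<^sup>2)" if "\<tau> \<in> {0..T}" for \<tau> and \<xi> :: 'a
    proof -
      have "norm (trunc_heat k (- \<tau>) \<xi>) \<le> exp (\<bar>- \<tau>\<bar> * (real k)\<^sup>2)" by (rule norm_trunc_heat_le)
      also have "\<dots> \<le> exp (T * (real k)\<^sup>2)" using that by (auto intro!: mult_right_mono)
      finally show ?thesis .
    qed
    show "continuous_on {0..T} (\<lambda>\<tau>. trunc_heat k (- \<tau>) \<xi>)" for \<xi> :: 'a
      unfolding trunc_heat_def heat_symbol_def by (cases "norm \<xi> \<le> real k")
          (auto intro!: continuous_intros)
  qed measurable
  have b: "bounded_symbol (duhamel_symbol t \<theta>)" if "\<theta> \<in> {0..1}" for \<theta>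
    by (rule bounded_symbolI[of _ "4 * sqrt t"])
        (use that t T in \<open>auto intro!: norm_duhamel_symbol_le\<close>)
  have pw: "multiplier (trunc_heat k 0) (multiplier (duhamel_symbol t \<theta>) (f (t * (1 - \<theta>\<^sup>2))))
     = multiplier (trunc_heat k t) ((2 * t * \<theta>) *\<^sub>R q (t * (1 - \<theta>\<^sup>2)))" if \<theta>: "\<theta> \<in> {0..1}" for \<theta>
  proof -
    have "trunc_heat k 0 \<xi> * duhamel_symbol t \<theta> \<xi>
       = complex_of_real (2 * t * \<theta>) * (trunc_heat k t \<xi> * (trunc_heat k (- (t * (1 - \<theta>\<^sup>2))) \<xi>
           * (trunc_heat k 0 \<xi> * weight 1 \<xi>)))" for \<xi> :: 'a
    proof -
      have "heat_symbol (t * \<theta>\<^sup>2) \<xi> = heat_symbol t \<xi> * heat_symbol (- (t * (1 - \<theta>\<^sup>2))) \<xi>"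
        unfolding heat_symbol_def of_real_mult[symmetric] exp_add[symmetric] by
            (simp add: algebra_simps)
      then show ?thesis by (auto simp: trunc_heat_def duhamel_symbol_def heat_symbol_def[of 0])
    qed
    then have "multiplier (trunc_heat k 0) (multiplier (duhamel_symbol t \<theta>) x)
       = multiplier (\<lambda>\<xi>. complex_of_real (2 * t * \<theta>) * (trunc_heat k t \<xi> * (trunc_heat k (- (t * (1
           - \<theta>\<^sup>2))) \<xi> * (trunc_heat k 0 \<xi> * weight 1 \<xi>)))) x" for x :: "'a l2"
      by (simp only: multiplier_multiplier[OF bt(1) b[OF \<theta>]])
    also have "\<dots> x = (2 * t * \<theta>) *\<^sub>R multiplier (\<lambda>\<xi>. trunc_heat k t \<xi> * (trunc_heat k (- (t * (1
        - \<theta>\<^sup>2))) \<xi> * (trunc_heat k 0 \<xi> * weight 1 \<xi>))) x" for x :: "'a l2"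
    proof -
      have "bounded_symbol (\<lambda>\<xi>. trunc_heat k t \<xi> * (trunc_heat k (- (t * (1 - \<theta>\<^sup>2))) \<xi>
          * (trunc_heat k 0 \<xi> * weight 1 \<xi>)))"
        by (intro bounded_symbol_mult[of "trunc_heat k _"] bt)
      from to_l2_scaleR[OF square_integrable_bounded_symbol[OF this rep_l2_square_integrable], of "2
          * t * \<theta>" x]
      show ?thesis unfolding multiplier_def scaleR_conv_of_real by (simp only: mult.assoc)
    qed
    finally show ?thesis
      by (simp add: q_def multiplier_multiplier bt bounded_symbol_mult bounded_linear_scaleR[OF
          bounded_linear_multiplier[OF bt(1)]])
  qed
  define Q where "Q = (\<lambda>r. integral {0..r} q)"
  have sub: "((\<lambda>\<theta>. (2 * t * \<theta>) *\<^sub>R q (t * (1 - \<theta>\<^sup>2))) has_integral (Q t)) {0..1}"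
  proof -
    have "((\<lambda>\<theta>. (2 * t * \<theta>) *\<^sub>R q (t * (1 - \<theta>\<^sup>2))) has_integral ((\<lambda>\<theta>. - Q (t * (1 - \<theta>\<^sup>2))) 1 - (\<lambda>\<theta>.
        - Q (t * (1 - \<theta>\<^sup>2))) 0)) {0..1}"
    proof (rule fundamental_theorem_of_calculus)
      fix \<theta> :: real assume \<theta>: "\<theta> \<in> {0..1}"
      have im: "(\<lambda>\<theta>. t * (1 - \<theta>\<^sup>2)) ` {0..1} \<subseteq> {0..T}" using duhamel_time t by auto
      have d1: "((\<lambda>\<theta>. t * (1 - \<theta>\<^sup>2)) has_vector_derivative (- 2 * t * \<theta>)) (at \<theta> within {0..1})"
        unfolding has_real_derivative_iff_has_vector_derivative[symmetric]
        by (auto intro!: derivative_eq_intros)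
      have d2: "(Q has_vector_derivative q (t * (1 - \<theta>\<^sup>2))) (at (t * (1 - \<theta>\<^sup>2)) within {0..T})"
        unfolding Q_def by (rule integral_has_vector_derivative[OF q]) (use im \<theta> in blast)
      have d3: "(Q has_vector_derivative q (t * (1 - \<theta>\<^sup>2))) (at (t * (1 - \<theta>\<^sup>2)) within (\<lambda>\<theta>. t * (1
          - \<theta>\<^sup>2)) ` {0..1})"
        by (rule has_vector_derivative_within_subset[OF d2 im])
      have "((Q \<circ> (\<lambda>\<theta>. t * (1 - \<theta>\<^sup>2))) has_vector_derivative ((- 2 * t * \<theta>) *\<^sub>R q (t * (1
          - \<theta>\<^sup>2)))) (at \<theta> within {0..1})"
        by (rule vector_diff_chain_within[OF d1 d3])
      from has_vector_derivative_minus[OF this]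
      show "((\<lambda>\<theta>. - Q (t * (1 - \<theta>\<^sup>2))) has_vector_derivative (2 * t * \<theta>) *\<^sub>R q (t * (1
          - \<theta>\<^sup>2))) (at \<theta> within {0..1})"
        by (simp add: o_def)
    qed simp
    then show ?thesis by (simp add: Q_def)
  qed
  have "multiplier (trunc_heat k 0) (duhamel f t)
     = integral {0..1} (multiplier (trunc_heat k 0) \<circ> (\<lambda>\<theta>. multiplier (duhamel_symbol t \<theta>) (f (t
         * (1 - \<theta>\<^sup>2)))))"
    unfolding duhamel_def
    by (rule integral_linear[symmetric, OF integrable_continuous_real[OF
        continuous_on_duhamel_section[OF T f t]] bounded_linear_multiplier[OF bt(1)]])
  also have "\<dots> = integral {0..1} (multiplier (trunc_heat k t) \<circ> (\<lambda>\<theta>. (2 * t * \<theta>) *\<^sub>R q (t * (1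
      - \<theta>\<^sup>2))))"
    by (rule Henstock_Kurzweil_Integration.integral_cong) (simp add: pw)
  also have "\<dots> = multiplier (trunc_heat k t) (integral {0..1} (\<lambda>\<theta>. (2 * t * \<theta>) *\<^sub>R q (t * (1
      - \<theta>\<^sup>2))))"
    by (rule integral_linear[OF has_integral_integrable[OF sub] bounded_linear_multiplier[OF
        bt(1)]])
  also have "integral {0..1} (\<lambda>\<theta>. (2 * t * \<theta>) *\<^sub>R q (t * (1 - \<theta>\<^sup>2))) = Q t" by
      (rule integral_unique[OF sub])
  finally show "multiplier (trunc_heat k 0) (duhamel f t)
      = multiplier (trunc_heat k t) (integral {0..t} q)" unfolding Q_def .
qed

text \<open>
  A mild solution is differentiable in the weaker norm. Below any frequency this is the product
  rule; the resulting integrated identity no longer mentions unbounded operators, so the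
  truncation can be removed.
\<close>

lemma mild_solution_has_derivative:
  fixes f z :: "real \<Rightarrow> 'a::euclidean_space l2"
  assumes T: "T \<le> 1" and f: "continuous_on {0..T} f" and zc: "continuous_on {0..T} z"
    and z: "\<And>t. t \<in> {0..T} \<Longrightarrow> z t = multiplier (heat_symbol t) w0 + duhamel f t" and t: "t \<in> {0..T}"
  shows "((\<lambda>t. multiplier (weight (- 2)) (z t)) has_vector_derivative
    multiplier (weight (- 2)) (z t) - z t + multiplier (weight (- 1)) (f t)) (at t within {0..T})"
proof -
  have b1: "bounded_symbol (weight (- 1) :: 'a \<Rightarrow> complex)"
      and b2: "bounded_symbol (weight (- 2) :: 'a \<Rightarrow> complex)"
    by (auto intro: bounded_symbol_weight)
  note bt = bounded_symbol_trunc_heat bounded_symbol_trunc_weight bounded_symbol_trunc_lap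
  define D where "D t = multiplier (weight (- 2)) (z t) - z t + multiplier (weight (- 1)) (f t)"
      for t
  have Dc: "continuous_on {0..T} D"
    unfolding D_def by (intro continuous_intros bounded_linear.continuous_on[OF
        bounded_linear_multiplier] b1 b2 zc f)
  have trunc: "((\<lambda>t. multiplier (trunc_heat k 0) (multiplier (weight (- 2)) (z t)))
      has_vector_derivative multiplier (trunc_heat k 0) (D t)) (at t within {0..T})"
    if t: "t \<in> {0..T}" for k t
  proof -
    define q where "q = (\<lambda>\<tau>. multiplier (trunc_heat k (- \<tau>)) (multiplier (\<lambda>\<xi>. trunc_heat k 0 \<xi>
        * weight 1 \<xi>) (f \<tau>)))"
    note q = trunc_duhamel[OF T f, where k=k, folded q_def]
    define g where "g r = multiplier (trunc_heat k 0) w0 + integral {0..r} q" for r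
    have tz: "multiplier (trunc_heat k 0) (z r) = multiplier (trunc_heat k r) (g r)"
        if r: "r \<in> {0..T}" for r
    proof -
      have bh: "bounded_symbol (heat_symbol r)"
        by (rule bounded_symbolI[of _ 1]) (use r norm_heat_symbol_le in auto)
      have "(\<lambda>\<xi>::'a. trunc_heat k 0 \<xi> * heat_symbol r \<xi>)
          = (\<lambda>\<xi>. trunc_heat k r \<xi> * trunc_heat k 0 \<xi>)"
        by (auto simp: trunc_heat_def heat_symbol_def[of 0])
      then have "multiplier (trunc_heat k 0) (multiplier (heat_symbol r) w0)
          = multiplier (trunc_heat k r) (multiplier (trunc_heat k 0) w0)"
        by (simp add: multiplier_multiplier bt bh)
      then show ?thesis
        unfolding z[OF r] g_def using q(2)[OF r]
        by (simp add: bounded_linear_add[OF bounded_linear_multiplier[OF bt(1)]])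
    qed
    have "((\<lambda>r. integral {0..r} q) has_vector_derivative q t) (at t within {0..T})"
      by (rule integral_has_vector_derivative[OF q(1)[OF t] t])
    then have "(g has_vector_derivative 0 + q t) (at t within {0..T})"
      unfolding g_def[abs_def] by (intro has_vector_derivative_add has_vector_derivative_const)
    then have "((\<lambda>r. multiplier (trunc_heat k r) (g r)) has_vector_derivative
        multiplier (trunc_lap k) (multiplier (trunc_heat k t) (g t))
            + multiplier (trunc_heat k t) (q t)) (at t within {0..T})"
      using trunc_heat_has_derivative[OF _ t, of g "q t" k] by simp
    then have "((\<lambda>r. multiplier (weight (- 2)) (multiplier (trunc_heat k r) (g r)))
        has_vector_derivative
        multiplier (weight (- 2)) (multiplier (trunc_lap k) (multiplier (trunc_heat k t) (g t))
            + multiplier (trunc_heat k t) (q t))) (at t within {0..T})"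
      by (rule bounded_linear.has_vector_derivative[OF bounded_linear_multiplier[OF b2]])
    moreover have "multiplier (weight (- 2)) (multiplier (trunc_lap k) (multiplier (trunc_heat k t)
        (g t)) + multiplier (trunc_heat k t) (q t)) = multiplier (trunc_heat k 0) (D t)"
    proof -
      have s1: "weight (- 2) \<xi> * (trunc_lap k \<xi> * trunc_heat k 0 \<xi>)
          = trunc_heat k 0 \<xi> * weight (- 2) \<xi> - trunc_heat k 0 \<xi>" for \<xi> :: 'a
      proof -
        have "weight (- 2) \<xi> * weight 2 \<xi> = 1" by (simp add: weight_add)
        moreover have "weight 2 \<xi> = 1 + complex_of_real ((norm \<xi>)\<^sup>2)" unfolding weight_def
            using weight_base[of \<xi>] by (simp add: powr_one)
        ultimately have "weight (- 2) \<xi> * complex_of_real ((norm \<xi>)\<^sup>2) = 1 - weight (- 2) \<xi>" by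
            (simp add: algebra_simps)
        then have "- (weight (- 2) \<xi> * complex_of_real ((norm \<xi>)\<^sup>2)) = weight (- 2) \<xi> - 1" by simp
        then show ?thesis unfolding trunc_lap_def by (auto simp: trunc_heat_def heat_symbol_def)
      qed
      have s2: "weight (- 2) \<xi> * (trunc_heat k t \<xi> * (trunc_heat k (- t) \<xi> * (trunc_heat k 0 \<xi>
          * weight 1 \<xi>))) = trunc_heat k 0 \<xi> * weight (- 1) \<xi>" for \<xi> :: 'a
      proof -
        have "heat_symbol t \<xi> * heat_symbol (- t) \<xi> = 1" by
            (simp add: heat_symbol_def flip: of_real_mult exp_add)
        moreover have "weight (- 2) \<xi> * weight 1 \<xi> = weight (- 1) \<xi>" by (simp add: weight_add)
        ultimately show ?thesis by (auto simp: trunc_heat_def heat_symbol_def[of 0] mult_ac)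
      qed
      have "multiplier (weight (- 2)) (multiplier (trunc_lap k) (multiplier (trunc_heat k 0) x))
          = multiplier (trunc_heat k 0) (multiplier (weight (- 2)) x)
          - multiplier (trunc_heat k 0) x" for x :: "'a l2"
      proof -
        have "multiplier (weight (- 2)) (multiplier (trunc_lap k) (multiplier (trunc_heat k 0) x))
            = multiplier (\<lambda>\<xi>. trunc_heat k 0 \<xi> * weight (- 2) \<xi> - trunc_heat k 0 \<xi>) x"
          by (simp add: multiplier_multiplier bounded_symbol_mult bt b2 s1)
        also have "\<dots> = multiplier (\<lambda>\<xi>. trunc_heat k 0 \<xi> * weight (- 2) \<xi>) x
            - multiplier (trunc_heat k 0) x"
          unfolding multiplier_def left_diff_distrib
          by (subst to_l2_diff) (auto intro!: square_integrable_bounded_symbol bounded_symbol_mult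
              bt b2)
        finally show ?thesis by (simp add: multiplier_multiplier bt b2)
      qed
      then have "multiplier (weight (- 2)) (multiplier (trunc_lap k) (multiplier (trunc_heat k t) (g
          t))) = multiplier (trunc_heat k 0) (multiplier (weight (- 2)) (z t))
          - multiplier (trunc_heat k 0) (z t)"
        unfolding tz[OF t, symmetric] by blast
      moreover have "multiplier (weight (- 2)) (multiplier (trunc_heat k t) (q t))
          = multiplier (trunc_heat k 0) (multiplier (weight (- 1)) (f t))"
        by (simp add: q_def multiplier_multiplier bounded_symbol_mult bt b1 b2 s2)
      ultimately show ?thesis
        by (simp add: D_def bounded_linear_add[OF bounded_linear_multiplier] bounded_linear_diff[OF
            bounded_linear_multiplier] b1 b2 bt)
    qed
    ultimately have d: "((\<lambda>r. multiplier (weight (- 2)) (multiplier (trunc_heat k r) (g r)))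
        has_vector_derivative multiplier (trunc_heat k 0) (D t)) (at t within {0..T})"
      by simp
    have "multiplier (trunc_heat k 0) (multiplier (weight (- 2)) (z r))
        = multiplier (weight (- 2)) (multiplier (trunc_heat k r) (g r))" if "r \<in> {0..T}" for r
      unfolding tz[OF that, symmetric] by (simp add: multiplier_multiplier b2 bt mult.commute)
    from has_vector_derivative_transform[OF t this d] show ?thesis .
  qed
  have int: "multiplier (weight (- 2)) (z t) = multiplier (weight (- 2)) (z 0) + integral {0..t} D"
      if t: "t \<in> {0..T}" for t
  proof (rule trunc_zero_imp)
    fix k
    have "(multiplier (trunc_heat k 0) \<circ> D has_integral multiplier (trunc_heat k 0) (multiplier
        (weight (- 2)) (z t)) - multiplier (trunc_heat k 0) (multiplier (weight (- 2)) (z 0)))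
        {0..t}"
      unfolding o_def
    proof (rule fundamental_theorem_of_calculus)
      fix x assume "x \<in> {0..t}"
      then have x: "x \<in> {0..T}" using t by auto
      show "((\<lambda>t. multiplier (trunc_heat k 0) (multiplier (weight (- 2)) (z t)))
          has_vector_derivative multiplier (trunc_heat k 0) (D x)) (at x within {0..t})"
        by (rule has_vector_derivative_within_subset[OF trunc[OF x]]) (use t in auto)
    qed (use t in auto)
    moreover have "integral {0..t} (multiplier (trunc_heat k 0) \<circ> D)
        = multiplier (trunc_heat k 0) (integral {0..t} D)"
      by (rule integral_linear[OF integrable_continuous_real bounded_linear_multiplier[OF bt(1)]])
        (rule continuous_on_subset[OF Dc], use t in auto)
    ultimately have "multiplier (trunc_heat k 0) (integral {0..t} D)
        = multiplier (trunc_heat k 0) (multiplier (weight (- 2)) (z t))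
        - multiplier (trunc_heat k 0) (multiplier (weight (- 2)) (z 0))"
      using integral_unique by metis
    then show "multiplier (trunc_heat k 0) (multiplier (weight (- 2)) (z t))
        = multiplier (trunc_heat k 0) (multiplier (weight (- 2)) (z 0) + integral {0..t} D)"
      by (simp add: bounded_linear_add[OF bounded_linear_multiplier[OF bt(1)]])
  qed
  have "((\<lambda>r. integral {0..r} D) has_vector_derivative D t) (at t within {0..T})"
    by (rule integral_has_vector_derivative[OF Dc t])
  then have "((\<lambda>r. multiplier (weight (- 2)) (z 0) + integral {0..r} D)
      has_vector_derivative 0 + D t) (at t within {0..T})"
    by (intro has_vector_derivative_add has_vector_derivative_const)
  then have "((\<lambda>r. multiplier (weight (- 2)) (z r)) has_vector_derivative D t) (at t within {0..T})"
    using has_vector_derivative_transform[OF t int] by simp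
  then show ?thesis unfolding D_def .
qed

section \<open>The nonlinear evolution in \<open>l2\<close>\<close>

lemma norm_multiplier_riesz_symbol_le: "b \<in> Basis \<Longrightarrow> norm (multiplier (riesz_symbol b) w) \<le> norm w"
  using norm_multiplier_le[of "riesz_symbol b" 1 w] norm_riesz_symbol_le by auto

text \<open>The nonlinearity is quadratic in \<open>w\<close>, so differences factor.\<close>

lemma nonlinearity_bounds:
  assumes r: "r > real DIM('a) / 2"
  obtains C where "C \<ge> 0"
    "\<And>w v :: 'a::euclidean_space l2. norm (nonlinearity r w v) \<le> C * (norm w)\<^sup>2 * norm v"
    "\<And>w w' v :: 'a l2. norm (nonlinearity r w v - nonlinearity r w' v)
        \<le> C * (norm w + norm w') * norm (w - w') * norm v"
proof -
  interpret B: bounded_bilinear "sobolev_product r :: 'a l2 \<Rightarrow> 'a l2 \<Rightarrow> 'a l2" by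
      (rule bounded_bilinear_sobolev_product[OF r])
  obtain K where K: "K > 0" "\<And>v w :: 'a l2. norm (sobolev_product r v w) \<le> norm v * norm w * K"
    using B.pos_bounded by blast
  define C where "C = real DIM('a) * (K * K)"
  have tri: "norm (sobolev_product r (sobolev_product r a b) v)
      \<le> norm a * norm b * norm v * (K * K)" for a b v :: "'a l2"
  proof -
    have "norm (sobolev_product r (sobolev_product r a b) v)
        \<le> norm (sobolev_product r a b) * norm v * K" by (rule K(2))
    also have "\<dots> \<le> (norm a * norm b * K) * norm v * K"
      using K by (intro mult_right_mono K(2)) auto
    finally show ?thesis by (simp add: mult_ac)
  qed
  show thesis
  proof (rule that[of C])
    show "C \<ge> 0" using K by (simp add: C_def)
    fix w w' v :: "'a l2"
    have "norm (nonlinearity r w v) \<le> (\<Sum>b\<in>(Basis::'a set). norm w * norm w * norm v * (K * K))"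
      unfolding nonlinearity_def
    proof (rule sum_norm_le)
      fix b :: 'a assume b: "b \<in> Basis"
      note nb = norm_multiplier_riesz_symbol_le[OF b, of w]
      show "norm (sobolev_product r (sobolev_product r (multiplier (riesz_symbol b) w) (multiplier
          (riesz_symbol b) w)) v) \<le> norm w * norm w * norm v * (K * K)"
        by (rule order_trans[OF tri]) (intro mult_right_mono mult_mono nb, use K in auto)
    qed
    then show "norm (nonlinearity r w v) \<le> C * (norm w)\<^sup>2 * norm v"
      by (simp add: C_def power2_eq_square mult_ac)
    have "norm (nonlinearity r w v - nonlinearity r w' v)
        \<le> (\<Sum>b\<in>(Basis::'a set). norm (w - w') * (norm w + norm w') * norm v * (K * K))"
      unfolding nonlinearity_def sum_subtractf[symmetric]
    proof (rule sum_norm_le)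
      fix b :: 'a assume b: "b \<in> Basis"
      define p where "p = multiplier (riesz_symbol b) w"
      define p' where "p' = multiplier (riesz_symbol b) w'"
      have pd: "p - p' = multiplier (riesz_symbol b) (w - w')"
        by (simp add: p_def p'_def bounded_linear_diff[OF bounded_linear_multiplier[OF
            bounded_symbol_riesz_symbol[OF b]]])
      have "sobolev_product r (sobolev_product r p p) v - sobolev_product r (sobolev_product r p'
          p') v = sobolev_product r (sobolev_product r (p - p') p) v
          + sobolev_product r (sobolev_product r p' (p - p')) v"
        by (simp add: B.diff_left B.diff_right)
      also have "norm \<dots> \<le> norm (p - p') * norm p * norm v * (K * K) + norm p' * norm (p - p')
          * norm v * (K * K)"
        by (intro order_trans[OF norm_triangle_ineq] add_mono tri)
      also have "\<dots> \<le> norm (w - w') * norm w * norm v * (K * K) + norm w' * norm (w - w') * norm v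
          * (K * K)"
        unfolding pd unfolding p_def p'_def by (intro add_mono mult_right_mono mult_mono
            norm_multiplier_riesz_symbol_le b) (use K in auto)
      also have "\<dots> = norm (w - w') * (norm w + norm w') * norm v * (K * K)" by
          (simp add: algebra_simps)
      finally show "norm (sobolev_product r (sobolev_product r (multiplier (riesz_symbol b) w)
          (multiplier (riesz_symbol b) w)) v - sobolev_product r (sobolev_product r (multiplier
          (riesz_symbol b) w') (multiplier (riesz_symbol b) w')) v)
          \<le> norm (w - w') * (norm w + norm w') * norm v * (K * K)"
        by (simp add: p_def p'_def)
    qed
    then show "norm (nonlinearity r w v - nonlinearity r w' v)
        \<le> C * (norm w + norm w') * norm (w - w') * norm v"
      by (simp add: C_def mult_ac)
  qed
qed

lemma continuous_on_nonlinearity: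
  fixes w v :: "real \<Rightarrow> 'a::euclidean_space l2"
  assumes r: "r > real DIM('a) / 2" and w: "continuous_on S w" and v: "continuous_on S v"
  shows "continuous_on S (\<lambda>t. nonlinearity r (w t) (v t))"
  unfolding nonlinearity_def
  by (intro continuous_on_sum bounded_bilinear.continuous_on[OF bounded_bilinear_sobolev_product[OF
      r]]
    bounded_linear.continuous_on[OF bounded_linear_multiplier] bounded_symbol_riesz_symbol w v)

text \<open>The coordinate of a product of real functions is the coordinate of a real function.\<close>

lemma conj_reflect_sobolev_product:
  fixes v w :: "'a::euclidean_space l2"
  assumes r: "r > real DIM('a) / 2" and "conj_reflect v = v" "conj_reflect w = w"
  shows "conj_reflect (sobolev_product r v w) = sobolev_product r v w"
proof -
  have r0: "r \<ge> 0" using less_imp_le[OF r] by (rule order_trans[rotated]) simp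
  obtain f g where "f \<in> sobolev_space r" "sobolev_coord r f
      = v" "g \<in> sobolev_space r" "sobolev_coord r g = w"
    using sobolev_coord_surj[OF r0] assms by metis
  then show ?thesis using sobolev_coord_mult[OF r, of f g] sobolev_coord_conj_reflect[OF r0,
      of "\<lambda>x. f x * g x"] by simp
qed

lemma conj_reflect_nonlinearity:
  fixes v w :: "'a::euclidean_space l2"
  assumes r: "r > real DIM('a) / 2" and w: "conj_reflect w = w" and v: "conj_reflect v = v"
  shows "conj_reflect (nonlinearity r w v) = nonlinearity r w v"
proof -
  have "conj_reflect (multiplier (riesz_symbol b) w) = multiplier (riesz_symbol b) w" if "b \<in> Basis"
      for b
    by (simp add: conj_reflect_multiplier bounded_symbol_riesz_symbol that w)
  then show ?thesis
    unfolding nonlinearity_def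
    by (simp add: linear_sum[OF bounded_linear.linear[OF bounded_linear_conj_reflect]]
        conj_reflect_sobolev_product[OF r] v)
qed

text \<open>
  The smallness factor \<open>sqrt T\<close> in the bound for the Duhamel integral makes the mild formulation a
  contraction on a ball of curves; the invariance under \<open>conj_reflect\<close> keeps the solution real.
\<close>

lemma mild_solution_exists:
  fixes w0 :: "'a::euclidean_space l2" and \<beta> :: "real \<Rightarrow> 'a l2"
  assumes r: "r > real DIM('a) / 2" and \<beta>c: "continuous_on {0..} \<beta>" and M: "\<And>t. t \<ge> 0 \<Longrightarrow> norm (\<beta> t)
      \<le> M"
    and \<beta>r: "\<And>t. t \<ge> 0 \<Longrightarrow> conj_reflect (\<beta> t) = \<beta> t" and w0: "conj_reflect w0 = w0"
  shows "\<exists>T z. 0 < T \<and> T \<le> 1 \<and> continuous_on {0..T} z \<and> (\<forall>t\<in>{0..T}. conj_reflect (z t) = z t \<and>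
     z t = multiplier (heat_symbol t) w0 + duhamel (\<lambda>\<tau>. nonlinearity r (z \<tau>) (\<beta> \<tau>)) t)"
proof -
  obtain C where C: "C \<ge> 0" "\<And>w v :: 'a l2. norm (nonlinearity r w v) \<le> C * (norm w)\<^sup>2 * norm v"
    "\<And>w w' v :: 'a l2. norm (nonlinearity r w v - nonlinearity r w' v)
        \<le> C * (norm w + norm w') * norm (w - w') * norm v"
    using nonlinearity_bounds[OF r] by blast
  have M0: "M \<ge> 0" using M[of 0] norm_ge_zero order_trans by blast
  define \<rho> where "\<rho> = norm w0 + 1"
  have \<rho>: "\<rho> > 0" by (simp add: \<rho>_def add_nonneg_pos)
  define p where "p = C * M * (\<rho>\<^sup>2 + \<rho>)"
  have p: "p \<ge> 0" unfolding p_def using C M0 \<rho> by simp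
  \<comment> \<open>Small enough for the two smallness conditions below; the summand 16 keeps \<open>T\<close> below 1.\<close>
  define T where "T = (1 / (16 * p + 16))\<^sup>2"
  have sT: "sqrt T = 1 / (16 * p + 16)" unfolding T_def using p by simp
  have T: "0 < T" "T \<le> 1" unfolding T_def using p by
      (auto intro!: power_le_one simp: divide_le_eq_1)
  have T0: "0 \<le> T" using T by simp
  have small1: "4 * sqrt T * (C * \<rho>\<^sup>2 * M) \<le> 1"
  proof -
    have "C * \<rho>\<^sup>2 * M \<le> p" unfolding p_def using C M0 \<rho> by (simp add: algebra_simps)
    then have "4 * (C * \<rho>\<^sup>2 * M) \<le> 16 * p + 16" using p by linarith
    then show ?thesis unfolding sT using p by (simp add: divide_le_eq)
  qed
  have small2: "4 * sqrt T * (C * (\<rho> + \<rho>) * M) \<le> 1 / 2"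
  proof -
    have "C * (\<rho> + \<rho>) * M \<le> 2 * p" unfolding p_def using C M0 \<rho> by (simp add: algebra_simps)
    then have "2 * (4 * (C * (\<rho> + \<rho>) * M)) \<le> 16 * p + 16" using p by linarith
    then show ?thesis unfolding sT using p by (simp add: divide_le_eq)
  qed
  \<comment> \<open>Curves on \<open>{0..T}\<close> are extended to constants, since bounded continuous functions live on the
      line.\<close>
  define cl where "cl t = max 0 (min T t)" for t
  have cl: "cl t \<in> {0..T}" for t using T by (auto simp: cl_def)
  have cl_id: "cl t = t" if "t \<in> {0..T}" for t using that by (auto simp: cl_def)
  have clc: "continuous_on UNIV cl" unfolding cl_def by (intro continuous_intros)
  define f where "f w \<tau> = nonlinearity r (apply_bcontfun w \<tau>) (\<beta> \<tau>)" for w :: "real \<Rightarrow>\<^sub>C 'a l2" and \<tau>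
  have fc: "continuous_on {0..T} (f w)" for w
    unfolding f_def by (intro continuous_on_nonlinearity[OF r] continuous_on_apply_bcontfun
        continuous_on_subset[OF \<beta>c]) auto
  define S where "S = PiC UNIV (\<lambda>_::real. {x. norm x \<le> \<rho> \<and> conj_reflect x = (x :: 'a l2)})"
  have S_iff: "w \<in> S \<longleftrightarrow> (\<forall>t. norm (apply_bcontfun w t) \<le> \<rho> \<and> conj_reflect (apply_bcontfun w t)
      = apply_bcontfun w t)" for w
    unfolding S_def mem_PiC_iff by auto
  have closedS: "closed S"
  proof -
    have "closed {x. norm x \<le> \<rho> \<and> conj_reflect x = (x :: 'a l2)}"
      by (intro closed_Collect_conj closed_Collect_le closed_Collect_eq continuous_intros
        bounded_linear.continuous_on[OF bounded_linear_conj_reflect])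
    then show ?thesis unfolding S_def by (intro closed_PiC) auto
  qed
  have neS: "S \<noteq> {}"
  proof -
    have "0 \<in> S" unfolding S_iff using \<rho>
      by (auto simp: zero_bcontfun.rep_eq linear_0[OF bounded_linear.linear[OF
          bounded_linear_conj_reflect]])
    then show ?thesis by blast
  qed
  define \<Psi> where "\<Psi> w t = multiplier (heat_symbol t) w0 + duhamel (f w) t" for w t
  have \<Psi>c: "continuous_on {0..T} (\<Psi> w)" for w
    unfolding \<Psi>_def
  proof (intro continuous_on_add continuous_on_duhamel T fc)
    show "continuous_on {0..T} (\<lambda>t. multiplier (heat_symbol t) w0)"
      by (rule continuous_on_multiplier[where C=1])
          (auto intro: norm_heat_symbol_le continuous_on_heat_symbol)
  qed
  have f_bd: "norm (f w \<tau>) \<le> C * \<rho>\<^sup>2 * M" if "w \<in> S" "\<tau> \<in> {0..T}" for w \<tau>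
  proof -
    have "norm (f w \<tau>) \<le> C * (norm (apply_bcontfun w \<tau>))\<^sup>2 * norm (\<beta> \<tau>)" unfolding f_def by
        (rule C(2))
    also have "\<dots> \<le> C * \<rho>\<^sup>2 * M"
      using that C(1) M[of \<tau>] \<rho> unfolding S_iff by (intro mult_mono power_mono) auto
    finally show ?thesis .
  qed
  have \<Psi>_bd: "norm (\<Psi> w t) \<le> \<rho>" if w: "w \<in> S" and t: "t \<in> {0..T}" for w t
  proof -
    have "norm (multiplier (heat_symbol t) w0) \<le> 1 * norm w0"
      by (rule norm_multiplier_le) (use t norm_heat_symbol_le in auto)
    moreover have "norm (duhamel (f w) t) \<le> 4 * sqrt T * (C * \<rho>\<^sup>2 * M)"
      by (rule norm_duhamel_le[OF T(2) fc t f_bd[OF w]])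
    ultimately show ?thesis
      using norm_triangle_ineq[of "multiplier (heat_symbol t) w0" "duhamel (f w) t"] small1 \<rho>_def
          unfolding \<Psi>_def by linarith
  qed
  have \<Psi>_real: "conj_reflect (\<Psi> w t) = \<Psi> w t" if w: "w \<in> S" and t: "t \<in> {0..T}" for w t
  proof -
    have b: "bounded_symbol (heat_symbol t :: 'a \<Rightarrow> complex)"
      by (rule bounded_symbolI[of _ 1]) (use t norm_heat_symbol_le in auto)
    have "cnj (heat_symbol t (- \<xi>)) = heat_symbol t \<xi>" for \<xi> :: 'a by (simp add: heat_symbol_def)
    then have "conj_reflect (multiplier (heat_symbol t) w0) = multiplier (heat_symbol t) w0"
      by (simp add: conj_reflect_multiplier[OF b] w0)
    moreover have "conj_reflect (duhamel (f w) t) = duhamel (f w) t"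
      by (rule conj_reflect_duhamel[OF T(2) fc t])
          (use w \<beta>r in \<open>auto simp: f_def S_iff intro!: conj_reflect_nonlinearity[OF r]\<close>)
    ultimately show ?thesis unfolding \<Psi>_def by
        (simp add: bounded_linear_add[OF bounded_linear_conj_reflect])
  qed
  define \<Phi> where "\<Phi> w = Bcontfun (\<lambda>t. \<Psi> w (cl t))" for w
  have \<Phi>: "apply_bcontfun (\<Phi> w) t = \<Psi> w (cl t)" if "w \<in> S" for w t
  proof -
    have "(\<lambda>t. \<Psi> w (cl t)) \<in> bcontfun"
      by (rule bcontfun_normI[OF continuous_on_compose2[OF \<Psi>c clc]]) (use cl \<Psi>_bd[OF that] in auto)
    then show ?thesis unfolding \<Phi>_def by (simp add: Bcontfun_inverse)
  qed
  have "\<exists>!w\<in>S. \<Phi> w = w"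
  proof (rule Banach_fix[OF complete_eq_closed[THEN iffD2, OF closedS] neS, of "1/2"])
    show "\<Phi> ` S \<subseteq> S"
      using \<Psi>_bd \<Psi>_real cl by (auto simp: S_iff[of "\<Phi> _"] \<Phi>)
    show "dist (\<Phi> v) (\<Phi> w) \<le> 1 / 2 * dist v w" if v: "v \<in> S" and w: "w \<in> S" for v w
    proof (rule dist_bound)
      fix t
      have dfb: "norm (f v \<tau> - f w \<tau>) \<le> C * (\<rho> + \<rho>) * M * dist v w" if \<tau>: "\<tau> \<in> {0..T}" for \<tau>
      proof -
        have "norm (f v \<tau> - f w \<tau>) \<le> C * (norm (apply_bcontfun v \<tau>) + norm (apply_bcontfun w \<tau>))
            * norm (apply_bcontfun v \<tau> - apply_bcontfun w \<tau>) * norm (\<beta> \<tau>)"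
          unfolding f_def by (rule C(3))
        also have "\<dots> \<le> C * (\<rho> + \<rho>) * dist v w * M"
        proof (intro mult_mono add_mono)
          show "norm (apply_bcontfun v \<tau> - apply_bcontfun w \<tau>) \<le> dist v w"
            using dist_bounded[of v \<tau> w] by (simp add: dist_norm)
        qed (use v w \<tau> C(1) M[of \<tau>] \<rho> in \<open>auto simp: S_iff\<close>)
        finally show ?thesis by (simp add: mult_ac)
      qed
      have "dist (apply_bcontfun (\<Phi> v) t) (apply_bcontfun (\<Phi> w) t)
          = norm (duhamel (\<lambda>\<tau>. f v \<tau> - f w \<tau>) (cl t))"
        unfolding \<Phi>[OF v] \<Phi>[OF w] dist_norm \<Psi>_def duhamel_diff[OF T(2) fc fc cl, symmetric] by simp
      also have "\<dots> \<le> 4 * sqrt T * (C * (\<rho> + \<rho>) * M * dist v w)"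
        by (rule norm_duhamel_le[OF T(2) _ cl dfb]) (intro continuous_intros fc)
      also have "\<dots> = 4 * sqrt T * (C * (\<rho> + \<rho>) * M) * dist v w" by simp
      also have "\<dots> \<le> 1 / 2 * dist v w" by (rule mult_right_mono[OF small2]) simp
      finally show "dist (apply_bcontfun (\<Phi> v) t) (apply_bcontfun (\<Phi> w) t) \<le> 1 / 2 * dist v w" .
    qed
  qed auto
  then obtain w where w: "w \<in> S" "\<Phi> w = w" by blast
  have fix_eq: "apply_bcontfun w t = \<Psi> w t" if "t \<in> {0..T}" for t
    using \<Phi>[OF w(1), of t] w(2) cl_id[OF that] by simp
  show ?thesis
  proof (intro exI conjI ballI)
    show "continuous_on {0..T} (apply_bcontfun w)" by simp
    show "conj_reflect (apply_bcontfun w t) = apply_bcontfun w t" for t using w(1) by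
        (simp add: S_iff)
    show "apply_bcontfun w t = multiplier (heat_symbol t) w0 + duhamel (\<lambda>\<tau>. nonlinearity r
        (apply_bcontfun w \<tau>) (\<beta> \<tau>)) t"
      if "t \<in> {0..T}" for t
      using fix_eq[OF that] unfolding \<Psi>_def f_def .
  qed (use T in auto)
qed

text \<open>
  Energy estimate for the difference \<open>z\<close> of two solutions. The energy is taken one order below the
  order of the solutions, where its derivative exists although \<open>z\<close> itself is only continuous; the
  dissipation \<open>- norm (z t)\<^sup>2\<close> absorbs the loss of one derivative in the nonlinearity.
\<close>

lemma energy_uniqueness:
  fixes z d :: "real \<Rightarrow> 'a::euclidean_space l2"
  assumes zc: "continuous_on {0..T} z" and z0: "z 0 = 0"
    and der: "\<And>t. t \<in> {0..T} \<Longrightarrow> ((\<lambda>t. multiplier (weight (- 2)) (z t)) has_vector_derivative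
        multiplier (weight (- 2)) (z t) - z t + multiplier (weight (- 1)) (d t)) (at t within
            {0..T})"
    and d: "\<And>t. t \<in> {0..T} \<Longrightarrow> norm (d t) \<le> K * norm (z t)" and t: "t \<in> {0..T}"
  shows "z t = 0"
proof -
  have b1: "bounded_symbol (weight (- 1) :: 'a \<Rightarrow> complex)"
      and b2: "bounded_symbol (weight (- 2) :: 'a \<Rightarrow> complex)"
    by (auto intro: bounded_symbol_weight)
  define A where "A = (multiplier (weight (- 2)) :: 'a l2 \<Rightarrow> 'a l2)"
  define B where "B = (multiplier (weight (- 1)) :: 'a l2 \<Rightarrow> 'a l2)"
  have blA: "bounded_linear A" and blB: "bounded_linear B"
    unfolding A_def B_def by (auto intro: bounded_linear_multiplier b1 b2)
  \<comment> \<open>Symmetry moves the difference quotient onto \<open>A z\<close>, so that \<open>z\<close> need not be differentiable.\<close>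
  have symA: "A x \<bullet> y = x \<bullet> A y" for x y
    unfolding A_def weight_def by (rule multiplier_inner_symmetric)
        (use b2 in \<open>simp add: weight_def[abs_def]\<close>)
  have symB: "B x \<bullet> y = x \<bullet> B y" for x y
    unfolding B_def weight_def by (rule multiplier_inner_symmetric)
        (use b1 in \<open>simp add: weight_def[abs_def]\<close>)
  have AB: "A x = B (B x)" for x unfolding A_def B_def by
      (simp add: multiplier_multiplier b1 weight_add)
  define E where "E t = A (z t) \<bullet> z t" for t
  have E: "E t = (norm (B (z t)))\<^sup>2" for t unfolding E_def AB symB power2_norm_eq_inner ..
  have Ec: "continuous_on {0..T} E"
    unfolding E_def by (intro continuous_intros bounded_linear.continuous_on[OF blA] zc)
  define E' where "E' t = (A (z t) - z t + B (d t)) \<bullet> (z t + z t)" for t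
  have Eder: "(E has_vector_derivative E' t) (at t within {0..T})" if t: "t \<in> {0..T}" for t
    unfolding has_vector_derivative_iff_quotient
  proof -
    have zt: "(z \<longlongrightarrow> z t) (at t within {0..T})" using zc t by (simp add: continuous_on_def)
    have q: "((\<lambda>r. (1 / (r - t)) *\<^sub>R (A (z r) - A (z t)))
        \<longlongrightarrow> A (z t) - z t + B (d t)) (at t within {0..T})"
      using der[OF t] unfolding has_vector_derivative_iff_quotient A_def B_def .
    have "((\<lambda>r. ((1 / (r - t)) *\<^sub>R (A (z r) - A (z t))) \<bullet> (z r + z t)) \<longlongrightarrow> E' t) (at t within {0..T})"
      unfolding E'_def by (intro tendsto_inner q tendsto_add zt tendsto_const)
    moreover have "((1 / (r - t)) *\<^sub>R (A (z r) - A (z t))) \<bullet> (z r + z t)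
        = (1 / (r - t)) *\<^sub>R (E r - E t)" for r
    proof -
      have "(A (z r) - A (z t)) \<bullet> (z r + z t) = E r - E t"
        using symA[of "z r" "z t"] by (simp add: E_def inner_diff_left inner_add_right
            inner_commute[of "z r" "A (z t)"])
      then show ?thesis by simp
    qed
    ultimately show "((\<lambda>r. (1 / (r - t)) *\<^sub>R (E r - E t)) \<longlongrightarrow> E' t) (at t within {0..T})" by
        (simp only:)
  qed
  define c where "c = 2 + K\<^sup>2 / 2"
  have E'_le: "E' t \<le> c * E t" if t: "t \<in> {0..T}" for t
  proof -
    define x where "x = norm (z t)"
    define y where "y = norm (B (z t))"
    have "B (d t) \<bullet> z t \<le> norm (d t) * y" unfolding symB y_def by (rule norm_cauchy_schwarz)
    also have "\<dots> \<le> (K * x) * y" unfolding x_def y_def by (intro mult_right_mono d t) simp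
    finally have "B (d t) \<bullet> z t \<le> K * x * y" .
    \<comment> \<open>Completing the square: the dissipation absorbs all of \<open>x\<close>.\<close>
    moreover have "2 * (K * x * y) \<le> 2 * x\<^sup>2 + K\<^sup>2 / 2 * y\<^sup>2"
      using zero_le_power2[of "2 * x - K * y"] by
          (simp add: power2_diff power_mult_distrib algebra_simps)
    moreover have "E' t = 2 * y\<^sup>2 - 2 * x\<^sup>2 + 2 * (B (d t) \<bullet> z t)"
      unfolding E'_def x_def y_def using E[of t]
      by (simp add: E_def inner_add_left inner_add_right inner_diff_left power2_norm_eq_inner)
    ultimately have "E' t \<le> 2 * y\<^sup>2 + K\<^sup>2 / 2 * y\<^sup>2" by linarith
    then show ?thesis unfolding c_def E y_def[symmetric] by (simp add: algebra_simps)
  qed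
  have "exp (- c * t) * E t \<le> exp (- c * 0) * E 0"
  proof (rule DERIV_nonpos_imp_decreasing_open[where f="\<lambda>t. exp (- c * t) * E t" and a=0 and b=t])
    show "0 \<le> t" using t by simp
    show "continuous_on {0..t} (\<lambda>t. exp (- c * t) * E t)"
      by (intro continuous_intros continuous_on_subset[OF Ec]) (use t in auto)
    fix x assume x: "0 < x" "x < t"
    have "(E has_real_derivative E' x) (at x within {0..T})"
      using Eder[of x] x t by (simp add: has_real_derivative_iff_has_vector_derivative)
    moreover have "at x within {0..T} = at x"
      by (rule at_within_interior) (use x t in auto)
    ultimately have "(E has_real_derivative E' x) (at x)" by simp
    then have "((\<lambda>t. exp (- c * t) * E t) has_real_derivative exp (- c * x) * (E' x - c
        * E x)) (at x)"
      by (auto intro!: derivative_eq_intros simp: algebra_simps)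
    moreover have "exp (- c * x) * (E' x - c * E x) \<le> 0"
      using E'_le[of x] x t by (simp add: mult_le_0_iff)
    ultimately show "\<exists>y. ((\<lambda>t. exp (- c * t) * E t) has_real_derivative y) (at x) \<and> y \<le> 0" by blast
  qed
  also have "\<dots> = 0" by (simp add: E_def z0)
  finally have "E t \<le> 0" by (simp add: mult_le_0_iff)
  then have "B (z t) = 0" unfolding E by simp
  then have "multiplier (weight (- 1)) (z t) = multiplier (weight (- 1)) 0"
    unfolding B_def[symmetric] by (simp add: linear_0[OF bounded_linear.linear[OF blB]])
  then show "z t = 0" by (simp add: multiplier_weight_inject)
qed

section \<open>Local well-posedness\<close>

lemma sobolev_continuous_on_iff:
  fixes u :: "real \<Rightarrow> 'a::euclidean_space \<Rightarrow> real"
  assumes s: "s \<ge> 0"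
  shows "sobolev_continuous_on s I u \<longleftrightarrow> (\<forall>t\<in>I. u t \<in> sobolev_space s)
      \<and> continuous_on I (\<lambda>t. sobolev_coord s (u t))"
proof (cases "\<forall>t\<in>I. u t \<in> sobolev_space s")
  case True
  have "((\<lambda>r. sobolev_norm s (\<lambda>x. u r x - u t x)) \<longlongrightarrow> 0) (at t within I)
     \<longleftrightarrow> ((\<lambda>r. sobolev_coord s (u r)) \<longlongrightarrow> sobolev_coord s (u t)) (at t within I)" if t: "t \<in> I" for t
  proof -
    have "((\<lambda>r. sobolev_norm s (\<lambda>x. u r x - u t x)) \<longlongrightarrow> 0) (at t within I)
       \<longleftrightarrow> ((\<lambda>r. norm (sobolev_coord s (u r) - sobolev_coord s (u t))) \<longlongrightarrow> 0) (at t within I)"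
    proof (rule tendsto_cong)
      have "sobolev_norm s (\<lambda>x. u r x - u t x)
          = norm (sobolev_coord s (u r) - sobolev_coord s (u t))" if "r \<in> I" for r
        using sobolev_coord_diff[OF s, of "u r" "u t"] True t that sobolev_norm_eq[of "\<lambda>x. u r x
            - u t x" s] by simp
      then show "\<forall>\<^sub>F r in at t within I. sobolev_norm s (\<lambda>x. u r x - u t x)
          = norm (sobolev_coord s (u r) - sobolev_coord s (u t))"
        by (auto simp: eventually_at_filter)
    qed
    then show ?thesis by (simp add: tendsto_norm_zero_iff LIM_zero_iff)
  qed
  then show ?thesis using True by (simp add: sobolev_continuous_on_def continuous_on_def)
qed (auto simp: sobolev_continuous_on_def)

lemma has_sobolev_time_derivative_iff:
  fixes u :: "real \<Rightarrow> 'a::euclidean_space \<Rightarrow> real"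
  assumes s: "s \<ge> 0" and t: "t \<in> I" and u: "\<And>r. r \<in> I \<Longrightarrow> u r \<in> sobolev_space s"
      and v: "v \<in> sobolev_space s"
  shows "has_sobolev_time_derivative s I u t v \<longleftrightarrow>
    ((\<lambda>r. sobolev_coord s (u r)) has_vector_derivative sobolev_coord s v) (at t within I)"
proof -
  have "sobolev_norm s (\<lambda>x. (u r x - u t x) / (r - t) - v x)
      = norm ((1 / (r - t)) *\<^sub>R (sobolev_coord s (u r) - sobolev_coord s (u t)) - sobolev_coord s v)"
          if r: "r \<in> I" for r
  proof -
    note 1 = sobolev_coord_diff[OF s u[OF r] u[OF t]]
    note 2 = sobolev_coord_cmult[OF s conjunct1[OF 1], of "1 / (r - t)"]
    note 3 = sobolev_coord_diff[OF s conjunct1[OF 2] v]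
    have e: "(u r x - u t x) / (r - t) - v x = 1 / (r - t) * (u r x - u t x) - v x" for x by simp
    show ?thesis unfolding e using 1 2 3 by (simp only: sobolev_norm_eq[OF conjunct1[OF 3]])
  qed
  then have "((\<lambda>r. sobolev_norm s (\<lambda>x. (u r x - u t x) / (r - t) - v x)) \<longlongrightarrow> 0) (at t within I) \<longleftrightarrow>
     ((\<lambda>r. norm ((1 / (r - t)) *\<^sub>R (sobolev_coord s (u r) - sobolev_coord s (u t))
         - sobolev_coord s v)) \<longlongrightarrow> 0) (at t within I)"
    by (intro tendsto_cong) (auto simp: eventually_at_filter intro!: always_eventually)
  then show ?thesis
    using u v by (simp add: has_sobolev_time_derivative_def has_vector_derivative_iff_quotient
        tendsto_norm_zero_iff LIM_zero_iff)
qed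

lemma sobolev_coord_right_hand_side:
  fixes f \<beta> :: "'a::euclidean_space \<Rightarrow> real"
  assumes s: "s - 1 > real DIM('a) / 2" "s \<ge> 2" and f: "f \<in> sobolev_space s"
    and G: "has_weak_gradient f G" and L: "has_weak_laplacian f L"
        and \<beta>: "\<beta> \<in> sobolev_space (s - 1)"
  shows "(\<lambda>x. L x + (norm (G x))\<^sup>2 * \<beta> x) \<in> sobolev_space (s - 2) \<and>
    sobolev_coord (s - 2) (\<lambda>x. L x + (norm (G x))\<^sup>2 * \<beta> x)
      = multiplier (weight (- 2)) (sobolev_coord s f) - sobolev_coord s f
          + multiplier (weight (- 1)) (nonlinearity (s - 1) (sobolev_coord s f) (sobolev_coord (s
          - 1) \<beta>))"
proof -
  note N = sobolev_coord_nonlinearity[OF s(1) f G \<beta>]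
  have N2: "(\<lambda>x. (norm (G x))\<^sup>2 * \<beta> x) \<in> sobolev_space (s - 2) \<and>
     sobolev_coord (s - 2) (\<lambda>x. (norm (G x))\<^sup>2 * \<beta> x)
         = multiplier (weight (- 1)) (nonlinearity (s - 1) (sobolev_coord s f) (sobolev_coord (s
         - 1) \<beta>))"
    using sobolev_coord_lower[of "s - 2" "s - 1", OF _ _ conjunct1[OF N]] N s(2) by simp
  note L2 = weak_laplacian_sobolev_coord[OF s(2) f L]
  show ?thesis using sobolev_coord_add[of "s - 2" L "\<lambda>x. (norm (G x))\<^sup>2 * \<beta> x"] L2 N2 s(2) by simp
qed

text \<open>
  The partial differential equation as an ordinary differential equation in \<open>l2\<close>. Weak gradients
  and Laplacians exist and are determined by \<open>u t\<close>, so the quantifiers over them disappear.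
\<close>

lemma solves_cauchy_problem_iff:
  fixes u b :: "real \<Rightarrow> 'a::euclidean_space \<Rightarrow> real"
  assumes s: "s - 1 > real DIM('a) / 2" "s \<ge> 2" and u: "\<And>t. t \<in> {0..T} \<Longrightarrow> u t \<in> sobolev_space s"
    and b: "\<And>t. t \<in> {0..T} \<Longrightarrow> b t \<in> sobolev_space (s - 1)"
  shows "solves_cauchy_problem s T b u0 u \<longleftrightarrow> (AE x in lborel. u 0 x = u0 x) \<and>
    (\<forall>t\<in>{0..T}. ((\<lambda>t. multiplier (weight (- 2)) (sobolev_coord s (u t))) has_vector_derivative
      multiplier (weight (- 2)) (sobolev_coord s (u t)) - sobolev_coord s (u t)
          + multiplier (weight (- 1)) (nonlinearity (s - 1) (sobolev_coord s (u t)) (sobolev_coord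
          (s - 1) (b t)))) (at t within {0..T}))"
proof -
  have s2: "s - 2 \<ge> 0" using s by simp
  have low: "u r \<in> sobolev_space (s - 2)" "sobolev_coord (s - 2) (u r)
      = multiplier (weight (- 2)) (sobolev_coord s (u r))" if "r \<in> {0..T}" for r
    using sobolev_coord_lower[OF s2 _ u[OF that]] by auto
  have "(\<exists>G L. has_weak_gradient (u t) G \<and> has_weak_laplacian (u t) L \<and>
        has_sobolev_time_derivative (s - 2) {0..T} u t (\<lambda>x. L x + (norm (G x))\<^sup>2 * b t x)) \<longleftrightarrow>
    ((\<lambda>t. multiplier (weight (- 2)) (sobolev_coord s (u t))) has_vector_derivative
      multiplier (weight (- 2)) (sobolev_coord s (u t)) - sobolev_coord s (u t)
          + multiplier (weight (- 1)) (nonlinearity (s - 1) (sobolev_coord s (u t)) (sobolev_coord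
          (s - 1) (b t)))) (at t within {0..T})"
    if t: "t \<in> {0..T}" for t
  proof -
    have "has_sobolev_time_derivative (s - 2) {0..T} u t (\<lambda>x. L x + (norm (G x))\<^sup>2 * b t x) \<longleftrightarrow>
      ((\<lambda>t. multiplier (weight (- 2)) (sobolev_coord s (u t))) has_vector_derivative
      multiplier (weight (- 2)) (sobolev_coord s (u t)) - sobolev_coord s (u t)
          + multiplier (weight (- 1)) (nonlinearity (s - 1) (sobolev_coord s (u t)) (sobolev_coord
          (s - 1) (b t)))) (at t within {0..T})"
      if G: "has_weak_gradient (u t) G" and L: "has_weak_laplacian (u t) L" for G L
    proof -
      note R = sobolev_coord_right_hand_side[OF s u[OF t] G L b[OF t]]
      have "has_sobolev_time_derivative (s - 2) {0..T} u t (\<lambda>x. L x + (norm (G x))\<^sup>2 * b t x) \<longleftrightarrow>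
        ((\<lambda>r. sobolev_coord (s - 2) (u r)) has_vector_derivative sobolev_coord (s - 2) (\<lambda>x. L x
            + (norm (G x))\<^sup>2 * b t x)) (at t within {0..T})"
        by (rule has_sobolev_time_derivative_iff[OF s2 t low(1) conjunct1[OF R]])
      also have "\<dots> \<longleftrightarrow> ((\<lambda>t. multiplier (weight (- 2)) (sobolev_coord s (u t)))
          has_vector_derivative sobolev_coord (s - 2) (\<lambda>x. L x + (norm (G x))\<^sup>2
          * b t x)) (at t within {0..T})"
        using has_vector_derivative_transform[OF t, of "\<lambda>r. sobolev_coord (s
            - 2) (u r)" "\<lambda>t. multiplier (weight (- 2)) (sobolev_coord s (u t))"]
          has_vector_derivative_transform[OF t, of "\<lambda>t. multiplier (weight (- 2)) (sobolev_coord s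
              (u t))" "\<lambda>r. sobolev_coord (s - 2) (u r)"] low(2) by auto
      finally show ?thesis using R by simp
    qed
    moreover obtain G where "has_weak_gradient (u t) G"
        using weak_gradient_exists[OF _ u[OF t]] s(2) by auto
    moreover obtain L where "has_weak_laplacian (u t) L"
        using weak_laplacian_exists[OF s(2) u[OF t]] by auto
    ultimately show ?thesis by blast
  qed
  then show ?thesis unfolding solves_cauchy_problem_def by auto
qed

theorem proposition1p1:
  fixes s :: real
    and u0 :: "real ^ 'n \<Rightarrow> real"
    and b :: "real \<Rightarrow> real ^ 'n \<Rightarrow> real"
  assumes "s > real CARD('n) / 2 + 3"
    and "u0 \<in> sobolev_space s"
    and "sobolev_continuous_on (s - 1) {0..} b"
    and "sobolev_bounded_on (s - 1) {0..} b"
  shows "\<exists>T0>0. \<exists>u.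
           sobolev_continuous_on s {0..T0} u \<and>
           solves_cauchy_problem s T0 b u0 u \<and>
           (\<forall>v. sobolev_continuous_on s {0..T0} v \<and> solves_cauchy_problem s T0 b u0 v \<longrightarrow>
                (\<forall>t\<in>{0..T0}. AE x in lborel. v t x = u t x))"
proof -
  have sn: "s - 1 > real DIM(real ^ 'n) / 2" using assms(1) by simp
  have s3: "s > 3" using assms(1) by (rule order_le_less_trans[rotated]) simp
  have s2: "s \<ge> 2" and s0: "s \<ge> 0" and s1: "s - 1 \<ge> 0" using s3 by auto
  define \<beta> where "\<beta> t = sobolev_coord (s - 1) (b t)" for t
  have bs: "b t \<in> sobolev_space (s - 1)" if "t \<ge> 0" for t
    using assms(3) that by (auto simp: sobolev_continuous_on_iff[OF s1])
  have \<beta>c: "continuous_on {0..} \<beta>"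
    using assms(3) by (simp add: sobolev_continuous_on_iff[OF s1] \<beta>_def[abs_def])
  obtain M where M: "\<And>t. t \<ge> 0 \<Longrightarrow> norm (\<beta> t) \<le> M"
    using assms(4) bs by (auto simp: sobolev_bounded_on_def \<beta>_def sobolev_norm_eq)
  have \<beta>r: "conj_reflect (\<beta> t) = \<beta> t" if "t \<ge> 0" for t
    unfolding \<beta>_def by (rule sobolev_coord_conj_reflect[OF s1 bs[OF that]])
  obtain T z where T: "0 < T" "T \<le> 1" and zc: "continuous_on {0..T} z"
    and zr: "\<And>t. t \<in> {0..T} \<Longrightarrow> conj_reflect (z t) = z t"
    and z: "\<And>t. t \<in> {0..T} \<Longrightarrow> z t = multiplier (heat_symbol t) (sobolev_coord s u0)
        + duhamel (\<lambda>\<tau>. nonlinearity (s - 1) (z \<tau>) (\<beta> \<tau>)) t"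
    using mild_solution_exists[OF sn \<beta>c M \<beta>r sobolev_coord_conj_reflect[OF s0 assms(2)]] by blast
  have fc: "continuous_on {0..T} (\<lambda>\<tau>. nonlinearity (s - 1) (z \<tau>) (\<beta> \<tau>))"
    by (intro continuous_on_nonlinearity[OF sn] zc continuous_on_subset[OF \<beta>c]) auto
  have z0: "z 0 = sobolev_coord s u0"
  proof -
    have "norm (duhamel (\<lambda>\<tau>. nonlinearity (s - 1) (z \<tau>) (\<beta> \<tau>)) 0)
        \<le> 4 * sqrt 0 * norm (nonlinearity (s - 1) (z 0) (\<beta> 0))"
      by (rule norm_duhamel_le) auto
    moreover have "multiplier (heat_symbol 0) (sobolev_coord s u0) = sobolev_coord s u0" by
        (simp add: multiplier_def heat_symbol_def)
    ultimately show ?thesis using z[of 0] T by simp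
  qed
  have "\<forall>t\<in>{0..T}. \<exists>f. f \<in> sobolev_space s \<and> sobolev_coord s f = z t"
    using sobolev_coord_surj[OF s0 zr] by blast
  then obtain u where u: "\<And>t. t \<in> {0..T} \<Longrightarrow> u t \<in> sobolev_space s" "\<And>t. t \<in> {0..T}
      \<Longrightarrow> sobolev_coord s (u t) = z t"
    by metis
  have bT: "b t \<in> sobolev_space (s - 1)" if "t \<in> {0..T}" for t using bs that by simp
  have cauchy_iff: "solves_cauchy_problem s T b u0 v \<longleftrightarrow> (AE x in lborel. v 0 x = u0 x) \<and>
      (\<forall>t\<in>{0..T}. ((\<lambda>t. multiplier (weight (- 2)) (sobolev_coord s (v t))) has_vector_derivative
        multiplier (weight (- 2)) (sobolev_coord s (v t)) - sobolev_coord s (v t)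
            + multiplier (weight (- 1)) (nonlinearity (s - 1) (sobolev_coord s (v t)) (\<beta> t))) (at t
            within {0..T}))"
    if "\<And>t. t \<in> {0..T} \<Longrightarrow> v t \<in> sobolev_space s" for v
    unfolding \<beta>_def by (rule solves_cauchy_problem_iff[OF sn s2]) (use that bT in blast)+
  have cu: "sobolev_continuous_on s {0..T} u"
    using u continuous_on_cong[of "{0..T}" "{0..T}" "\<lambda>t. sobolev_coord s (u t)" z] zc by
        (simp add: sobolev_continuous_on_iff[OF s0])
  have su: "solves_cauchy_problem s T b u0 u"
  proof (rule cauchy_iff[THEN iffD2], fact u(1), intro conjI ballI)
    show "AE x in lborel. u 0 x = u0 x"
      using sobolev_coord_inject[OF s0 u(1)[of 0] assms(2)] u(2)[of 0] z0 T by simp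
    fix t assume t: "t \<in> {0..T}"
    have "((\<lambda>t. multiplier (weight (- 2)) (z t)) has_vector_derivative
       multiplier (weight (- 2)) (z t) - z t + multiplier (weight (- 1)) (nonlinearity (s
           - 1) (z t) (\<beta> t))) (at t within {0..T})"
      by (rule mild_solution_has_derivative[OF T(2) fc zc z t])
    then show "((\<lambda>t. multiplier (weight (- 2)) (sobolev_coord s (u t))) has_vector_derivative
      multiplier (weight (- 2)) (sobolev_coord s (u t)) - sobolev_coord s (u t)
          + multiplier (weight (- 1)) (nonlinearity (s - 1) (sobolev_coord s (u t)) (\<beta> t))) (at t
          within {0..T})"
      unfolding u(2)[OF t]
      by (rule has_vector_derivative_transform[OF t, rotated]) (simp add: u(2))
  qed
  have unique: "AE x in lborel. v t x = u t x"
    if cv: "sobolev_continuous_on s {0..T} v" and sv: "solves_cauchy_problem s T b u0 v"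
        and t: "t \<in> {0..T}" for v t
  proof -
    have v: "\<And>t. t \<in> {0..T} \<Longrightarrow> v t \<in> sobolev_space s"
        and vc: "continuous_on {0..T} (\<lambda>t. sobolev_coord s (v t))"
      using cv by (auto simp: sobolev_continuous_on_iff[OF s0])
    have uc: "continuous_on {0..T} (\<lambda>t. sobolev_coord s (u t))" using cu by
        (simp add: sobolev_continuous_on_iff[OF s0])
    have ev: "AE x in lborel. v 0 x = u0 x" "t \<in> {0..T}
        \<Longrightarrow> ((\<lambda>t. multiplier (weight (- 2)) (sobolev_coord s (v t))) has_vector_derivative
        multiplier (weight (- 2)) (sobolev_coord s (v t)) - sobolev_coord s (v t)
            + multiplier (weight (- 1)) (nonlinearity (s - 1) (sobolev_coord s (v t)) (\<beta> t))) (at t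
            within {0..T})" for t
      using sv cauchy_iff[of v] v by blast+
    have eu: "AE x in lborel. u 0 x = u0 x" "t \<in> {0..T}
        \<Longrightarrow> ((\<lambda>t. multiplier (weight (- 2)) (sobolev_coord s (u t))) has_vector_derivative
        multiplier (weight (- 2)) (sobolev_coord s (u t)) - sobolev_coord s (u t)
            + multiplier (weight (- 1)) (nonlinearity (s - 1) (sobolev_coord s (u t)) (\<beta> t))) (at t
            within {0..T})" for t
      using su cauchy_iff[of u] u(1) by blast+
    have b1: "bounded_symbol (weight (- 1) :: real ^ 'n \<Rightarrow> complex)"
        and b2: "bounded_symbol (weight (- 2) :: real ^ 'n \<Rightarrow> complex)"
      by (auto intro: bounded_symbol_weight)
    obtain C where C: "C \<ge> 0" "\<And>w x :: (real ^ 'n) l2. norm (nonlinearity (s - 1) w x)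
        \<le> C * (norm w)\<^sup>2 * norm x"
      "\<And>w w' x :: (real ^ 'n) l2. norm (nonlinearity (s - 1) w x - nonlinearity (s - 1) w' x)
          \<le> C * (norm w + norm w') * norm (w - w') * norm x"
      using nonlinearity_bounds[OF sn] by blast
    have "bounded ((\<lambda>t. sobolev_coord s (v t)) ` {0..T})" "bounded ((\<lambda>t. sobolev_coord s (u t)) `
        {0..T})"
      by (intro compact_imp_bounded compact_continuous_image vc uc compact_Icc)+
    then obtain N1 N2 where N: "\<forall>y\<in>(\<lambda>t. sobolev_coord s (v t)) ` {0..T}. norm y
        \<le> N1" "\<forall>y\<in>(\<lambda>t. sobolev_coord s (u t)) ` {0..T}. norm y \<le> N2"
      unfolding bounded_iff by blast
    define y where "y t = sobolev_coord s (v t) - sobolev_coord s (u t)" for t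
    define d where "d t = nonlinearity (s - 1) (sobolev_coord s (v t)) (\<beta> t) - nonlinearity (s
        - 1) (sobolev_coord s (u t)) (\<beta> t)" for t
    have "y t = 0"
    proof (rule energy_uniqueness[OF _ _ _ _ t])
      show "continuous_on {0..T} y" unfolding y_def by (intro continuous_intros vc uc)
      have "AE x in lborel. v 0 x = u 0 x"
        using ev(1) eu(1) by eventually_elim simp
      then have "sobolev_coord s (v 0) = sobolev_coord s (u 0)"
        using sobolev_coord_inject[OF s0 v[of 0] u(1)[of 0]] T by simp
      then show "y 0 = 0" by (simp add: y_def)
      fix t assume t: "t \<in> {0..T}"
      from has_vector_derivative_diff[OF ev(2)[OF t] eu(2)[OF t]]
      show "((\<lambda>t. multiplier (weight (- 2)) (y t))
          has_vector_derivative multiplier (weight (- 2)) (y t) - y t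
          + multiplier (weight (- 1)) (d t)) (at t within {0..T})"
        by (simp add: y_def d_def bounded_linear_diff[OF bounded_linear_multiplier] b1 b2
            algebra_simps)
      have "norm (d t) \<le> C * (norm (sobolev_coord s (v t)) + norm (sobolev_coord s (u t)))
          * norm (y t) * norm (\<beta> t)"
        unfolding d_def y_def by (rule C(3))
      also have "\<dots> \<le> C * (N1 + N2) * norm (y t) * M"
      proof -
        have n: "norm (sobolev_coord s (v t)) \<le> N1" "norm (sobolev_coord s (u t)) \<le> N2" "norm (\<beta> t)
            \<le> M" using t N M[of t] by auto
        then have "0 \<le> N1" "0 \<le> N2" by (auto intro: order_trans[OF norm_ge_zero])
        with n C(1) show ?thesis by (intro mult_mono add_mono) auto
      qed
      finally show "norm (d t) \<le> (C * (N1 + N2) * M) * norm (y t)" by (simp add: mult_ac)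
    qed
    then show ?thesis using sobolev_coord_inject[OF s0 v[OF t] u(1)[OF t]] by (simp add: y_def)
  qed
  show ?thesis using T cu su unique by blast
qed

end
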